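(* Let $N\ge3$ be an integer and let $\frac{2}{N-2}<\alpha<\alpha_0$. Let $f\in C^2(0,\infty)$ be a solution of $$f''+\Bigl(\frac{N-1}{r}+\frac r2\Bigr)f'+\frac1\alpha f+|f|^\alpha f=0\quad\text{on }(0,\infty)$$ having the singularity $r^{\frac2\alpha}f(r)\to\beta^{\frac1\alpha}$ as $r\to0$, let $\mu=\lim_{r\to\infty}r^{\frac2\alpha}f(r)\in\mathbb{R}$ (this limit exists and is finite), and let $$U(t,x)=t^{-\frac1\alpha}f\Bigl(\frac{|x|}{\sqrt t}\Bigr),\qquad t>0,\ x\neq0,$$ so that $U$ is a self-similar solution of $\partial_tu=\Delta u+|u|^\alpha u$. Given $\delta>0$ and $u_0\in L^1_{\mathrm{loc}}(\mathbb{R}^N)\cap L^\infty(\{|x|>\delta\})$ such that $u_0(x)=\mu|x|^{-\frac2\alpha}$ for a.e. $x$ with $|x|<\delta$, there exist $T>0$ and a solution $u\in L^{\alpha+1}_{\mathrm{loc}}((0,T)\times\mathbb{R}^N)\cap C((0,T)\times(\mathbb{R}^N\setminus\{0\}))$ of $$\partial_tu=\Delta u+|u|^\alpha u$$ in the sense of distributions $\mathcal{D}'((0,T)\times\mathbb{R}^N)$, such that, for some constant $C$, $$|u(t,x)-U(t,x)|\le C(1+|x|^{-\eta}),\qquad 0<t<T,\ x\ne0,$$ and $u(t)\to u_0$ in $L^1_{\mathrm{loc}}(\mathbb{R}^N)$ as $t\to0$. Moreover, $u(t)$ is singular at $x=0$ for all $0<t<T$ and satisfies $|x|^{\frac2\alpha}u(t,x)\to\beta^{\frac1\alpha}$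 as $x\to0$.
   Context: All functions are real-valued. Constants: $$\alpha_0=\frac{4}{N-4+2\sqrt{N-1}}\in\Bigl(\frac2{N-2},\frac4{N-2}\Bigr),\quad \beta=\frac2\alpha\Bigl(N-2-\frac2\alpha\Bigr)>0,\quad \eta=\frac{N-2}{2}-\sqrt{\frac{(N-2)^2}{4}-\beta(\alpha+1)}>0$$ (the quantity under the square root is positive when $\frac2{N-2}<\alpha<\alpha_0$). *)

theory Defs
  imports "HOL-Analysis.Analysis"
begin

section \<open>Constants\<close>

definition alpha0 :: "nat \<Rightarrow> real" where
  "alpha0 N = 4 / (real N - 4 + 2 * sqrt (real N - 1))"

definition beta :: "nat \<Rightarrow> real \<Rightarrow> real" where
  "beta N \<alpha> = 2 / \<alpha> * (real N - 2 - 2 / \<alpha>)"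

definition eta :: "nat \<Rightarrow> real \<Rightarrow> real" where
  "eta N \<alpha> = (real N - 2) / 2 - sqrt ((real N - 2)\<^sup>2 / 4 - beta N \<alpha> * (\<alpha> + 1))"

definition nonlin :: "real \<Rightarrow> real \<Rightarrow> real" where
  "nonlin \<alpha> v = \<bar>v\<bar> powr \<alpha> * v"

section \<open>Function spaces\<close>

text \<open>Functions are total, but only their values on the open set \<open>\<Omega>\<close> matter.\<close>

definition Lp_loc :: "real \<Rightarrow> 'e::euclidean_space set \<Rightarrow> ('e \<Rightarrow> real) \<Rightarrow> bool" where
  "Lp_loc p \<Omega> g \<longleftrightarrow> g \<in> borel_measurable (lebesgue_on \<Omega>) \<and>
     (\<forall>K. compact K \<longrightarrow> K \<subseteq> \<Omega> \<longrightarrow> integrable (lebesgue_on K) (\<lambda>z. \<bar>g z\<bar> powr p))"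

definition Linf_on :: "'e::euclidean_space set \<Rightarrow> ('e \<Rightarrow> real) \<Rightarrow> bool" where
  "Linf_on S g \<longleftrightarrow> g \<in> borel_measurable (lebesgue_on S) \<and>
     (\<exists>C. AE x in lebesgue_on S. \<bar>g x\<bar> \<le> C)"

definition tendsto_L1_loc ::
    "('i \<Rightarrow> 'e::euclidean_space \<Rightarrow> real) \<Rightarrow> ('e \<Rightarrow> real) \<Rightarrow> 'i filter \<Rightarrow> bool" where
  "tendsto_L1_loc g h F \<longleftrightarrow>
     (\<forall>\<^sub>F i in F. Lp_loc 1 UNIV (g i)) \<and> Lp_loc 1 UNIV h \<and>
     (\<forall>K. compact K \<longrightarrow> ((\<lambda>i. LINT x|lebesgue_on K. \<bar>g i x - h x\<bar>) \<longlongrightarrow> 0) F)"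

text \<open>Singular at \<open>a\<close>: essentially unbounded in every neighbourhood of \<open>a\<close>; the value
  of \<open>g\<close> at \<open>a\<close> itself plays no role.\<close>

definition singular_at :: "('e::euclidean_space \<Rightarrow> real) \<Rightarrow> 'e \<Rightarrow> bool" where
  "singular_at g a \<longleftrightarrow> (\<forall>\<rho>>0. \<nexists>C. AE x in lebesgue_on (ball a \<rho>). \<bar>g x\<bar> \<le> C)"

section \<open>Test functions and distributional solutions\<close>

primrec Ck :: "nat \<Rightarrow> ('e::euclidean_space \<Rightarrow> real) \<Rightarrow> bool" where
  "Ck 0 \<phi> \<longleftrightarrow> continuous_on UNIV \<phi>"
| "Ck (Suc k) \<phi> \<longleftrightarrow> (\<forall>z. \<phi> differentiable (at z)) \<and>
     (\<forall>v. Ck k (\<lambda>z. frechet_derivative \<phi> (at z) v))"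

text \<open>\<open>C\<^sub>c\<^sup>\<infinity>(\<Omega>)\<close>, each function being extended by zero to the whole space.\<close>

definition test_function :: "'e::euclidean_space set \<Rightarrow> ('e \<Rightarrow> real) \<Rightarrow> bool" where
  "test_function \<Omega> \<phi> \<longleftrightarrow> (\<forall>k. Ck k \<phi>) \<and>
     compact (closure {z. \<phi> z \<noteq> 0}) \<and> closure {z. \<phi> z \<noteq> 0} \<subseteq> \<Omega>"

definition laplacian :: "('e::euclidean_space \<Rightarrow> real) \<Rightarrow> 'e \<Rightarrow> real" where
  "laplacian g x = (\<Sum>b\<in>Basis. deriv (deriv (\<lambda>s. g (x + s *\<^sub>R b))) 0)"

text \<open>\<open>u\<close> solves \<open>\<partial>\<^sub>t u = \<Delta> u + |u|\<^sup>\<alpha> u\<close> in \<open>\<D>'(I \<times> \<real>\<^sup>N)\<close>, where \<open>I\<close> is an open set of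
  times. Both \<open>u\<close> and \<open>|u|\<^sup>\<alpha> u\<close> must be locally integrable in order to define distributions.\<close>

definition heat_solution ::
    "real \<Rightarrow> real set \<Rightarrow> (real \<Rightarrow> 'e::euclidean_space \<Rightarrow> real) \<Rightarrow> bool" where
  "heat_solution \<alpha> I u \<longleftrightarrow>
     Lp_loc 1 (I \<times> UNIV) (\<lambda>(t, x). u t x) \<and>
     Lp_loc 1 (I \<times> UNIV) (\<lambda>(t, x). nonlin \<alpha> (u t x)) \<and>
     (\<forall>\<phi>. test_function (I \<times> UNIV) \<phi> \<longrightarrow>
        - (LINT (t, x)|lebesgue_on (I \<times> UNIV). u t x * deriv (\<lambda>s. \<phi> (s, x)) t)
        = (LINT (t, x)|lebesgue_on (I \<times> UNIV). u t x * laplacian (\<lambda>y. \<phi> (t, y)) x)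
          + (LINT (t, x)|lebesgue_on (I \<times> UNIV). nonlin \<alpha> (u t x) * \<phi> (t, x)))"

section \<open>Profiles\<close>

definition profile_solution :: "nat \<Rightarrow> real \<Rightarrow> (real \<Rightarrow> real) \<Rightarrow> bool" where
  "profile_solution N \<alpha> f \<longleftrightarrow>
     f C1_differentiable_on {0<..} \<and> deriv f C1_differentiable_on {0<..} \<and>
     (\<forall>r>0. deriv (deriv f) r + ((real N - 1) / r + r / 2) * deriv f r
        + 1 / \<alpha> * f r + nonlin \<alpha> (f r) = 0)"

text \<open>The value at \<open>x = 0\<close> is irrelevant.\<close>

definition U_of :: "real \<Rightarrow> (real \<Rightarrow> real) \<Rightarrow> real \<Rightarrow> 'e::euclidean_space \<Rightarrow> real" where
  "U_of \<alpha> f t x = t powr (- 1 / \<alpha>) * f (norm x / sqrt t)"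

text \<open>Invariance under the scaling of the equation.\<close>

definition self_similar :: "real \<Rightarrow> (real \<Rightarrow> 'e::euclidean_space \<Rightarrow> real) \<Rightarrow> bool" where
  "self_similar \<alpha> u \<longleftrightarrow>
     (\<forall>c>0. \<forall>t>0. \<forall>x. x \<noteq> 0 \<longrightarrow> c powr (2 / \<alpha>) * u (c\<^sup>2 * t) (c *\<^sub>R x) = u t x)"

end

theory Submission
 imports Defs
begin

text \<open>
 Write \<open>u = U + w\<close>. The remainder solves \<open>\<partial>\<^sub>t w = \<Delta> w + g(U + w) - g(U)\<close>, \<open>g(v) = |v|\<^sup>\<alpha> v\<close>, and its initial
 value \<open>v = u\<^sub>0 - \<mu> |x|\<^bsup>-2/\<alpha>\<^esup>\<close> is bounded and vanishes near the origin. The derivative of \<open>g\<close> at \<open>U\<close> is at most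
 \<open>(\<beta>(\<alpha>+1) + small)/|x|\<^sup>2\<close> where \<open>|x|\<^sup>2/t\<close> is small, and \<open>\<alpha> < \<alpha>\<^sub>0\<close> puts \<open>\<beta>(\<alpha>+1)\<close> below Hardy's
 constant \<open>(N-2)\<^sup>2/4\<close>: the function \<open>|x|\<^bsup>-\<eta>\<^esup>\<close> solves the limiting linear equation exactly, and \<open>\<eta> < (N-2)/2\<close> leaves
 room for strict supersolutions.

 Two barriers control \<open>w\<close>. The inner one is a combination of the functions
 \<open>e\<^bsup>\<Lambda>t\<^esup> |x|\<^bsup>2a\<^esup> (|x|\<^sup>2 + K t)\<^bsup>J\<^esup>\<close>, with \<open>a = -\<eta>/2\<close> as leading exponent; it is a supersolution for the true
 potential (\<open>supersolution_exists\<close>), but it grows at infinity. The outer one is a multiple of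
 \<open>e\<^bsup>\<Lambda>t\<^esup> (1 + |x|\<^bsup>-\<eta>\<^esup>)\<close>. Their minimum is invariant under the integral equation, because the heat flow and
 the Duhamel integral are monotone and each barrier satisfies its own integral equation (\<open>radial_mild\<close>).
 The nonlinearity is increasing, so iteration from below converges monotonically (\<open>monotone_fixed_point\<close>)
 and yields \<open>w\<close> with \<open>|w| \<le> C (1 + |x|\<^bsup>-\<eta>\<^esup>)\<close> (\<open>perturbation\<close>).

 The integral equation implies the weak one by duality (\<open>mild_weak\<close>). The function \<open>U\<close> itself is a distributional
 solution because \<open>|x|\<^bsup>-2/\<alpha>-2\<^esup>\<close> is locally integrable, so that the singularity can be removed by replacing
 \<open>|x|\<^sup>2\<close> by \<open>|x|\<^sup>2 + \<epsilon>\<close> (\<open>selfsim_weak\<close>). Since \<open>\<eta> < 2/\<alpha>\<close>, the sum has the singularity of \<open>U\<close>.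
\<close>

section \<open>The exponents\<close>

locale singular_exponents =
 fixes N :: nat and \<alpha> :: real
 assumes N_ge_3: "3 <= N"
  and alpha_lower: "2/(real N-2) < \<alpha>"
  and alpha_upper: "\<alpha> < alpha0 N"
begin

abbreviation "\<kappa> \<equiv> 2/\<alpha>"

abbreviation "\<beta> \<equiv> beta N \<alpha>"

abbreviation "\<eta> \<equiv> eta N \<alpha>"

abbreviation "L \<equiv> \<beta> powr (1/\<alpha>)"

lemma n_ge_1: "1 <= real N-2" using N_ge_3 by linarith

lemma alpha_pos: "0 < \<alpha>" using n_ge_1 alpha_lower by (smt (verit) divide_pos_pos)

lemma kappa_less: "\<kappa> < real N-2" using alpha_lower alpha_pos n_ge_1 by (simp add: field_simps)

lemma kappa_pos: "0 < \<kappa>" using alpha_pos by simp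

lemma kappa_greater: "(real N-4)/2 + sqrt (real N-1) < \<kappa>"
proof -
 define D where "D = real N-4+2 * sqrt (real N-1)"
 have "sqrt (real N-1) \<ge> 1" using n_ge_1 by simp
 then have D: "D > 0" using N_ge_3 unfolding D_def by linarith
 have "\<alpha> < 4/D" using alpha_upper unfolding alpha0_def D_def .
 then have "\<alpha>*D < 4" using D by (simp add: field_simps)
 then have "D/2 < \<kappa>" using alpha_pos by (simp add: field_simps)
 then show ?thesis unfolding D_def by (simp add: field_simps)
qed

lemma two_kappa_greater: "real N-2 < 2*\<kappa>"
proof -
 obtain s where s: "s = sqrt (real N-1)" by blast
 have "s > 1" unfolding s using n_ge_1 by simp
 then have "(real N-2)/2 < \<kappa>" using kappa_greater unfolding s[symmetric] by (simp add: field_simps)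
 then show ?thesis by simp
qed

lemma beta_eq: "\<beta> = \<kappa>*(real N-2-\<kappa>)" by (simp add: beta_def)

lemma beta_pos: "0 < \<beta>" unfolding beta_eq using kappa_pos kappa_less by (intro mult_pos_pos) auto

lemma beta_alpha: "\<beta>*(\<alpha>+1) = (\<kappa>+2)*(real N-2-\<kappa>)" unfolding beta_eq using alpha_pos by (simp add: field_simps)

lemma disc_pos: "0 < (real N-2)\<^sup>2/4-\<beta>*(\<alpha>+1)"
proof -
 define n where "n = real N-2"
 obtain k where k: "k = \<kappa>" by blast
 have "sqrt (n+1) < k-(n-2)/2" using kappa_greater unfolding n_def k[symmetric] by (simp add: field_simps)
 moreover have "0 <= sqrt (n+1)" using n_ge_1 n_def by simp
 ultimately have "(sqrt (n+1))\<^sup>2 < (k-(n-2)/2)\<^sup>2" by (intro power_strict_mono) auto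
 then have "n+1 < (k-(n-2)/2)\<^sup>2" using n_ge_1 n_def by simp
 then show ?thesis unfolding beta_alpha n_def[symmetric] k[symmetric] by (simp add: power2_eq_square field_simps)
qed

lemma eta_root: "\<eta>*(real N-2-\<eta>) = \<beta>*(\<alpha>+1)"
proof -
 define s where "s = sqrt ((real N-2)\<^sup>2/4-\<beta>*(\<alpha>+1))"
 have "s * s = (real N-2)\<^sup>2/4-\<beta>*(\<alpha>+1)" unfolding s_def using disc_pos by (simp add: real_sqrt_mult_self)
 moreover have "(n/2-s)*(n-(n/2-s)) = n\<^sup>2/4-s * s" for n by (simp add: power2_eq_square field_simps)
 moreover have "\<eta> = (real N-2)/2-s" unfolding eta_def s_def ..
 ultimately have "\<eta>*(real N-2-\<eta>) = (real N-2)\<^sup>2/4-((real N-2)\<^sup>2/4-\<beta>*(\<alpha>+1))" by presburger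
 then show ?thesis by linarith
qed

lemma eta_less_half: "\<eta> < (real N-2)/2"
proof -
 have "0 < sqrt ((real N-2)\<^sup>2/4-\<beta>*(\<alpha>+1))" using disc_pos by (simp only: real_sqrt_gt_0_iff)
 then show ?thesis unfolding eta_def by linarith
qed

lemma eta_pos: "0 < \<eta>"
proof (rule ccontr)
 assume "~ 0 < \<eta>"
 then have "\<eta>*(real N-2-\<eta>) <= 0" using eta_less_half n_ge_1 by (intro mult_nonpos_nonneg) auto
 then show False using eta_root beta_pos alpha_pos by (smt (verit) mult_pos_pos)
qed

lemma eta_less_kappa: "\<eta> < \<kappa>"
proof -
 have "(real N-2)/2 < \<kappa>" using two_kappa_greater by simp
 then show ?thesis using eta_less_half by simp
qed

lemma L_pos: "0 < L" using beta_pos by simp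

lemma L_powr: "L powr \<alpha> = \<beta>" using beta_pos alpha_pos by (simp add: powr_powr)

end

section \<open>The nonlinearity\<close>

lemma nonlin_abs: "abs (nonlin a v) = abs v powr (a+1)" by (cases "v = 0") (auto simp: nonlin_def abs_mult powr_add)

lemma nonlin_nonneg: "0 <= v ==> nonlin a v = v powr (a+1)" by (cases "v = 0") (auto simp: nonlin_def powr_add)

lemma nonlin_minus: "nonlin a (- v) = - nonlin a v" by (simp add: nonlin_def)

lemma nonlin_scale: "0 <= c ==> nonlin a (c * v) = c powr (a+1)*nonlin a v" by (cases "c = 0") (auto simp: nonlin_def abs_mult powr_mult powr_add)

lemma DERIV_nonlin:
 assumes "0 < a"
 shows "(nonlin a has_real_derivative (a+1)*abs v powr a) (at v)"
proof -
 have pos: "(nonlin a has_real_derivative (a+1)*abs v powr a) (at v)" if "v > 0" for v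
 proof -
  have "((%x. x powr (a+1)) has_real_derivative (a+1) * v powr (a+1-1)) (at v)" using that by (intro has_real_derivative_powr) auto
  moreover have "\<forall>\<^sub>F x in nhds v. nonlin a x = x powr (a+1)"
   using that by (intro eventually_mono[OF eventually_nhds_in_open[of "{0<..}"]])
    (auto simp: nonlin_nonneg)
  ultimately show ?thesis using that DERIV_cong_ev[of v v "nonlin a"] by simp
 qed
 consider "v > 0" | "v < 0" | "v = 0" by linarith
 then show ?thesis
 proof cases
  case 1 then show ?thesis by (rule pos)
 next
  case 2
  have "((%x. - nonlin a (- x)) has_real_derivative - ((a+1)*abs (-v) powr a * - 1)) (at v)"
   using 2 by (intro derivative_intros DERIV_chain2[OF pos]) auto
  then show ?thesis by (simp add: nonlin_minus)
 next
  case 3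
  have "((%h. abs h powr a) \<longlongrightarrow> abs 0 powr a) (at 0)" using assms by (intro tendsto_powr' tendsto_intros) auto
  moreover have "\<forall>\<^sub>F h in at 0. abs h powr a = (nonlin a (0+h)-nonlin a 0)/h" by (auto simp: eventually_at_filter nonlin_def)
  ultimately have "((%h. (nonlin a (0+h)-nonlin a 0)/h) \<longlongrightarrow> 0) (at 0)" using assms by (simp add: filterlim_cong[OF refl refl])
  then show ?thesis using 3 assms by (simp add: DERIV_def)
 qed
qed

lemma continuous_nonlin: "0 < a ==> continuous_on UNIV (nonlin a)" by (auto intro!: continuous_at_imp_continuous_on DERIV_isCont[OF DERIV_nonlin])

lemma borel_nonlin [measurable]: "nonlin a\<in>borel_measurable borel" unfolding nonlin_def by measurable

lemma nonlin_mono: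
 assumes "0 < a" "x <= y" shows "nonlin a x <= nonlin a y"
proof (rule DERIV_nonneg_imp_nondecreasing[OF assms(2)])
 fix z
 show "\<exists>d. (nonlin a has_real_derivative d) (at z) \<and> 0 <= d"
  using DERIV_nonlin[OF assms(1), of z] assms(1) by (intro exI[of _ "(a+1)*abs z powr a"]) auto
qed

lemma nonlin_diff_bound:
 assumes "0 < a" "abs w <= W"
 shows "abs (nonlin a (v+w)-nonlin a v) <= (a+1)*(abs v+W) powr a*W"
proof -
 have "norm (nonlin a (v+w)-nonlin a v) <= (a+1)*(abs v+W) powr a*norm ((v+w)-v)"
 proof (rule field_differentiable_bound[of "cball 0 (abs v+W)"])
  show "(nonlin a has_field_derivative (a+1)*abs z powr a) (at z within cball 0 (abs v+W))" for z
   using DERIV_nonlin[OF assms(1)] has_field_derivative_at_within by blast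
  show "norm ((a+1)*abs z powr a) <= (a+1)*(abs v+W) powr a"
   if "z\<in>cball 0 (abs v+W)" for z using that assms by (auto simp: abs_mult intro!: powr_mono2)
 qed (use assms in auto)
 also have "... <= (a+1)*(abs v+W) powr a*W" using assms by (intro mult_left_mono) auto
 finally show ?thesis by simp
qed

section \<open>The profile near the origin\<close>

text \<open>
 With \<open>log r\<close> as time, the equilibrium is an unstable node or spiral of the linearised system because \<open>d\<close> and \<open>q\<close> are positive; a
 quadratic Lyapunov function therefore decays at a fixed rate towards \<open>r = 0\<close> along any orbit that tends to the equilibrium.
\<close>

lemma lyapunov_rate:
 fixes z p \<Psi> :: "real => real"
 assumes d: "d > 0" and q: "q > 0" and r0: "r0 > 0"
  and Dz: "!!r. 0 < r ==> r < r0 ==> (z has_real_derivative p r / r) (at r)"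
  and Dp: "!!r. 0 < r ==> r < r0 ==>
    (p has_real_derivative ((d-r\<^sup>2/2)*p r-\<Psi> (z r)) / r) (at r)"
  and Psi0: "\<Psi> 0 = 0" and DPsi: "(\<Psi> has_real_derivative q) (at 0)"
  and lim: "(z \<longlongrightarrow> 0) (at_right 0)"
 shows "\<exists>s>0. \<exists>C. \<exists>r1>0. \<forall>r. 0 < r --> r <= r1 --> abs (z r) <= C * r powr s \<and> abs (p r) <= C * r powr s"
proof -
 define e where "e = Min {1/2, q/2, d/8, q/(8*d)}"
 have e: "e > 0" "e <= 1/2" "e <= q/2" "e <= d/8" "e <= q/(8*d)" using d q by (auto simp: e_def)
 have ed: "2*e * d <= q/4" using e(5) d by (simp add: field_simps)
 define \<nu> where "\<nu> = Min {d/8, e*q/4, q/4}"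
 have nu: "\<nu> > 0" "\<nu> <= d/8" "\<nu> <= e*q/4" "\<nu> <= q/4" unfolding \<nu>_def using d q e(1) by (auto intro: Min_le)
 have "((%h. \<Psi> h/h) \<longlongrightarrow> q) (at 0)" using DPsi Psi0 by (simp add: DERIV_def)
 then obtain \<rho> where rho: "\<rho> > 0" "!!h. h ~= 0 ==> abs h < \<rho> ==> abs (\<Psi> h/h-q) < \<nu>"
  using nu(1) unfolding tendsto_iff eventually_at dist_real_def by (metis UNIV_I diff_zero)
 have Psi: "abs (\<Psi> h-q*h) <= \<nu>*abs h" if "abs h < \<rho>" for h
 proof (cases "h = 0")
  case False
  then have "abs (\<Psi> h-q*h) = abs (\<Psi> h/h-q)*abs h" by (simp flip: abs_mult add: field_simps)
  then show ?thesis using rho(2)[OF False that] by (simp add: mult_right_mono)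
 qed (simp add: Psi0)
 from lim rho(1) obtain r2 where r2: "r2 > 0" "!!r. 0 < r ==> r < r2 ==> abs (z r) < \<rho>"
  unfolding tendsto_iff eventually_at_right_field dist_real_def by (metis diff_zero)
 define r1 where "r1 = Min {r0/2, r2/2, sqrt d}"
 have r1: "r1 > 0" "r1 < r0" "r1 < r2" "r1 <= sqrt d" using r0 r2 d by (auto simp: r1_def min_def)
 define c where "c = min (d/16) (e*q/4)"
 have c: "c > 0" "c <= d/16" "c <= e*q/4" using d e q by (auto simp: c_def)
 define s where "s = c/(2*(1 + q))"
 have s: "s > 0" "2 * s*(1 + q) = c" using c q by (auto simp: s_def field_simps)
 define H where "H r = (p r)\<^sup>2/2 + q*(z r)\<^sup>2/2-e*z r*p r" for r
 define DH where "DH r = p r*((d-r\<^sup>2/2)*p r-\<Psi> (z r)) + q*z r*p r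
   - e*p r*p r-e*z r*((d-r\<^sup>2/2)*p r-\<Psi> (z r))" for r
 have HD: "(H has_real_derivative DH r / r) (at r)" if "0 < r" "r < r0" for r unfolding H_def[abs_def] DH_def using that
  by (auto intro!: derivative_eq_intros Dz Dp simp: field_simps)
 have zp: "e*abs (z r*p r) <= e*((z r)\<^sup>2+(p r)\<^sup>2)/2" for r
 proof -
  have "abs (z r*p r) <= ((z r)\<^sup>2+(p r)\<^sup>2)/2" using sum_squares_bound[of "abs (z r)" "abs (p r)"] by (simp add: abs_mult)
  then show ?thesis using e(1) by (metis mult_left_mono less_eq_real_def times_divide_eq_right)
 qed
 have Hlow: "(p r)\<^sup>2/4 + q*(z r)\<^sup>2/4 <= H r" for r
 proof -
  have "e*z r*p r <= e*((z r)\<^sup>2+(p r)\<^sup>2)/2" using zp[of r]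
   mult_left_mono[OF abs_ge_self[of "z r*p r"], of e] e(1) by (simp add: mult.assoc)
  also have "... <= q*(z r)\<^sup>2/4+(p r)\<^sup>2/4" using mult_right_mono[OF e(2), of "(p r)\<^sup>2"] mult_right_mono[OF e(3), of "(z r)\<^sup>2"]
   by (simp add: field_simps)
  finally show ?thesis unfolding H_def by simp
 qed
 have Hup: "H r <= (1 + q)*((p r)\<^sup>2+(z r)\<^sup>2)" for r
 proof -
  have "- (e*z r*p r) = e * - (z r*p r)" by simp
  also have "... <= e*abs (z r*p r)" using e(1) by (intro mult_left_mono) auto
  also have "... <= e*((z r)\<^sup>2+(p r)\<^sup>2)/2" by (rule zp)
  also have "... <= (z r)\<^sup>2/4+(p r)\<^sup>2/4" using mult_right_mono[OF e(2), of "(p r)\<^sup>2"] mult_right_mono[OF e(2), of "(z r)\<^sup>2"]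
   by (simp add: field_simps)
  finally have "H r <= (p r)\<^sup>2 + q*(z r)\<^sup>2+(z r)\<^sup>2"
   unfolding H_def using mult_nonneg_nonneg[of q "(z r)\<^sup>2"] q zero_le_power2[of "z r"]
    zero_le_power2[of "p r"] by linarith
  moreover have "0 <= q*(p r)\<^sup>2" using q by simp
  ultimately show ?thesis by (simp add: algebra_simps)
 qed
 have DHlow: "2 * s*H r <= DH r" if r: "0 < r" "r <= r1" for r
 proof -
  define P where "P = (p r)\<^sup>2"
  define Z where "Z = (z r)\<^sup>2"
  define E where "E = \<Psi> (z r)-q*z r"
  define d' where "d' = d-r\<^sup>2/2"
  have PZ: "P \<ge> 0" "Z \<ge> 0" by (auto simp: P_def Z_def)
  have "r\<^sup>2 <= (sqrt d)\<^sup>2" using r r1(4) by (intro power_mono) auto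
  then have "r\<^sup>2 <= d" using d by simp
  then have d': "d/2 <= d'" "d' <= d" unfolding d'_def by auto
  have E: "abs E <= \<nu>*abs (z r)" unfolding E_def using Psi r2(2)[of r] r r1 by force
  have eq: "DH r = d'*P-e*P-p r*E-e*d'*(z r*p r)+e * q*Z+e*(z r*E)"
   unfolding DH_def d'_def[symmetric] P_def Z_def E_def by (simp add: power2_eq_square algebra_simps)
  have "abs (z r*p r) <= (Z+P)/2" using sum_squares_bound[of "abs (z r)" "abs (p r)"] by (simp add: abs_mult Z_def P_def)
  have 1: "p r*E <= \<nu>*((Z+P)/2)"
  proof -
   have "p r*E <= abs (p r)*abs E" by (metis abs_ge_self abs_mult)
   also have "... <= abs (p r)*(\<nu>*abs (z r))" using E by (intro mult_left_mono) auto
   also have "... = \<nu>*abs (z r*p r)" by (simp add: abs_mult)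
   also have "... <= \<nu>*((Z+P)/2)" using \<open>(abs (z r*p r)) <= _\<close> nu by (intro mult_left_mono) auto
   finally show ?thesis .
  qed
  have 2: "- (\<nu>*Z) <= z r*E"
  proof -
   have "- (z r*E) <= abs (z r)*abs E" by (metis abs_ge_minus_self abs_mult)
   also have "... <= abs (z r)*(\<nu>*abs (z r))" using E by (intro mult_left_mono) auto
   also have "... = \<nu>*Z" by (simp add: Z_def power2_eq_square)
   finally show ?thesis by simp
  qed
  have 3: "e*d'*(z r*p r) <= d/8 * P+e * q/4 * Z"
  proof -
   have "e*d'*(z r*p r) <= e*d'*abs (z r*p r)" using e d' d by (intro mult_left_mono) auto
   also have "... <= e*d * abs (z r*p r)" using e d' d by (intro mult_right_mono mult_left_mono) auto
   also have "... = d*(e*abs (z r)*abs (p r))" by (simp add: abs_mult)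
   also have "... <= d*(P/8+2*e\<^sup>2*Z)"
   proof (rule mult_left_mono)
    have "0 <= (abs (p r)/4-2*e * abs (z r))\<^sup>2" by simp
    also have "... = P/16+4*e\<^sup>2*Z-e*abs (z r)*abs (p r)" unfolding P_def Z_def by (simp add: power2_diff power_divide power_mult_distrib)
    finally have *: "e*abs (z r)*abs (p r) <= P/16+4*e\<^sup>2*Z" by simp
    have "0 <= (abs (p r)-4*e * abs (z r))\<^sup>2" by simp
    also have "... = P+16*e\<^sup>2*Z-8*(e*abs (z r)*abs (p r))" unfolding P_def Z_def by (simp add: power2_diff power_mult_distrib)
    finally show "e*abs (z r)*abs (p r) <= P/8+2*e\<^sup>2*Z" by simp
   qed (use d in auto)
   also have "... = d/8 * P+e*(2*e * d)*Z" by (simp add: power2_eq_square algebra_simps)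
   also have "... <= d/8 * P+e*(q/4)*Z" using ed e PZ by (intro add_left_mono mult_right_mono mult_left_mono) auto
   finally show ?thesis by simp
  qed
  have 4: "e*(z r*E) \<ge>-(e * q/4 * Z)"
  proof -
   have "e*(z r*E) \<ge> e * - (\<nu>*Z)" using 2 e by (intro mult_left_mono) auto
   moreover have "e*(\<nu>*Z) <= e*(q/4 * Z)" using nu e PZ by (intro mult_left_mono mult_right_mono) auto
   ultimately show ?thesis by simp
  qed
  have 5: "\<nu>*((Z+P)/2) <= e * q/8 * Z+d/16*P" using mult_right_mono[OF nu(3) PZ(2)] mult_right_mono[OF nu(2) PZ(1)] by (simp add: field_simps)
  have 6: "d/2 * P <= d'*P" "e*P <= d/8 * P" using mult_right_mono[OF d'(1) PZ(1)] mult_right_mono[OF e(4) PZ(1)] by simp_all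
  have "c*(P+Z) <= d/16*P+e * q/4 * Z" using mult_right_mono[OF c(2) PZ(1)] mult_right_mono[OF c(3) PZ(2)] by (simp add: algebra_simps)
  also have "... <= DH r"
  proof -
   have "0 <= d*P" "0 <= e * q*Z" using d e q PZ by auto
   then show ?thesis unfolding eq using 1 3 4 5 6 by (simp add: field_simps)
  qed
  finally have "c*(P+Z) <= DH r" .
  moreover have "2 * s*H r <= c*(P+Z)" using mult_left_mono[OF Hup[of r], of "2 * s"] s unfolding P_def Z_def by (simp add: mult.assoc[symmetric])
  ultimately show ?thesis by simp
 qed
 define C where "C = H r1 * r1 powr (- 2 * s)"
 have Hr: "H r <= C * r powr (2 * s)" if r: "0 < r" "r <= r1" for r
 proof -
  have "H r * r powr (- 2 * s) <= H r1 * r1 powr (- 2 * s)"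
  proof (rule DERIV_nonneg_imp_nondecreasing[OF r(2)])
   fix x assume x: "r <= x" "x <= r1"
   then have x0: "0 < x" "x < r0" using r r1 by auto
   have "((%x. H x*x powr (- 2 * s)) has_real_derivative
     DH x/x * x powr (- 2 * s)+H x*(- 2 * s*x powr (- 2 * s-1))) (at x)" using x0 by (auto intro!: derivative_eq_intros HD has_real_derivative_powr)
   moreover have "DH x/x * x powr (- 2 * s)+H x*(- 2 * s*x powr (- 2 * s-1)) =
     (DH x-2 * s*H x)*x powr (- 2 * s-1)" using x0 by (simp add: powr_diff field_simps)
   moreover have "0 <= (DH x-2 * s*H x)*x powr (- 2 * s-1)" using DHlow[of x] x0 x by (intro mult_nonneg_nonneg) auto
   ultimately show "\<exists>y. ((%x. H x*x powr (- 2 * s)) has_real_derivative y) (at x) \<and> 0 <= y" by metis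
  qed
  then have "H r * r powr (- 2 * s) * r powr (2 * s) <= C * r powr (2 * s)" unfolding C_def by (intro mult_right_mono) auto
  then show ?thesis using r by (simp add: mult.assoc flip: powr_add)
 qed
 define C1 where "C1 = sqrt (4*C) + sqrt (4*C / q)"
 have "0 <= (p r1)\<^sup>2/4 + q*(z r1)\<^sup>2/4" using q by simp
 then have "0 <= H r1" using Hlow[of r1] by linarith
 then have C0: "C \<ge> 0" unfolding C_def by auto
 have "abs (z r) <= C1 * r powr s \<and> abs (p r) <= C1 * r powr s" if r: "0 < r" "r <= r1" for r
 proof -
  have sq: "r powr (2 * s) = (r powr s)\<^sup>2" using r by (simp add: power2_eq_square flip: powr_add)
  have a: "0 <= q*(z r)\<^sup>2" using q by auto
  have "(p r)\<^sup>2 <= 4*C * (r powr s)\<^sup>2" using Hlow[of r] Hr[OF r] a unfolding sq by linarith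
  then have "abs (p r) <= sqrt (4*C * (r powr s)\<^sup>2)" by (metis real_sqrt_abs real_sqrt_le_mono)
  then have 1: "abs (p r) <= sqrt (4*C) * r powr s" by (simp add: real_sqrt_mult)
  have "q*(z r)\<^sup>2 <= 4*C * (r powr s)\<^sup>2" using Hlow[of r] Hr[OF r] zero_le_power2[of "p r"] unfolding sq by linarith
  then have "(z r)\<^sup>2 <= 4*C / q*(r powr s)\<^sup>2" using q by (simp add: field_simps)
  then have "abs (z r) <= sqrt (4*C / q*(r powr s)\<^sup>2)" by (metis real_sqrt_abs real_sqrt_le_mono)
  moreover have "sqrt (4*C / q*(r powr s)\<^sup>2) = sqrt (4*C / q) * r powr s" by (subst real_sqrt_mult) simp
  ultimately have 2: "abs (z r) <= sqrt (4*C / q) * r powr s" by simp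
  have "0 <= sqrt (4*C) * r powr s" "0 <= sqrt (4*C / q) * r powr s" using C0 q by (auto intro!: mult_nonneg_nonneg)
  then show ?thesis using 1 2 unfolding C1_def by (simp add: algebra_simps)
 qed
 then show ?thesis using s(1) r1(1) by blast
qed

locale singular_profile = singular_exponents +
 fixes f :: "real => real"
 assumes solution: "profile_solution N \<alpha> f"
  and singularity: "((%r. r powr (2/\<alpha>)*f r) \<longlongrightarrow> beta N \<alpha> powr (1/\<alpha>)) (at_right 0)"
begin

lemma C1_derivs:
 assumes "g C1_differentiable_on {0<..}"
 shows "0 < r ==> (g has_real_derivative deriv g r) (at r)" "continuous_on {0<..} (deriv g)"
proof -
 from assms obtain D where D: "!!x. 0 < x ==> (g has_real_derivative D x) (at x)"
   "continuous_on {0<..} D" unfolding C1_differentiable_on_def by (auto simp: has_real_derivative_iff_has_vector_derivative)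
 have eq: "deriv g x = D x" if "0 < x" for x using D(1)[OF that] by (rule DERIV_imp_deriv)
 show "(g has_real_derivative deriv g r) (at r)" if "0 < r" using D(1)[OF that] eq[OF that] by simp
 show "continuous_on {0<..} (deriv g)" using D(2) eq
  continuous_on_cong[of "{0<..}" "{0<..}" D "deriv g"] by (metis greaterThan_iff)
qed

lemma Df: "0 < r ==> (f has_real_derivative deriv f r) (at r)"
 and Ddf: "0 < r ==> (deriv f has_real_derivative deriv (deriv f) r) (at r)"
 and continuous_ddf: "continuous_on {0<..} (deriv (deriv f))"
 and ode: "0 < r ==> deriv (deriv f) r =
   - ((real N-1) / r*deriv f r)-r/2 * deriv f r-\<kappa>/2 * f r-nonlin \<alpha> (f r)" using solution unfolding profile_solution_def
 by (auto simp: C1_derivs algebra_simps)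

lemma continuous_f: "continuous_on {0<..} f" and continuous_df: "continuous_on {0<..} (deriv f)"
 by (auto intro!: continuous_at_imp_continuous_on DERIV_isCont[OF Df] DERIV_isCont[OF Ddf])

lemma kappa_alpha: "\<kappa>*(\<alpha>+1) = \<kappa>+2" using alpha_pos by (simp add: field_simps)

lemma powr_times_nonlin:
 "0 < r ==> r powr (\<kappa>+2)*nonlin \<alpha> (f r) = nonlin \<alpha> (r powr \<kappa>*f r)"
 by (simp only: nonlin_scale[OF powr_ge_zero] powr_powr kappa_alpha)

text \<open>
 In the variable \<open>log r\<close> the rescaled profile obeys an autonomous damped Newton equation up to the term \<open>r\<^sup>2/2\<close>
 from the drift. The same system governs both ends of the half-line.
\<close>

lemma emden_fowler:
 assumes r: "0 < r"
 shows "((%r. r powr \<kappa>*f r) has_real_derivative (\<kappa> * r powr \<kappa>*f r + r powr \<kappa> * r*deriv f r) / r) (at r)"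
  and "((%r. \<kappa> * r powr \<kappa>*f r + r powr \<kappa> * r*deriv f r) has_real_derivative
   ((2*\<kappa>-(real N-2)-r\<^sup>2/2)*(\<kappa> * r powr \<kappa>*f r + r powr \<kappa> * r*deriv f r) -
    (nonlin \<alpha> (r powr \<kappa>*f r)-\<beta>*(r powr \<kappa>*f r))) / r) (at r)"
proof -
 obtain k where k: "k = \<kappa>" by blast
 define \<rho> where "\<rho> = (%r::real. r powr \<kappa>)"
 define R where "R = \<rho> r"
 define g where "g = deriv f r"
 have D\<rho>: "(\<rho> has_real_derivative k*\<rho> r / r) (at r)" unfolding \<rho>_def k[symmetric] using r
  by (auto intro!: derivative_eq_intros simp: powr_diff)
 have "((%r. \<rho> r*f r) has_real_derivative (k*\<rho> r*f r+\<rho> r * r*deriv f r) / r) (at r)"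
  using r by (auto intro!: derivative_eq_intros Df D\<rho> simp: field_simps)
 then show "((%r. r powr \<kappa>*f r) has_real_derivative
   (\<kappa> * r powr \<kappa>*f r + r powr \<kappa> * r*deriv f r) / r) (at r)" unfolding \<rho>_def k .
 have *: "((%r. k*\<rho> r*f r+\<rho> r * r*deriv f r) has_real_derivative
   (k*(k * R / r)*f r+k * R*g+(k * R / r) * r*g+R*g+R * r*deriv (deriv f) r)) (at r)"
  using r by (auto intro!: derivative_eq_intros Df Ddf D\<rho> simp: field_simps R_def g_def)
 have nl: "nonlin \<alpha> (r powr \<kappa>*f r) = R * r * r*nonlin \<alpha> (f r)"
  using powr_times_nonlin[OF r] r by (simp add: powr_add R_def \<rho>_def power2_eq_square)
 have "(\<kappa>*(\<kappa> * R / r)*f r+\<kappa> * R*g+(\<kappa> * R / r) * r*g+R*g+R * r*deriv (deriv f) r)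
  = ((2*\<kappa>-(real N-2)-r\<^sup>2/2)*(\<kappa> * R*f r+R * r*g)-(R * r * r*nonlin \<alpha> (f r)-\<beta>*(R*f r))) / r"
  unfolding ode[OF r] beta_eq k[symmetric] g_def[symmetric] using r by (simp add: field_simps power2_eq_square)
 with *[unfolded \<rho>_def k] nl show "((%r. \<kappa> * r powr \<kappa>*f r + r powr \<kappa> * r*deriv f r) has_real_derivative
   ((2*\<kappa>-(real N-2)-r\<^sup>2/2)*(\<kappa> * r powr \<kappa>*f r + r powr \<kappa> * r*deriv f r) -
    (nonlin \<alpha> (r powr \<kappa>*f r)-\<beta>*(r powr \<kappa>*f r))) / r) (at r)" unfolding R_def g_def \<rho>_def by simp
qed

lemma rate_near_zero:
 "\<exists>s>0. \<exists>C. \<exists>r1>0. \<forall>r. 0 < r --> r <= r1 --> abs (r powr \<kappa>*f r-L) <= C * r powr s \<and>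
   abs (\<kappa> * r powr \<kappa>*f r + r powr \<kappa> * r*deriv f r) <= C * r powr s"
proof (rule lyapunov_rate[where d = "2*\<kappa>-(real N-2)" and q = "\<alpha>*\<beta>" and ?r0.0 = 1
   and \<Psi> = "%z. nonlin \<alpha> (L+z)-\<beta>*(L+z)"])
 show "0 < 2*\<kappa>-(real N-2)" using two_kappa_greater by linarith
 show "0 < \<alpha>*\<beta>" using alpha_pos beta_pos by simp
 fix r :: real assume r: "0 < r"
 show "((%r. r powr \<kappa>*f r-L) has_real_derivative (\<kappa> * r powr \<kappa>*f r + r powr \<kappa> * r*deriv f r) / r) (at r)"
  using DERIV_diff[OF emden_fowler(1)[OF r] DERIV_const[of L]] by simp
 show "((%r. \<kappa> * r powr \<kappa>*f r + r powr \<kappa> * r*deriv f r) has_real_derivative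
   ((2*\<kappa>-(real N-2)-r\<^sup>2/2)*(\<kappa> * r powr \<kappa>*f r + r powr \<kappa> * r*deriv f r) -
    (nonlin \<alpha> (L+(r powr \<kappa>*f r-L))-\<beta>*(L+(r powr \<kappa>*f r-L)))) / r) (at r)" using emden_fowler(2)[OF r] by simp
next
 show "nonlin \<alpha> (L+0)-\<beta>*(L+0) = 0" using L_pos L_powr by (simp add: nonlin_def)
 have "((%z. nonlin \<alpha> (L+z)-\<beta>*(L+z)) has_real_derivative
   (\<alpha>+1)*abs (L+0) powr \<alpha>*(0+1)-\<beta>*(0+1)) (at 0)" by (intro derivative_intros DERIV_chain2[OF DERIV_nonlin[OF alpha_pos]])
   (auto intro!: derivative_eq_intros)
 moreover have "(\<alpha>+1)*abs (L+0) powr \<alpha>*(0+1)-\<beta>*(0+1) = \<alpha>*\<beta>" using L_pos L_powr by (simp add: algebra_simps)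
 ultimately show "((%z. nonlin \<alpha> (L+z)-\<beta>*(L+z)) has_real_derivative \<alpha>*\<beta>) (at 0)" by metis
 show "((%r. r powr \<kappa>*f r-L) \<longlongrightarrow> 0) (at_right 0)" using tendsto_diff[OF singularity tendsto_const[of L]] by simp
qed simp

lemma bounded_from_zero:
 fixes g :: "real => real"
 assumes "continuous_on {0<..} g" "r1 > 0" "!!r. 0 < r ==> r <= r1 ==> abs (g r) <= C"
 shows "\<exists>C. \<forall>r. 0 < r --> r <= R --> abs (g r) <= C"
proof -
 have "compact (g ` {r1..R})" using assms by (intro compact_continuous_image) (auto intro: continuous_on_subset)
 then obtain B where "!!x. x\<in>g ` {r1..R} ==> norm x <= B" using compact_imp_bounded bounded_iff by metis
 then show ?thesis using assms(3) by (intro exI[of _ "max B C"]) (force simp: le_max_iff_disj)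
qed

lemma profile_bounds_near_zero:
 obtains C where "!!r. 0 < r ==> r <= R ==> abs (f r) <= C * r powr (- \<kappa>)"
  "!!r. 0 < r ==> r <= R ==> abs (deriv f r) <= C * r powr (- \<kappa>-1)"
  "!!r. 0 < r ==> r <= R ==> abs (deriv (deriv f) r) <= C * r powr (- \<kappa>-2)"
proof -
 obtain s C r0 where s: "s > 0" "r0 > 0" and
  C: "!!r. 0 < r ==> r <= r0 ==> abs (r powr \<kappa>*f r-L) <= C * r powr s"
   "!!r. 0 < r ==> r <= r0 ==> abs (\<kappa> * r powr \<kappa>*f r + r powr \<kappa> * r*deriv f r) <= C * r powr s" using rate_near_zero by blast
 define r1 where "r1 = min r0 1"
 have r1: "r1 > 0" "r1 <= r0" "r1 <= 1" using s by (auto simp: r1_def)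
 have C0: "C \<ge> 0" using C(1)[of r0] s by (smt (verit) powr_gt_zero mult_neg_pos)
 have Crs: "C * r powr s <= C" if "0 < r" "r <= r1" for r using that r1 s C0 by (auto intro!: mult_left_le powr_le1)
 have b0: "abs (r powr \<kappa>*f r) <= C+L" if "0 < r" "r <= r1" for r using C(1)[of r] Crs[OF that] that r1 L_pos by linarith
 have b1: "abs (r powr \<kappa> * r*deriv f r) <= C+\<kappa>*(C+L)" if "0 < r" "r <= r1" for r
 proof -
  have "abs (\<kappa>*(r powr \<kappa>*f r)) <= \<kappa>*(C+L)"
   unfolding abs_mult[of \<kappa>] using mult_left_mono[OF b0[OF that], of \<kappa>] kappa_pos by (simp add: abs_mult)
  moreover have "r <= r0" using that r1 by simp
  ultimately show ?thesis using C(2)[OF that(1) \<open>r <= r0\<close>] Crs[OF that] by (simp only: mult.assoc)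
 qed
 have b2: "abs (r powr \<kappa> * r * r*deriv (deriv f) r) <=
   (real N-1)*(C+\<kappa>*(C+L))+1*(C+\<kappa>*(C+L))+\<kappa>*(C+L)+(C+L) powr (\<alpha>+1)" if r: "0 < r" "r <= r1" for r
 proof -
  have le1: "r * r <= 1" using r r1 by (simp add: mult_le_one)
  have e: "r powr \<kappa> * r * r*deriv (deriv f) r = - ((real N-1)*(r powr \<kappa> * r*deriv f r))
    - (r * r/2)*(r powr \<kappa> * r*deriv f r)-(\<kappa>/2 * (r * r))*(r powr \<kappa>*f r)
    - nonlin \<alpha> (r powr \<kappa>*f r)" unfolding ode[OF r(1)] using powr_times_nonlin[OF r(1)] r(1)
   by (simp add: field_simps powr_add power2_eq_square)
  have "abs ((real N-1)*(r powr \<kappa> * r*deriv f r)) <= (real N-1)*(C+\<kappa>*(C+L))"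
   unfolding abs_mult[of "real N-1"] using n_ge_1 mult_left_mono[OF b1[OF r], of "real N-1"] by simp
  moreover have "abs ((r * r/2)*(r powr \<kappa> * r*deriv f r)) <= 1*(C+\<kappa>*(C+L))"
   unfolding abs_mult[of "r * r/2"] using b1[OF r] le1 r by (intro mult_mono) auto
  moreover have "abs ((\<kappa>/2 * (r * r))*(r powr \<kappa>*f r)) <= \<kappa>*(C+L)"
  proof -
   obtain k where k: "k = \<kappa>" by blast
   have "abs (k/2 * (r * r)) <= k" using kappa_pos mult_left_mono[OF le1, of k] unfolding k[symmetric] by (simp add: abs_mult)
   then show ?thesis using b0[OF r] kappa_pos unfolding k[symmetric] abs_mult[of "k/2 * (r * r)" "r powr k*f r"] by (intro mult_mono) auto
  qed
  moreover have "abs (nonlin \<alpha> (r powr \<kappa>*f r)) <= (C+L) powr (\<alpha>+1)"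
   unfolding nonlin_abs using b0[OF r] alpha_pos by (intro powr_mono2) auto
  moreover have "abs (- a1-a2-a3-a4) <= b1+b2+b3+b4"
   if "abs a1 <= b1" "abs a2 <= b2" "abs a3 <= b3" "abs a4 <= b4" for a1 a2 a3 a4 b1 b2 b3 b4 :: real using that by linarith
  ultimately show ?thesis unfolding e by blast
 qed
 have cp: "continuous_on {0<..} (%r. r powr \<kappa>)" by (intro continuous_intros) auto
 have "\<exists>C. \<forall>r. 0 < r --> r <= R --> abs (r powr \<kappa>*f r) <= C"
  by (rule bounded_from_zero[OF _ r1(1) b0]) (intro continuous_intros cp continuous_f)
 then obtain C0 where C0: "!!r. 0 < r ==> r <= R ==> abs (r powr \<kappa>*f r) <= C0" by blast
 have "\<exists>C. \<forall>r. 0 < r --> r <= R --> abs (r powr \<kappa> * r*deriv f r) <= C"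
  by (rule bounded_from_zero[OF _ r1(1) b1]) (intro continuous_intros cp continuous_df)
 then obtain C1 where C1: "!!r. 0 < r ==> r <= R ==> abs (r powr \<kappa> * r*deriv f r) <= C1" by blast
 have "\<exists>C. \<forall>r. 0 < r --> r <= R --> abs (r powr \<kappa> * r * r*deriv (deriv f) r) <= C"
  by (rule bounded_from_zero[OF _ r1(1) b2]) (intro continuous_intros cp continuous_ddf)
 then obtain C2 where C2: "!!r. 0 < r ==> r <= R ==> abs (r powr \<kappa> * r * r*deriv (deriv f) r) <= C2" by blast
 define C where "C = Max {C0, C1, C2}"
 have CC: "C0 <= C" "C1 <= C" "C2 <= C" by (auto simp: C_def)
 show ?thesis
 proof
  fix r :: real assume r: "0 < r" "r <= R"
  show "abs (f r) <= C * r powr (- \<kappa>)" using C0[OF r] CC r by (simp add: abs_mult powr_minus field_simps)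
  show "abs (deriv f r) <= C * r powr (- \<kappa>-1)" using C1[OF r] CC r by (simp add: abs_mult powr_minus powr_diff field_simps)
  show "abs (deriv (deriv f) r) <= C * r powr (- \<kappa>-2)"
   using C2[OF r] CC r by (simp add: abs_mult powr_minus powr_diff field_simps power2_eq_square)
 qed
qed

end

lemma DERIV_powr_potential:
 assumes "0 < a"
 shows "((%v. nonlin a v * v / (a+2)) has_real_derivative nonlin a v) (at v)"
proof -
 have "((%v. nonlin a v * v / (a+2)) has_real_derivative
   ((a+1)*abs v powr a * v+nonlin a v)/(a+2)) (at v)" using assms by (auto intro!: derivative_eq_intros DERIV_nonlin)
 moreover have "((a+1)*abs v powr a * v+nonlin a v)/(a+2) = nonlin a v" using assms by (simp add: divide_eq_eq nonlin_def algebra_simps)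
 ultimately show ?thesis by metis
qed

lemma tendsto_antimono_bounded:
 fixes h :: "real => real"
 assumes anti: "!!x y. R <= x ==> x <= y ==> h y <= h x" and low: "!!x. R <= x ==> b <= h x"
 shows "\<exists>l. (h \<longlongrightarrow> l) at_top"
proof (intro exI decreasing_tendsto)
 have bdd: "bdd_below (h ` {R..})" using low by (auto intro!: bdd_belowI)
 show "\<forall>\<^sub>F x in at_top. Inf (h ` {R..}) <= h x" using eventually_ge_at_top[of R] by eventually_elim (auto intro!: cInf_lower bdd)
 fix x assume "Inf (h ` {R..}) < x"
 then obtain y where y: "R <= y" "h y < x" using cInf_lessD[of "h ` {R..}" x] by auto
 show "\<forall>\<^sub>F n in at_top. h n < x" using eventually_ge_at_top[of y] by eventually_elim (use anti y in fastforce)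
qed

text \<open>
 The superquadratic term beats the quadratic one; this bounds orbits whose energy is bounded.
\<close>

lemma potential_coercive:
 fixes a b :: real
 assumes a: "0 < a" and b: "0 <= b"
 obtains m where "!!v. abs v-m <= nonlin a v * v / (a+2)-b * v\<^sup>2/2"
proof -
 define B where "B = max 1 (((a+2)*(b/2+1)) powr (1/a))"
 have B: "1 <= B" by (simp add: B_def)
 have e: "nonlin a v * v = abs v powr a * v\<^sup>2" for v by (simp add: nonlin_def power2_eq_square)
 have "abs v-(B+b*B\<^sup>2/2) <= nonlin a v * v / (a+2)-b * v\<^sup>2/2" for v
 proof (cases "abs v <= B")
  case True
  then have "v\<^sup>2 <= B\<^sup>2" using B by (simp add: abs_le_square_iff[symmetric])
  then have "b * v\<^sup>2 <= b*B\<^sup>2" using b by (rule mult_left_mono)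
  moreover have "0 <= nonlin a v * v / (a+2)" using a by (simp add: e)
  ultimately show ?thesis using True by linarith
 next
  case False
  have "(((a+2)*(b/2+1)) powr (1/a)) powr a <= abs v powr a" using False a by (intro powr_mono2) (auto simp: B_def)
  then have "(a+2)*(b/2+1) <= abs v powr a" using a b by (simp add: powr_powr)
  then have "b/2+1 <= abs v powr a/(a+2)" using a by (simp add: pos_le_divide_eq mult.commute)
  then have "(b/2+1) * v\<^sup>2 <= abs v powr a/(a+2) * v\<^sup>2" by (rule mult_right_mono) simp
  moreover have "abs v * 1 <= abs v * abs v" using False B by (intro mult_left_mono) auto
  then have "abs v <= v\<^sup>2" by (simp add: power2_eq_square)
  moreover have "0 <= b*B\<^sup>2" using b by simp
  moreover have "(b/2+1) * v\<^sup>2 = b * v\<^sup>2/2+v\<^sup>2" by (simp add: algebra_simps)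
  moreover have "nonlin a v * v / (a+2) = abs v powr a/(a+2) * v\<^sup>2" unfolding e by simp
  ultimately show ?thesis using B by linarith
 qed
 then show thesis by (rule that)
qed

context singular_profile
begin

text \<open>
 For large \<open>r\<close> the drift dissipates the energy \<open>p\<^sup>2/2 + V(w)\<close> at a rate of at least \<open>r p\<^sup>2/4\<close>, while
 \<open>|w'| = |p|/r \<le> (r p\<^sup>2 + r\<^bsup>-3\<^esup>)/2\<close>. Hence, with \<open>H\<close> twice the energy plus \<open>1/(4r\<^sup>2)\<close>, both \<open>H + w\<close> and \<open>H - w\<close>
 decrease; being bounded below they converge, and so does their difference.
\<close>

lemma limit_at_infinity: "\<exists>\<mu>. ((%r. r powr \<kappa>*f r) \<longlongrightarrow> \<mu>) at_top"
proof -
 define w where "w r = r powr \<kappa>*f r" for r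
 define p where "p r = \<kappa> * r powr \<kappa>*f r + r powr \<kappa> * r*deriv f r" for r
 define d where "d = 2*\<kappa>-(real N-2)"
 define V where "V v = nonlin \<alpha> v * v / (\<alpha>+2)-\<beta> * v\<^sup>2/2" for v
 define H where "H r = (p r)\<^sup>2+2*V (w r)+1/(4 * r\<^sup>2)" for r
 define R where "R = max 1 (4*abs d)"
 obtain m where m: "!!v. abs v-m <= V v" using potential_coercive[OF alpha_pos, of \<beta>] beta_pos unfolding V_def by auto
 have Dw: "(w has_real_derivative p r / r) (at r)" if "0 < r" for r using emden_fowler(1)[OF that] unfolding w_def p_def .
 have Dp: "(p has_real_derivative ((d-r\<^sup>2/2)*p r-(nonlin \<alpha> (w r)-\<beta>*w r)) / r) (at r)" if "0 < r" for r
  using emden_fowler(2)[OF that] unfolding w_def p_def d_def .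
 have DV: "(V has_real_derivative nonlin \<alpha> v-\<beta> * v) (at v)" for v
 proof -
  have "((%v. \<beta> * v\<^sup>2/2) has_real_derivative \<beta> * v) (at v)" by (auto intro!: derivative_eq_intros)
  from DERIV_diff[OF DERIV_powr_potential[OF alpha_pos] this] show ?thesis unfolding V_def .
 qed
 have DH: "(H has_real_derivative 2*(d-r\<^sup>2/2)*(p r)\<^sup>2 / r-1/(2 * r ^ 3)) (at r)" if r: "0 < r" for r
 proof -
  have "((%r. (p r)\<^sup>2) has_real_derivative 2*p r*(((d-r\<^sup>2/2)*p r-(nonlin \<alpha> (w r)-\<beta>*w r)) / r)) (at r)"
   using Dp[OF r] by (auto intro!: derivative_eq_intros)
  moreover have "((%r. 2*V (w r)) has_real_derivative 2*((nonlin \<alpha> (w r)-\<beta>*w r)*(p r / r))) (at r)"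
   by (intro DERIV_cmult DERIV_chain2[OF DV Dw[OF r]])
  moreover have "((%r. 1/(4 * r\<^sup>2)) has_real_derivative - 1/(2 * r ^ 3)) (at r)"
   using r by (auto intro!: derivative_eq_intros simp: field_simps power2_eq_square power3_eq_cube)
  ultimately have "(H has_real_derivative 2*p r*(((d-r\<^sup>2/2)*p r-(nonlin \<alpha> (w r)-\<beta>*w r)) / r) +
    2*((nonlin \<alpha> (w r)-\<beta>*w r)*(p r / r)) + - 1/(2 * r ^ 3)) (at r)" unfolding H_def by (intro DERIV_add)
  then show ?thesis by (rule DERIV_cong) (use r in \<open>simp add: field_simps power2_eq_square\<close>)
 qed
 have dom: "abs (p r / r) <= - (2*(d-r\<^sup>2/2)*(p r)\<^sup>2 / r-1/(2 * r ^ 3))" if r: "R <= r" for r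
 proof -
  have r1: "1 <= r" "4*abs d <= r" using r by (auto simp: R_def)
  have "r*1 <= r\<^sup>2" unfolding power2_eq_square using r1 by (intro mult_left_mono) auto
  then have "4*d <= r\<^sup>2" using r1 abs_ge_self[of d] by linarith
  then have "2*(d-r\<^sup>2/2) <= - (r\<^sup>2/2)" by (simp add: algebra_simps)
  then have "2*(d-r\<^sup>2/2)*((p r)\<^sup>2 / r) <= - (r\<^sup>2/2)*((p r)\<^sup>2 / r)" using r1 by (intro mult_right_mono) auto
  moreover have "- (r\<^sup>2/2)*((p r)\<^sup>2 / r) = - (r*(p r)\<^sup>2/2)" using r1 by (simp add: power2_eq_square)
  ultimately have 1: "2*(d-r\<^sup>2/2)*(p r)\<^sup>2 / r <= - (r*(p r)\<^sup>2/2)" by simp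
  have "0 <= (r\<^sup>2*abs (p r)-1)\<^sup>2/(2 * r ^ 3)" using r1 by simp
  also have "... = r*(p r)\<^sup>2/2-abs (p r) / r+1/(2 * r ^ 3)"
   using r1 by (simp add: power2_diff power_mult_distrib field_simps power2_eq_square power3_eq_cube)
  finally show ?thesis using 1 r1 by simp
 qed
 have lim: "\<exists>l. ((%r. H r + c*w r) \<longlongrightarrow> l) at_top" if c: "abs c = 1" for c
 proof (rule tendsto_antimono_bounded)
  fix x y assume xy: "R <= x" "x <= y"
  show "H y + c*w y <= H x + c*w x"
  proof (rule DERIV_nonpos_imp_nonincreasing[OF xy(2)])
   fix r assume "x <= r"
   then have r: "R <= r" "0 < r" using xy by (auto simp: R_def)
   have "c*(p r / r) <= abs (p r / r)" using abs_ge_self[of "c*(p r / r)"] c by (simp add: abs_mult)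
   then show "\<exists>D. ((%r. H r + c*w r) has_real_derivative D) (at r) \<and> D <= 0"
    using DERIV_add[OF DH[OF r(2)] DERIV_cmult[OF Dw[OF r(2)], of c]] dom[OF r(1)] by (intro exI conjI) auto
  qed
 next
  fix x assume "R <= x"
  have "abs (c*w x) = abs (w x)" using c by (simp add: abs_mult)
  moreover have "0 <= (p x)\<^sup>2+1/(4*x\<^sup>2)" by simp
  ultimately show "- 2*m <= H x + c*w x" unfolding H_def using m[of "w x"] by linarith
 qed
 obtain l1 l2 where "((%r. H r+1*w r) \<longlongrightarrow> l1) at_top" "((%r. H r+(- 1)*w r) \<longlongrightarrow> l2) at_top"
  using lim[of 1] lim[of "- 1"] by auto
 from tendsto_divide[OF tendsto_diff[OF this] tendsto_const[of 2]]
 have "(w \<longlongrightarrow> (l1-l2)/2) at_top" by simp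
 then show ?thesis unfolding w_def by blast
qed

end

section \<open>Integrability of radial functions\<close>

lemma sets_balls [measurable]:
 "cball (x::'a::euclidean_space) r\<in>sets borel" "ball (x::'a::euclidean_space) r\<in>sets borel" by auto

lemma emeasure_cball_0:
 assumes "0 <= r"
 shows "emeasure lborel (cball (0::'a::euclidean_space) r) =
  ennreal (measure lborel (ball (0::'a) 1) * r ^ DIM('a))"
proof -
 have "emeasure lborel (cball (0::'a) r) = ennreal (measure lborel (cball (0::'a) r))"
  using emeasure_lborel_cball_finite[of "0::'a" r] by (intro emeasure_eq_ennreal_measure) auto
 also have "measure lborel (cball (0::'a) r) = r ^ DIM('a)*measure lborel (ball (0::'a) 1)"
  using content_ball_conv_unit_ball[OF assms, of "0::'a"] by (simp only: content_cball_conv_ball)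
 finally show ?thesis by (simp only: mult.commute)
qed

lemma nn_integral_geometric_shells:
 fixes g :: "'a::euclidean_space => real" and a \<rho> :: "nat => real"
 assumes [measurable]: "g\<in>borel_measurable borel"
  and a: "!!k. 0 <= a k" and rho: "!!k. 0 <= \<rho> k"
  and shell: "!!x. x\<in>S ==> g x ~= 0 ==> \<exists>k. norm x <= \<rho> k \<and> g x <= a k"
  and sum: "summable (%k. a k*\<rho> k ^ DIM('a))"
  and [measurable]: "S\<in>sets borel"
 shows "(\<integral>\<^sup>+x. ennreal (g x)*indicator S x \<partial>lborel) < \<infinity>"
proof -
 define c where "c = measure lborel (ball (0::'a) 1)"
 have c: "c \<ge> 0" by (simp add: c_def)
 have "(\<integral>\<^sup>+x. ennreal (g x)*indicator S x \<partial>lborel) <=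
   (\<integral>\<^sup>+x. (\<Sum>k. ennreal (a k)*indicator (cball 0 (\<rho> k)) (x::'a)) \<partial>lborel)"
 proof (rule nn_integral_mono)
  fix x
  show "ennreal (g x)*indicator S x <= (\<Sum>k. ennreal (a k)*indicator (cball 0 (\<rho> k)) x)"
  proof (cases "x\<in>S \<and> g x ~= 0")
   case True
   then obtain k where k: "norm x <= \<rho> k" "g x <= a k" using shell by blast
   have "ennreal (g x)*indicator S x <= (\<Sum>k\<in>{k}. ennreal (a k)*indicator (cball 0 (\<rho> k)) x)" using k True by (auto intro: ennreal_leI)
   also have "... <= (\<Sum>k. ennreal (a k)*indicator (cball 0 (\<rho> k)) x)" by (intro sum_le_suminf) auto
   finally show ?thesis .
  qed (auto simp: indicator_def)
 qed
 also have "... = (\<Sum>k. ennreal (a k)*emeasure lborel (cball (0::'a) (\<rho> k)))"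
  by (subst nn_integral_suminf) (measurable, simp add: nn_integral_cmult_indicator)
 also have "... = (\<Sum>k. ennreal (c*(a k*\<rho> k ^ DIM('a))))"
 proof (rule suminf_cong)
  fix k
  have "ennreal (a k)*emeasure lborel (cball (0::'a) (\<rho> k)) = ennreal (a k*(c*\<rho> k ^ DIM('a)))"
   unfolding emeasure_cball_0[OF rho] c_def[symmetric] using a rho c by (intro ennreal_mult[symmetric]) auto
  then show "ennreal (a k)*emeasure lborel (cball (0::'a) (\<rho> k)) = ennreal (c*(a k*\<rho> k ^ DIM('a)))" by (simp only: mult.left_commute)
 qed
 also have "... = ennreal (\<Sum>k. c*(a k*\<rho> k ^ DIM('a)))" using a rho c sum by (intro suminf_ennreal2 summable_mult) auto
 also have "... < \<infinity>" by simp
 finally show ?thesis .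
qed

lemma nn_integral_norm_powr_ball:
 assumes g: "0 <= \<gamma>" "\<gamma> < real DIM('a)"
 shows "(\<integral>\<^sup>+x. ennreal (norm x powr - \<gamma>)*indicator (cball 0 1) (x::'a::euclidean_space) \<partial>lborel) < \<infinity>"
proof (rule nn_integral_geometric_shells[where a = "%k. 2 powr (\<gamma>*(real k+1))" and \<rho> = "%k. (1/2) ^ k"])
 fix x :: 'a assume x: "x\<in>cball 0 1" "norm x powr - \<gamma> ~= 0"
 then have x0: "0 < norm x" "norm x <= 1" by auto
 obtain n where n: "(1/2) ^ n < norm x" using x0 real_arch_pow_inv[of "norm x" "1/2"] by auto
 define m where "m = (LEAST n. (1/2) ^ n < norm x)"
 have m: "(1/2) ^ m < norm x" unfolding m_def using n by (rule LeastI)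
 have "m ~= 0" using m x0 by (intro notI) auto
 then obtain k where k: "m = Suc k" using not0_implies_Suc by blast
 have "~ (1/2) ^ k < norm x" using not_less_Least[of k "%n. (1/2) ^ n < norm x"] k m_def by auto
 moreover have "norm x powr - \<gamma> <= 2 powr (\<gamma>*(real k+1))"
 proof -
  have "norm x powr - \<gamma> <= ((1/2) ^ Suc k) powr - \<gamma>" using m k g by (intro powr_mono2') auto
  also have "(1/2::real) ^ Suc k = 2 powr - (real k+1)"
   using powr_realpow[of 2 "Suc k"] by (simp only: powr_minus power_one_over) (simp add: inverse_eq_divide add.commute)
  also have "(2 powr - (real k+1)) powr - \<gamma> = 2 powr (\<gamma>*(real k+1))" by (simp add: powr_powr algebra_simps)
  finally show ?thesis .
 qed
 ultimately show "\<exists>k. norm x <= (1/2) ^ k \<and> norm x powr - \<gamma> <= 2 powr (\<gamma>*(real k+1))" by (intro exI[of _ k]) auto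
next
 define q where "q = 2 powr (\<gamma>-real DIM('a))"
 have "q < 2 powr 0" unfolding q_def using g by (intro powr_less_mono) auto
 then have q: "0 <= q" "q < 1" by (auto simp: q_def)
 have "2 powr (\<gamma>*(real k+1))*((1/2) ^ k) ^ DIM('a) = 2 powr \<gamma> * q ^ k" for k
 proof -
  have "((1/2::real) ^ k) ^ DIM('a) = 2 powr - (real k * real DIM('a))" using powr_realpow[of 2 "k*DIM('a)"]
   by (simp add: powr_minus power_one_over inverse_eq_divide flip: power_mult)
  moreover have "q ^ k = 2 powr ((\<gamma>-real DIM('a)) * real k)" unfolding q_def by (simp add: powr_powr flip: powr_realpow)
  ultimately show ?thesis by (simp add: algebra_simps flip: powr_add)
 qed
 then show "summable (%k. 2 powr (\<gamma>*(real k+1))*((1/2) ^ k) ^ DIM('a))" using q by (simp add: summable_mult summable_geometric)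
qed auto

lemma integrable_norm_powr_ball:
 assumes g: "0 <= \<gamma>" "\<gamma> < real DIM('a)"
 shows "integrable lborel (%x::'a::euclidean_space. norm x powr - \<gamma>*indicator (cball 0 R) x)"
proof (rule integrableI_bounded)
 have "(\<integral>\<^sup>+x. ennreal (norm (norm (x::'a) powr - \<gamma>*indicator (cball 0 R) x)) \<partial>lborel) <=
   (\<integral>\<^sup>+x. ennreal (norm x powr - \<gamma>)*indicator (cball 0 1) (x::'a)+indicator (cball 0 R) x \<partial>lborel)"
 proof (rule nn_integral_mono)
  fix x :: 'a
  have "norm x powr - \<gamma> <= 1" if "norm x > 1"
  proof -
   have "x ~= 0" using that by auto
   then show ?thesis using that g powr_mono[of "- \<gamma>" 0 "norm x"] by simp
  qed
  then show "ennreal (norm (norm x powr - \<gamma>*indicator (cball 0 R) x)) <=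
   ennreal (norm x powr - \<gamma>)*indicator (cball 0 1) (x::'a)+indicator (cball 0 R) x"
   by (cases "norm x <= 1") (auto simp: indicator_def intro: add_increasing2)
 qed
 also have "... = (\<integral>\<^sup>+x. ennreal (norm x powr - \<gamma>)*indicator (cball 0 1) (x::'a) \<partial>lborel)+emeasure lborel (cball (0::'a) R)"
 proof -
  have [measurable]: "(%x::'a. indicator (cball 0 r) x :: ennreal)\<in>borel_measurable borel" for r by (rule borel_measurable_indicator) simp
  have "(\<integral>\<^sup>+x. indicator (cball (0::'a) R) x \<partial>lborel) = emeasure lborel (cball (0::'a) R)"
   by (rule nn_integral_indicator) simp
  then show ?thesis by (subst nn_integral_add) simp_all
 qed
 also have "... < \<infinity>" using nn_integral_norm_powr_ball[OF g] emeasure_lborel_cball_finite[of "0::'a" R] by simp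
 finally show "(\<integral>\<^sup>+x. ennreal (norm (norm (x::'a) powr - \<gamma>*indicator (cball 0 R) x)) \<partial>lborel) < \<infinity>" .
qed measurable

lemma integrable_gaussian:
 assumes c: "0 < c"
 shows "integrable lborel (%x::'a::euclidean_space. exp (- c*(norm x)\<^sup>2))"
proof (rule integrableI_bounded)
 define d where "d = DIM('a)"
 have "((%r::real. r ^ (d+1)*exp (- c * r\<^sup>2)) \<longlongrightarrow> 0) at_top"
 proof -
  have "((%r::real. r ^ (d+1)/exp r) \<longlongrightarrow> 0) at_top" by (rule tendsto_power_div_exp_0)
  then show ?thesis
  proof (rule Lim_null_comparison[rotated])
   show "\<forall>\<^sub>F r in at_top. norm (r ^ (d+1)*exp (- c * r\<^sup>2)) <= r ^ (d+1)/exp r" using eventually_ge_at_top[of "max 0 (1 / c)"]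
   proof eventually_elim
    case (elim r)
    then have r: "0 <= r" "1 / c <= r" by auto
    then have "r*1 <= r*(c * r)" using c by (intro mult_left_mono) (auto simp: field_simps)
    then have "exp (- c * r\<^sup>2) <= exp (- r)" by (simp add: power2_eq_square mult_ac)
    then show ?case using r by (simp add: abs_mult mult_left_mono exp_minus divide_inverse)
   qed
  qed
 qed
 then have "\<forall>\<^sub>F r in at_top. r ^ (d+1)*exp (- c * r\<^sup>2) < 1" by (rule order_tendstoD) simp
 then obtain R where R: "!!r. R <= r ==> r ^ (d+1)*exp (- c * r\<^sup>2) < 1" by (auto simp: eventually_at_top_linorder)
 obtain n0 where n0: "max R 1 <= 2 ^ n0" using real_arch_pow[of 2 "max R 1"] by (auto intro: less_imp_le)
 define a where "a k = (if k = 0 then 1 else ((1/2::real) ^ (n0+k-1)) ^ (d+1))" for k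
 have "(\<integral>\<^sup>+x. ennreal (exp (- c*(norm (x::'a))\<^sup>2))*indicator UNIV x \<partial>lborel) < \<infinity>"
 proof (rule nn_integral_geometric_shells[where a = a and \<rho> = "%k. 2 ^ (n0+k)"])
  fix x :: 'a
  show "\<exists>k. norm x <= 2 ^ (n0+k) \<and> exp (- c*(norm x)\<^sup>2) <= a k"
  proof (cases "norm x <= 2 ^ n0")
   case True
   then show ?thesis using c by (intro exI[of _ 0]) (auto simp: a_def)
  next
   case False
   have "\<exists>n. norm x < 2 ^ n" by (rule real_arch_pow) simp
   then obtain n where n: "norm x <= 2 ^ n" using less_imp_le by blast
   define m where "m = (LEAST n. norm x <= 2 ^ n)"
   have m: "norm x <= 2 ^ m" unfolding m_def by (rule LeastI[of "%n. norm x <= 2 ^ n", OF n])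
   have mn: "n0 < m"
   proof (rule ccontr)
    assume "~ n0 < m"
    then have "(2::real) ^ m <= 2 ^ n0" by (intro power_increasing) auto
    then show False using m False by linarith
   qed
   have l: "2 ^ (m-1) < norm x" using not_less_Least[of "m-1" "%n. norm x <= 2 ^ n"] mn m_def by auto
   have R': "max R 1 <= norm x" using False n0 by linarith
   have "exp (- c*(norm x)\<^sup>2) <= 1/norm x ^ (d+1)"
   proof -
    have "0 < norm x ^ (d+1)" using R' by (intro zero_less_power) linarith
    then show ?thesis using R[of "norm x"] R' by (simp only: pos_le_divide_eq) (simp add: mult.commute)
   qed
   also have "... <= 1/(2 ^ (m-1)) ^ (d+1)"
    using l by (intro divide_left_mono power_mono mult_pos_pos zero_less_power) (auto intro: order_less_trans[OF _ l])
   finally show ?thesis using mn m by (intro exI[of _ "m-n0"]) (auto simp: a_def power_one_over)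
  qed
 next
  have "summable (%k. a (Suc k)*(2 ^ (n0+Suc k)) ^ DIM('a))"
  proof -
   have "a (Suc k)*(2 ^ (n0+Suc k)) ^ DIM('a) = 2 ^ d*(1/2) ^ n0*(1/2) ^ k" for k
   proof -
    have "(1/2::real) ^ (n0+k)*2 ^ (n0+k) = 1" by (simp flip: power_mult_distrib)
    then have "((1/2::real) ^ (n0+k)) ^ d*(2 ^ (n0+k)) ^ d = 1" by (simp flip: power_mult_distrib)
    then show ?thesis unfolding a_def d_def[symmetric] by (simp add: power_mult_distrib power_add algebra_simps)
   qed
   then show ?thesis by (simp add: summable_mult summable_geometric)
  qed
  then show "summable (%k. a k*(2 ^ (n0+k)) ^ DIM('a))" by (subst summable_Suc_iff[symmetric])
 qed (auto simp: a_def)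
 then show "(\<integral>\<^sup>+x. ennreal (norm (exp (- c*(norm (x::'a))\<^sup>2))) \<partial>lborel) < \<infinity>" by simp
qed measurable

lemma integrable_gaussian_exp:
 assumes c: "0 < c"
 shows "integrable lborel (%x::'a::euclidean_space. exp (b*norm x)*exp (- c*(norm x)\<^sup>2))"
proof (rule Bochner_Integration.integrable_bound)
 show "integrable lborel (%x::'a. exp (b\<^sup>2/(2 * c))*exp (- (c/2)*(norm x)\<^sup>2))"
  using c by (intro integrable_mult_right integrable_gaussian) auto
 show "AE x in lborel. norm (exp (b*norm (x::'a))*exp (- c*(norm x)\<^sup>2)) <=
   norm (exp (b\<^sup>2/(2 * c))*exp (- (c/2)*(norm x)\<^sup>2))"
 proof (rule AE_I2)
  fix x :: 'a
  have "0 <= (b / sqrt c-sqrt c*norm x)\<^sup>2/2" by simp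
  also have "... = b\<^sup>2/(2 * c)+(c/2)*(norm x)\<^sup>2-b*norm x" using c by (simp add: power2_diff power_divide power_mult_distrib field_simps)
  finally show "norm (exp (b*norm x)*exp (- c*(norm x)\<^sup>2)) <=
   norm (exp (b\<^sup>2/(2 * c))*exp (- (c/2)*(norm x)\<^sup>2))" by (simp flip: exp_add)
 qed
qed measurable

section \<open>The heat kernel\<close>

definition gauss_mass :: "'a::euclidean_space itself => real" where
 "gauss_mass _ = (LINT x::'a|lborel. exp (- (norm x)\<^sup>2/4))"

definition heat_kernel :: "real => 'a::euclidean_space => real" where
 "heat_kernel t x = exp (- (norm x)\<^sup>2/(4*t))/(sqrt t ^ DIM('a)*gauss_mass TYPE('a))"

lemma gauss_mass_pos: "0 < gauss_mass TYPE('a::euclidean_space)"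
proof -
 have i: "integrable lborel (%x::'a. exp (- (norm x)\<^sup>2/4))" using integrable_gaussian[of "1/4", where 'a = 'a] by simp
 have "gauss_mass TYPE('a) ~= 0" unfolding gauss_mass_def using integral_nonneg_eq_0_iff_AE[OF i] by (auto simp: AE_iff_null)
 moreover have "0 <= gauss_mass TYPE('a)" unfolding gauss_mass_def by simp
 ultimately show ?thesis by linarith
qed

lemma heat_kernel_nonneg [simp]: "0 <= t ==> 0 <= heat_kernel t x"
 unfolding heat_kernel_def using gauss_mass_pos[where 'a = 'a] by (simp add: order_less_imp_le)

lemma borel_measurable_heat_kernel [measurable]:
 "(%p. heat_kernel (fst p) (snd p :: 'a::euclidean_space))\<in>borel_measurable (borel \<Otimes>\<^sub>M borel)"
 unfolding heat_kernel_def by measurable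

lemma borel_heat_kernel' [measurable (raw)]:
 assumes [measurable]: "f\<in>borel_measurable M" "g\<in>borel_measurable M"
 shows "(%z. heat_kernel (f z) (g z :: 'a::euclidean_space))\<in>borel_measurable M" unfolding heat_kernel_def by measurable

lemma heat_kernel_commute: "heat_kernel t (x-y) = heat_kernel t (y-x)" by (simp add: heat_kernel_def norm_minus_commute)

lemma lborel_affine_integral:
 fixes v :: "'a::euclidean_space => real"
 assumes c: "c ~= 0" and [measurable]: "v\<in>borel_measurable borel"
 shows "integrable lborel (%z. v (x + c *\<^sub>R z)) \<longleftrightarrow> integrable lborel v" (is ?I)
  and "(LINT y|lborel. v y) = abs c ^ DIM('a)*(LINT z|lborel. v (x + c *\<^sub>R z))" (is ?J)
proof -
 have e: "(lborel :: 'a measure) = density (distr lborel borel (%z. x + c *\<^sub>R z)) (%_. ennreal (abs c ^ DIM('a)))"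
  using lborel_affine[OF c, of x] by simp
 have "integrable lborel v \<longleftrightarrow> integrable (density (distr lborel borel (%z. x + c *\<^sub>R z)) (%_. ennreal (abs c ^ DIM('a)))) v"
  by (subst e) simp
 also have "... \<longleftrightarrow> integrable (distr lborel borel (%z. x + c *\<^sub>R z)) (%y. abs c ^ DIM('a) *\<^sub>R v y)"
  by (subst integrable_density) auto
 also have "... \<longleftrightarrow> integrable lborel (%z. v (x + c *\<^sub>R z))" using c by (subst integrable_distr_eq) auto
 finally show ?I by simp
 have "(LINT y|lborel. v y) = integral\<^sup>L (density (distr lborel borel (%z. x + c *\<^sub>R z)) (%_. ennreal (abs c ^ DIM('a)))) v"
  by (subst e) simp
 also have "... = integral\<^sup>L (distr lborel borel (%z. x + c *\<^sub>R z)) (%y. abs c ^ DIM('a) *\<^sub>R v y)" by (subst integral_density) auto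
 also have "... = (LINT z|lborel. abs c ^ DIM('a) *\<^sub>R v (x + c *\<^sub>R z))" by (subst integral_distr) auto
 finally show ?J by simp
qed

lemma lborel_translation_integral:
 fixes v :: "'a::euclidean_space => real"
 assumes [measurable]: "v\<in>borel_measurable borel"
 shows "integrable lborel (%z. v (x+z)) \<longleftrightarrow> integrable lborel v"
  and "(LINT z|lborel. v (x+z)) = (LINT y|lborel. v y)" using lborel_affine_integral[of 1 v x] by auto

lemma heat_kernel_rescale:
 assumes "0 < t"
 shows "sqrt t ^ DIM('a)*heat_kernel t (x-(x + sqrt t *\<^sub>R z)) = heat_kernel 1 (z::'a::euclidean_space)"
 using assms by (simp add: heat_kernel_def power_mult_distrib)

lemma heat_kernel_average:
 fixes v :: "'a::euclidean_space => real"
 assumes t: "0 < t" and [measurable]: "v\<in>borel_measurable borel"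
 shows "integrable lborel (%y. heat_kernel t (x-y) * v y) \<longleftrightarrow>
   integrable lborel (%z. heat_kernel 1 z * v (x + sqrt t *\<^sub>R z))" (is ?I)
  and "(LINT y|lborel. heat_kernel t (x-y) * v y) =
   (LINT z|lborel. heat_kernel 1 z * v (x + sqrt t *\<^sub>R z))" (is ?J)
proof -
 have t': "sqrt t ~= 0" using t by simp
 have r: "heat_kernel 1 z * v (x + sqrt t *\<^sub>R z) =
   sqrt t ^ DIM('a)*(heat_kernel t (x-(x + sqrt t *\<^sub>R z)) * v (x + sqrt t *\<^sub>R z))" for z
  by (simp only: mult.assoc[symmetric] heat_kernel_rescale[OF t])
 show ?I unfolding r using lborel_affine_integral(1)[OF t', of "%y. heat_kernel t (x-y) * v y" x] t by simp
 show ?J unfolding r using lborel_affine_integral(2)[OF t', of "%y. heat_kernel t (x-y) * v y" x] t by simp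
qed

lemma integrable_heat_kernel_1: "integrable lborel (heat_kernel 1 :: 'a::euclidean_space => real)"
 unfolding heat_kernel_def using integrable_gaussian[of "1/4", where 'a = 'a] by simp

lemma integral_heat_kernel_1: "(LINT z|lborel. heat_kernel 1 (z::'a::euclidean_space)) = 1"
 unfolding heat_kernel_def using gauss_mass_pos[where 'a = 'a] by (simp add: gauss_mass_def)

lemma integrable_heat_kernel:
 "0 < t ==> integrable lborel (%y. heat_kernel t (x-y :: 'a::euclidean_space))"
 using heat_kernel_average(1)[of t "%_. 1" x] integrable_heat_kernel_1 by simp

lemma integral_heat_kernel:
 "0 < t ==> (LINT y|lborel. heat_kernel t (x-y :: 'a::euclidean_space)) = 1"
 using heat_kernel_average(2)[of t "%_. 1" x] integral_heat_kernel_1 by simp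

lemma integrable_heat_kernel_1_exp:
 "integrable lborel (%z::'a::euclidean_space. heat_kernel 1 z*exp (b*norm z))"
proof -
 have "integrable lborel (%x::'a. exp (b*norm x)*exp (- (1/4)*(norm x)\<^sup>2))" by (rule integrable_gaussian_exp) simp
 then show ?thesis unfolding heat_kernel_def by (simp add: mult.commute)
qed

section \<open>Change of variables and Fubini\<close>

lemma integral_eq_from_nn_integral:
 fixes f :: "'a => real" and g :: "'b => real"
 assumes [measurable]: "f\<in>borel_measurable M" "g\<in>borel_measurable N"
  and "(\<integral>\<^sup>+x. ennreal (f x) \<partial>M) = (\<integral>\<^sup>+x. ennreal (g x) \<partial>N)"
  and "(\<integral>\<^sup>+x. ennreal (- f x) \<partial>M) = (\<integral>\<^sup>+x. ennreal (- g x) \<partial>N)"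
 shows "integrable M f \<longleftrightarrow> integrable N g" "integral\<^sup>L M f = integral\<^sup>L N g"
proof -
 show i: "integrable M f \<longleftrightarrow> integrable N g" using assms by (simp add: real_integrable_def)
 show "integral\<^sup>L M f = integral\<^sup>L N g"
 proof (cases "integrable M f")
  case True
  then show ?thesis using i assms by (simp add: real_lebesgue_integral_def)
 qed (use i in \<open>simp add: not_integrable_integral_eq\<close>)
qed

lemma nn_integral_lborel_pair:
 fixes f :: "real\<times>'a::euclidean_space => ennreal"
 assumes [measurable]: "f\<in>borel_measurable borel"
 shows "(\<integral>\<^sup>+p. f p \<partial>lborel) = (\<integral>\<^sup>+s. (\<integral>\<^sup>+y. f (s, y) \<partial>lborel) \<partial>lborel)"
proof -
 have [measurable]: "f\<in>borel_measurable (lborel \<Otimes>\<^sub>M lborel)" by (simp add: lborel_prod)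
 show ?thesis using lborel.nn_integral_fst[of f lborel] by (simp add: lborel_prod)
qed

lemma nn_integral_lborel_affine:
 fixes v :: "'a::euclidean_space => ennreal"
 assumes c: "c ~= 0" and [measurable]: "v\<in>borel_measurable borel"
 shows "(\<integral>\<^sup>+y. v y \<partial>lborel) = ennreal (abs c ^ DIM('a))*(\<integral>\<^sup>+z. v (x + c *\<^sub>R z) \<partial>lborel)"
proof -
 have "(\<integral>\<^sup>+y. v y \<partial>lborel) = nn_integral (density (distr lborel borel (%z. x + c *\<^sub>R z)) (%_. ennreal (abs c ^ DIM('a)))) v"
  using lborel_affine[OF c, of x] by simp
 also have "... = (\<integral>\<^sup>+z. ennreal (abs c ^ DIM('a)) * v (x + c *\<^sub>R z) \<partial>lborel)"
  by (subst nn_integral_density) (auto simp: nn_integral_distr)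
 also have "... = ennreal (abs c ^ DIM('a))*(\<integral>\<^sup>+z. v (x + c *\<^sub>R z) \<partial>lborel)" by (rule nn_integral_cmult) measurable
 finally show ?thesis .
qed

lemma nn_integral_real_reflect:
 fixes g :: "real => ennreal"
 assumes [measurable]: "g\<in>borel_measurable borel"
 shows "(\<integral>\<^sup>+s. g s \<partial>lborel) = (\<integral>\<^sup>+s. g (c-s) \<partial>lborel)"
 using nn_integral_lborel_affine[of "-1" g c] by simp

lemma integrable_product_functions:
 fixes a :: "real => real" and b :: "'a::euclidean_space => real"
 assumes a: "integrable lborel a" and b: "integrable lborel b"
 shows "integrable lborel (%p. a (fst p)*b (snd p))"
proof -
 have [measurable]: "a\<in>borel_measurable borel" "b\<in>borel_measurable borel" using a b by auto
 have "integrable (lborel \<Otimes>\<^sub>M lborel) (%p. a (fst p)*b (snd p))"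
 proof (rule lborel_pair.Fubini_integrable)
  show "integrable lborel (%x. LINT y|lborel. norm (a (fst (x, y))*b (snd (x, y))))" using a b by (simp add: abs_mult)
  show "AE x in lborel. integrable lborel (%y. a (fst (x, y))*b (snd (x, y)))" using b by simp
 qed measurable
 then show ?thesis by (simp add: lborel_prod)
qed

lemma borel_pairI:
 assumes "f\<in>borel_measurable (borel \<Otimes>\<^sub>M borel)"
 shows "f\<in>borel_measurable (borel :: ('a::second_countable_topology\<times>'b::second_countable_topology) measure)"
 using assms by (simp add: borel_prod)

lemma borel_fst_comp:
  "f\<in>borel_measurable M ==> (%z. fst (f z :: 'a::second_countable_topology\<times>'b::second_countable_topology))\<in>borel_measurable M"
 and borel_snd_comp:
  "f\<in>borel_measurable M ==> (%z. snd (f z :: 'a::second_countable_topology\<times>'b::second_countable_topology))\<in>borel_measurable M"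
 by (erule measurable_compose, simp add: borel_prod[symmetric])+

lemma time_reflection:
 fixes f :: "real\<times>'a::euclidean_space => real"
 assumes [measurable]: "f\<in>borel_measurable borel"
 shows "integrable lborel f \<longleftrightarrow> integrable lborel (%p. f (c-fst p, snd p))"
  and "(LINT p|lborel. f p) = (LINT p|lborel. f (c-fst p, snd p))"
proof -
 have *: "(\<integral>\<^sup>+p. g p \<partial>lborel) = (\<integral>\<^sup>+p. g (c-fst p, snd p) \<partial>lborel)"
  if [measurable]: "g\<in>borel_measurable borel" for g :: "real\<times>'a => ennreal"
 proof -
  have "(\<integral>\<^sup>+p. g p \<partial>lborel) = (\<integral>\<^sup>+s. (\<integral>\<^sup>+y. g (s, y) \<partial>lborel) \<partial>lborel)"
   by (rule nn_integral_lborel_pair) measurable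
  also have "... = (\<integral>\<^sup>+s. (\<integral>\<^sup>+y. g (c-s, y) \<partial>lborel) \<partial>lborel)"
   by (rule nn_integral_real_reflect) measurable
  also have "... = (\<integral>\<^sup>+p. g (c-fst p, snd p) \<partial>lborel)"
  proof -
   have m: "(%p. g (c-fst p, snd p))\<in>borel_measurable borel" by (rule borel_pairI) measurable
   show ?thesis by (subst nn_integral_lborel_pair[OF m]) simp
  qed
  finally show ?thesis .
 qed
 show "integrable lborel f \<longleftrightarrow> integrable lborel (%p. f (c-fst p, snd p))"
  "(LINT p|lborel. f p) = (LINT p|lborel. f (c-fst p, snd p))"
 proof -
  have [measurable]: "(%p. f (c-fst p, snd p))\<in>borel_measurable borel" by (rule borel_pairI) measurable
  have n: "(\<integral>\<^sup>+p. ennreal (f p) \<partial>lborel) = (\<integral>\<^sup>+p. ennreal (f (c-fst p, snd p)) \<partial>lborel)"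
    "(\<integral>\<^sup>+p. ennreal (- f p) \<partial>lborel) = (\<integral>\<^sup>+p. ennreal (- f (c-fst p, snd p)) \<partial>lborel)"
   using *[of "%p. ennreal (f p)"] *[of "%p. ennreal (- f p)"] by auto
  show "integrable lborel f \<longleftrightarrow> integrable lborel (%p. f (c-fst p, snd p))"
   "(LINT p|lborel. f p) = (LINT p|lborel. f (c-fst p, snd p))" by (rule integral_eq_from_nn_integral[OF _ _ n]; simp)+
 qed
qed

text \<open>\<open>duhamel h t x\<close> is the solution at time \<open>t\<close> of the heat equation with source \<open>h\<close> and zero
 initial value.\<close>

definition duhamel_kernel :: "real => 'a::euclidean_space => real\<times>'a => real" where
 "duhamel_kernel t x p = indicator {0<..<t} (fst p)*heat_kernel (t-fst p) (x-snd p)"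

definition duhamel :: "(real\<times>'a::euclidean_space => real) => real => 'a => real" where
 "duhamel h t x = (LINT p|lborel. duhamel_kernel t x p*h p)"

definition heat_flow :: "('a::euclidean_space => real) => real => 'a => real" where
 "heat_flow v t x = (LINT y|lborel. heat_kernel t (x-y) * v y)"

lemma duhamel_kernel_nonneg [simp]: "0 <= duhamel_kernel t x p" unfolding duhamel_kernel_def by (auto simp: indicator_def)

lemma borel_duhamel_kernel [measurable (raw)]:
 assumes [measurable]: "f\<in>borel_measurable M" "g\<in>borel_measurable M" "h\<in>M \<rightarrow>\<^sub>M borel"
 shows "(%z. duhamel_kernel (f z) (g z :: 'a::euclidean_space) (h z))\<in>borel_measurable M"
proof -
 define u where "u = (%z. fst (h z))"
 define v where "v = (%z. snd (h z))"
 have h: "h = (%z. (u z, v z))" unfolding u_def v_def by simp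
 have [measurable]: "u\<in>borel_measurable M" "v\<in>borel_measurable M" using borel_fst_comp[OF assms(3)] borel_snd_comp[OF assms(3)]
  unfolding u_def v_def by simp_all
 show ?thesis unfolding duhamel_kernel_def indicator_def greaterThanLessThan_iff h fst_conv snd_conv by measurable
qed

lemma borel_duhamel_average:
 fixes h :: "real\<times>'a::euclidean_space => real"
 assumes [measurable]: "h\<in>borel_measurable borel"
 shows "(%p. indicator {0<..<t} (fst p)*heat_kernel 1 (snd p)
   * h (t-fst p, x + sqrt (fst p) *\<^sub>R snd p))\<in>borel_measurable borel" by (rule borel_pairI) measurable

lemma nn_integral_duhamel:
 fixes h :: "real\<times>'a::euclidean_space => real"
 assumes [measurable]: "h\<in>borel_measurable borel"
 shows "(\<integral>\<^sup>+p. ennreal (duhamel_kernel t x p*h p) \<partial>lborel) =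
  (\<integral>\<^sup>+p. ennreal (indicator {0<..<t} (fst p)*heat_kernel 1 (snd p)
    * h (t-fst p, x + sqrt (fst p) *\<^sub>R snd p)) \<partial>lborel)"
proof -
 have inner: "(\<integral>\<^sup>+y. ennreal (duhamel_kernel t x (t-s, y)*h (t-s, y)) \<partial>lborel) =
   (\<integral>\<^sup>+z. ennreal (indicator {0<..<t} s*heat_kernel 1 z*h (t-s, x + sqrt s *\<^sub>R z)) \<partial>lborel)" for s
 proof (cases "s\<in>{0<..<t}")
  case True
  then have s: "0 < s" "s < t" "sqrt s ~= 0" by auto
  have "(\<integral>\<^sup>+y. ennreal (duhamel_kernel t x (t-s, y)*h (t-s, y)) \<partial>lborel) =
   (\<integral>\<^sup>+y. ennreal (heat_kernel s (x-y)*h (t-s, y)) \<partial>lborel)" using s by (simp add: duhamel_kernel_def)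
  also have "... = ennreal (abs (sqrt s) ^ DIM('a)) *
    (\<integral>\<^sup>+z. ennreal (heat_kernel s (x-(x + sqrt s *\<^sub>R z))*h (t-s, x + sqrt s *\<^sub>R z)) \<partial>lborel)"
   by (rule nn_integral_lborel_affine[OF s(3)]) measurable
  also have "... = (\<integral>\<^sup>+z. ennreal (abs (sqrt s) ^ DIM('a)) *
    ennreal (heat_kernel s (x-(x + sqrt s *\<^sub>R z))*h (t-s, x + sqrt s *\<^sub>R z)) \<partial>lborel)"
   by (rule nn_integral_cmult[symmetric]) measurable
  also have "... = (\<integral>\<^sup>+z. ennreal (heat_kernel 1 z*h (t-s, x + sqrt s *\<^sub>R z)) \<partial>lborel)"
  proof (rule nn_integral_cong)
   fix z :: 'a
   have "ennreal (abs (sqrt s) ^ DIM('a))*ennreal (heat_kernel s (x-(x + sqrt s *\<^sub>R z))*h (t-s, x + sqrt s *\<^sub>R z))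
    = ennreal (abs (sqrt s) ^ DIM('a)*(heat_kernel s (x-(x + sqrt s *\<^sub>R z))*h (t-s, x + sqrt s *\<^sub>R z)))"
    by (rule ennreal_mult'[symmetric]) simp
   also have "abs (sqrt s) ^ DIM('a)*(heat_kernel s (x-(x + sqrt s *\<^sub>R z))*h (t-s, x + sqrt s *\<^sub>R z))
    = heat_kernel 1 z*h (t-s, x + sqrt s *\<^sub>R z)" unfolding mult.assoc[symmetric] using heat_kernel_rescale[OF s(1), of x z] s by simp
   finally show "ennreal (abs (sqrt s) ^ DIM('a))*ennreal (heat_kernel s (x-(x + sqrt s *\<^sub>R z))*h (t-s, x + sqrt s *\<^sub>R z))
    = ennreal (heat_kernel 1 z*h (t-s, x + sqrt s *\<^sub>R z))" .
  qed
  finally show ?thesis using s by simp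
 next
  case False
  then show ?thesis by (auto simp: duhamel_kernel_def indicator_def)
 qed
 have "(\<integral>\<^sup>+p. ennreal (duhamel_kernel t x p*h p) \<partial>lborel) =
   (\<integral>\<^sup>+s. (\<integral>\<^sup>+y. ennreal (duhamel_kernel t x (s, y)*h (s, y)) \<partial>lborel) \<partial>lborel)"
  by (rule nn_integral_lborel_pair) measurable
 also have "... = (\<integral>\<^sup>+s. (\<integral>\<^sup>+y. ennreal (duhamel_kernel t x (t-s, y)*h (t-s, y)) \<partial>lborel) \<partial>lborel)"
  by (rule nn_integral_real_reflect) measurable
 also have "... = (\<integral>\<^sup>+s. (\<integral>\<^sup>+z. ennreal (indicator {0<..<t} s*heat_kernel 1 z*h (t-s, x + sqrt s *\<^sub>R z)) \<partial>lborel) \<partial>lborel)"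
  unfolding inner ..
 also have "... = (\<integral>\<^sup>+p. ennreal (indicator {0<..<t} (fst p)*heat_kernel 1 (snd p)
    * h (t-fst p, x + sqrt (fst p) *\<^sub>R snd p)) \<partial>lborel)"
 proof -
  have m: "(%p. ennreal (indicator {0<..<t} (fst p)*heat_kernel 1 (snd p)
    * h (t-fst p, x + sqrt (fst p) *\<^sub>R snd p)))\<in>borel_measurable borel" using borel_duhamel_average[OF assms] by simp
  show ?thesis by (subst nn_integral_lborel_pair[OF m]) simp
 qed
 finally show ?thesis .
qed

lemma duhamel_average:
 fixes h :: "real\<times>'a::euclidean_space => real"
 assumes [measurable]: "h\<in>borel_measurable borel"
 shows "integrable lborel (%p. duhamel_kernel t x p*h p) \<longleftrightarrow>
   integrable lborel (%p. indicator {0<..<t} (fst p)*heat_kernel 1 (snd p)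
    * h (t-fst p, x + sqrt (fst p) *\<^sub>R snd p))" (is ?I)
  and "duhamel h t x = (LINT p|lborel. indicator {0<..<t} (fst p)*heat_kernel 1 (snd p)
    * h (t-fst p, x + sqrt (fst p) *\<^sub>R snd p))" (is ?J)
proof -
 note n1 = nn_integral_duhamel[OF assms, of t x]
 have n2: "(\<integral>\<^sup>+p. ennreal (- (duhamel_kernel t x p*h p)) \<partial>lborel) =
  (\<integral>\<^sup>+p. ennreal (- (indicator {0<..<t} (fst p)*heat_kernel 1 (snd p)
    * h (t-fst p, x + sqrt (fst p) *\<^sub>R snd p))) \<partial>lborel)" using nn_integral_duhamel[of "%p. - h p" t x] by simp
 have m: "(%p. duhamel_kernel t x p*h p)\<in>borel_measurable lborel"
  "(%p. indicator {0<..<t} (fst p)*heat_kernel 1 (snd p)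
   * h (t-fst p, x + sqrt (fst p) *\<^sub>R snd p))\<in>borel_measurable lborel" using borel_duhamel_average[OF assms] by simp_all
 show ?I by (rule integral_eq_from_nn_integral(1)[OF m n1 n2])
 show ?J unfolding duhamel_def by (rule integral_eq_from_nn_integral(2)[OF m n1 n2])
qed

section \<open>Integration by parts\<close>

lemma integral_directional_derivative:
 fixes G G' H :: "'a::euclidean_space => real" and b :: 'a
 assumes G: "integrable lborel G"
  and D: "!!x. ((%s. G (x + s *\<^sub>R b)) has_real_derivative G' x) (at 0)"
  and meas [measurable]: "G'\<in>borel_measurable borel"
  and H: "integrable lborel H" and bound: "!!x s. abs s <= 1 ==> abs (G' (x + s *\<^sub>R b)) <= H x"
 shows "integrable lborel G'" "(LINT x|lborel. G' x) = 0"
proof -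
 have [measurable]: "G\<in>borel_measurable borel" using G by auto
 have Ds: "((%s. G (x + s *\<^sub>R b)) has_real_derivative G' (x + s *\<^sub>R b)) (at s)" for x s
 proof -
  have "((%h. G (x+(h + s) *\<^sub>R b)) has_real_derivative G' (x + s *\<^sub>R b)) (at 0)"
   using D[of "x + s *\<^sub>R b"] by (simp add: scaleR_add_left add_ac)
  then show ?thesis using DERIV_shift[of "%s. G (x + s *\<^sub>R b)" "G' (x + s *\<^sub>R b)" 0 s] by simp
 qed
 define \<sigma> where "\<sigma> n = 1/(real n+1)" for n
 have sg: "0 < \<sigma> n" "\<sigma> n <= 1" for n by (auto simp: \<sigma>_def)
 define q where "q n x = (G (x+\<sigma> n *\<^sub>R b)-G x)/\<sigma> n" for n x
 have [measurable]: "q n\<in>borel_measurable borel" for n unfolding q_def by measurable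
 have qb: "abs (q n x) <= H x" for n x
 proof -
  have "norm (G (x+\<sigma> n *\<^sub>R b)-G (x+0 *\<^sub>R b)) <= H x*norm (\<sigma> n-0)"
  proof (rule field_differentiable_bound[of "{0..1}"])
   show "((%s. G (x + s *\<^sub>R b)) has_field_derivative G' (x+z *\<^sub>R b)) (at z within {0..1})" for z
    using Ds has_field_derivative_at_within by blast
   show "norm (G' (x+z *\<^sub>R b)) <= H x" if "z\<in>{0..1}" for z using bound[of z x] that by simp
  qed (use sg[of n] in auto)
  then show ?thesis using sg[of n] unfolding q_def by (simp add: divide_le_eq)
 qed
 have sl: "\<sigma> \<longlonglongrightarrow> 0" unfolding \<sigma>_def using LIMSEQ_inverse_real_of_nat by (simp add: inverse_eq_divide add.commute)
 have lim: "(%n. q n x) \<longlonglongrightarrow> G' x" for x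
 proof -
  have "((%h. (G (x+(0+h) *\<^sub>R b)-G (x+0 *\<^sub>R b))/h) \<longlongrightarrow> G' x) (at 0)" using D[of x] by (simp add: DERIV_def)
  moreover have "filterlim \<sigma> (at 0) sequentially" using sl sg by (auto simp: filterlim_at intro!: always_eventually) (metis less_irrefl)
  ultimately have "(%n. (G (x+(0+\<sigma> n) *\<^sub>R b)-G (x+0 *\<^sub>R b))/\<sigma> n) \<longlonglongrightarrow> G' x" by (rule filterlim_compose)
  then show ?thesis by (simp add: q_def)
 qed
 have GT: "integrable lborel (%x. G (x + c))" "(LINT x|lborel. G (x + c)) = (LINT x|lborel. G x)" for c
  using lborel_translation_integral[of G c] G by (simp_all add: add.commute)
 have q0: "(LINT x|lborel. q n x) = 0" for n unfolding q_def using GT[of "\<sigma> n *\<^sub>R b"] G by simp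
 have AEb: "AE x in lborel. norm (q n x) <= H x" for n using qb by simp
 show "integrable lborel G'" by (rule integrable_dominated_convergence[of _ _ q H]) (use lim H AEb in auto)
 have "(%n. LINT x|lborel. q n x) \<longlonglongrightarrow> (LINT x|lborel. G' x)"
  by (rule integral_dominated_convergence[of _ _ _ H]) (use lim H AEb in auto)
 then show "(LINT x|lborel. G' x) = 0" unfolding q0 using LIMSEQ_unique tendsto_const by blast
qed

section \<open>Representation of smooth functions by the heat kernel\<close>

text \<open>\<open>C12_with I \<psi> \<psi>t g H\<close>: on the time set \<open>I\<close>, the function \<open>\<psi>\<close> is continuously differentiable with time
 derivative \<open>\<psi>t\<close> and spatial gradient \<open>g\<close>, and \<open>H b\<close> is its second derivative in direction \<open>b\<close>.\<close>

definition C12_with :: "real set => (real => 'a::euclidean_space => real) => (real => 'a => real) =>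
  (real => 'a => 'a) => ('a => real => 'a => real) => bool" where
 "C12_with I \<psi> \<psi>t g H \<longleftrightarrow>
   (\<forall>s\<in>I. \<forall>y. ((%p. \<psi> (fst p) (snd p)) has_derivative (%k. fst k*\<psi>t s y + snd k \<bullet> g s y)) (at (s, y))) \<and>
   (\<forall>s\<in>I. \<forall>y. \<forall>b\<in>Basis. ((%r. g s (y + r *\<^sub>R b) \<bullet> b) has_real_derivative H b s y) (at 0)) \<and>
   continuous_on (I\<times>UNIV) (%p. \<psi>t (fst p) (snd p)) \<and>
   continuous_on (I\<times>UNIV) (%p. g (fst p) (snd p)) \<and>
   (\<forall>b\<in>Basis. continuous_on (I\<times>UNIV) (%p. H b (fst p) (snd p)))"

lemma heat_kernel_1_shift_le:
 fixes z b :: "'a::euclidean_space"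
 assumes "norm b <= 1" "abs s <= 1"
 shows "heat_kernel 1 (z + s *\<^sub>R b) <= exp (1/4)/gauss_mass TYPE('a)*exp (- (1/8)*(norm z)\<^sup>2)"
proof -
 define w where "w = z + s *\<^sub>R b"
 have "norm (s *\<^sub>R b) <= 1" using assms by (simp add: mult_le_one)
 then have "norm z <= norm w+1" unfolding w_def by (metis add_diff_cancel norm_triangle_sub norm_minus_commute add.commute add_left_mono order_trans)
 then have "(norm z)\<^sup>2 <= (norm w+1)\<^sup>2" by (intro power_mono) auto
 also have "... <= 2*(norm w)\<^sup>2+2" using sum_squares_bound[of "norm w" 1] by (simp add: power2_sum)
 finally have "- (norm w)\<^sup>2/4 <= 1/4 + - (1/8)*(norm z)\<^sup>2" by simp
 then have "exp (- (norm w)\<^sup>2/4) <= exp (1/4)*exp (- (1/8)*(norm z)\<^sup>2)" by (simp flip: exp_add)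
 then show ?thesis unfolding w_def[symmetric] heat_kernel_def using gauss_mass_pos[where 'a = 'a] by (simp add: divide_right_mono)
qed

lemma gaussian_integration_by_parts:
 fixes v v' :: "'a::euclidean_space => real"
 assumes b: "b\<in>Basis"
  and D: "!!z. ((%r. v (z + r *\<^sub>R b)) has_real_derivative v' z) (at 0)"
  and [measurable]: "v\<in>borel_measurable borel" "v'\<in>borel_measurable borel"
  and bound: "!!z. abs (v z) <= C*exp (c*norm z)" "!!z. abs (v' z) <= C*exp (c*norm z)" and c: "0 <= c"
 shows "(LINT z|lborel. heat_kernel 1 z*((z \<bullet> b) * v z)) = 2*(LINT z|lborel. heat_kernel 1 z * v' z)"
proof -
 have C: "0 <= C" using bound(1)[of 0] by simp
 define M where "M = 2*C * exp (c+1)*(exp (1/4)/gauss_mass TYPE('a))"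
 define H where "H z = M*(exp ((c+1)*norm z)*exp (- (1/8)*(norm z)\<^sup>2))" for z :: 'a
 define G where "G z = heat_kernel 1 z * v z" for z
 define G' where "G' z = heat_kernel 1 z*(- (z \<bullet> b)/2) * v z+heat_kernel 1 z * v' z" for z
 have i: "integrable lborel (%z. heat_kernel 1 z*w z)"
  if [measurable]: "w\<in>borel_measurable borel" and "!!z. abs (w z) <= C'*exp (c'*norm z)" for w :: "'a => real" and C' c'
 proof (rule Bochner_Integration.integrable_bound)
  show "integrable lborel (%z::'a. C'*(heat_kernel 1 z*exp (c'*norm z)))" by (intro integrable_mult_right integrable_heat_kernel_1_exp)
  show "AE z in lborel. norm (heat_kernel 1 z*w z) <= norm (C'*(heat_kernel 1 z*exp (c'*norm z)))"
  proof (rule AE_I2)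
   fix z
   have "norm (heat_kernel 1 z*w z) <= heat_kernel 1 z*(C'*exp (c'*norm z))" using that(2) by (simp add: abs_mult mult_left_mono)
   then show "norm (heat_kernel 1 z*w z) <= norm (C'*(heat_kernel 1 z*exp (c'*norm z)))" by (simp add: mult_ac)
  qed
 qed measurable
 have nb: "norm b = 1" using b by simp
 have zb: "abs (z \<bullet> b) <= exp (norm z)" for z
 proof -
  have "abs (z \<bullet> b) <= norm z" using Cauchy_Schwarz_ineq2[of z b] nb by simp
  also have "... <= exp (norm z)" using exp_ge_add_one_self[of "norm z"] by linarith
  finally show ?thesis .
 qed
 have zbv: "abs ((z \<bullet> b) * v z) <= C*exp ((c+1)*norm z)" for z
 proof -
  have "abs ((z \<bullet> b) * v z) <= exp (norm z)*(C*exp (c*norm z))" unfolding abs_mult using zb bound by (intro mult_mono) auto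
  then show ?thesis by (simp add: algebra_simps exp_add)
 qed
 have iG: "integrable lborel G" unfolding G_def using bound by (intro i) auto
 have "(LINT z|lborel. G' z) = 0"
 proof (rule integral_directional_derivative(2)[OF iG])
  fix z
  have *: "((%s. heat_kernel 1 (z + s *\<^sub>R b)) has_real_derivative heat_kernel 1 z*(- (z \<bullet> b)/2)) (at 0)"
  proof -
   have "(norm (z + s *\<^sub>R b))\<^sup>2 = (norm z)\<^sup>2+2 * s*(z \<bullet> b) + s\<^sup>2" for s using b unfolding power2_norm_eq_inner
    by (simp add: inner_simps inner_commute[of b z] power2_eq_square algebra_simps)
   then show ?thesis unfolding heat_kernel_def using gauss_mass_pos[where 'a = 'a] by (auto intro!: derivative_eq_intros simp: field_simps)
  qed
  show "((%s. G (z + s *\<^sub>R b)) has_real_derivative G' z) (at 0)"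
   unfolding G_def G'_def using DERIV_mult[OF*D[of z]] by (simp add: add.commute mult.commute)
 next
  show "integrable lborel H" unfolding H_def by (intro integrable_mult_right integrable_gaussian_exp) simp
  fix z s assume s: "abs (s::real) <= 1"
  define w where "w = z + s *\<^sub>R b"
  have "norm (s *\<^sub>R b) <= 1" using s nb by simp
  then have nw: "norm w <= norm z+1" unfolding w_def using norm_triangle_ineq[of z "s *\<^sub>R b"] by linarith
  have "G' w = heat_kernel 1 w*(v' w-(w \<bullet> b) * v w/2)" by (simp add: G'_def algebra_simps)
  then have "abs (G' w) = heat_kernel 1 w*abs (v' w-(w \<bullet> b) * v w/2)" by (simp add: abs_mult)
  also have "... <= (exp (1/4)/gauss_mass TYPE('a)*exp (- (1/8)*(norm z)\<^sup>2))*(2*C * exp ((c+1)*norm w))"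
  proof (rule mult_mono)
   show "heat_kernel 1 w <= exp (1/4)/gauss_mass TYPE('a)*exp (- (1/8)*(norm z)\<^sup>2)"
    unfolding w_def using s nb by (intro heat_kernel_1_shift_le) auto
   have "C*exp (c*norm w) <= C*exp ((c+1)*norm w)" using C by (intro mult_left_mono) (auto simp: algebra_simps)
   then show "abs (v' w-(w \<bullet> b) * v w/2) <= 2*C * exp ((c+1)*norm w)" using zbv[of w] bound(2)[of w] by linarith
  qed (use gauss_mass_pos[where 'a = 'a] in auto)
  also have "... <= (exp (1/4)/gauss_mass TYPE('a)*exp (- (1/8)*(norm z)\<^sup>2))*(2*C * exp ((c+1)*(norm z+1)))"
   using nw c C gauss_mass_pos[where 'a = 'a] by (intro mult_left_mono) (auto intro!: mult_left_mono)
  also have "... = H z" unfolding H_def M_def by (simp add: algebra_simps exp_add)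
  finally show "abs (G' (z + s *\<^sub>R b)) <= H z" unfolding w_def .
 qed (simp add: G'_def)
 moreover have "(LINT z|lborel. G' z) = (LINT z|lborel. (- 1/2)*(heat_kernel 1 z*((z \<bullet> b) * v z))+heat_kernel 1 z * v' z)"
  unfolding G'_def by (intro Bochner_Integration.integral_cong) (auto simp: algebra_simps)
 moreover have "... = (- 1/2)*(LINT z|lborel. heat_kernel 1 z*((z \<bullet> b) * v z))+(LINT z|lborel. heat_kernel 1 z * v' z)"
  using i[OF _ zbv] i[OF _ bound(2)] by (subst Bochner_Integration.integral_add) auto
 ultimately show ?thesis by simp
qed

text \<open>
 The substitution \<open>y = x + \<surd>\<tau> z\<close> turns the heat kernel into a fixed Gaussian in \<open>z\<close>. Then the derivative in \<open>\<tau>\<close> of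
 \<open>\<psi>(t - \<tau>, x + \<surd>\<tau> z)\<close> integrates to the difference of the end values, and Gaussian integration by parts
 identifies its average with the source.
\<close>

lemma heat_representation:
 fixes \<psi> \<psi>t :: "real => 'a::euclidean_space => real"
 assumes t: "0 < t" and C12: "C12_with {0<..<t} \<psi> \<psi>t g H"
  and cont: "continuous_on ({0..t}\<times>UNIV) (%p. \<psi> (fst p) (snd p))"
  and b0: "!!s y. 0 <= s ==> s <= t ==> abs (\<psi> s y) <= C*exp (norm y)"
  and bt: "!!s y. 0 < s ==> s < t ==> abs (\<psi>t s y) <= C*exp (norm y)"
  and bg: "!!s y. 0 < s ==> s < t ==> norm (g s y) <= C*exp (norm y)"
  and bH: "!!s y b. 0 < s ==> s < t ==> b\<in>Basis ==> abs (H b s y) <= C*exp (norm y)"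
  and S_meas [measurable]: "S\<in>borel_measurable borel"
  and S: "!!s y. 0 < s ==> s < t ==> S (s, y) = \<psi>t s y-(\<Sum>b\<in>Basis. H b s y)"
 shows "integrable lborel (%p. duhamel_kernel t x p * S p)"
  and "\<psi> t x = heat_flow (\<psi> 0) t x+duhamel S t x"
proof -
 note C12' = C12[unfolded C12_with_def]
 have C: "0 <= C" using b0[of t 0] t by simp
 define I where "I = {0<..<t}"
 define y where "y \<tau> z = x + sqrt \<tau> *\<^sub>R z" for \<tau> z
 have ny: "exp (norm (y \<tau> z)) <= exp (norm x)*exp (sqrt t*norm z)" if "0 <= \<tau>" "\<tau> <= t" for \<tau> z
 proof -
  have "norm (y \<tau> z) <= norm x + sqrt \<tau>*norm z" unfolding y_def using norm_triangle_ineq[of x "sqrt \<tau> *\<^sub>R z"] that by simp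
  also have "... <= norm x + sqrt t*norm z" using that by (intro add_left_mono mult_right_mono) auto
  finally show ?thesis by (simp flip: exp_add)
 qed
 define P where "P \<tau> z = - \<psi>t (t-\<tau>) (y \<tau> z)+(z \<bullet> g (t-\<tau>) (y \<tau> z))/(2 * sqrt \<tau>)" for \<tau> z
 define F where "F z \<tau> = \<psi> (t-\<tau>) (y \<tau> z)" for z \<tau>
 have DF: "(F z has_real_derivative P \<tau> z) (at \<tau>)" if \<tau>: "\<tau>\<in>I" for z \<tau>
 proof -
  have d1: "((%\<tau>. t-\<tau>) has_derivative (%h. - h)) (at \<tau>)" by (auto intro!: derivative_eq_intros)
  have d2: "(sqrt has_derivative (%h. (inverse (sqrt \<tau>)/2)*h)) (at \<tau>)"
  proof -
   have "0 < \<tau>" using \<tau> by (simp add: I_def)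
   from DERIV_real_sqrt[OF this] show ?thesis unfolding has_field_derivative_def .
  qed
  have d3: "((%\<tau>. y \<tau> z) has_derivative (%h. ((inverse (sqrt \<tau>)/2)*h) *\<^sub>R z)) (at \<tau>)"
   unfolding y_def using has_derivative_add[OF has_derivative_const has_derivative_scaleR_left[OF d2, of z]] by simp
  have d4: "((%p. \<psi> (fst p) (snd p)) has_derivative
    (%k. fst k*\<psi>t (t-\<tau>) (y \<tau> z) + snd k \<bullet> g (t-\<tau>) (y \<tau> z))) (at (t-\<tau>, y \<tau> z))"
   using C12' \<tau> unfolding I_def by auto
  have "(F z has_derivative (%h. - h*\<psi>t (t-\<tau>) (y \<tau> z)+(((inverse (sqrt \<tau>)/2)*h) *\<^sub>R z) \<bullet> g (t-\<tau>) (y \<tau> z))) (at \<tau>)"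
   unfolding F_def using has_derivative_compose[OF has_derivative_Pair[OF d1 d3] d4] by simp
  then show ?thesis unfolding has_field_derivative_def P_def by (rule has_derivative_eq_rhs) (auto simp: fun_eq_iff field_simps)
 qed
 have cy: "continuous_on A (%p. y (fst p) (snd p))" for A unfolding y_def by (intro continuous_intros)
 have comp: "continuous_on (I\<times>UNIV) (%p. w (t-fst p) (y (fst p) (snd p)))"
  if "continuous_on (I\<times>UNIV) (%p. w (fst p) (snd p))" for w :: "real => 'a => 'b::topological_space"
 proof -
  have c: "continuous_on (I\<times>UNIV) (%p. (t-fst p, y (fst p) (snd p)))" by (intro continuous_intros cy)
  have im: "(%p. (t-fst p, y (fst p) (snd p))) ` (I\<times>UNIV) \<subseteq> I\<times>UNIV" by (auto simp: I_def)
  show ?thesis using continuous_on_compose2[OF that c im] by simp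
 qed
 have cP: "continuous_on (I\<times>UNIV) (%p. P (fst p) (snd p))" unfolding P_def using C12' unfolding I_def[symmetric]
  by (intro continuous_intros comp) (auto simp: I_def)
 have isC: "isCont (%\<tau>. P \<tau> z) \<tau>" if "\<tau>\<in>I" for z \<tau>
 proof -
  have "continuous_on I (%\<tau>. P (fst (\<tau>, z)) (snd (\<tau>, z)))" by (rule continuous_on_compose2[OF cP]) (auto intro!: continuous_intros)
  then show ?thesis using that unfolding I_def by (simp add: continuous_on_eq_continuous_at)
 qed
 define a where "a \<tau> = indicator I \<tau>*(1+abs \<tau> powr - (1/2))" for \<tau> :: real
 define b where "b z = real (DIM('a)+1)*C * exp (norm x)*(heat_kernel 1 z*exp ((sqrt t+1)*norm z))" for z :: 'a
 have ia: "integrable lborel a"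
 proof -
  have "integrable lborel (%\<tau>::real. norm \<tau> powr - (1/2)*indicator (cball 0 t) \<tau>)" by (rule integrable_norm_powr_ball) auto
  then have 1: "integrable lborel (%\<tau>::real. indicator I \<tau>*abs \<tau> powr - (1/2))"
   by (rule Bochner_Integration.integrable_bound) (auto simp: I_def indicator_def intro!: AE_I2)
  have 2: "integrable lborel (indicator I :: real => real)"
   unfolding I_def by (rule integrable_real_indicator) (auto simp: emeasure_lborel_Ioo t less_imp_le)
  show ?thesis unfolding a_def using Bochner_Integration.integrable_add[OF 2 1] by (simp add: algebra_simps)
 qed
 have ib: "integrable lborel b" unfolding b_def by (intro integrable_mult_right integrable_heat_kernel_1_exp)
 have iab: "integrable lborel (%p. a (fst p)*b (snd p))" by (rule integrable_product_functions[OF ia ib])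
 have b_nn: "0 <= b z" for z unfolding b_def using C by simp
 have bd: "abs w <= real (DIM('a)+1)*C * exp (norm (y \<tau> z))*(1+norm z)*(1+\<tau> powr - (1/2)) ==>
   abs (indicator I \<tau>*heat_kernel 1 z*w) <= a \<tau>*b z" for w \<tau> z
 proof (cases "\<tau>\<in>I")
  case True
  then have tau: "0 < \<tau>" "\<tau> < t" by (auto simp: I_def)
  assume "abs w <= real (DIM('a)+1)*C * exp (norm (y \<tau> z))*(1+norm z)*(1+\<tau> powr - (1/2))"
  also have "... <= real (DIM('a)+1)*C * (exp (norm x)*exp (sqrt t*norm z))*exp (norm z)*(1+\<tau> powr - (1/2))"
   using C ny[of \<tau> z] tau exp_ge_add_one_self[of "norm z"] by (intro mult_right_mono mult_mono mult_left_mono) auto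
  finally have "abs w <= (1+\<tau> powr - (1/2))*(real (DIM('a)+1)*C * exp (norm x)*exp ((sqrt t+1)*norm z))" by (simp add: exp_add algebra_simps)
  then have "heat_kernel 1 z*abs w <= heat_kernel 1 z*((1+\<tau> powr - (1/2))*(real (DIM('a)+1)*C * exp (norm x)*exp ((sqrt t+1)*norm z)))"
   by (intro mult_left_mono) auto
  then show ?thesis using True tau unfolding a_def b_def by (simp add: abs_mult mult_ac)
 qed (simp add: a_def)
 define Q where "Q p = indicator I (fst p)*heat_kernel 1 (snd p)*P (fst p) (snd p)" for p
 define QS where "QS p = indicator I (fst p)*heat_kernel 1 (snd p) * S (t-fst p, y (fst p) (snd p))" for p
 have Q_meas: "Q\<in>borel_measurable borel"
 proof -
  have "(%p. indicator (I\<times>UNIV) p *\<^sub>R P (fst p) (snd p))\<in>borel_measurable (borel :: (real\<times>'a) measure)"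
   by (rule borel_measurable_continuous_on_indicator[OF _ cP]) (auto simp: I_def intro!: borel_open open_Times)
  moreover have "(%p. heat_kernel 1 (snd p :: 'a))\<in>borel_measurable (borel :: (real\<times>'a) measure)" by (rule borel_pairI) measurable
  ultimately have "(%p. heat_kernel 1 (snd p)*(indicator (I\<times>UNIV) p *\<^sub>R P (fst p) (snd p)))\<in>borel_measurable borel"
   by (rule borel_measurable_times[rotated])
  moreover have "Q = (%p. heat_kernel 1 (snd p)*(indicator (I\<times>UNIV) p *\<^sub>R P (fst p) (snd p)))"
   unfolding Q_def by (auto simp: fun_eq_iff indicator_def)
  ultimately show ?thesis by simp
 qed
 have tau_le: "1 <= 1+\<tau> powr - (1/2)" for \<tau> :: real by simp
 have Cny: "C*exp (norm (y \<tau> z)) <= C*exp (norm (y \<tau> z))*(1+norm z)*(1+\<tau> powr - (1/2))" for \<tau> z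
 proof -
  have "1*1 <= (1+norm z)*(1+\<tau> powr - (1/2))" by (intro mult_mono) auto
  then show ?thesis using mult_left_mono[of 1 _ "C*exp (norm (y \<tau> z))"] C by (simp add: mult.assoc)
 qed
 have Pb: "abs (P \<tau> z) <= real (DIM('a)+1)*C * exp (norm (y \<tau> z))*(1+norm z)*(1+\<tau> powr - (1/2))"
  if "\<tau>\<in>I" for \<tau> z
 proof -
  have tau: "0 < \<tau>" "\<tau> < t" "0 < t-\<tau>" "t-\<tau> < t" using that by (auto simp: I_def)
  define E where "E = C*exp (norm (y \<tau> z))"
  have E: "0 <= E" using C by (simp add: E_def)
  have sq: "\<tau> powr - (1/2) = 1 / sqrt \<tau>" using tau by (simp add: powr_minus powr_half_sqrt inverse_eq_divide)
  have "abs (z \<bullet> g (t-\<tau>) (y \<tau> z)) <= norm z*E"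
   using Cauchy_Schwarz_ineq2[of z "g (t-\<tau>) (y \<tau> z)"] mult_left_mono[OF bg[OF tau(3,4), of "y \<tau> z"], of "norm z"]
   unfolding E_def by simp
  then have "abs ((z \<bullet> g (t-\<tau>) (y \<tau> z))/(2 * sqrt \<tau>)) <= norm z*E / sqrt \<tau>"
  proof -
   have "abs ((z \<bullet> g (t-\<tau>) (y \<tau> z))/(2 * sqrt \<tau>)) <= (norm z*E)/(2 * sqrt \<tau>)"
    unfolding abs_divide using \<open>(abs (z \<bullet> g (t-\<tau>) (y \<tau> z))) <= norm z*E\<close> tau by (auto intro!: divide_right_mono)
   also have "... <= (norm z*E) / sqrt \<tau>" using tau E by (intro divide_left_mono) auto
   finally show ?thesis .
  qed
  moreover have "abs (\<psi>t (t-\<tau>) (y \<tau> z)) <= E" unfolding E_def using bt tau by auto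
  ultimately have "abs (P \<tau> z) <= E+norm z*E / sqrt \<tau>" unfolding P_def by linarith
  also have "... <= E*((1+norm z)*(1+1 / sqrt \<tau>))"
  proof -
   have "0 <= E*norm z" "0 <= E / sqrt \<tau>" using E tau by auto
   then show ?thesis by (simp add: algebra_simps add_divide_distrib)
  qed
  also have "... <= (real (DIM('a)+1)*E)*((1+norm z)*(1+1 / sqrt \<tau>))"
   using E tau mult_right_mono[of 1 "real (DIM('a)+1)" E] by (intro mult_right_mono) auto
  finally show ?thesis unfolding sq E_def by (simp add: mult.assoc)
 qed
 have Sb: "abs (S (t-\<tau>, y \<tau> z)) <= real (DIM('a)+1)*C * exp (norm (y \<tau> z))*(1+norm z)*(1+\<tau> powr - (1/2))"
  if "\<tau>\<in>I" for \<tau> z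
 proof -
  have tau: "0 < t-\<tau>" "t-\<tau> < t" using that by (auto simp: I_def)
  have "abs (S (t-\<tau>, y \<tau> z)) <= abs (\<psi>t (t-\<tau>) (y \<tau> z))+(\<Sum>b\<in>Basis. abs (H b (t-\<tau>) (y \<tau> z)))"
   unfolding S[OF tau] using sum_abs[of "%b. H b (t-\<tau>) (y \<tau> z)" Basis] by linarith
  also have "... <= C*exp (norm (y \<tau> z))+(\<Sum>b\<in>(Basis :: 'a set). C*exp (norm (y \<tau> z)))"
   using tau by (intro add_mono sum_mono bt bH) auto
  also have "... = real (DIM('a)+1)*(C*exp (norm (y \<tau> z)))" by (simp add: algebra_simps)
  also have "... <= real (DIM('a)+1)*(C*exp (norm (y \<tau> z))*(1+norm z)*(1+\<tau> powr - (1/2)))" using Cny by (intro mult_left_mono) auto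
  finally show ?thesis by (simp add: mult.assoc)
 qed
 have iQ: "integrable lborel Q" by (rule Bochner_Integration.integrable_bound[OF iab]) (use Q_meas in simp, use bd[OF Pb] b_nn in
   \<open>auto intro!: AE_I2 simp: Q_def a_def indicator_def abs_mult split: if_splits\<close>)
 have QS_meas: "QS\<in>borel_measurable borel" unfolding QS_def y_def I_def by (rule borel_duhamel_average[OF S_meas])
 have iQS: "integrable lborel QS" by (rule Bochner_Integration.integrable_bound[OF iab]) (use QS_meas in simp, use bd[OF Sb] b_nn in
   \<open>auto intro!: AE_I2 simp: QS_def a_def indicator_def abs_mult split: if_splits\<close>)
 show int: "integrable lborel (%p. duhamel_kernel t x p * S p)" using iQS unfolding duhamel_average(1)[OF S_meas, of t x] QS_def I_def y_def .
 have duh: "duhamel S t x = (LINT p|lborel. QS p)" unfolding duhamel_average(2)[OF S_meas] QS_def I_def y_def ..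
 have iz: "integrable lborel (%z. heat_kernel 1 z*w z)"
  if [measurable]: "w\<in>borel_measurable borel" and "!!z. abs (w z) <= C'*exp (c'*norm z)" for w :: "'a => real" and C' c'
 proof (rule Bochner_Integration.integrable_bound)
  show "integrable lborel (%z::'a. C'*(heat_kernel 1 z*exp (c'*norm z)))" by (intro integrable_mult_right integrable_heat_kernel_1_exp)
  show "AE z in lborel. norm (heat_kernel 1 z*w z) <= norm (C'*(heat_kernel 1 z*exp (c'*norm z)))"
  proof (rule AE_I2)
   fix z
   have "norm (heat_kernel 1 z*w z) <= heat_kernel 1 z*(C'*exp (c'*norm z))" using that(2) by (simp add: abs_mult mult_left_mono)
   then show "norm (heat_kernel 1 z*w z) <= norm (C'*(heat_kernel 1 z*exp (c'*norm z)))" by (simp add: mult_ac)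
  qed
 qed measurable
 \<comment> \<open>first in time, by the fundamental theorem of calculus\<close>
 have time: "(LINT \<tau>|lborel. Q (\<tau>, z)) = heat_kernel 1 z*(\<psi> 0 (x + sqrt t *\<^sub>R z)-\<psi> t x)" for z
 proof -
  have cF: "continuous_on {0..t} (F z)"
  proof -
   have "continuous_on {0..t} (%\<tau>. (t-\<tau>, y \<tau> z))" unfolding y_def by (intro continuous_intros)
   moreover have "(%\<tau>. (t-\<tau>, y \<tau> z)) ` {0..t} \<subseteq> {0..t}\<times>UNIV" by auto
   ultimately show ?thesis using continuous_on_compose2[OF cont, of "{0..t}" "%\<tau>. (t-\<tau>, y \<tau> z)"] unfolding F_def by simp
  qed
  have "integrable lborel (%\<tau>. a \<tau>*(b z/heat_kernel 1 z))" using ia by simp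
  then have iP: "set_integrable lborel I (%\<tau>. P \<tau> z)" unfolding set_integrable_def
  proof (rule Bochner_Integration.integrable_bound)
   have "continuous_on I (%\<tau>. P \<tau> z)" using isC by (auto intro: continuous_at_imp_continuous_on)
   then show "(%\<tau>. indicator I \<tau> *\<^sub>R P \<tau> z)\<in>borel_measurable lborel"
    using borel_measurable_continuous_on_indicator[of I "%\<tau>. P \<tau> z"] by (simp add: I_def)
   have k: "0 < heat_kernel 1 z" unfolding heat_kernel_def using gauss_mass_pos[where 'a = 'a] by simp
   show "AE \<tau> in lborel. norm (indicator I \<tau> *\<^sub>R P \<tau> z) <= norm (a \<tau>*(b z/heat_kernel 1 z))"
   proof (rule AE_I2)
    fix \<tau>
    show "norm (indicator I \<tau> *\<^sub>R P \<tau> z) <= norm (a \<tau>*(b z/heat_kernel 1 z))"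
    proof (cases "\<tau>\<in>I")
     case True
     then have "heat_kernel 1 z*abs (P \<tau> z) <= a \<tau>*b z" using bd[OF Pb[OF True], of z] by (simp add: abs_mult)
     then have "abs (P \<tau> z) <= a \<tau>*(b z/heat_kernel 1 z)" using k by (simp add: field_simps)
     then have "abs (P \<tau> z) <= abs (a \<tau>*(b z/heat_kernel 1 z))" by linarith
     then show ?thesis using True by (simp only: real_norm_def indicator_simps scaleR_one)
    qed simp
   qed
  qed
  have "(LBINT \<tau>=ereal 0..ereal t. P \<tau> z) = F z t-F z 0"
  proof (rule interval_integral_FTC_integrable)
   show "((F z \<circ> real_of_ereal) \<longlongrightarrow> F z 0) (at_right (ereal 0))"
    using continuous_on_Icc_at_rightD[OF cF t] by (simp add: ereal_tendsto_simps)
   show "((F z \<circ> real_of_ereal) \<longlongrightarrow> F z t) (at_left (ereal t))"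
    using continuous_on_Icc_at_leftD[OF cF t] by (simp add: ereal_tendsto_simps)
   show "set_integrable lborel (einterval (ereal 0) (ereal t)) (%\<tau>. P \<tau> z)" using iP by (simp add: I_def)
  qed (use t DF isC in \<open>auto simp: I_def has_real_derivative_iff_has_vector_derivative[symmetric]\<close>)
  then have "(LINT \<tau>|lborel. indicator I \<tau>*P \<tau> z) = F z t-F z 0"
   using t by (simp add: interval_integral_Ioo set_lebesgue_integral_def I_def)
  moreover have "(LINT \<tau>|lborel. Q (\<tau>, z)) = heat_kernel 1 z*(LINT \<tau>|lborel. indicator I \<tau>*P \<tau> z)"
  proof -
   have "(%\<tau>. Q (\<tau>, z)) = (%\<tau>. heat_kernel 1 z*(indicator I \<tau>*P \<tau> z))" by (auto simp: Q_def)
   then show ?thesis by (simp only: integral_mult_right_zero)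
  qed
  ultimately show ?thesis by (simp add: F_def y_def)
 qed
 have \<psi>0m [measurable]: "\<psi> 0\<in>borel_measurable borel"
 proof -
  have "continuous_on UNIV (%y. \<psi> (fst (0::real, y)) (snd (0::real, y)))"
   by (rule continuous_on_compose2[OF cont]) (use t in \<open>auto intro!: continuous_intros\<close>)
  then show ?thesis by (simp add: borel_measurable_continuous_onI)
 qed
 have ex: "abs (w (x + sqrt \<tau> *\<^sub>R z)) <= C*exp (norm x)*exp (sqrt t*norm z)"
  if "!!y. abs (w y) <= C*exp (norm y)" "0 <= \<tau>" "\<tau> <= t" for w :: "'a => real" and \<tau> z
  using order_trans[OF that(1) mult_left_mono[OF ny[OF that(2,3), of z] C]] unfolding y_def by (simp add: mult.assoc)
 have i\<psi>: "integrable lborel (%z. heat_kernel 1 z*\<psi> 0 (x + sqrt t *\<^sub>R z))"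
 proof (rule iz)
  show "abs (\<psi> 0 (x + sqrt t *\<^sub>R z)) <= C*exp (norm x)*exp (sqrt t*norm z)" for z using b0 t by (intro ex) auto
 qed measurable
 have "(LINT z|lborel. (LINT \<tau>|lborel. Q (\<tau>, z))) = heat_flow (\<psi> 0) t x-\<psi> t x"
  unfolding time heat_flow_def heat_kernel_average(2)[OF t \<psi>0m] right_diff_distrib
  using i\<psi> integrable_heat_kernel_1[where 'a = 'a] integral_heat_kernel_1[where 'a = 'a] by simp
 moreover have "(LINT z|lborel. (LINT \<tau>|lborel. Q (\<tau>, z))) = (LINT p|lborel. Q p)"
  using lborel_pair.integral_snd[of "%\<tau> z. Q (\<tau>, z)"] iQ by (simp add: lborel_prod)
 moreover have "(LINT \<tau>|lborel. (LINT z|lborel. Q (\<tau>, z))) = (LINT p|lborel. Q p)"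
  using lborel_pair.integral_fst[of "%\<tau> z. Q (\<tau>, z)"] iQ by (simp add: lborel_prod)
 moreover have "(LINT \<tau>|lborel. (LINT z|lborel. QS (\<tau>, z))) = (LINT p|lborel. QS p)"
  using lborel_pair.integral_fst[of "%\<tau> z. QS (\<tau>, z)"] iQS by (simp add: lborel_prod)
 \<comment> \<open>then in space, by parts against the Gaussian\<close>
 moreover have space: "(LINT z|lborel. Q (\<tau>, z)) = - (LINT z|lborel. QS (\<tau>, z))" for \<tau>
 proof (cases "\<tau>\<in>I")
  case True
  then have tau: "0 < \<tau>" "\<tau> < t" "0 < t-\<tau>" "t-\<tau> < t" by (auto simp: I_def)
  define s where "s = t-\<tau>"
  have s: "0 < s" "s < t" "s\<in>{0<..<t}" using tau by (auto simp: s_def)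
  have sec: "continuous_on UNIV (%z. w s z)" if "continuous_on ({0<..<t}\<times>UNIV) (%p. w (fst p) (snd p))"
   for w :: "real => 'a => 'c::topological_space"
  proof -
   have "continuous_on UNIV (%z. w (fst (s, z)) (snd (s, z)))"
    by (rule continuous_on_compose2[OF that]) (use s in \<open>auto intro!: continuous_intros\<close>)
   then show ?thesis by simp
  qed
  have m1 [measurable]: "\<psi>t s\<in>borel_measurable borel" "g s\<in>borel_measurable borel"
   using sec[of \<psi>t] sec[of g] C12' by (auto intro: borel_measurable_continuous_onI)
  have m2 [measurable]: "b\<in>Basis ==> H b s\<in>borel_measurable borel" for b
   using sec[of "H b"] C12' by (auto intro: borel_measurable_continuous_onI)
  have iH: "integrable lborel (%z. heat_kernel 1 z*H b s (x + sqrt \<tau> *\<^sub>R z))" if "b\<in>Basis" for b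
  proof (rule iz)
   show "(%z. H b s (x + sqrt \<tau> *\<^sub>R z))\<in>borel_measurable borel" using m2[OF that] by measurable
   show "abs (H b s (x + sqrt \<tau> *\<^sub>R z)) <= C*exp (norm x)*exp (sqrt t*norm z)" for z using bH s that tau by (intro ex) auto
  qed
  have it: "integrable lborel (%z. heat_kernel 1 z*\<psi>t s (x + sqrt \<tau> *\<^sub>R z))"
  proof (rule iz)
   show "abs (\<psi>t s (x + sqrt \<tau> *\<^sub>R z)) <= C*exp (norm x)*exp (sqrt t*norm z)" for z using bt s tau by (intro ex) auto
  qed measurable
  have gb: "abs (g s y \<bullet> b) <= C*exp (norm y)" if "b\<in>Basis" for b y using order_trans[OF Basis_le_norm[OF that] bg[OF s(1,2)]] .
  have ig: "integrable lborel (%z. heat_kernel 1 z*((z \<bullet> b)*(g s (x + sqrt \<tau> *\<^sub>R z) \<bullet> b)))" if "b\<in>Basis" for b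
  proof (rule iz)
   fix z
   have "abs (z \<bullet> b) <= exp (norm z)" using Basis_le_norm[OF that, of z] exp_ge_add_one_self[of "norm z"] by linarith
   then have "abs ((z \<bullet> b)*(g s (x + sqrt \<tau> *\<^sub>R z) \<bullet> b)) <= exp (norm z)*(C*exp (norm x)*exp (sqrt t*norm z))"
    unfolding abs_mult using ex[of "%y. g s y \<bullet> b" \<tau> z] gb[OF that] tau by (intro mult_mono) auto
   also have "... = C*exp (norm x)*exp ((sqrt t+1)*norm z)" by (simp add: algebra_simps exp_add)
   finally show "abs ((z \<bullet> b)*(g s (x + sqrt \<tau> *\<^sub>R z) \<bullet> b)) <= C*exp (norm x)*exp ((sqrt t+1)*norm z)" .
  qed measurable
  have ibp: "(LINT z|lborel. heat_kernel 1 z*((z \<bullet> b)*(g s (x + sqrt \<tau> *\<^sub>R z) \<bullet> b))) =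
    2 * sqrt \<tau>*(LINT z|lborel. heat_kernel 1 z*H b s (x + sqrt \<tau> *\<^sub>R z))" if b: "b\<in>Basis" for b
  proof -
   have [measurable]: "H b s\<in>borel_measurable borel" by (rule m2[OF b])
   have "(LINT z|lborel. heat_kernel 1 z*((z \<bullet> b)*(g s (x + sqrt \<tau> *\<^sub>R z) \<bullet> b))) =
    2*(LINT z|lborel. heat_kernel 1 z*(sqrt \<tau>*H b s (x + sqrt \<tau> *\<^sub>R z)))"
   proof (rule gaussian_integration_by_parts[OF b])
    fix z
    have "((%r. g s (x + sqrt \<tau> *\<^sub>R z + r *\<^sub>R b) \<bullet> b) has_real_derivative H b s (x + sqrt \<tau> *\<^sub>R z)) (at (sqrt \<tau>*0))"
     using C12' s b by auto
    moreover have "((%r. sqrt \<tau> * r) has_real_derivative sqrt \<tau>) (at 0)" by (auto intro!: derivative_eq_intros)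
    ultimately have "((%r. g s (x + sqrt \<tau> *\<^sub>R z+(sqrt \<tau> * r) *\<^sub>R b) \<bullet> b) has_real_derivative
      H b s (x + sqrt \<tau> *\<^sub>R z) * sqrt \<tau>) (at 0)"
     by (rule DERIV_chain2[where g = "%r. sqrt \<tau> * r" and f = "%r. g s (x + sqrt \<tau> *\<^sub>R z + r *\<^sub>R b) \<bullet> b"])
    then show "((%r. g s (x + sqrt \<tau> *\<^sub>R (z + r *\<^sub>R b)) \<bullet> b) has_real_derivative sqrt \<tau>*H b s (x + sqrt \<tau> *\<^sub>R z)) (at 0)"
     by (simp add: scaleR_add_right add.assoc mult.commute)
    have "abs (g s (x + sqrt \<tau> *\<^sub>R z) \<bullet> b) <= C*exp (norm x)*exp (sqrt t*norm z)"
     using gb[OF b] tau by (intro ex[of "%y. g s y \<bullet> b"]) auto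
    also have "... <= (1 + sqrt t)*(C*exp (norm x)*exp (sqrt t*norm z))" using C t by (simp add: algebra_simps)
    finally show "abs (g s (x + sqrt \<tau> *\<^sub>R z) \<bullet> b) <= ((1 + sqrt t)*C * exp (norm x))*exp (sqrt t*norm z)"
     by (simp add: mult.assoc)
    have "abs (H b s (x + sqrt \<tau> *\<^sub>R z)) <= C*exp (norm x)*exp (sqrt t*norm z)" using bH s b tau by (intro ex) auto
    then have "sqrt \<tau>*abs (H b s (x + sqrt \<tau> *\<^sub>R z)) <= (1 + sqrt t)*(C*exp (norm x)*exp (sqrt t*norm z))"
     using tau real_sqrt_le_mono[of \<tau> t] real_sqrt_ge_zero[of t] by (intro mult_mono) (auto simp del: real_sqrt_le_iff)
    then show "abs (sqrt \<tau>*H b s (x + sqrt \<tau> *\<^sub>R z)) <= ((1 + sqrt t)*C * exp (norm x))*exp (sqrt t*norm z)"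
     using tau by (simp add: abs_mult mult.assoc)
   qed (use t in \<open>measurable, simp\<close>)
   also have "(LINT z|lborel. heat_kernel 1 z*(sqrt \<tau>*H b s (x + sqrt \<tau> *\<^sub>R z))) =
     sqrt \<tau>*(LINT z|lborel. heat_kernel 1 z*H b s (x + sqrt \<tau> *\<^sub>R z))"
   proof -
    have "(%z. heat_kernel 1 z*(sqrt \<tau>*H b s (x + sqrt \<tau> *\<^sub>R z))) =
     (%z. sqrt \<tau>*(heat_kernel 1 z*H b s (x + sqrt \<tau> *\<^sub>R z)))" by (auto simp: mult_ac)
    then show ?thesis by (simp only: integral_mult_right_zero)
   qed
   finally show ?thesis by simp
  qed
  have "(LINT z|lborel. Q (\<tau>, z)) = (LINT z|lborel. - (heat_kernel 1 z*\<psi>t s (x + sqrt \<tau> *\<^sub>R z)) +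
    (\<Sum>b\<in>Basis. (1/(2 * sqrt \<tau>))*(heat_kernel 1 z*((z \<bullet> b)*(g s (x + sqrt \<tau> *\<^sub>R z) \<bullet> b)))))"
   using True unfolding Q_def P_def y_def s_def by (intro Bochner_Integration.integral_cong)
    (auto simp: euclidean_inner[of _ "g _ _"] sum_distrib_left sum_divide_distrib algebra_simps intro!: sum.cong)
  also have "... = - (LINT z|lborel. heat_kernel 1 z*\<psi>t s (x + sqrt \<tau> *\<^sub>R z)) +
    (\<Sum>b\<in>Basis. (1/(2 * sqrt \<tau>))*(LINT z|lborel. heat_kernel 1 z*((z \<bullet> b)*(g s (x + sqrt \<tau> *\<^sub>R z) \<bullet> b))))"
   using it ig by (subst Bochner_Integration.integral_add) (auto intro!: Bochner_Integration.integrable_sum simp: Bochner_Integration.integral_sum)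
  also have "... = - (LINT z|lborel. heat_kernel 1 z*\<psi>t s (x + sqrt \<tau> *\<^sub>R z)) +
    (\<Sum>b\<in>Basis. (LINT z|lborel. heat_kernel 1 z*H b s (x + sqrt \<tau> *\<^sub>R z)))"
   using tau ibp by (intro arg_cong2[where f = "(+)"] refl sum.cong) auto
  also have "... = - (LINT z|lborel. heat_kernel 1 z*\<psi>t s (x + sqrt \<tau> *\<^sub>R z) -
    (\<Sum>b\<in>Basis. heat_kernel 1 z*H b s (x + sqrt \<tau> *\<^sub>R z)))"
   using it iH by (subst Bochner_Integration.integral_diff) (auto intro!: Bochner_Integration.integrable_sum simp: Bochner_Integration.integral_sum)
  also have "(%z. heat_kernel 1 z*\<psi>t s (x + sqrt \<tau> *\<^sub>R z) -
    (\<Sum>b\<in>Basis. heat_kernel 1 z*H b s (x + sqrt \<tau> *\<^sub>R z))) = (%z. QS (\<tau>, z))"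
   using True by (simp add: QS_def y_def s_def[symmetric] S[OF s(1,2)] right_diff_distrib sum_distrib_left)
  finally show ?thesis .
 qed (simp add: Q_def QS_def)
 ultimately have "heat_flow (\<psi> 0) t x-\<psi> t x = - (LINT p|lborel. QS p)" by simp
 then show "\<psi> t x = heat_flow (\<psi> 0) t x+duhamel S t x" unfolding duh by simp
qed

section \<open>Pointwise bounds for the heat kernel away from the diagonal\<close>

lemma power_le_exp: "0 <= x ==> x ^ n/fact n <= exp (x::real)"
proof -
 assume x: "0 <= x"
 have "(\<Sum>k\<in>{n}. inverse (fact k) *\<^sub>R x ^ k) <= (\<Sum>k. inverse (fact k) *\<^sub>R x ^ k)"
  by (rule sum_le_suminf) (use x summable_exp_generic[of x] in auto)
 then show ?thesis by (simp add: exp_def divide_inverse mult.commute)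
qed

lemma heat_kernel_off_diagonal:
 assumes r: "0 < r" and t: "0 < t"
 obtains M where "!!s (z::'a::euclidean_space). 0 < s ==> s <= t ==> r <= norm z ==> heat_kernel s z <= M"
proof -
 define n where "n = DIM('a)"
 define M where "M = fact n*4 ^ n * sqrt t ^ n/(r ^ (2*n))/gauss_mass TYPE('a)"
 have "heat_kernel s z <= M" if s: "0 < s" "s <= t" and z: "r <= norm z" for s and z :: 'a
 proof -
  define v where "v = r\<^sup>2/(4 * s)"
  have v: "0 < v" using r s by (simp add: v_def)
  have "r\<^sup>2 <= (norm z)\<^sup>2" using r z by (intro power_mono) auto
  then have "exp (- (norm z)\<^sup>2/(4 * s)) <= exp (- v)" unfolding v_def using s by (simp add: divide_right_mono)
  also have "... <= fact n / v ^ n" using power_le_exp[of v n] v by (simp add: exp_minus field_simps)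
  finally have e: "exp (- (norm z)\<^sup>2/(4 * s)) <= fact n / v ^ n" .
  have "fact n / v ^ n / sqrt s ^ n = fact n*4 ^ n * sqrt s ^ n / r ^ (2*n)"
  proof -
   have "s ^ n = sqrt s ^ n * sqrt s ^ n" using s by (simp flip: power_mult_distrib)
   then show ?thesis using s r by (simp add: v_def power_divide power_mult_distrib power_mult[symmetric] field_simps)
  qed
  also have "... <= fact n*4 ^ n * sqrt t ^ n / r ^ (2*n)" using s r by (intro divide_right_mono mult_left_mono power_mono) auto
  finally have "fact n / v ^ n / sqrt s ^ n <= fact n*4 ^ n * sqrt t ^ n / r ^ (2*n)" .
  moreover have "exp (- (norm z)\<^sup>2/(4 * s)) / sqrt s ^ n <= fact n / v ^ n / sqrt s ^ n" using e s by (intro divide_right_mono) auto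
  ultimately have "exp (- (norm z)\<^sup>2/(4 * s)) / sqrt s ^ n <= fact n*4 ^ n * sqrt t ^ n / r ^ (2*n)" by linarith
  then have "exp (- (norm z)\<^sup>2/(4 * s)) / sqrt s ^ n/gauss_mass TYPE('a) <= M"
   unfolding M_def using gauss_mass_pos[where 'a = 'a] by (intro divide_right_mono) auto
  then show ?thesis unfolding heat_kernel_def n_def by simp
 qed
 then show ?thesis using that by blast
qed

lemma integrable_norm_powr_ball_bounded:
 fixes w :: "'a::euclidean_space => real"
 assumes g: "0 <= \<gamma>" "\<gamma> < real DIM('a)" and [measurable]: "w\<in>borel_measurable borel"
  and w: "!!y. norm y <= R ==> abs (w y) <= C"
 shows "integrable lborel (%y::'a. norm y powr - \<gamma>*indicator (cball 0 R) y*w y)"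
proof (rule Bochner_Integration.integrable_bound)
 show "integrable lborel (%y::'a. abs C*(norm y powr - \<gamma>*indicator (cball 0 R) y))"
  by (intro integrable_mult_right integrable_norm_powr_ball g)
 show "AE y in lborel. norm (norm y powr - \<gamma>*indicator (cball 0 R) y*w y) <=
   norm (abs C*(norm (y::'a) powr - \<gamma>*indicator (cball 0 R) y))"
 proof (rule AE_I2)
  fix y :: 'a
  have "norm y powr - \<gamma>*abs (w y) <= norm y powr - \<gamma>*abs C" if "norm y <= R" using w[OF that] by (intro mult_left_mono) auto
  then show "norm (norm y powr - \<gamma>*indicator (cball 0 R) y*w y) <= norm (abs C*(norm y powr - \<gamma>*indicator (cball 0 R) y))"
   by (auto simp: indicator_def abs_mult mult.commute)
 qed
qed measurable

text \<open>
 This weight dominates every singular or growing function that occurs below, and the heat flow keeps it finite off the origin.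
\<close>

definition sing_weight :: "real => 'a::euclidean_space => real" where
 "sing_weight \<gamma> y = norm y powr - \<gamma>*exp (norm y)"

lemma sing_weight_nonneg [simp]: "0 <= sing_weight \<gamma> y" by (simp add: sing_weight_def)

lemma borel_sing_weight [measurable]: "sing_weight \<gamma>\<in>borel_measurable borel" unfolding sing_weight_def by measurable

lemma heat_kernel_sing_weight_bound:
 fixes x :: "'a::euclidean_space"
 assumes g: "0 <= \<gamma>" "\<gamma> < real DIM('a)" and x: "x ~= 0" and t: "0 < t"
 obtains M where "!!s. 0 < s ==> s <= t ==> integrable lborel (%y. heat_kernel s (x-y) * sing_weight \<gamma> y)"
  "!!s. 0 < s ==> s <= t ==> (LINT y|lborel. heat_kernel s (x-y) * sing_weight \<gamma> y) <= M"
  "0 <= M"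
proof -
 define r where "r = norm x/2"
 have r: "0 < r" using x by (simp add: r_def)
 obtain K where K: "!!s z. 0 < s ==> s <= t ==> r <= norm (z::'a) ==> heat_kernel s z <= K"
  using heat_kernel_off_diagonal[OF r t, where 'a = 'a] by blast
 have iw: "integrable lborel (%y::'a. K*(norm y powr - \<gamma>*indicator (cball 0 r) y*exp (norm y)))"
  by (intro integrable_mult_right integrable_norm_powr_ball_bounded[where C = "exp r"] g) auto
 define b where "b s y = r powr - \<gamma>*(heat_kernel s (x-y)*exp (norm y))" for s y
 define M1 where "M1 = r powr - \<gamma>*(LINT z|lborel. exp (norm x)*(heat_kernel 1 (z::'a)*exp (sqrt t*norm z)))"
 have ie: "integrable lborel (%z::'a. exp (norm x)*(heat_kernel 1 z*exp (sqrt t*norm z)))"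
  by (intro integrable_mult_right integrable_heat_kernel_1_exp)
 have ib: "integrable lborel (b s)" "(LINT y|lborel. b s y) <= M1" if s: "0 < s" "s <= t" for s
 proof -
  have le: "heat_kernel 1 z*exp (norm (x + sqrt s *\<^sub>R z)) <= exp (norm x)*(heat_kernel 1 z*exp (sqrt t*norm z))" for z :: 'a
  proof -
   have "norm (x + sqrt s *\<^sub>R z) <= norm x + sqrt s*norm z" using norm_triangle_ineq[of x "sqrt s *\<^sub>R z"] s by simp
   also have "... <= norm x + sqrt t*norm z" using s by (intro add_left_mono mult_right_mono) auto
   finally have "exp (norm (x + sqrt s *\<^sub>R z)) <= exp (norm x)*exp (sqrt t*norm z)" by (simp flip: exp_add)
   then have "heat_kernel 1 z*exp (norm (x + sqrt s *\<^sub>R z)) <= heat_kernel 1 z*(exp (norm x)*exp (sqrt t*norm z))"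
    by (intro mult_left_mono) auto
   then show ?thesis by (simp add: mult_ac)
  qed
  have i1: "integrable lborel (%z. heat_kernel 1 z*exp (norm (x + sqrt s *\<^sub>R z)))"
   by (rule Bochner_Integration.integrable_bound[OF ie]) (use le in \<open>auto intro!: AE_I2\<close>)
  then have i2: "integrable lborel (%y. heat_kernel s (x-y)*exp (norm y))" using heat_kernel_average(1)[OF s(1), of "%y. exp (norm y)" x] by simp
  then show "integrable lborel (b s)" unfolding b_def by (intro integrable_mult_right)
  have "(LINT y|lborel. heat_kernel s (x-y)*exp (norm y)) = (LINT z|lborel. heat_kernel 1 z*exp (norm (x + sqrt s *\<^sub>R z)))"
   by (rule heat_kernel_average(2)[OF s(1)]) measurable
  also have "... <= (LINT z|lborel. exp (norm x)*(heat_kernel 1 (z::'a)*exp (sqrt t*norm z)))" by (rule integral_mono[OF i1 ie le])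
  finally show "(LINT y|lborel. b s y) <= M1" unfolding b_def M1_def integral_mult_right_zero by (intro mult_left_mono) auto
 qed
 define M2 where "M2 = (LINT y|lborel. K*(norm (y::'a) powr - \<gamma>*indicator (cball 0 r) y*exp (norm y)))"
 have le: "heat_kernel s (x-y) * sing_weight \<gamma> y <= K*(norm y powr - \<gamma>*indicator (cball 0 r) y*exp (norm y))+b s y"
  if s: "0 < s" "s <= t" for s y
 proof (cases "norm y <= r")
  case True
  have "r <= norm (x-y)" using norm_triangle_ineq2[of x y] True unfolding r_def by linarith
  then have "heat_kernel s (x-y) * sing_weight \<gamma> y <= K * sing_weight \<gamma> y" using K[OF s] by (intro mult_right_mono) auto
  moreover have "0 <= b s y" unfolding b_def using s by simp
  ultimately show ?thesis using True by (simp add: sing_weight_def indicator_def)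
 next
  case False
  have "norm y powr - \<gamma> <= r powr - \<gamma>" using False r g by (intro powr_mono2') auto
  then have "heat_kernel s (x-y)*(norm y powr - \<gamma>*exp (norm y)) <= heat_kernel s (x-y)*(r powr - \<gamma>*exp (norm y))"
   using s by (intro mult_left_mono mult_right_mono) auto
  then show ?thesis using False unfolding sing_weight_def b_def by (simp add: mult_ac)
 qed
 show thesis
 proof (rule that)
  fix s assume s: "0 < s" "s <= t"
  have isum: "integrable lborel (%y. K*(norm y powr - \<gamma>*indicator (cball 0 r) y*exp (norm y))+b s y)"
   by (intro Bochner_Integration.integrable_add iw ib s)
  show i: "integrable lborel (%y. heat_kernel s (x-y) * sing_weight \<gamma> y)"
   by (rule Bochner_Integration.integrable_bound[OF isum]) (use le[OF s] s in \<open>auto intro!: AE_I2 order_trans[OF _ abs_ge_self]\<close>)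
  have "(LINT y|lborel. heat_kernel s (x-y) * sing_weight \<gamma> y) <=
    (LINT y|lborel. K*(norm y powr - \<gamma>*indicator (cball 0 r) y*exp (norm y))+b s y)" by (rule integral_mono[OF i isum le[OF s]])
  also have "... = M2+(LINT y|lborel. b s y)" unfolding M2_def by (rule Bochner_Integration.integral_add[OF iw ib(1)[OF s]])
  also have "... <= abs M2+abs M1" using ib(2)[OF s] by linarith
  finally show "(LINT y|lborel. heat_kernel s (x-y) * sing_weight \<gamma> y) <= abs M2+abs M1" .
 qed simp
qed

lemma integrable_heat_kernel_sing_weight:
 fixes x :: "'a::euclidean_space"
 assumes "0 <= \<gamma>" "\<gamma> < real DIM('a)" "x ~= 0" "0 < t"
 shows "integrable lborel (%y. heat_kernel t (x-y) * sing_weight \<gamma> y)"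
 using heat_kernel_sing_weight_bound[OF assms] assms(4) by (metis order_refl)

lemma duhamel_sing_weight:
 fixes x :: "'a::euclidean_space"
 assumes g: "0 <= \<gamma>" "\<gamma> < real DIM('a)" and x: "x ~= 0" and t: "0 < t"
 obtains M where "0 <= M"
  "!!s. 0 < s ==> s <= t ==> integrable lborel (%p. duhamel_kernel s x p * sing_weight \<gamma> (snd p))"
  "!!s. 0 < s ==> s <= t ==> (LINT p|lborel. duhamel_kernel s x p * sing_weight \<gamma> (snd p)) <= M * s"
proof -
 obtain M where M: "!!s. 0 < s ==> s <= t ==> integrable lborel (%y. heat_kernel s (x-y) * sing_weight \<gamma> y)"
  "!!s. 0 < s ==> s <= t ==> (LINT y|lborel. heat_kernel s (x-y) * sing_weight \<gamma> y) <= M" "0 <= M"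
  using heat_kernel_sing_weight_bound[OF assms] by blast
 have m: "(%p. duhamel_kernel s x p * sing_weight \<gamma> (snd p))\<in>borel_measurable borel" for s
  by (intro borel_measurable_times borel_duhamel_kernel
    measurable_compose[OF borel_snd_comp[OF measurable_ident_sets[OF refl]] borel_sing_weight]) auto
 have nn: "(\<integral>\<^sup>+p. ennreal (duhamel_kernel s x p * sing_weight \<gamma> (snd p)) \<partial>lborel) <= ennreal (M * s)"
  if s: "0 < s" "s <= t" for s
 proof -
  have "(\<integral>\<^sup>+p. ennreal (duhamel_kernel s x p * sing_weight \<gamma> (snd p)) \<partial>lborel) =
   (\<integral>\<^sup>+\<tau>. (\<integral>\<^sup>+y. ennreal (duhamel_kernel s x (\<tau>, y) * sing_weight \<gamma> y) \<partial>lborel) \<partial>lborel)"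
  proof -
   have m': "(%p. ennreal (duhamel_kernel s x p * sing_weight \<gamma> (snd p)))\<in>borel_measurable borel" using m by simp
   show ?thesis by (subst nn_integral_lborel_pair[OF m']) simp
  qed
  also have "... <= (\<integral>\<^sup>+\<tau>. ennreal M*indicator {0<..<s} \<tau> \<partial>lborel)"
  proof (rule nn_integral_mono)
   fix \<tau>
   show "(\<integral>\<^sup>+y. ennreal (duhamel_kernel s x (\<tau>, y) * sing_weight \<gamma> y) \<partial>lborel) <= ennreal M*indicator {0<..<s} \<tau>"
   proof (cases "\<tau>\<in>{0<..<s}")
    case True
    then have "(\<integral>\<^sup>+y. ennreal (duhamel_kernel s x (\<tau>, y) * sing_weight \<gamma> y) \<partial>lborel) =
      ennreal (LINT y|lborel. heat_kernel (s-\<tau>) (x-y) * sing_weight \<gamma> y)"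
     unfolding duhamel_kernel_def using M(1)[of "s-\<tau>"] s by (simp add: nn_integral_eq_integral)
    also have "... <= ennreal M" using M(2)[of "s-\<tau>"] True s by (intro ennreal_leI) auto
    finally show ?thesis using True by simp
   qed (simp add: duhamel_kernel_def)
  qed
  also have "... = ennreal (M * s)" using s M(3) by (subst nn_integral_cmult_indicator) (auto simp: ennreal_mult)
  finally show ?thesis .
 qed
 have int: "integrable lborel (%p. duhamel_kernel s x p * sing_weight \<gamma> (snd p))" if s: "0 < s" "s <= t" for s
  by (rule integrableI_nonneg) (use m nn[OF s] in \<open>auto intro: order.strict_trans1\<close>)
 show thesis
 proof (rule that[OF M(3) int])
  fix s assume s: "0 < s" "s <= t"
  have "ennreal (LINT p|lborel. duhamel_kernel s x p * sing_weight \<gamma> (snd p)) <= ennreal (M * s)"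
   using nn[OF s] nn_integral_eq_integral[OF int[OF s]] by simp
  then show "(LINT p|lborel. duhamel_kernel s x p * sing_weight \<gamma> (snd p)) <= M * s" using M(3) s by (subst (asm) ennreal_le_iff) auto
 qed
qed

lemma AE_snd_nonzero: "AE p in lborel. snd (p :: real\<times>'a::euclidean_space) ~= 0"
proof -
 have z: "(\<integral>\<^sup>+y. indicator {0::'a} y \<partial>lborel) = 0"
 proof -
  have "(\<integral>\<^sup>+y. indicator {0::'a} y \<partial>lborel) = emeasure lborel {0::'a}" by (rule nn_integral_indicator) simp
  then show ?thesis by (simp only: emeasure_lborel_singleton)
 qed
 have m: "(%p. indicator (UNIV\<times>{0::'a}) p :: ennreal)\<in>borel_measurable (borel :: (real\<times>'a) measure)"
  by (intro borel_measurable_indicator borel_closed closed_Times) auto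
 have "emeasure lborel (UNIV\<times>{0::'a} :: (real\<times>'a) set) = (\<integral>\<^sup>+p. indicator (UNIV\<times>{0::'a}) p \<partial>(lborel :: (real\<times>'a) measure))"
  by (intro nn_integral_indicator[symmetric]) (auto intro!: borel_closed closed_Times)
 also have "... = (\<integral>\<^sup>+s. (\<integral>\<^sup>+y. indicator {0::'a} y \<partial>lborel) \<partial>(lborel :: real measure))"
 proof -
  have e: "(indicator (UNIV\<times>{0::'a}) (s, y) :: ennreal) = indicator {0} y" for s :: real and y by (simp add: indicator_def)
  show ?thesis by (subst nn_integral_lborel_pair[OF m]) (simp only: e)
 qed
 also have "... = 0" unfolding z by simp
 finally show ?thesis by (intro AE_I[of _ _ "UNIV\<times>{0}"]) (auto intro!: borel_closed closed_Times)
qed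

lemma AE_lborel_fst_neq: "AE p in lborel. fst (p :: real\<times>'a::euclidean_space) ~= c"
proof -
 have m: "(%p. indicator ({c}\<times>(UNIV::'a set)) p :: ennreal)\<in>borel_measurable (borel :: (real\<times>'a) measure)"
  by (intro borel_measurable_indicator borel_closed closed_Times) auto
 have "emeasure lborel ({c}\<times>(UNIV::'a set)) = (\<integral>\<^sup>+p. indicator ({c}\<times>(UNIV::'a set)) p \<partial>lborel)"
  by (intro nn_integral_indicator[symmetric]) (auto intro!: borel_closed closed_Times)
 also have "... = (\<integral>\<^sup>+s. (\<integral>\<^sup>+y. indicator {c} s \<partial>(lborel :: 'a measure)) \<partial>lborel)"
  by (subst nn_integral_lborel_pair[OF m]) (auto intro!: nn_integral_cong simp: indicator_def)
 also have "... = (\<integral>\<^sup>+s. \<infinity>*indicator {c} s \<partial>lborel)" by (intro nn_integral_cong) (auto simp: indicator_def)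
 also have "... = 0" by (subst nn_integral_cmult_indicator) auto
 finally show ?thesis by (intro AE_I[of _ _ "{c}\<times>UNIV"]) (auto intro!: borel_closed closed_Times)
qed

section \<open>Radial functions\<close>

lemma radial_C12:
 fixes F F1 F2 F3 :: "real => real => real"
 assumes I: "open I" and e: "0 < \<epsilon>"
  and DF: "!!s \<sigma>. s\<in>I ==> 0 < \<sigma> ==> ((%p. F (fst p) (snd p)) has_derivative
    (%k. fst k*F1 s \<sigma> + snd k*F2 s \<sigma>)) (at (s, \<sigma>))"
  and DF2: "!!s \<sigma>. s\<in>I ==> 0 < \<sigma> ==> (F2 s has_real_derivative F3 s \<sigma>) (at \<sigma>)"
  and c1: "continuous_on (I\<times>{0<..}) (%p. F1 (fst p) (snd p))"
  and c2: "continuous_on (I\<times>{0<..}) (%p. F2 (fst p) (snd p))"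
  and c3: "continuous_on (I\<times>{0<..}) (%p. F3 (fst p) (snd p))"
 shows "C12_with I (%s y::'a::euclidean_space. F s ((norm y)\<^sup>2+\<epsilon>)) (%s y. F1 s ((norm y)\<^sup>2+\<epsilon>))
   (%s y. (2*F2 s ((norm y)\<^sup>2+\<epsilon>)) *\<^sub>R y)
   (%b s y. 2*F2 s ((norm y)\<^sup>2+\<epsilon>)+4*(y \<bullet> b)\<^sup>2*F3 s ((norm y)\<^sup>2+\<epsilon>))"
proof -
 have pos: "0 < (norm y)\<^sup>2+\<epsilon>" for y :: 'a using e by (simp add: add_nonneg_pos)
 have comp: "continuous_on (I\<times>UNIV) (%p. w (fst p) ((norm (snd p :: 'a))\<^sup>2+\<epsilon>))"
  if "continuous_on (I\<times>{0<..}) (%p. w (fst p) (snd p))" for w :: "real => real => real"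
 proof -
  have c: "continuous_on (I\<times>UNIV) (%p. (fst p, (norm (snd p :: 'a))\<^sup>2+\<epsilon>))" by (intro continuous_intros)
  have im: "(%p. (fst p, (norm (snd p :: 'a))\<^sup>2+\<epsilon>)) ` (I\<times>UNIV) \<subseteq> I\<times>{0<..}" using pos by auto
  show ?thesis using continuous_on_compose2[OF that c im] by simp
 qed
 show ?thesis unfolding C12_with_def
 proof (intro conjI ballI allI)
  fix s and y :: 'a assume s: "s\<in>I"
  have d0: "((%p. (norm (snd p :: 'a))\<^sup>2) has_derivative (%k. 2*(y \<bullet> snd k))) (at (s, y))"
  proof -
   have sn: "((%p. snd p :: 'a) has_derivative snd) (at (s, y))" by (rule bounded_linear_imp_has_derivative[OF bounded_linear_snd])
   show ?thesis unfolding power2_norm_eq_inner by (rule has_derivative_eq_rhs[OF has_derivative_inner[OF sn sn]]) (simp add: inner_commute)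
  qed
  have d1: "((%p. (fst p, (norm (snd p :: 'a))\<^sup>2+\<epsilon>)) has_derivative (%k. (fst k, 2*(y \<bullet> snd k)))) (at (s, y))"
  proof -
   have "(fst has_derivative fst) (at (s, y))" by (rule bounded_linear_imp_has_derivative[OF bounded_linear_fst])
   moreover have "((%p. (norm (snd p :: 'a))\<^sup>2+\<epsilon>) has_derivative (%k. 2*(y \<bullet> snd k)+0)) (at (s, y))"
    by (rule has_derivative_add[OF d0 has_derivative_const])
   ultimately show ?thesis using has_derivative_Pair by fastforce
  qed
  have d2: "((%p. F (fst p) (snd p)) has_derivative
    (%k. fst k*F1 s ((norm y)\<^sup>2+\<epsilon>) + snd k*F2 s ((norm y)\<^sup>2+\<epsilon>)))
    (at ((%p. (fst p, (norm (snd p :: 'a))\<^sup>2+\<epsilon>)) (s, y)))" using DF[OF s pos[of y]] by simp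
  have "((%p. F (fst p) ((norm (snd p :: 'a))\<^sup>2+\<epsilon>)) has_derivative
    (%k. fst k*F1 s ((norm y)\<^sup>2+\<epsilon>)+(2*(y \<bullet> snd k))*F2 s ((norm y)\<^sup>2+\<epsilon>))) (at (s, y))"
   using has_derivative_compose[OF d1 d2] by simp
  then show "((%p. F (fst p) ((norm (snd p :: 'a))\<^sup>2+\<epsilon>)) has_derivative
    (%k. fst k*F1 s ((norm y)\<^sup>2+\<epsilon>) + snd k \<bullet> ((2*F2 s ((norm y)\<^sup>2+\<epsilon>)) *\<^sub>R y))) (at (s, y))"
   by (rule has_derivative_eq_rhs) (auto simp: inner_commute fun_eq_iff)
  fix b :: 'a assume b: "b\<in>Basis"
  have bb: "b \<bullet> b = 1" using b by simp
  have n: "(norm (y + r *\<^sub>R b))\<^sup>2 = (norm y)\<^sup>2+2 * r*(y \<bullet> b) + r\<^sup>2" for r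
   unfolding power2_norm_eq_inner using bb by (simp add: inner_simps inner_commute[of b y] power2_eq_square algebra_simps)
  have dn: "((%r. (norm (y + r *\<^sub>R b))\<^sup>2+\<epsilon>) has_real_derivative 2*(y \<bullet> b)) (at 0)"
   unfolding n by (auto intro!: derivative_eq_intros)
  have "((%r. F2 s ((norm (y + r *\<^sub>R b))\<^sup>2+\<epsilon>)) has_real_derivative F3 s ((norm y)\<^sup>2+\<epsilon>)*(2*(y \<bullet> b))) (at 0)"
   by (rule DERIV_chain2[where f = "F2 s" and g = "%r. (norm (y + r *\<^sub>R b))\<^sup>2+\<epsilon>"]) (use DF2[OF s pos] dn in auto)
  then have "((%r. 2*F2 s ((norm (y + r *\<^sub>R b))\<^sup>2+\<epsilon>)*(y \<bullet> b + r)) has_real_derivative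
    2*(F3 s ((norm y)\<^sup>2+\<epsilon>)*(2*(y \<bullet> b)))*(y \<bullet> b)+2*F2 s ((norm y)\<^sup>2+\<epsilon>)) (at 0)"
   by (auto intro!: derivative_eq_intros)
  moreover have "2*(F3 s ((norm y)\<^sup>2+\<epsilon>)*(2*(y \<bullet> b)))*(y \<bullet> b)+2*F2 s ((norm y)\<^sup>2+\<epsilon>) =
    2*F2 s ((norm y)\<^sup>2+\<epsilon>)+4*(y \<bullet> b)\<^sup>2*F3 s ((norm y)\<^sup>2+\<epsilon>)" by (simp add: power2_eq_square)
  moreover have "(%r. (2*F2 s ((norm (y + r *\<^sub>R b))\<^sup>2+\<epsilon>)) *\<^sub>R (y + r *\<^sub>R b) \<bullet> b) =
    (%r. 2*F2 s ((norm (y + r *\<^sub>R b))\<^sup>2+\<epsilon>)*(y \<bullet> b + r))" using bb by (auto simp: inner_simps)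
  ultimately show "((%r. (2*F2 s ((norm (y + r *\<^sub>R b))\<^sup>2+\<epsilon>)) *\<^sub>R (y + r *\<^sub>R b) \<bullet> b) has_real_derivative
    2*F2 s ((norm y)\<^sup>2+\<epsilon>)+4*(y \<bullet> b)\<^sup>2*F3 s ((norm y)\<^sup>2+\<epsilon>)) (at 0)" by metis
 qed (intro continuous_intros comp c1 c2 c3)+
qed

lemma radial_laplacian_sum:
 "(\<Sum>b\<in>Basis. 2*A+4*((y::'a::euclidean_space) \<bullet> b)\<^sup>2*B) = 2 * real DIM('a)*A+4*(norm y)\<^sup>2*(B::real)"
proof -
 have "(norm y)\<^sup>2 = (\<Sum>b\<in>Basis. (y \<bullet> b)\<^sup>2)"
  unfolding power2_norm_eq_inner by (subst euclidean_inner) (simp add: power2_eq_square)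
 then show ?thesis by (simp add: sum.distrib sum_distrib_left sum_distrib_right mult_ac)
qed

lemma LIMSEQ_reciprocal: "(%n. 1/(real n+1)) \<longlonglongrightarrow> 0"
 using LIMSEQ_inverse_real_of_nat by (simp add: inverse_eq_divide add.commute)

lemma borel_radial:
 fixes F :: "real => real => real"
 assumes "(%p. F (fst p) (snd p))\<in>borel_measurable borel"
 shows "(%p. F (fst p) ((norm (snd p :: 'a::euclidean_space))\<^sup>2+\<epsilon>))\<in>borel_measurable borel"
proof -
 have "(%p::real\<times>'a. (fst p, (norm (snd p))\<^sup>2+\<epsilon>))\<in>borel_measurable borel"
  by (intro borel_measurable_continuous_onI continuous_intros)
 from measurable_compose[OF this assms] show ?thesis by simp
qed

text \<open>
 The representation formula is applied with \<open>|x|\<^sup>2\<close> replaced by \<open>|x|\<^sup>2 + \<epsilon>\<close>; as \<open>\<epsilon> \<rightarrow> 0\<close> the singular weight dominates.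
\<close>

lemma radial_mild:
 fixes F F1 F2 F3 :: "real => real => real" and x :: "'a::euclidean_space"
 assumes t: "0 < t" and x: "x ~= 0" and g: "0 <= \<gamma>" "\<gamma> < real DIM('a)"
  and DF: "!!s \<sigma>. 0 < s ==> s < t ==> 0 < \<sigma> ==> ((%p. F (fst p) (snd p)) has_derivative
    (%k. fst k*F1 s \<sigma> + snd k*F2 s \<sigma>)) (at (s, \<sigma>))"
  and DF2: "!!s \<sigma>. 0 < s ==> s < t ==> 0 < \<sigma> ==> (F2 s has_real_derivative F3 s \<sigma>) (at \<sigma>)"
  and c0: "continuous_on ({0..t}\<times>{0<..}) (%p. F (fst p) (snd p))"
  and c1: "continuous_on ({0<..<t}\<times>{0<..}) (%p. F1 (fst p) (snd p))"
  and c2: "continuous_on ({0<..<t}\<times>{0<..}) (%p. F2 (fst p) (snd p))"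
  and c3: "continuous_on ({0<..<t}\<times>{0<..}) (%p. F3 (fst p) (snd p))"
  and m0: "(%p. F (fst p) (snd p))\<in>borel_measurable borel"
  and m1: "(%p. F1 (fst p) (snd p))\<in>borel_measurable borel"
  and m2: "(%p. F2 (fst p) (snd p))\<in>borel_measurable borel"
  and m3: "(%p. F3 (fst p) (snd p))\<in>borel_measurable borel"
  and b0: "!!s \<sigma>. 0 <= s ==> s <= t ==> 0 < \<sigma> ==> abs (F s \<sigma>) <= C*(\<sigma> powr - (\<gamma>/2)*exp (sqrt \<sigma>/2))"
  and b1: "!!s \<sigma>. 0 < s ==> s < t ==> 0 < \<sigma> ==> abs (F1 s \<sigma>) <= C*(\<sigma> powr - (\<gamma>/2)*exp (sqrt \<sigma>/2))"
  and b2: "!!s \<sigma>. 0 < s ==> s < t ==> 0 < \<sigma> ==> abs (F2 s \<sigma>) <= C*(\<sigma> powr - (\<gamma>/2)*exp (sqrt \<sigma>/2))"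
  and b3: "!!s \<sigma>. 0 < s ==> s < t ==> 0 < \<sigma> ==> \<sigma>*abs (F3 s \<sigma>) <= C*(\<sigma> powr - (\<gamma>/2)*exp (sqrt \<sigma>/2))"
 defines "S \<equiv> %p::real\<times>'a. F1 (fst p) ((norm (snd p))\<^sup>2) -
   (2 * real DIM('a)*F2 (fst p) ((norm (snd p))\<^sup>2)+4*(norm (snd p))\<^sup>2*F3 (fst p) ((norm (snd p))\<^sup>2))"
 shows "integrable lborel (%p. duhamel_kernel t x p * S p)"
  and "F t ((norm x)\<^sup>2) = heat_flow (%y. F 0 ((norm y)\<^sup>2)) t x+duhamel S t x"
proof -
 define e where "e n = 1/(real n+1)" for n
 have e: "0 < e n" "e n <= 1" for n by (auto simp: e_def)
 have el: "e \<longlonglongrightarrow> 0" unfolding e_def by (rule LIMSEQ_reciprocal)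
 have "0 <= C*exp (1/2)" using order_trans[OF abs_ge_zero b0[of 0 1]] t by simp
 then have C: "0 <= C" by (simp add: zero_le_mult_iff)
 define sg where "sg n y = (norm (y::'a))\<^sup>2+e n" for n y
 have sgp: "0 < sg n y" "e n <= sg n y" "(norm y)\<^sup>2 <= sg n y" for n y unfolding sg_def using e[of n] by (auto simp: add_nonneg_pos)
 have sq: "sqrt (sg n y) <= norm y+1" for n y
 proof (rule real_le_lsqrt)
  have "sg n y <= (norm y)\<^sup>2+1" unfolding sg_def using e by simp
  also have "... <= (norm y+1)\<^sup>2" by (simp add: power2_sum)
  finally show "sg n y <= (norm y+1)\<^sup>2" .
 qed auto
 have w1: "C*(sg n y powr - (\<gamma>/2)*exp (sqrt (sg n y)/2)) <= C*(e n powr - (\<gamma>/2)*(exp (1/2)*exp (norm y/2)))" for n y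
  using sgp(1,2)[of n y] e[of n] sq[of n y] g C by (intro mult_left_mono mult_mono powr_mono2') (auto simp: field_simps simp flip: exp_add)
 have sg_conv: "(%n. sg n y) \<longlonglongrightarrow> (norm y)\<^sup>2" for y
  unfolding sg_def using tendsto_add[OF tendsto_const el, of "(norm y)\<^sup>2"] by simp
 have w2: "C*(sg n y powr - (\<gamma>/2)*exp (sqrt (sg n y)/2)) <= C*exp (1/2) * sing_weight \<gamma> y" if "y ~= 0" for n y
 proof -
  have "sg n y powr - (\<gamma>/2) <= ((norm y)\<^sup>2) powr - (\<gamma>/2)" using sgp(3)[of y n] that g by (intro powr_mono2') auto
  also have "... = norm y powr - \<gamma>" using that by (simp add: powr_powr flip: powr_numeral)
  finally have p: "sg n y powr - (\<gamma>/2) <= norm y powr - \<gamma>" .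
  have "sqrt (sg n y)/2 <= 1/2+norm y" using sq[of n y] norm_ge_zero[of y] by linarith
  then have "exp (sqrt (sg n y)/2) <= exp (1/2)*exp (norm y)" by (simp flip: exp_add)
  with p have "sg n y powr - (\<gamma>/2)*exp (sqrt (sg n y)/2) <= norm y powr - \<gamma>*(exp (1/2)*exp (norm y))" by (intro mult_mono) auto
  then have "C*(sg n y powr - (\<gamma>/2)*exp (sqrt (sg n y)/2)) <= C*(norm y powr - \<gamma>*(exp (1/2)*exp (norm y)))"
   using C by (intro mult_left_mono)
  then show ?thesis unfolding sing_weight_def by (simp add: mult_ac)
 qed
 define Sn where "Sn n p = F1 (fst p) (sg n (snd p)) -
   (2 * real DIM('a)*F2 (fst p) (sg n (snd p))+4*(norm (snd p))\<^sup>2*F3 (fst p) (sg n (snd p)))" for n and p :: "real\<times>'a"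
 have ns: "(%p::real\<times>'a. (norm (snd p))\<^sup>2)\<in>borel_measurable borel" by (intro borel_measurable_continuous_onI continuous_intros)
 have Sn_meas: "Sn n\<in>borel_measurable borel" for n unfolding Sn_def[abs_def] sg_def
  by (intro borel_measurable_diff borel_measurable_add borel_measurable_times borel_measurable_const
    borel_radial m1 m2 m3 ns)
 have S_meas: "S\<in>borel_measurable borel" unfolding S_def using borel_radial[OF m1, of 0] borel_radial[OF m2, of 0] borel_radial[OF m3, of 0] ns
  by (intro borel_measurable_diff borel_measurable_add borel_measurable_times borel_measurable_const) auto
 have Snb: "abs (Sn n p) <= (5+2 * real DIM('a))*(C*(sg n (snd p) powr - (\<gamma>/2)*exp (sqrt (sg n (snd p))/2)))"
  if "0 < fst p" "fst p < t" for n p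
 proof -
  define W where "W = C*(sg n (snd p) powr - (\<gamma>/2)*exp (sqrt (sg n (snd p))/2))"
  define f1 where "f1 = F1 (fst p) (sg n (snd p))"
  define f2 where "f2 = F2 (fst p) (sg n (snd p))"
  define f3 where "f3 = F3 (fst p) (sg n (snd p))"
  have "abs f1 <= W" "abs f2 <= W" "sg n (snd p)*abs f3 <= W" unfolding f1_def f2_def f3_def W_def using b1 b2 b3 that sgp by auto
  moreover have "(norm (snd p))\<^sup>2*abs f3 <= sg n (snd p)*abs f3" using sgp by (intro mult_right_mono) auto
  moreover have "abs (2 * real DIM('a)*f2) <= 2 * real DIM('a)*W"
   unfolding abs_mult using \<open>(abs f2) <= W\<close> by (auto intro!: mult_left_mono)
  moreover have "abs (4*(norm (snd p))\<^sup>2*f3) = 4*((norm (snd p))\<^sup>2*abs f3)" by (simp add: abs_mult)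
  ultimately have "abs (f1-(2 * real DIM('a)*f2+4*(norm (snd p))\<^sup>2*f3)) <= W+(2 * real DIM('a)*W+4*W)" by linarith
  then show ?thesis unfolding Sn_def W_def[symmetric] f1_def[symmetric] f2_def[symmetric] f3_def[symmetric] by (simp add: algebra_simps)
 qed
 define D where "D p = (5+2 * real DIM('a))*(C*exp (1/2))*(duhamel_kernel t x p * sing_weight \<gamma> (snd p))" for p
 obtain M0 where "!!s. 0 < s ==> s <= t ==> integrable lborel (%p. duhamel_kernel s x p * sing_weight \<gamma> (snd p))"
  using duhamel_sing_weight[OF g x t] by blast
 then have iD: "integrable lborel D" unfolding D_def using t by (intro integrable_mult_right) auto
 have dom: "AE p in lborel. norm (duhamel_kernel t x p * Sn n p) <= D p" for n using AE_snd_nonzero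
 proof eventually_elim
  case (elim p)
  show ?case
  proof (cases "0 < fst p \<and> fst p < t")
   case True
   have "abs (Sn n p) <= (5+2 * real DIM('a))*(C*exp (1/2) * sing_weight \<gamma> (snd p))"
    using Snb[of p n] True w2[OF elim, of n] by (smt (verit) mult_left_mono of_nat_0_le_iff)
   then have "duhamel_kernel t x p*abs (Sn n p) <= duhamel_kernel t x p*((5+2 * real DIM('a))*(C*exp (1/2) * sing_weight \<gamma> (snd p)))"
    by (intro mult_left_mono) auto
   then show ?thesis unfolding D_def by (simp add: abs_mult mult_ac)
  qed (auto simp: duhamel_kernel_def D_def)
 qed
 have cs: "(%n. w s (sg n y)) \<longlonglongrightarrow> w s ((norm y)\<^sup>2)"
  if "continuous_on (J\<times>{0<..}) (%p. w (fst p) (snd p))" "s\<in>J" "y ~= 0" for w :: "real => real => real" and s y J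
 proof -
  have "continuous_on {0<..} (%\<sigma>. w (fst (s, \<sigma>)) (snd (s, \<sigma>)))"
   by (rule continuous_on_compose2[OF that(1)]) (use that in \<open>auto intro!: continuous_intros\<close>)
  then have "isCont (w s) ((norm y)\<^sup>2)" using that(3) by (simp add: continuous_on_eq_continuous_at)
  then show ?thesis using sg_conv by (rule isCont_tendsto_compose)
 qed
 have lim: "AE p in lborel. (%n. duhamel_kernel t x p * Sn n p) \<longlonglongrightarrow> duhamel_kernel t x p * S p" using AE_snd_nonzero
 proof eventually_elim
  case (elim p)
  show ?case
  proof (cases "0 < fst p \<and> fst p < t")
   case True
   then have I: "fst p\<in>{0<..<t}" by simp
   show ?thesis unfolding Sn_def S_def by (intro tendsto_intros cs[OF c1 I elim] cs[OF c2 I elim] cs[OF c3 I elim])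
  qed (auto simp: duhamel_kernel_def)
 qed
 have mk: "(%p. duhamel_kernel t x p)\<in>borel_measurable borel" by measurable
 have mSn: "(%p. duhamel_kernel t x p * Sn n p)\<in>borel_measurable lborel" for n using borel_measurable_times[OF mk Sn_meas] by simp
 have mS: "(%p. duhamel_kernel t x p * S p)\<in>borel_measurable lborel" using borel_measurable_times[OF mk S_meas] by simp
 show "integrable lborel (%p. duhamel_kernel t x p * S p)" by (rule integrable_dominated_convergence[OF mS mSn iD lim dom])
 have l1: "(%n. duhamel (Sn n) t x) \<longlonglongrightarrow> duhamel S t x"
  unfolding duhamel_def by (rule integral_dominated_convergence[OF mS mSn iD lim dom])
 have mF0: "(%y. F 0 ((norm (y::'a))\<^sup>2 + r))\<in>borel_measurable borel" for r
 proof -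
  have "(%y::'a. (0::real, (norm y)\<^sup>2 + r))\<in>borel_measurable borel" by (intro borel_measurable_continuous_onI continuous_intros)
  from measurable_compose[OF this m0] show ?thesis by simp
 qed
 have l2: "(%n. heat_flow (%y. F 0 (sg n y)) t x) \<longlonglongrightarrow> heat_flow (%y. F 0 ((norm y)\<^sup>2)) t x" unfolding heat_flow_def
 proof (rule integral_dominated_convergence)
  show "integrable lborel (%y. C*exp (1/2)*(heat_kernel t (x-y) * sing_weight \<gamma> y))"
   by (intro integrable_mult_right integrable_heat_kernel_sing_weight g x t)
  have "AE y in lborel. (y::'a) ~= 0" by (rule AE_lborel_singleton)
  then show "AE y in lborel. (%n. heat_kernel t (x-y)*F 0 (sg n y)) \<longlonglongrightarrow> heat_kernel t (x-y)*F 0 ((norm y)\<^sup>2)"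
  proof eventually_elim
   case (elim y)
   show ?case using t by (intro tendsto_intros cs[OF c0 _ elim]) auto
  qed
  show "AE y in lborel. norm (heat_kernel t (x-y)*F 0 (sg n y)) <= C*exp (1/2)*(heat_kernel t (x-y) * sing_weight \<gamma> y)" for n
   using \<open>AE y in lborel. (y::'a) ~= 0\<close>
  proof eventually_elim
   case (elim y)
   have "abs (F 0 (sg n y)) <= C*exp (1/2) * sing_weight \<gamma> y" using order_trans[OF b0[of 0 "sg n y"] w2[OF elim, of n]] t sgp by simp
   then have "heat_kernel t (x-y)*abs (F 0 (sg n y)) <= heat_kernel t (x-y)*(C*exp (1/2) * sing_weight \<gamma> y)"
    using t by (intro mult_left_mono) auto
   then show ?case using t by (simp add: abs_mult mult_ac)
  qed
 qed (use mF0[of 0] mF0[of "e _"] in \<open>auto simp: sg_def intro!: borel_measurable_times borel_heat_kernel'\<close>)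
 have eq: "F t (sg n x) = heat_flow (%y. F 0 (sg n y)) t x+duhamel (Sn n) t x" for n
 proof -
  define Cn where "Cn = 12*(C*(e n powr - (\<gamma>/2)*exp (1/2)))"
  have Cn: "0 <= Cn" unfolding Cn_def using C by simp
  have W: "C*(sg n y powr - (\<gamma>/2)*exp (sqrt (sg n y)/2)) <= Cn/12*exp (norm y/2)" for y
   using w1[of n y] unfolding Cn_def by (simp add: mult_ac)
  have W': "Cn/12*exp (norm y/2) <= Cn/12*exp (norm y)" for y :: 'a using Cn by (intro mult_left_mono) auto
  have "F t ((norm x)\<^sup>2+e n) = heat_flow (%y. F 0 ((norm y)\<^sup>2+e n)) t x+duhamel (Sn n) t x"
  proof (rule heat_representation(2)[where C = Cn and g = "%s y. (2*F2 s ((norm y)\<^sup>2+e n)) *\<^sub>R y"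
     and \<psi>t = "%s y. F1 s ((norm y)\<^sup>2+e n)"
     and H = "%b s y. 2*F2 s ((norm y)\<^sup>2+e n)+4*(y \<bullet> b)\<^sup>2*F3 s ((norm y)\<^sup>2+e n)"])
   show "C12_with {0<..<t} (%s y::'a. F s ((norm y)\<^sup>2+e n)) (%s y. F1 s ((norm y)\<^sup>2+e n))
     (%s y. (2*F2 s ((norm y)\<^sup>2+e n)) *\<^sub>R y)
     (%b s y. 2*F2 s ((norm y)\<^sup>2+e n)+4*(y \<bullet> b)\<^sup>2*F3 s ((norm y)\<^sup>2+e n))"
    by (rule radial_C12) (use e DF DF2 c1 c2 c3 in auto)
   show "continuous_on ({0..t}\<times>UNIV) (%p. F (fst p) ((norm (snd p :: 'a))\<^sup>2+e n))"
   proof -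
    have c: "continuous_on ({0..t}\<times>UNIV) (%p. (fst p, (norm (snd p :: 'a))\<^sup>2+e n))" by (intro continuous_intros)
    have im: "(%p. (fst p, (norm (snd p :: 'a))\<^sup>2+e n)) ` ({0..t}\<times>UNIV) \<subseteq> {0..t}\<times>{0<..}"
     using sgp unfolding sg_def by auto
    show ?thesis using continuous_on_compose2[OF c0 c im] by simp
   qed
   fix s and y :: 'a
   have nn: "0 <= Cn/12*exp (norm y)" using Cn by simp
   { assume s: "0 <= s" "s <= t"
    show "abs (F s ((norm y)\<^sup>2+e n)) <= Cn*exp (norm y)" using b0[OF s sgp(1), of n y] W[of y] W'[of y] nn unfolding sg_def by linarith }
   assume s: "0 < s" "s < t"
   show "abs (F1 s ((norm y)\<^sup>2+e n)) <= Cn*exp (norm y)" using b1[OF s sgp(1), of n y] W[of y] W'[of y] nn unfolding sg_def by linarith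
   have f2: "abs (F2 s (sg n y)) <= Cn/12*exp (norm y/2)" using b2[OF s sgp(1), of n y] W[of y] by linarith
   have "norm y/2 <= exp (norm y/2)" using exp_ge_add_one_self[of "norm y/2"] by linarith
   then have "abs (F2 s (sg n y))*(norm y/2) <= (Cn/12*exp (norm y/2))*exp (norm y/2)" using f2 by (intro mult_mono) auto
   also have "... = Cn/12*exp (norm y)" by (simp flip: exp_add)
   finally have "abs (F2 s (sg n y))*(norm y/2) <= Cn/12*exp (norm y)" .
   then show "norm ((2*F2 s ((norm y)\<^sup>2+e n)) *\<^sub>R y) <= Cn*exp (norm y)"
   proof -
    have "norm ((2*F2 s (sg n y)) *\<^sub>R y) = 2*(abs (F2 s (sg n y))*norm y)" by (simp add: abs_mult)
    moreover have "0 <= abs (F2 s (sg n y))*norm y" by simp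
    ultimately have "norm ((2*F2 s (sg n y)) *\<^sub>R y) <= Cn*exp (norm y)"
     using \<open>(abs (F2 s (sg n y)))*(norm y/2) <= Cn/12*exp (norm y)\<close> nn by linarith
    then show ?thesis unfolding sg_def .
   qed
   show "Sn n (s, y) = F1 s ((norm y)\<^sup>2+e n) -
     (\<Sum>b\<in>Basis. 2*F2 s ((norm y)\<^sup>2+e n)+4*(y \<bullet> b)\<^sup>2*F3 s ((norm y)\<^sup>2+e n))"
    unfolding radial_laplacian_sum by (simp add: Sn_def sg_def)
   fix b :: 'a assume b: "b\<in>Basis"
   have "(abs (y \<bullet> b))\<^sup>2 <= (norm y)\<^sup>2" using Basis_le_norm[OF b] by (intro power_mono) auto
   then have "(y \<bullet> b)\<^sup>2 <= sg n y" using sgp(3)[of y n] by simp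
   then have "(y \<bullet> b)\<^sup>2*abs (F3 s (sg n y)) <= sg n y*abs (F3 s (sg n y))" by (intro mult_right_mono) auto
   then have "abs (4*(y \<bullet> b)\<^sup>2*F3 s (sg n y)) <= 4*(Cn/12*exp (norm y))"
    using b3[OF s sgp(1), of n y] W[of y] W'[of y] by (simp add: abs_mult)
   then show "abs (2*F2 s ((norm y)\<^sup>2+e n)+4*(y \<bullet> b)\<^sup>2*F3 s ((norm y)\<^sup>2+e n)) <= Cn*exp (norm y)"
    using f2 W'[of y] nn unfolding sg_def by linarith
  qed (rule t, rule Sn_meas)
  then show ?thesis unfolding sg_def .
 qed
 have l0: "(%n. F t (sg n x)) \<longlonglongrightarrow> F t ((norm x)\<^sup>2)" using t by (intro cs[OF c0 _ x]) auto
 have "(%n. F t (sg n x)) \<longlonglongrightarrow> heat_flow (%y. F 0 ((norm y)\<^sup>2)) t x+duhamel S t x"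
  unfolding eq by (intro tendsto_add l1 l2)
 with l0 show "F t ((norm x)\<^sup>2) = heat_flow (%y. F 0 ((norm y)\<^sup>2)) t x+duhamel S t x" by (rule LIMSEQ_unique)
qed

section \<open>Continuity of heat potentials\<close>

lemma continuous_on_open_cover:
 fixes f :: "'a::t2_space => 'b::topological_space"
 assumes "!!p. p\<in>S ==> \<exists>D. open D \<and> p\<in>D \<and> continuous_on D f"
 shows "continuous_on S f"
proof (intro continuous_at_imp_continuous_on ballI)
 fix p assume "p\<in>S"
 then obtain D where "open D" "p\<in>D" "continuous_on D f" using assms by blast
 then show "isCont f p" using continuous_on_eq_continuous_at by blast
qed

lemma tendsto_heat_kernel:
 assumes "(f \<longlongrightarrow> t) F" "(g \<longlongrightarrow> (x::'a::euclidean_space)) F" "0 < t"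
 shows "((%z. heat_kernel (f z) (g z)) \<longlongrightarrow> heat_kernel t x) F" unfolding heat_kernel_def using assms gauss_mass_pos[where 'a = 'a]
 by (intro tendsto_intros) auto

lemma continuous_heat_flow:
 fixes v :: "'a::euclidean_space => real"
 assumes v [measurable]: "v\<in>borel_measurable borel" and g: "0 <= \<gamma>" "\<gamma> < real DIM('a)"
  and b: "!!y. abs (v y) <= C*(1+norm y powr - \<gamma>)"
 shows "continuous_on ({0<..}\<times>UNIV) (%p. heat_flow v (fst p) (snd p))"
  and "0 < t ==> integrable lborel (%y. heat_kernel t (x-y) * v y)"
proof -
 have C: "0 <= C" using b[of 0] by simp
 have bound: "\<exists>G. integrable lborel G \<and> (\<forall>t x y. t1 < t --> t < t2 --> norm (x::'a) < R --> abs (heat_kernel t (x-y) * v y) <= G y)"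
  if t1: "0 < t1" for t1 t2 R
 proof (cases "t1 < t2")
  case True
  define c where "c = 1/(8*t2)"
  have c: "0 < c" using True t1 by (simp add: c_def)
  define A where "A = exp (R\<^sup>2/(4*t2))/(sqrt t1 ^ DIM('a)*gauss_mass TYPE('a))"
  have A: "0 <= A" unfolding A_def using t1 gauss_mass_pos[where 'a = 'a] by (intro divide_nonneg_nonneg mult_nonneg_nonneg) auto
  define G where "G y = A*C * (2*exp (- c*(norm y)\<^sup>2)+norm y powr - \<gamma>*indicator (cball 0 1) y)" for y :: 'a
  have "integrable lborel G" unfolding G_def
   by (intro integrable_mult_right Bochner_Integration.integrable_add integrable_gaussian c integrable_norm_powr_ball g)
  moreover have "abs (heat_kernel t (x-y) * v y) <= G y" if t: "t1 < t" "t < t2" and x: "norm x < R" for t and x y :: 'a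
  proof -
   have "norm y <= norm x+norm (x-y)" by (metis norm_triangle_sub norm_minus_commute add.commute)
   then have "(norm y)\<^sup>2 <= (norm x+norm (x-y))\<^sup>2" by (intro power_mono) auto
   also have "... <= 2*(norm x)\<^sup>2+2*(norm (x-y))\<^sup>2" using sum_squares_bound[of "norm x" "norm (x-y)"] by (simp add: power2_sum)
   also have "(norm x)\<^sup>2 <= R\<^sup>2" using x by (intro power_mono) auto
   finally have n: "(norm y)\<^sup>2/2-R\<^sup>2 <= (norm (x-y))\<^sup>2" by simp
   have "- (norm (x-y))\<^sup>2/(4*t) <= - (norm (x-y))\<^sup>2/(4*t2)" using t t1 by (simp add: frac_le)
   also have "... <= (R\<^sup>2-(norm y)\<^sup>2/2)/(4*t2)" using n t t1 by (intro divide_right_mono) auto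
   also have "... = R\<^sup>2/(4*t2) + - c*(norm y)\<^sup>2" unfolding c_def by (simp add: diff_divide_distrib)
   finally have ex: "exp (- (norm (x-y))\<^sup>2/(4*t)) <= exp (R\<^sup>2/(4*t2))*exp (- c*(norm y)\<^sup>2)" by (simp flip: exp_add)
   have "heat_kernel t (x-y) <= exp (R\<^sup>2/(4*t2))*exp (- c*(norm y)\<^sup>2)/(sqrt t1 ^ DIM('a)*gauss_mass TYPE('a))"
    unfolding heat_kernel_def using ex t t1 gauss_mass_pos[where 'a = 'a] by (intro frac_le mult_right_mono power_mono mult_pos_pos) auto
   then have k: "heat_kernel t (x-y) <= A*exp (- c*(norm y)\<^sup>2)" by (simp add: A_def)
   have "abs (heat_kernel t (x-y) * v y) = heat_kernel t (x-y)*abs (v y)" using t t1 by (simp add: abs_mult)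
   also have "... <= (A*exp (- c*(norm y)\<^sup>2))*(C*(1+norm y powr - \<gamma>))" using k b[of y] A C t t1 by (intro mult_mono) auto
   also have "... = A*C * (exp (- c*(norm y)\<^sup>2)*(1+norm y powr - \<gamma>))" by (simp add: mult_ac)
   also have "... <= G y" unfolding G_def
   proof (intro mult_left_mono)
    have e1: "exp (- c*(norm y)\<^sup>2) <= 1" using c by simp
    show "exp (- c*(norm y)\<^sup>2)*(1+norm y powr - \<gamma>) <= 2*exp (- c*(norm y)\<^sup>2)+norm y powr - \<gamma>*indicator (cball 0 1) y"
    proof (cases "norm y <= 1")
     case True
     define E where "E = exp (- c*(norm y)\<^sup>2)"
     define P where "P = norm y powr - \<gamma>"
     have EP: "0 <= E" "E <= 1" "0 <= P" using e1 by (auto simp: E_def P_def)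
     have "E*P <= 1*P" using EP by (intro mult_right_mono)
     then have "E*(1+P) <= 2*E+P*1" using EP by (simp add: distrib_left)
     then show ?thesis using True unfolding E_def P_def by simp
    next
     case False
     then have "norm y powr - \<gamma> <= norm y powr 0" using g by (intro powr_mono) auto
     also have "... <= 1" by simp
     finally have "exp (- c*(norm y)\<^sup>2)*(1+norm y powr - \<gamma>) <= exp (- c*(norm y)\<^sup>2)*2" by (intro mult_left_mono) auto
     then show ?thesis using False by simp
    qed
   qed (use A C in auto)
   finally show ?thesis .
  qed
  ultimately show ?thesis by blast
 qed (auto intro!: exI[of _ "%_. 0"])
 have mv: "(%y. heat_kernel t (x-y) * v y)\<in>borel_measurable lborel" for t x by measurable
 show "integrable lborel (%y. heat_kernel t (x-y) * v y)" if "0 < t" for t x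
 proof -
  have "0 < t/2" using that by simp
  from bound[OF this, of "2*t" "norm x+1"] obtain G where G: "integrable lborel G"
   and G2: "\<forall>t' x' y. t/2 < t' --> t' < 2*t --> norm (x'::'a) < norm x+1 --> abs (heat_kernel t' (x'-y) * v y) <= G y" by blast
  have G': "abs (heat_kernel t (x-y) * v y) <= G y" for y using G2[rule_format, of t x y] that by simp
  show ?thesis by (rule Bochner_Integration.integrable_bound[OF G mv]) (use G' in \<open>auto intro!: AE_I2 order_trans[OF _ abs_ge_self]\<close>)
 qed
 show "continuous_on ({0<..}\<times>UNIV) (%p. heat_flow v (fst p) (snd p))"
 proof (rule continuous_on_open_cover)
  fix p :: "real\<times>'a" assume "p\<in>{0<..}\<times>UNIV"
  then have p: "0 < fst p" by auto
  define D where "D = {fst p/2<..<2*fst p}\<times>ball (0::'a) (norm (snd p)+1)"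
  obtain G where G: "integrable lborel G"
   "!!t x y. fst p/2 < t ==> t < 2*fst p ==> norm x < norm (snd p)+1 ==> abs (heat_kernel t (x-y) * v y) <= G y"
   using bound[of "fst p/2" "2*fst p" "norm (snd p)+1"] p by (auto simp del: less_divide_eq_numeral1)
  have "continuous_on D (%p. heat_flow v (fst p) (snd p))" unfolding continuous_on_sequentially
  proof (intro ballI allI impI, elim conjE)
   fix q :: "nat => real\<times>'a" and a assume a: "a\<in>D" and q: "\<forall>n. q n\<in>D" "q \<longlonglongrightarrow> a"
   have a0: "0 < fst a" using a p unfolding D_def by auto
   show "((%p. heat_flow v (fst p) (snd p)) \<circ> q) \<longlonglongrightarrow> heat_flow v (fst a) (snd a)" unfolding heat_flow_def comp_def
   proof (rule integral_dominated_convergence[OF mv mv G(1)])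
    show "AE y in lborel. (%n. heat_kernel (fst (q n)) (snd (q n)-y) * v y) \<longlonglongrightarrow> heat_kernel (fst a) (snd a-y) * v y"
     using q(2) a0 by (intro AE_I2 tendsto_mult tendsto_heat_kernel tendsto_intros) auto
    show "AE y in lborel. norm (heat_kernel (fst (q n)) (snd (q n)-y) * v y) <= G y" for n
    proof (rule AE_I2)
     fix y
     have "q n\<in>D" using q(1) by blast
     then show "norm (heat_kernel (fst (q n)) (snd (q n)-y) * v y) <= G y"
      using G(2)[of "fst (q n)" "snd (q n)" y] unfolding D_def by (auto simp: mem_Times_iff)
    qed
   qed
  qed
  then show "\<exists>D. open D \<and> p\<in>D \<and> continuous_on D (%p. heat_flow v (fst p) (snd p))"
   using p by (intro exI[of _ D]) (auto simp: D_def mem_Times_iff intro!: open_Times)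
 qed
qed

lemma tendsto_duhamel_kernel:
 assumes "(f \<longlongrightarrow> t) F" "(g \<longlongrightarrow> (x::'a::euclidean_space)) F" "fst p ~= t"
 shows "((%z. duhamel_kernel (f z) (g z) p) \<longlongrightarrow> duhamel_kernel t x p) F"
proof -
 consider "fst p <= 0" | "0 < fst p" "fst p < t" | "t < fst p" using assms(3) by linarith
 then show ?thesis
 proof cases
  case 1
  then show ?thesis by (simp add: duhamel_kernel_def)
 next
  case 2
  have "((%z. heat_kernel (f z-fst p) (g z-snd p)) \<longlongrightarrow> heat_kernel (t-fst p) (x-snd p)) F"
   using assms 2 by (intro tendsto_heat_kernel tendsto_intros) auto
  moreover have "\<forall>\<^sub>F z in F. heat_kernel (f z-fst p) (g z-snd p) = duhamel_kernel (f z) (g z) p"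
   using order_tendstoD(1)[OF assms(1) 2(2)] by eventually_elim (use 2 in \<open>auto simp: duhamel_kernel_def\<close>)
  ultimately have "((%z. duhamel_kernel (f z) (g z) p) \<longlongrightarrow> heat_kernel (t-fst p) (x-snd p)) F" by (rule Lim_transform_eventually)
  then show ?thesis using 2 by (simp add: duhamel_kernel_def)
 next
  case 3
  have "\<forall>\<^sub>F z in F. 0 = duhamel_kernel (f z) (g z) p"
   using order_tendstoD(2)[OF assms(1) 3] by eventually_elim (auto simp: duhamel_kernel_def)
  then have "((%z. duhamel_kernel (f z) (g z) p) \<longlongrightarrow> 0) F" using tendsto_const by (rule Lim_transform_eventually[rotated])
  then show ?thesis using 3 by (simp add: duhamel_kernel_def)
 qed
qed

lemma duhamel_bound:
 fixes h S :: "real\<times>'a::euclidean_space => real"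
 assumes h: "h\<in>borel_measurable borel"
  and i: "integrable lborel (%p. duhamel_kernel t x p * S p)"
  and b: "AE p in lborel. 0 < fst p --> fst p < t --> abs (h p) <= S p"
 shows "integrable lborel (%p. duhamel_kernel t x p*h p)" "abs (duhamel h t x) <= duhamel S t x"
proof -
 have mk: "(%p. duhamel_kernel t x p)\<in>borel_measurable borel" by measurable
 have mh: "(%p. duhamel_kernel t x p*h p)\<in>borel_measurable lborel" using borel_measurable_times[OF mk h] by simp
 have le: "AE p in lborel. abs (duhamel_kernel t x p*h p) <= duhamel_kernel t x p * S p"
  using b by eventually_elim (auto simp: duhamel_kernel_def abs_mult indicator_def intro!: mult_left_mono)
 show i': "integrable lborel (%p. duhamel_kernel t x p*h p)"
 proof (rule Bochner_Integration.integrable_bound[OF i mh])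
  show "AE p in lborel. norm (duhamel_kernel t x p*h p) <= norm (duhamel_kernel t x p * S p)"
   using le by eventually_elim (metis abs_ge_self order_trans real_norm_def)
 qed
 have "abs (duhamel h t x) <= (LINT p|lborel. abs (duhamel_kernel t x p*h p))" unfolding duhamel_def by (rule integral_abs_bound)
 also have "... <= duhamel S t x" unfolding duhamel_def by (rule integral_mono_AE) (use i' i le in auto)
 finally show "abs (duhamel h t x) <= duhamel S t x" .
qed

lemma duhamel_Fatou:
 fixes G :: "real\<times>'a::euclidean_space => real"
 assumes G: "G\<in>borel_measurable borel"
  and i: "!!n. integrable lborel (%p. duhamel_kernel (t n) (x n) p*G p)"
   "integrable lborel (%p. duhamel_kernel t0 x0 p*G p)"
  and pos: "AE p in lborel. 0 < fst p --> fst p < T --> 0 <= G p" and T: "!!n. t n < T" "t0 < T"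
  and lim: "t \<longlonglongrightarrow> t0" "x \<longlonglongrightarrow> x0" and e: "0 < e"
 shows "\<forall>\<^sub>F n in sequentially. duhamel G t0 x0-e < duhamel G (t n) (x n)"
proof -
 have mk: "(%p. duhamel_kernel s y p)\<in>borel_measurable borel" for s and y :: 'a by measurable
 have mG: "(%p. ennreal (duhamel_kernel s y p*G p))\<in>borel_measurable lborel" for s y using borel_measurable_times[OF mk G] by simp
 have nn: "AE p in lborel. 0 <= duhamel_kernel s y p*G p" if "s < T" for s y
  using pos by eventually_elim (use that in \<open>auto simp: duhamel_kernel_def indicator_def\<close>)
 have eq: "(\<integral>\<^sup>+p. ennreal (duhamel_kernel s y p*G p) \<partial>lborel) = ennreal (duhamel G s y)"
  if "integrable lborel (%p. duhamel_kernel s y p*G p)" "s < T" for s y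
  unfolding duhamel_def by (rule nn_integral_eq_integral[OF that(1) nn[OF that(2)]])
 have dn: "0 <= duhamel G s y" if "s < T" for s y unfolding duhamel_def by (rule integral_nonneg_AE[OF nn[OF that]])
 have "AE p in lborel. ennreal (duhamel_kernel t0 x0 p*G p) = liminf (%n. ennreal (duhamel_kernel (t n) (x n) p*G p))" using AE_lborel_fst_neq[of t0]
 proof eventually_elim
  case (elim p)
  have "(%n. ennreal (duhamel_kernel (t n) (x n) p*G p)) \<longlonglongrightarrow> ennreal (duhamel_kernel t0 x0 p*G p)"
   by (intro tendsto_ennrealI tendsto_mult tendsto_duhamel_kernel lim tendsto_const elim)
  then show ?case by (intro lim_imp_Liminf[symmetric]) auto
 qed
 then have "ennreal (duhamel G t0 x0) = (\<integral>\<^sup>+p. liminf (%n. ennreal (duhamel_kernel (t n) (x n) p*G p)) \<partial>lborel)"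
  unfolding eq[OF i(2) T(2), symmetric] by (rule nn_integral_cong_AE)
 also have "... <= liminf (%n. \<integral>\<^sup>+p. ennreal (duhamel_kernel (t n) (x n) p*G p) \<partial>lborel)" by (rule nn_integral_liminf[OF mG])
 also have "... = liminf (%n. ennreal (duhamel G (t n) (x n)))" using eq[OF i(1) T(1)] by simp
 finally have F: "ennreal (duhamel G t0 x0) <= liminf (%n. ennreal (duhamel G (t n) (x n)))" .
 show ?thesis
 proof (cases "duhamel G t0 x0-e < 0")
  case True
  then show ?thesis using dn[OF T(1)] by (intro always_eventually allI) (smt (verit))
 next
  case False
  then have "ennreal (duhamel G t0 x0-e) < ennreal (duhamel G t0 x0)" using e by (intro ennreal_lessI) auto
  then have "ennreal (duhamel G t0 x0-e) < liminf (%n. ennreal (duhamel G (t n) (x n)))" using F by (rule order_less_le_trans)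
  then have "\<forall>\<^sub>F n in sequentially. ennreal (duhamel G t0 x0-e) < ennreal (duhamel G (t n) (x n))" by (rule less_LiminfD)
  then show ?thesis by eventually_elim (use False dn T in \<open>auto simp: ennreal_less_iff\<close>)
 qed
qed

text \<open>A dominated source has a continuous potential as soon as the dominating source has one: Fatou's
 lemma makes the potentials of \<open>S+h\<close> and of \<open>S-h\<close> lower semicontinuous, and their sum is continuous.\<close>

text \<open>
 Fatou's lemma makes the Duhamel integrals of \<open>S + h\<close> and \<open>S - h\<close> lower semicontinuous; their sum is
 continuous, so both are.
\<close>

lemma continuous_duhamel:
 fixes h S :: "real\<times>'a::euclidean_space => real"
 assumes h: "h\<in>borel_measurable borel" and S: "S\<in>borel_measurable borel"
  and D: "D \<subseteq> {..<T}\<times>UNIV"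
  and i: "!!p. p\<in>D ==> integrable lborel (%q. duhamel_kernel (fst p) (snd p) q * S q)"
  and b: "AE p in lborel. 0 < fst p --> fst p < T --> abs (h p) <= S p"
  and c: "continuous_on D (%p. duhamel S (fst p) (snd p))"
 shows "continuous_on D (%p. duhamel h (fst p) (snd p))" unfolding continuous_on_sequentially
proof (intro ballI allI impI, elim conjE)
 fix q :: "nat => real\<times>'a" and a assume a: "a\<in>D" and q: "\<forall>n. q n\<in>D" "q \<longlonglongrightarrow> a"
 have b': "AE p in lborel. 0 < fst p --> fst p < fst z --> abs (h p) <= S p" if "z\<in>D" for z using b by eventually_elim (use D that in auto)
 have ih: "integrable lborel (%p. duhamel_kernel (fst z) (snd z) p*h p)" if "z\<in>D" for z by (rule duhamel_bound(1)[OF h i[OF that] b'[OF that]])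
 have ip: "integrable lborel (%p. duhamel_kernel (fst z) (snd z) p*(S p+h p))"
    "duhamel (%p. S p+h p) (fst z) (snd z) = duhamel S (fst z) (snd z)+duhamel h (fst z) (snd z)" if "z\<in>D" for z
  unfolding duhamel_def using i[OF that] ih[OF that] by (simp_all add: distrib_left)
 have im: "integrable lborel (%p. duhamel_kernel (fst z) (snd z) p*(S p-h p))"
   "duhamel (%p. S p-h p) (fst z) (snd z) = duhamel S (fst z) (snd z)-duhamel h (fst z) (snd z)" if "z\<in>D" for z
  unfolding duhamel_def using i[OF that] ih[OF that] by (simp_all add: right_diff_distrib)
 have qD: "q n\<in>D" for n using q by blast
 have qT: "fst (q n) < T" "fst a < T" for n using qD[of n] a D by auto
 have ql: "(%n. fst (q n)) \<longlonglongrightarrow> fst a" "(%n. snd (q n)) \<longlonglongrightarrow> snd a"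
  using q(2) by (auto intro: tendsto_fst tendsto_snd)
 have Sl: "(%n. duhamel S (fst (q n)) (snd (q n))) \<longlonglongrightarrow> duhamel S (fst a) (snd a)"
  using c a q unfolding continuous_on_sequentially comp_def by blast
 show "((%p. duhamel h (fst p) (snd p)) \<circ> q) \<longlonglongrightarrow> duhamel h (fst a) (snd a)" unfolding comp_def tendsto_iff
 proof (intro allI impI)
  fix e :: real assume e: "0 < e"
  have e2: "0 < e/2" using e by simp
  have p1: "AE p in lborel. 0 < fst p --> fst p < T --> 0 <= S p+h p" using b by eventually_elim auto
  have p2: "AE p in lborel. 0 < fst p --> fst p < T --> 0 <= S p-h p" using b by eventually_elim auto
  have m: "(%p. S p+h p)\<in>borel_measurable borel" "(%p. S p-h p)\<in>borel_measurable borel" using h S by auto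
  have A: "\<forall>\<^sub>F n in sequentially. duhamel (%p. S p+h p) (fst a) (snd a)-e/2 < duhamel (%p. S p+h p) (fst (q n)) (snd (q n))"
   by (rule duhamel_Fatou[OF m(1) ip(1)[OF qD] ip(1)[OF a] p1 qT ql e2])
  have B: "\<forall>\<^sub>F n in sequentially. duhamel (%p. S p-h p) (fst a) (snd a)-e/2 < duhamel (%p. S p-h p) (fst (q n)) (snd (q n))"
   by (rule duhamel_Fatou[OF m(2) im(1)[OF qD] im(1)[OF a] p2 qT ql e2])
  have "\<forall>\<^sub>F n in sequentially. dist (duhamel S (fst (q n)) (snd (q n))) (duhamel S (fst a) (snd a)) < e/2"
   using Sl e2 unfolding tendsto_iff by blast
  with A B show "\<forall>\<^sub>F n in sequentially. dist (duhamel h (fst (q n)) (snd (q n))) (duhamel h (fst a) (snd a)) < e"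
  proof eventually_elim
   case (elim n)
   then show ?case unfolding ip(2)[OF qD] ip(2)[OF a] im(2)[OF qD] im(2)[OF a] dist_real_def by linarith
  qed
 qed
qed

section \<open>Test functions\<close>

lemma test_function_differentiable:
 assumes "test_function \<Omega> \<phi>"
 shows "\<phi> differentiable (at z)" "(%z. frechet_derivative \<phi> (at z) v) differentiable (at z)"
  "continuous_on UNIV (%z. frechet_derivative (%z. frechet_derivative \<phi> (at z) v) (at z) u)"
proof -
 have "Ck (Suc (Suc 0)) \<phi>" using assms unfolding test_function_def by blast
 then show "\<phi> differentiable (at z)" "(%z. frechet_derivative \<phi> (at z) v) differentiable (at z)"
  "continuous_on UNIV (%z. frechet_derivative (%z. frechet_derivative \<phi> (at z) v) (at z) u)" by auto
qed

lemma frechet_derivative_zero_outside: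
 assumes "closed K" "!!z. z ~: K ==> \<phi> z = (0::real)" "z ~: K"
 shows "frechet_derivative \<phi> (at z) v = 0"
proof -
 have "(\<phi> has_derivative (%_. 0)) (at z)" by (rule has_derivative_transform_within_open[of "%_. 0" _ _ UNIV "- K"])
   (use assms in \<open>auto intro: has_derivative_const\<close>)
 then show ?thesis by (simp add: frechet_derivative_at[symmetric])
qed

definition test_dt :: "(real\<times>'a::euclidean_space => real) => real => 'a => real" where
 "test_dt \<phi> s y = frechet_derivative \<phi> (at (s, y)) (1, 0)"

definition test_grad :: "(real\<times>'a::euclidean_space => real) => real => 'a => 'a" where
 "test_grad \<phi> s y = (\<Sum>b\<in>Basis. frechet_derivative \<phi> (at (s, y)) (0, b) *\<^sub>R b)"

definition test_hess :: "(real\<times>'a::euclidean_space => real) => 'a => real => 'a => real" where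
 "test_hess \<phi> b s y = frechet_derivative (%z. frechet_derivative \<phi> (at z) (0, b)) (at (s, y)) (0, b)"

abbreviation adjoint_heat :: "(real\<times>'a::euclidean_space => real) => real\<times>'a => real" where
 "adjoint_heat \<phi> p \<equiv>-test_dt \<phi> (fst p) (snd p)-(\<Sum>b\<in>Basis. test_hess \<phi> b (fst p) (snd p))"

lemma has_derivative_line:
 assumes "(f has_derivative f') (at z)"
 shows "((%r. f (z + r *\<^sub>R v)) has_real_derivative f' v) (at 0)"
proof -
 have "((%r. z + r *\<^sub>R v) has_derivative (%h. h *\<^sub>R v)) (at 0)" by (auto intro!: derivative_eq_intros)
 moreover have "(f has_derivative f') (at (z+0 *\<^sub>R v))" using assms by simp
 ultimately have "((%r. f (z + r *\<^sub>R v)) has_derivative (%h. f' (h *\<^sub>R v))) (at 0)" by (rule has_derivative_compose)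
 moreover have "f' (h *\<^sub>R v) = f' v * h" for h using has_derivative_linear[OF assms] by (simp add: linear_cmul)
 ultimately show ?thesis by (simp add: has_field_derivative_def)
qed

lemma test_function_C12:
 assumes "test_function \<Omega> (\<phi> :: real\<times>'a::euclidean_space => real)"
 shows "C12_with UNIV (%s y. \<phi> (s, y)) (test_dt \<phi>) (test_grad \<phi>) (test_hess \<phi>)" unfolding C12_with_def
proof (intro conjI ballI allI)
 note D = test_function_differentiable[OF assms]
 have D1: "(\<phi> has_derivative frechet_derivative \<phi> (at z)) (at z)" for z using D(1) by (simp add: frechet_derivative_works)
 have D2: "((%z. frechet_derivative \<phi> (at z) v) has_derivative frechet_derivative (%z. frechet_derivative \<phi> (at z) v) (at z)) (at z)" for z v
  using D(2) by (simp add: frechet_derivative_works)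
 have c1: "continuous_on UNIV (%z. frechet_derivative \<phi> (at z) v)" for v
  by (intro continuous_at_imp_continuous_on ballI differentiable_imp_continuous_within D(2))
 fix s and y :: 'a
 have lin: "frechet_derivative \<phi> (at (s, y)) k = fst k*test_dt \<phi> s y + snd k \<bullet> test_grad \<phi> s y" for k
 proof -
  have l: "linear (frechet_derivative \<phi> (at (s, y)))" using has_derivative_linear[OF D1] .
  have "k = fst k *\<^sub>R (1, 0)+(\<Sum>b\<in>Basis. (snd k \<bullet> b) *\<^sub>R (0, b))"
   by (simp add: prod_eq_iff fst_sum snd_sum euclidean_representation)
  then have "frechet_derivative \<phi> (at (s, y)) k =
    frechet_derivative \<phi> (at (s, y)) (fst k *\<^sub>R (1, 0)+(\<Sum>b\<in>Basis. (snd k \<bullet> b) *\<^sub>R (0, b)))" by (rule arg_cong)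
  also have "... = fst k*test_dt \<phi> s y+(\<Sum>b\<in>Basis. (snd k \<bullet> b)*frechet_derivative \<phi> (at (s, y)) (0, b))"
   unfolding test_dt_def by (simp only: linear_add[OF l] linear_cmul[OF l] linear_sum[OF l] real_scaleR_def)
  finally have "frechet_derivative \<phi> (at (s, y)) k =
   fst k*test_dt \<phi> s y+(\<Sum>b\<in>Basis. (snd k \<bullet> b)*frechet_derivative \<phi> (at (s, y)) (0, b))" .
  then show ?thesis unfolding test_grad_def by (simp add: inner_sum_right mult.commute)
 qed
 show "((%p. \<phi> (fst p, snd p)) has_derivative (%k. fst k*test_dt \<phi> s y + snd k \<bullet> test_grad \<phi> s y)) (at (s, y))"
  using D1[of "(s, y)"] unfolding lin[abs_def] by (simp add: lin[abs_def])
 fix b :: 'a assume b: "b\<in>Basis"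
 have g: "test_grad \<phi> s z \<bullet> b = frechet_derivative \<phi> (at (s, z)) (0, b)" for z
  unfolding test_grad_def using b by (simp add: inner_sum_left inner_Basis if_distrib cong: if_cong)
 show "((%r. test_grad \<phi> s (y + r *\<^sub>R b) \<bullet> b) has_real_derivative test_hess \<phi> b s y) (at 0)"
  unfolding g test_hess_def using has_derivative_line[OF D2[of "(0, b)" "(s, y)"], where v = "(0, b)"] by simp
next
 note D = test_function_differentiable[OF assms]
 have c1: "continuous_on UNIV (%z. frechet_derivative \<phi> (at z) v)" for v
  by (intro continuous_at_imp_continuous_on ballI differentiable_imp_continuous_within D(2))
 show "continuous_on (UNIV\<times>UNIV) (%p. test_dt \<phi> (fst p) (snd p))" unfolding test_dt_def using c1 by simp
 show "continuous_on (UNIV\<times>UNIV) (%p. test_grad \<phi> (fst p) (snd p))" unfolding test_grad_def using c1 by (auto intro!: continuous_intros)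
 fix b :: 'a
 show "continuous_on (UNIV\<times>UNIV) (%p. test_hess \<phi> b (fst p) (snd p))" unfolding test_hess_def using D(3) by simp
qed

lemma C12_line_derivs:
 fixes y b :: "'a::euclidean_space"
 assumes C12: "C12_with I \<psi> \<psi>t g H" and s: "s\<in>I"
 shows "((%r. \<psi> r y) has_real_derivative \<psi>t s y) (at s)"
  and "((%r. \<psi> s (y + r *\<^sub>R b)) has_real_derivative g s (y + r *\<^sub>R b) \<bullet> b) (at r)"
proof -
 have D: "((%p. \<psi> (fst p) (snd p)) has_derivative (%k. fst k*\<psi>t s y + snd k \<bullet> g s y)) (at (s, y))" for y
  using C12 s unfolding C12_with_def by blast
 have "((%r. \<psi> (s + r) y) has_real_derivative \<psi>t s y) (at 0)" using has_derivative_line[OF D[of y], where v = "(1, 0)"] by simp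
 then show "((%r. \<psi> r y) has_real_derivative \<psi>t s y) (at s)"
  using DERIV_shift[of "%r. \<psi> r y" "\<psi>t s y" 0 s] by (simp add: add.commute)
 have "((%h. \<psi> s (y+(h + r) *\<^sub>R b)) has_real_derivative b \<bullet> g s (y + r *\<^sub>R b)) (at 0)"
  using has_derivative_line[OF D[of "y + r *\<^sub>R b"], where v = "(0, b)"] by (simp add: scaleR_add_left add_ac)
 then show "((%r. \<psi> s (y + r *\<^sub>R b)) has_real_derivative g s (y + r *\<^sub>R b) \<bullet> b) (at r)"
  using DERIV_shift[of "%r. \<psi> s (y + r *\<^sub>R b)" "g s (y + r *\<^sub>R b) \<bullet> b" 0 r] by (simp add: inner_commute)
qed

lemma test_function_deriv_laplacian:
 assumes "test_function \<Omega> (\<phi> :: real\<times>'a::euclidean_space => real)"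
 shows "deriv (%s. \<phi> (s, x)) t = test_dt \<phi> t x"
  and "laplacian (%y. \<phi> (t, y)) x = (\<Sum>b\<in>Basis. test_hess \<phi> b t x)"
proof -
 note C = test_function_C12[OF assms]
 show "deriv (%s. \<phi> (s, x)) t = test_dt \<phi> t x" using C12_line_derivs(1)[OF C, of t x] by (auto intro: DERIV_imp_deriv)
 have "deriv (%s. \<phi> (t, x + s *\<^sub>R b)) = (%r. test_grad \<phi> t (x + r *\<^sub>R b) \<bullet> b)" for b
  using C12_line_derivs(2)[OF C, of t x b] by (auto intro!: DERIV_imp_deriv)
 moreover have "deriv (%r. test_grad \<phi> t (x + r *\<^sub>R b) \<bullet> b) 0 = test_hess \<phi> b t x" if "b\<in>Basis" for b
  using C that unfolding C12_with_def by (auto intro!: DERIV_imp_deriv)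
 ultimately show "laplacian (%y. \<phi> (t, y)) x = (\<Sum>b\<in>Basis. test_hess \<phi> b t x)" unfolding laplacian_def by (simp cong: sum.cong)
qed

lemma test_function_support:
 assumes "test_function \<Omega> (\<phi> :: real\<times>'a::euclidean_space => real)"
 obtains K where "compact K" "K \<subseteq> \<Omega>" "!!p. p ~: K ==> \<phi> p = 0"
  "!!p. p ~: K ==> test_dt \<phi> (fst p) (snd p) = 0"
  "!!p. p ~: K ==> test_grad \<phi> (fst p) (snd p) = 0"
  "!!p b. p ~: K ==> test_hess \<phi> b (fst p) (snd p) = 0"
proof -
 define K where "K = closure {z. \<phi> z ~= 0}"
 have K: "compact K" "K \<subseteq> \<Omega>" "closed K" using assms unfolding test_function_def K_def by auto
 have z: "\<phi> p = 0" if "p ~: K" for p using that closure_subset[of "{z. \<phi> z ~= 0}"] unfolding K_def by auto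
 have z1: "frechet_derivative \<phi> (at p) v = 0" if "p ~: K" for p v by (rule frechet_derivative_zero_outside[OF K(3) z that])
 have z2: "frechet_derivative (%z. frechet_derivative \<phi> (at z) v) (at p) u = 0" if "p ~: K" for p v u
  by (rule frechet_derivative_zero_outside[OF K(3) z1 that])
 show thesis using that[OF K(1,2) z] z1 z2 unfolding test_dt_def test_grad_def test_hess_def by simp
qed

lemma continuous_compact_support_bounded:
 fixes f :: "'a::euclidean_space => 'b::real_normed_vector"
 assumes "compact K" "!!p. p ~: K ==> f p = 0" "continuous_on UNIV f"
 obtains B where "0 <= B" "!!p. norm (f p) <= B"
proof -
 have "compact (f ` K)" using assms by (intro compact_continuous_image) (auto intro: continuous_on_subset)
 then obtain B where "!!x. x\<in>f ` K ==> norm x <= B" using compact_imp_bounded bounded_iff by metis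
 then show thesis using that[of "abs B"] assms(2) by (metis abs_ge_self abs_ge_zero imageI norm_zero order_trans)
qed

lemma C12_time_reversal:
 fixes \<psi> :: "real => 'a::euclidean_space => real"
 assumes C12: "C12_with UNIV \<psi> \<psi>t g H"
 shows "C12_with I (%s. \<psi> (c-s)) (%s y. - \<psi>t (c-s) y) (%s. g (c-s)) (%b s. H b (c-s))"
proof -
 have comp: "continuous_on (I\<times>UNIV) (%p. w (c-fst p) (snd p))"
  if "continuous_on (UNIV\<times>UNIV) (%p. w (fst p) (snd p))" for w :: "real => 'a => 'b::topological_space"
 proof -
  have c: "continuous_on (I\<times>UNIV) (%p::real\<times>'a. (c-fst p, snd p))" by (intro continuous_intros)
  show ?thesis using continuous_on_compose2[OF that c] by simp
 qed
 show ?thesis unfolding C12_with_def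
 proof (intro conjI ballI allI)
  fix s :: real and y :: 'a
  have f: "(fst has_derivative fst) (at (s, y))" "(snd has_derivative snd) (at (s, y))"
   by (auto intro!: bounded_linear_imp_has_derivative bounded_linear_fst bounded_linear_snd)
  have "((%p. (c-fst p, snd p)) has_derivative (%k. (0-fst k, snd k))) (at (s, y))"
   by (rule has_derivative_Pair[OF has_derivative_diff[OF has_derivative_const f(1)] f(2)])
  moreover have "((%p. \<psi> (fst p) (snd p)) has_derivative (%k. fst k*\<psi>t (c-s) y + snd k \<bullet> g (c-s) y)) (at ((%p. (c-fst p, snd p)) (s, y)))"
   using C12 unfolding C12_with_def by simp
  ultimately have "((%p. \<psi> (c-fst p) (snd p)) has_derivative (%k. (0-fst k)*\<psi>t (c-s) y + snd k \<bullet> g (c-s) y)) (at (s, y))"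
   using has_derivative_compose by fastforce
  then show "((%p. \<psi> (c-fst p) (snd p)) has_derivative (%k. fst k * - \<psi>t (c-s) y + snd k \<bullet> g (c-s) y)) (at (s, y))"
   by (rule has_derivative_eq_rhs) auto
  fix b :: 'a assume "b\<in>Basis"
  then show "((%r. g (c-s) (y + r *\<^sub>R b) \<bullet> b) has_real_derivative H b (c-s) y) (at 0)" using C12 unfolding C12_with_def by blast
 qed (use C12 in \<open>auto simp: C12_with_def simp del: UNIV_Times_UNIV intro!: continuous_on_minus comp\<close>)
qed

lemma test_function_representation:
 fixes \<phi> :: "real\<times>'a::euclidean_space => real"
 assumes tf: "test_function ({0<..<T}\<times>UNIV) \<phi>" and T: "0 < T" and s: "0 <= s"
 shows "(LINT p|lborel. indicator {s<..} (fst p)*heat_kernel (fst p-s) (snd p-y) *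
   adjoint_heat \<phi> p) = \<phi> (s, y)"
proof -
 obtain K where K: "compact K" "K \<subseteq> {0<..<T}\<times>UNIV" "!!p. p ~: K ==> \<phi> p = 0"
  "!!p. p ~: K ==> test_dt \<phi> (fst p) (snd p) = 0"
  "!!p. p ~: K ==> test_grad \<phi> (fst p) (snd p) = 0"
  "!!p b. p ~: K ==> test_hess \<phi> b (fst p) (snd p) = 0" using test_function_support[OF tf] by blast
 note C = test_function_C12[OF tf]
 have cont: "continuous_on UNIV \<phi>"
  by (intro continuous_at_imp_continuous_on ballI differentiable_imp_continuous_within test_function_differentiable(1)[OF tf])
 have ct: "continuous_on UNIV (%p. test_dt \<phi> (fst p) (snd p))" and cg: "continuous_on UNIV (%p. test_grad \<phi> (fst p) (snd p))"
  and ch: "!!b. b\<in>Basis ==> continuous_on UNIV (%p. test_hess \<phi> b (fst p) (snd p))" using C unfolding C12_with_def by auto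
 obtain B0 where B0: "0 <= B0" "!!p. norm (\<phi> p) <= B0" using continuous_compact_support_bounded[OF K(1,3) cont] by blast
 obtain B1 where B1: "0 <= B1" "!!p. norm (test_dt \<phi> (fst p) (snd p)) <= B1" using continuous_compact_support_bounded[OF K(1,4) ct] by blast
 obtain B2 where B2: "0 <= B2" "!!p. norm (test_grad \<phi> (fst p) (snd p)) <= B2" using continuous_compact_support_bounded[OF K(1,5) cg] by blast
 have "\<exists>B. 0 <= B \<and> (\<forall>p. norm (test_hess \<phi> b (fst p) (snd p)) <= B)" if b: "b\<in>Basis" for b
  using continuous_compact_support_bounded[OF K(1) K(6) ch[OF b]] by metis
 then obtain B3 where B3: "!!b. b\<in>Basis ==> 0 <= B3 b \<and> (\<forall>p. norm (test_hess \<phi> b (fst p) (snd p)) <= B3 b)" by metis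
 define B where "B = B0+B1+B2+(\<Sum>b\<in>Basis. B3 b)"
 have B3s: "B3 b <= (\<Sum>b\<in>Basis. B3 b)" if "b\<in>Basis" for b using B3 that by (intro member_le_sum) auto
 have B3p: "0 <= (\<Sum>b\<in>Basis. B3 b)" using B3 by (intro sum_nonneg) auto
 have le: "B' <= B ==> X <= B' ==> X <= B*exp (norm y)" for X B' and y :: 'a
 proof -
  assume "B' <= B" "X <= B'"
  moreover have "B*1 <= B*exp (norm y)" using B0 B1 B2 B3p unfolding B_def by (intro mult_left_mono) auto
  ultimately show ?thesis by linarith
 qed
 define \<zeta> where "\<zeta> p = adjoint_heat \<phi> p" for p
 have \<zeta>c: "continuous_on UNIV \<zeta>" unfolding \<zeta>_def[abs_def] by (intro continuous_intros ct ch)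
 have z0: "\<phi> p = 0" "\<zeta> p = 0" if "~ (0 < fst p \<and> fst p < T)" for p
 proof -
  have "p ~: K" using that K(2) by auto
  then show "\<phi> p = 0" "\<zeta> p = 0" using K(3,4,6) unfolding \<zeta>_def by auto
 qed
 define c where "c = s+T"
 have "(%s. \<phi> (c-s, y)) T = heat_flow (%y. \<phi> (c-0, y)) T y+duhamel (%p. \<zeta> (c-fst p, snd p)) T y"
 proof (rule heat_representation(2)[where \<psi> = "%s y. \<phi> (c-s, y)" and C = B, OF T C12_time_reversal[OF C]])
  show "continuous_on ({0..T}\<times>UNIV) (%p. \<phi> (c-fst p, snd p))" by (rule continuous_on_compose2[OF cont]) (auto intro!: continuous_intros)
  show "abs (\<phi> (c-s, y)) <= B*exp (norm y)" for s y by (rule le[of B0]) (use B0 B1 B2 B3p in \<open>auto simp: B_def\<close>)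
  show "abs (- test_dt \<phi> (c-s) y) <= B*exp (norm y)" for s y
   by (rule le[of B1]) (use B0 B1(1) B1(2)[of "(c-s, y)"] B2 B3p in \<open>auto simp: B_def\<close>)
  show "norm (test_grad \<phi> (c-s) y) <= B*exp (norm y)" for s y
   by (rule le[of B2]) (use B0 B1 B2(1) B2(2)[of "(c-s, y)"] B3p in \<open>auto simp: B_def\<close>)
  show "abs (test_hess \<phi> b (c-s) y) <= B*exp (norm y)" if "b\<in>Basis" for s y b
  proof (rule le[of "B3 b"])
   show "abs (test_hess \<phi> b (c-s) y) <= B3 b" using B3[OF that] by (auto dest!: spec[of _ "(c-s, y)"])
  qed (use B0 B1 B2 B3s[OF that] in \<open>auto simp: B_def\<close>)
  show "(%p. \<zeta> (c-fst p, snd p))\<in>borel_measurable borel"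
   by (intro borel_measurable_continuous_onI continuous_on_compose2[OF \<zeta>c] continuous_intros) auto
 qed (simp add: \<zeta>_def)
 moreover have "heat_flow (%y. \<phi> (c-0, y)) T y = 0" using z0 s unfolding heat_flow_def c_def by simp
 ultimately have 1: "\<phi> (s, y) = duhamel (%p. \<zeta> (c-fst p, snd p)) T y" by (simp add: c_def)
 define G where "G p = indicator {s<..} (fst p)*heat_kernel (fst p-s) (snd p-y)*\<zeta> p" for p
 have Gm: "G\<in>borel_measurable borel"
 proof -
  have "(%p. indicator {s<..} (fst p)*heat_kernel (fst p-s) (snd p-y))\<in>borel_measurable (borel :: (real\<times>'a) measure)"
   by (rule borel_pairI) measurable
  from borel_measurable_times[OF this borel_measurable_continuous_onI[OF \<zeta>c]]
  show ?thesis unfolding G_def[abs_def] .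
 qed
 have "(LINT p|lborel. G p) = (LINT p|lborel. G (c-fst p, snd p))" by (rule time_reflection(2)[OF Gm])
 also have "(%p. G (c-fst p, snd p)) = (%p. duhamel_kernel T y p*\<zeta> (c-fst p, snd p))"
 proof (rule ext)
  fix p :: "real\<times>'a"
  show "G (c-fst p, snd p) = duhamel_kernel T y p*\<zeta> (c-fst p, snd p)"
  proof (cases "0 < fst p")
   case True
   then show ?thesis using s unfolding G_def duhamel_kernel_def c_def by (auto simp: indicator_def heat_kernel_commute[of _ y])
  next
   case False
   then have "\<zeta> (c-fst p, snd p) = 0" using s by (intro z0) (auto simp: c_def)
   then show ?thesis by (simp add: G_def)
  qed
 qed
 finally have "(LINT p|lborel. G p) = \<phi> (s, y)" unfolding 1 duhamel_def .
 then show ?thesis unfolding G_def \<zeta>_def .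
qed

section \<open>Mild solutions are distributional solutions\<close>

lemma integral_product_sections:
 fixes f :: "'a::euclidean_space => 'b::euclidean_space => real"
 assumes m: "(%z. f (fst z) (snd z))\<in>borel_measurable borel"
  and i: "!!x. integrable lborel (f x)" and d: "integrable lborel d"
  and b: "AE x in lborel. (LINT y|lborel. abs (f x y)) <= d x"
 shows "integrable lborel (%x. LINT y|lborel. f x y)"
  and "(LINT x|lborel. (LINT y|lborel. f x y)) = (LINT y|lborel. (LINT x|lborel. f x y))"
  and "integrable lborel (%y. LINT x|lborel. f x y)"
proof -
 have m': "(%(x, y). f x y)\<in>borel_measurable (lborel \<Otimes>\<^sub>M lborel)" using m by (simp add: lborel_prod case_prod_beta')
 have ma: "(%x. LINT y|lborel. abs (f x y))\<in>borel_measurable lborel"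
  by (rule lborel.borel_measurable_lebesgue_integral) (use m' in \<open>simp add: case_prod_beta'\<close>)
 have "integrable lborel (%x. LINT y|lborel. abs (f x y))"
 proof (rule Bochner_Integration.integrable_bound[OF d ma])
  show "AE x in lborel. norm (LINT y|lborel. abs (f x y)) <= norm (d x)" using b by eventually_elim (simp add: order_trans[OF _ abs_ge_self])
 qed
 then have int: "integrable (lborel \<Otimes>\<^sub>M lborel) (%(x, y). f x y)" using i m' by (intro lborel_pair.Fubini_integrable) auto
 show "integrable lborel (%x. LINT y|lborel. f x y)" by (rule lborel_pair.integrable_fst[OF int])
 show "integrable lborel (%y. LINT x|lborel. f x y)" by (rule lborel_pair.integrable_snd[OF int])
 show "(LINT x|lborel. (LINT y|lborel. f x y)) = (LINT y|lborel. (LINT x|lborel. f x y))" by (rule lborel_pair.Fubini_integral[OF int, symmetric])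
qed

lemma integrable_singular_box:
 fixes \<gamma> :: real
 assumes g: "0 <= \<gamma>" "\<gamma> < real DIM('a::euclidean_space)"
 shows "integrable lborel (%p::real\<times>'a. indicator (cball 0 R) (fst p)*(indicator (cball 0 R) (snd p)+norm (snd p) powr - \<gamma>*indicator (cball 0 R) (snd p)))"
  and "integrable lborel (%x::'a. indicator (cball 0 R) x+norm x powr - \<gamma>*indicator (cball 0 R) x :: real)"
proof -
 have i1: "integrable lborel (indicator (cball (0::real) R) :: real => real)"
  by (rule integrable_real_indicator) (use emeasure_lborel_cball_finite[of "0::real" R] in auto)
 have "integrable lborel (indicator (cball (0::'a) R) :: 'a => real)"
  by (rule integrable_real_indicator) (use emeasure_lborel_cball_finite[of "0::'a" R] in auto)
 then show i2: "integrable lborel (%x::'a. indicator (cball 0 R) x+norm x powr - \<gamma>*indicator (cball 0 R) x :: real)"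
  by (intro Bochner_Integration.integrable_add integrable_norm_powr_ball g)
 from integrable_product_functions[OF i1 i2]
 show "integrable lborel (%p::real\<times>'a. indicator (cball 0 R) (fst p)*(indicator (cball 0 R) (snd p)+norm (snd p) powr - \<gamma>*indicator (cball 0 R) (snd p)))" .
qed

lemma integrable_singular_compact:
 fixes q :: "real\<times>'a::euclidean_space => real"
 assumes g: "0 <= \<gamma>" "\<gamma> < real DIM('a)" and K: "compact K" and q: "q\<in>borel_measurable borel"
  and b: "!!p. p\<in>K ==> snd p ~= 0 ==> abs (q p) <= C*(1+norm (snd p) powr - \<gamma>)"
 shows "integrable lborel (%p. indicator K p * q p)"
proof -
 obtain R where R: "!!p. p\<in>K ==> norm p <= R" using compact_imp_bounded[OF K] bounded_iff by metis
 show ?thesis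
 proof (rule Bochner_Integration.integrable_bound[OF integrable_mult_right[OF integrable_singular_box(1)[OF g, where R = R], of "abs C"]])
  show "(%p. indicator K p * q p)\<in>borel_measurable lborel"
   using borel_measurable_times[OF borel_measurable_indicator[OF borel_compact[OF K]] q] by simp
  show "AE p in lborel. norm (indicator K p * q p) <= norm (abs C*(indicator (cball 0 R) (fst p) *
    (indicator (cball 0 R) (snd p)+norm (snd p) powr - \<gamma>*indicator (cball 0 R) (snd p))))" using AE_snd_nonzero
  proof eventually_elim
   case (elim p)
   show ?case
   proof (cases "p\<in>K")
    case True
    have "norm (fst p) <= R" "norm (snd p) <= R" using R[OF True] norm_fst_le[of "fst p" "snd p"] norm_snd_le[of "snd p" "fst p"] by auto
    moreover have "C*(1+norm (snd p) powr - \<gamma>) <= abs C*(1+norm (snd p) powr - \<gamma>)" by (intro mult_right_mono) auto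
    ultimately show ?thesis using b[OF True elim] True by (simp add: abs_mult)
   qed simp
  qed
 qed
qed

lemma integrable_times_test:
 fixes q \<zeta> :: "real\<times>'a::euclidean_space => real"
 assumes g: "0 <= \<gamma>" "\<gamma> < real DIM('a)" and K: "compact K" and q: "q\<in>borel_measurable borel"
  and b: "!!p. p\<in>K ==> snd p ~= 0 ==> abs (q p) <= C*(1+norm (snd p) powr - \<gamma>)"
  and z: "continuous_on UNIV \<zeta>" "!!p. p ~: K ==> \<zeta> p = 0"
 shows "integrable lborel (%p. q p*\<zeta> p)"
proof -
 obtain B where B: "0 <= B" "!!p. norm (\<zeta> p) <= B" using continuous_compact_support_bounded[OF K z(2,1)] by blast
 have "integrable lborel (%p. indicator K p*(q p*\<zeta> p))"
 proof (rule integrable_singular_compact[OF g K, where C = "abs C*B"])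
  show "(%p. q p*\<zeta> p)\<in>borel_measurable borel" using q borel_measurable_continuous_onI[OF z(1)] by (rule borel_measurable_times)
  fix p assume p: "p\<in>K" "snd p ~= 0"
  have "abs (q p) <= abs C*(1+norm (snd p) powr - \<gamma>)" using b[OF p] by (rule order_trans) (intro mult_right_mono, auto)
  then have "abs (q p)*abs (\<zeta> p) <= (abs C*(1+norm (snd p) powr - \<gamma>))*B" using B(2)[of p] by (intro mult_mono) auto
  then show "abs (q p*\<zeta> p) <= abs C*B * (1+norm (snd p) powr - \<gamma>)" by (simp add: abs_mult mult_ac)
 qed
 moreover have "(%p. indicator K p*(q p*\<zeta> p)) = (%p. q p*\<zeta> p)" using z(2) by (auto simp: indicator_def fun_eq_iff)
 ultimately show ?thesis by simp
qed

lemma integrable_test_times_singular: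
 fixes \<zeta> :: "real\<times>'a::euclidean_space => real"
 assumes \<zeta>: "continuous_on UNIV \<zeta>" "compact K" "!!p. p ~: K ==> \<zeta> p = 0" and g: "0 <= \<gamma>" "\<gamma> < real DIM('a)"
 shows "integrable lborel (%p. (C*(1+norm (snd p) powr - \<gamma>))*abs (\<zeta> p))"
proof (rule integrable_times_test[OF g \<zeta>(2), where C = "abs C"])
 show "(%p::real\<times>'a. C*(1+norm (snd p) powr - \<gamma>))\<in>borel_measurable borel" by (rule borel_pairI) measurable
 show "continuous_on UNIV (%p. abs (\<zeta> p))" using \<zeta>(1) by (intro continuous_intros)
qed (use \<zeta>(3) in \<open>auto simp: abs_mult\<close>)

text \<open>
 Fubini's theorem moves the heat kernel onto the test function, where \<open>test_function_representation\<close> evaluates it. The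
 contribution of the initial value cancels because the test function vanishes near time zero.
\<close>

lemma mild_weak:
 fixes h :: "real\<times>'a::euclidean_space => real" and v :: "'a => real"
 assumes tf: "test_function ({0<..<T}\<times>UNIV) \<phi>" and T: "0 < T"
  and v: "v\<in>borel_measurable borel" "!!y. abs (v y) <= M"
  and h: "h\<in>borel_measurable borel" and g: "0 <= \<gamma>" "\<gamma> < real DIM('a)"
  and int: "!!t x. 0 < t ==> t < T ==> x ~= 0 ==> integrable lborel (%q. duhamel_kernel t x q*abs (h q))"
  and bd: "!!t x. 0 < t ==> t < T ==> x ~= 0 ==> duhamel (%q. abs (h q)) t x <= C*(1+norm x powr - \<gamma>)"
 defines "\<zeta> \<equiv> %p. adjoint_heat \<phi> p"
 shows "(LINT p|lborel. (heat_flow v (fst p) (snd p)+duhamel h (fst p) (snd p))*\<zeta> p) = (LINT q|lborel. h q*\<phi> q)"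
proof -
 obtain K where K: "compact K" "K \<subseteq> {0<..<T}\<times>UNIV" "!!p. p ~: K ==> \<phi> p = 0"
  "!!p. p ~: K ==> test_dt \<phi> (fst p) (snd p) = 0"
  "!!p. p ~: K ==> test_grad \<phi> (fst p) (snd p) = 0"
  "!!p b. p ~: K ==> test_hess \<phi> b (fst p) (snd p) = 0" using test_function_support[OF tf] by blast
 have M: "0 <= M" using order_trans[OF abs_ge_zero v(2)] .
 have \<zeta>c: "continuous_on UNIV \<zeta>" unfolding \<zeta>_def
  using test_function_C12[OF tf] unfolding C12_with_def by (intro continuous_intros) auto
 have \<zeta>m: "\<zeta>\<in>borel_measurable borel" using \<zeta>c by (rule borel_measurable_continuous_onI)
 have \<zeta>K: "\<zeta> p = 0" if "p ~: K" for p unfolding \<zeta>_def using K(4,6)[OF that] by simp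
 have \<zeta>0: "\<zeta> p = 0" if "~ (0 < fst p \<and> fst p < T)" for p using that K(2) by (intro \<zeta>K) auto
 have mz: "(%z. \<zeta> (fst z))\<in>borel_measurable (borel :: ((real\<times>'a)\<times>'b::euclidean_space) measure)"
  by (intro measurable_compose[OF borel_fst_comp \<zeta>m]) auto
 \<comment> \<open>the initial value contributes nothing\<close>
 define f where "f p y = indicator {0<..} (fst p)*heat_kernel (fst p) (snd p-y) * v y*\<zeta> p" for p and y :: 'a
 have fm: "(%z. f (fst z) (snd z))\<in>borel_measurable borel"
 proof -
  have "(%z. fst (fst z))\<in>borel_measurable (borel :: ((real\<times>'a)\<times>'a) measure)" by (intro borel_fst_comp) auto
  moreover from this have "(%z. indicator {0<..} (fst (fst z)) :: real)\<in>borel_measurable (borel :: ((real\<times>'a)\<times>'a) measure)"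
   by (rule measurable_compose) measurable
  moreover have "(%z. snd (fst z)-snd z)\<in>borel_measurable (borel :: ((real\<times>'a)\<times>'a) measure)"
   by (intro borel_measurable_diff borel_snd_comp borel_fst_comp) auto
  moreover have "(%z. v (snd z))\<in>borel_measurable (borel :: ((real\<times>'a)\<times>'a) measure)"
   by (intro measurable_compose[OF borel_snd_comp v(1)]) auto
  ultimately show ?thesis unfolding f_def by (intro borel_measurable_times borel_heat_kernel' mz) auto
 qed
 have bk: "abs (heat_kernel t (x-y) * v y) <= M*heat_kernel t (x-y)" if "0 < t" for t and x y :: 'a
 proof -
  have "heat_kernel t (x-y)*abs (v y) <= heat_kernel t (x-y)*M" using that v(2) by (intro mult_left_mono) auto
  then show ?thesis using that by (simp add: abs_mult mult.commute)
 qed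
 have ik: "integrable lborel (%y. heat_kernel t (x-y) * v y)" if "0 < t" for t and x :: 'a
 proof (rule Bochner_Integration.integrable_bound)
  show "integrable lborel (%y. M*heat_kernel t (x-y))" by (intro integrable_mult_right integrable_heat_kernel that)
  show "AE y in lborel. norm (heat_kernel t (x-y) * v y) <= norm (M*heat_kernel t (x-y))"
   using bk[OF that] by (intro AE_I2) (metis abs_ge_self order_trans real_norm_def)
 qed (use v(1) in measurable)
 have iff: "integrable lborel (f p)" for p
 proof (cases "0 < fst p")
  case True
  then have "f p = (%y. \<zeta> p*(heat_kernel (fst p) (snd p-y) * v y))" by (auto simp: f_def)
  then show ?thesis using ik[OF True] by simp
 qed (simp add: f_def[abs_def])
 have d1: "integrable lborel (%p::real\<times>'a. (M*(1+norm (snd p) powr - 0))*abs (\<zeta> p))"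
  using integrable_test_times_singular[OF \<zeta>c K(1) \<zeta>K, of 0 M] by simp
 have "AE p in lborel. (LINT y|lborel. abs (f p y)) <= (M*(1+norm (snd p) powr - 0))*abs (\<zeta> p)"
 proof (rule AE_I2)
  fix p :: "real\<times>'a"
  show "(LINT y|lborel. abs (f p y)) <= (M*(1+norm (snd p) powr - 0))*abs (\<zeta> p)"
  proof (cases "0 < fst p")
   case True
   have "(LINT y|lborel. abs (f p y)) <= (LINT y|lborel. abs (\<zeta> p)*(M*heat_kernel (fst p) (snd p-y)))"
   proof (rule integral_mono)
    show "integrable lborel (%y. abs (f p y))" using iff by simp
    show "integrable lborel (%y. abs (\<zeta> p)*(M*heat_kernel (fst p) (snd p-y)))" by (intro integrable_mult_right integrable_heat_kernel True)
    fix y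
    have "abs (f p y) = abs (\<zeta> p)*abs (heat_kernel (fst p) (snd p-y) * v y)" using True by (simp add: f_def abs_mult)
    also have "... <= abs (\<zeta> p)*(M*heat_kernel (fst p) (snd p-y))" using bk[OF True] by (intro mult_left_mono) auto
    finally show "abs (f p y) <= abs (\<zeta> p)*(M*heat_kernel (fst p) (snd p-y))" .
   qed
   also have "... = abs (\<zeta> p)*M" by (simp add: integral_heat_kernel[OF True])
   also have "... <= (M*(1+norm (snd p) powr - 0))*abs (\<zeta> p)" using M by (simp add: algebra_simps)
   finally show ?thesis .
  qed (use M in \<open>simp add: f_def\<close>)
 qed
 note F1 = integral_product_sections[OF fm iff d1 this]
 have "(LINT p|lborel. heat_flow v (fst p) (snd p)*\<zeta> p) = (LINT p|lborel. (LINT y|lborel. f p y))"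
 proof (rule Bochner_Integration.integral_cong[OF refl])
  fix p :: "real\<times>'a"
  show "heat_flow v (fst p) (snd p)*\<zeta> p = (LINT y|lborel. f p y)"
  proof (cases "0 < fst p")
   case True
   then show ?thesis unfolding f_def heat_flow_def by simp
  qed (use \<zeta>0[of p] in \<open>simp add: f_def\<close>)
 qed
 also have "... = (LINT y|lborel. (LINT p|lborel. f p y))" by (rule F1(2))
 also have "... = 0"
 proof -
  have "(LINT p|lborel. f p y) = 0" for y
  proof -
   have "(LINT p|lborel. f p y) = v y*(LINT p|lborel. indicator {0<..} (fst p)*heat_kernel (fst p-0) (snd p-y)*\<zeta> p)"
    unfolding f_def by (subst integral_mult_right_zero[symmetric]) (simp add: mult_ac)
   also have "(LINT p|lborel. indicator {0<..} (fst p)*heat_kernel (fst p-0) (snd p-y)*\<zeta> p) = \<phi> (0, y)"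
    unfolding \<zeta>_def by (rule test_function_representation[OF tf T]) simp
   also have "\<phi> (0, y) = 0" using K(2) by (intro K(3)) auto
   finally show ?thesis by simp
  qed
  then show ?thesis by simp
 qed
 finally have V: "(LINT p|lborel. heat_flow v (fst p) (snd p)*\<zeta> p) = 0" .
 have iV: "integrable lborel (%p. heat_flow v (fst p) (snd p)*\<zeta> p)"
 proof -
  have "(%p. heat_flow v (fst p) (snd p)*\<zeta> p) = (%p. LINT y|lborel. f p y)"
  proof (rule ext)
   fix p
   show "heat_flow v (fst p) (snd p)*\<zeta> p = (LINT y|lborel. f p y)"
   proof (cases "0 < fst p")
    case True
    then show ?thesis unfolding f_def heat_flow_def by simp
   qed (use \<zeta>0[of p] in \<open>simp add: f_def\<close>)
  qed
  then show ?thesis using F1(1) by simp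
 qed
 \<comment> \<open>the source\<close>
 define k where "k p q = (if 0 < fst p \<and> fst p < T \<and> snd p ~= 0 then duhamel_kernel (fst p) (snd p) q*h q*\<zeta> p else 0)"
  for p q :: "real\<times>'a"
 have km: "(%z. k (fst z) (snd z))\<in>borel_measurable borel"
 proof -
  have m1: "(%z. duhamel_kernel (fst (fst z)) (snd (fst z)) (snd z)*h (snd z)*\<zeta> (fst z)) \<in>
    borel_measurable (borel :: ((real\<times>'a)\<times>(real\<times>'a)) measure)"
   by (intro borel_measurable_times borel_duhamel_kernel mz measurable_compose[OF borel_snd_comp h]
     borel_snd_comp borel_fst_comp) auto
  have "open {z :: (real\<times>'a)\<times>(real\<times>'a). 0 < fst (fst z) \<and> fst (fst z) < T \<and> snd (fst z) ~= 0}"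
   by (intro open_Collect_conj open_Collect_less open_Collect_neq continuous_intros)
  then have m2: "(%z. indicator {z. 0 < fst (fst z) \<and> fst (fst z) < T \<and> snd (fst z) ~= 0} z :: real)
   \<in>borel_measurable (borel :: ((real\<times>'a)\<times>(real\<times>'a)) measure)" by (intro borel_measurable_indicator borel_open)
  from borel_measurable_times[OF m2 m1] show ?thesis by (rule measurable_cong[THEN iffD1, rotated]) (auto simp: k_def indicator_def)
 qed
 have ikk: "integrable lborel (k p)" for p
 proof (cases "0 < fst p \<and> fst p < T \<and> snd p ~= 0")
  case True
  then have "integrable lborel (%q. duhamel_kernel (fst p) (snd p) q*h q)" by (intro duhamel_bound(1)[OF h int]) auto
  then have "integrable lborel (%q. duhamel_kernel (fst p) (snd p) q*h q*\<zeta> p)" by simp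
  then show ?thesis using True unfolding k_def[abs_def] by simp
 next
  case False
  then have "k p = (%_. 0)" unfolding k_def by auto
  then show ?thesis by simp
 qed
 have d2: "integrable lborel (%p::real\<times>'a. (C*(1+norm (snd p) powr - \<gamma>))*abs (\<zeta> p))"
  by (rule integrable_test_times_singular[OF \<zeta>c K(1) \<zeta>K g])
 have "AE p in lborel. (LINT q|lborel. abs (k p q)) <= (C*(1+norm (snd p) powr - \<gamma>))*abs (\<zeta> p)" using AE_snd_nonzero
 proof eventually_elim
  case (elim p)
  show ?case
  proof (cases "0 < fst p \<and> fst p < T")
   case True
   have "(LINT q|lborel. abs (k p q)) = (LINT q|lborel. duhamel_kernel (fst p) (snd p) q*abs (h q)*abs (\<zeta> p))"
    using True elim unfolding k_def by (intro Bochner_Integration.integral_cong) (auto simp: abs_mult)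
   also have "... = duhamel (%q. abs (h q)) (fst p) (snd p)*abs (\<zeta> p)" unfolding duhamel_def by simp
   also have "... <= (C*(1+norm (snd p) powr - \<gamma>))*abs (\<zeta> p)" using bd[of "fst p" "snd p"] True elim by (intro mult_right_mono) auto
   finally show ?thesis .
  next
   case False
   then show ?thesis using \<zeta>0[of p] by (auto simp: k_def)
  qed
 qed
 note F2 = integral_product_sections[OF km ikk d2 this]
 have keq: "AE p in lborel. duhamel h (fst p) (snd p)*\<zeta> p = (LINT q|lborel. k p q)" using AE_snd_nonzero
 proof eventually_elim
  case (elim p)
  show ?case
  proof (cases "0 < fst p \<and> fst p < T")
   case True
   then show ?thesis using elim unfolding k_def duhamel_def by simp
  next
   case False
   then show ?thesis using \<zeta>0[of p] by (auto simp: k_def)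
  qed
 qed
 have md: "(%p. duhamel h (fst p) (snd p)*\<zeta> p)\<in>borel_measurable lborel"
 proof -
  have "(%z. duhamel_kernel (fst (fst z)) (snd (fst z)) (snd z)*h (snd z)) \<in>
    borel_measurable (borel :: ((real\<times>'a)\<times>(real\<times>'a)) measure)"
   by (intro borel_measurable_times borel_duhamel_kernel measurable_compose[OF borel_snd_comp h]
     borel_snd_comp borel_fst_comp) auto
  then have "(%(p, q). duhamel_kernel (fst p) (snd p) q*h q) \<in>
    borel_measurable (lborel \<Otimes>\<^sub>M (lborel :: (real\<times>'a) measure))" by (simp add: lborel_prod case_prod_beta')
  then have "(%p. duhamel h (fst p) (snd p))\<in>borel_measurable lborel" unfolding duhamel_def by (rule lborel.borel_measurable_lebesgue_integral)
  then show ?thesis using \<zeta>m by simp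
 qed
 have iD: "integrable lborel (%p. duhamel h (fst p) (snd p)*\<zeta> p)" using F2(1) keq md by (subst integrable_cong_AE) auto
 have "(LINT p|lborel. duhamel h (fst p) (snd p)*\<zeta> p) = (LINT p|lborel. (LINT q|lborel. k p q))"
  by (rule integral_cong_AE[OF md _ keq]) (use F2(1) in auto)
 also have "... = (LINT q|lborel. (LINT p|lborel. k p q))" by (rule F2(2))
 also have "... = (LINT q|lborel. h q*\<phi> q)"
 proof (rule Bochner_Integration.integral_cong[OF refl])
  fix q :: "real\<times>'a"
  show "(LINT p|lborel. k p q) = h q*\<phi> q"
  proof (cases "0 < fst q")
   case True
   define G where "G p = h q*(indicator {fst q<..} (fst p)*heat_kernel (fst p-fst q) (snd p-snd q)*\<zeta> p)" for p
   have Gm: "G\<in>borel_measurable lborel"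
   proof -
    have "(%p::real\<times>'a. indicator {fst q<..} (fst p)*heat_kernel (fst p-fst q) (snd p-snd q))\<in>borel_measurable borel"
     by (rule borel_pairI) measurable
    then show ?thesis unfolding G_def[abs_def] using \<zeta>m by simp
   qed
   have ae: "AE p in lborel. k p q = G p" using AE_snd_nonzero
   proof eventually_elim
    case (elim p)
    show ?case
    proof (cases "0 < fst p \<and> fst p < T")
     case True
     then show ?thesis using elim \<open>0 < fst q\<close> by (auto simp: k_def G_def duhamel_kernel_def indicator_def)
    next
     case False
     then show ?thesis using \<zeta>0[of p] by (auto simp: k_def G_def)
    qed
   qed
   have mkq: "(%p. k p q)\<in>borel_measurable lborel"
   proof -
    have "(%p. (p, q))\<in>borel_measurable (borel :: (real\<times>'a) measure)" by (intro borel_measurable_continuous_onI continuous_intros)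
    from measurable_compose[OF this km] show ?thesis by simp
   qed
   have "(LINT p|lborel. k p q) = (LINT p|lborel. G p)" by (rule integral_cong_AE[OF mkq Gm ae])
   also have "... = h q*(LINT p|lborel. indicator {fst q<..} (fst p)*heat_kernel (fst p-fst q) (snd p-snd q)*\<zeta> p)" unfolding G_def by simp
   also have "(LINT p|lborel. indicator {fst q<..} (fst p)*heat_kernel (fst p-fst q) (snd p-snd q)*\<zeta> p) = \<phi> (fst q, snd q)"
    unfolding \<zeta>_def by (rule test_function_representation[OF tf T]) (use True in simp)
   finally show ?thesis by simp
  next
   case False
   then have "\<phi> q = 0" using K(2) by (intro K(3)) auto
   moreover have "k p q = 0" for p using False by (simp add: k_def duhamel_kernel_def)
   ultimately show ?thesis by simp
  qed
 qed
 finally have "(LINT p|lborel. duhamel h (fst p) (snd p)*\<zeta> p) = (LINT q|lborel. h q*\<phi> q)" .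
 then show ?thesis using V iV iD by (simp add: distrib_right)
qed

section \<open>Initial values of the heat flow\<close>

lemma heat_flow_bound:
 fixes v :: "'a::euclidean_space => real"
 assumes "v\<in>borel_measurable borel" "!!y. abs (v y) <= M" "0 < t"
 shows "abs (heat_flow v t x) <= M" "integrable lborel (%z. heat_kernel 1 z * v (x + sqrt t *\<^sub>R z))"
proof -
 have [measurable]: "v\<in>borel_measurable borel" by fact
 have b: "abs (heat_kernel 1 z * v (x + sqrt t *\<^sub>R z)) <= M*heat_kernel 1 z" for z
  using mult_left_mono[OF assms(2)[of "x + sqrt t *\<^sub>R z"], of "heat_kernel 1 z"] by (simp add: abs_mult mult.commute)
 have iM: "integrable lborel (%z::'a. M*heat_kernel 1 z)" by (intro integrable_mult_right integrable_heat_kernel_1)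
 show i: "integrable lborel (%z. heat_kernel 1 z * v (x + sqrt t *\<^sub>R z))"
 proof (rule Bochner_Integration.integrable_bound[OF iM])
  show "AE z in lborel. norm (heat_kernel 1 z * v (x + sqrt t *\<^sub>R z)) <= norm (M*heat_kernel 1 z)"
   using b by (intro AE_I2) (metis abs_ge_self order_trans real_norm_def)
 qed measurable
 have "abs (heat_flow v t x) <= (LINT z|lborel. abs (heat_kernel 1 z * v (x + sqrt t *\<^sub>R z)))"
  unfolding heat_flow_def heat_kernel_average(2)[OF assms(3,1)] by (rule integral_abs_bound)
 also have "... <= (LINT z::'a|lborel. M*heat_kernel 1 z)" by (rule integral_mono) (use i iM b in auto)
 also have "... = M" by (simp add: integral_heat_kernel_1)
 finally show "abs (heat_flow v t x) <= M" .
qed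

lemma continuous_approximation:
 fixes v :: "'a::euclidean_space => real"
 assumes v: "v\<in>borel_measurable borel" and M: "!!y. abs (v y) <= M"
 obtains g where "!!n. continuous_on UNIV (g n)" "!!n y. abs (g n y) <= M" "AE y in lborel. (%n. g n y) \<longlonglongrightarrow> v y"
proof -
 have M0: "0 <= M" using order_trans[OF abs_ge_zero M] .
 have "v\<in>borel_measurable (lebesgue_on UNIV)" using v by (simp add: measurable_completion lebesgue_on_UNIV_eq)
 then have "v measurable_on UNIV" by (subst measurable_on_iff_borel_measurable) auto
 then obtain N g where N: "negligible N" and g: "!!n. continuous_on UNIV (g n)"
  and lim: "!!x. x ~: N ==> (%n. g n x) \<longlonglongrightarrow> v x" unfolding measurable_on_def by auto
 show thesis
 proof (rule that)
  show "continuous_on UNIV (%y. max (- M) (min M (g n y)))" for n by (intro continuous_intros g)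
  show "abs (max (- M) (min M (g n y))) <= M" for n y using M0 by auto
  have "AE y in lebesgue. y ~: N" using N unfolding negligible_iff_null_sets by (rule AE_not_in)
  then have "AE y in lborel. y ~: N" by (simp add: AE_completion_iff)
  then show "AE y in lborel. (%n. max (- M) (min M (g n y))) \<longlonglongrightarrow> v y"
  proof eventually_elim
   case (elim y)
   have "(%n. max (- M) (min M (g n y))) \<longlonglongrightarrow> max (- M) (min M (v y))" by (intro tendsto_intros lim elim)
   moreover have "max (- M) (min M (v y)) = v y" using M[of y] by (auto simp: abs_le_iff)
   ultimately show ?case by simp
  qed
 qed
qed

lemma integrable_bounded_compact:
 fixes u :: "'a::euclidean_space => real"
 assumes u: "u\<in>borel_measurable borel" "!!y. abs (u y) <= M" and K: "compact K"
 shows "integrable lborel (%x. indicator K x*u x)"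
proof (rule Bochner_Integration.integrable_bound)
 have Kb: "K\<in>sets borel" using K by (simp add: borel_compact)
 have "integrable lborel (indicator K :: 'a => real)"
  using Kb emeasure_bounded_finite[OF compact_imp_bounded[OF K]] by (intro integrable_real_indicator) auto
 then show "integrable lborel (%x. M*indicator K x :: real)" by (rule integrable_mult_right)
 show "(%x. indicator K x*u x)\<in>borel_measurable lborel" using u Kb by simp
 show "AE x in lborel. norm (indicator K x*u x) <= norm (M*indicator K x :: real)"
 proof (rule AE_I2)
  fix x
  have "abs (u x) <= abs M" using u(2)[of x] by linarith
  then show "norm (indicator K x*u x) <= norm (M*indicator K x :: real)" by (auto simp: indicator_def)
 qed
qed

lemma translation_continuous_L1:
 fixes v :: "'a::euclidean_space => real"
 assumes v: "v\<in>borel_measurable borel" and M: "!!y. abs (v y) <= M" and K: "compact K"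
  and c: "c \<longlonglongrightarrow> 0"
 shows "(%i. LINT x|lborel. indicator K x*abs (v (x + c i)-v x)) \<longlonglongrightarrow> 0"
proof -
 have M0: "0 <= M" using order_trans[OF abs_ge_zero M] .
 obtain g where g: "!!n. continuous_on UNIV (g n)" "!!n y. abs (g n y) <= M" "AE y in lborel. (%n. g n y) \<longlonglongrightarrow> v y"
  using continuous_approximation[OF v M] by blast
 have gm: "g n\<in>borel_measurable borel" for n using g(1) by (rule borel_measurable_continuous_onI)
 obtain r where r: "!!x. x\<in>K ==> norm x <= r" using compact_imp_bounded[OF K] bounded_iff by metis
 define B where "B = cball (0::'a) (r+1)"
 have B: "compact B" by (simp add: B_def)
 have b2: "abs ((abs (a-a'))) <= 2*M" if "abs a <= M" "abs a' <= M" for a a' :: real using that by linarith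
 have m1: "(%x. abs (v x-g n x))\<in>borel_measurable borel" for n using v gm[of n] by simp
 have i1: "integrable lborel (%x. indicator A x*abs (v x-g n x))" if "compact A" for A n
  by (rule integrable_bounded_compact[OF m1 b2 that]) (use M g in auto)
 have d0: "(%n. LINT x|lborel. indicator B x*abs (v x-g n x)) \<longlonglongrightarrow> (LINT x::'a|lborel. (0::real))"
 proof (rule integral_dominated_convergence)
  show "integrable lborel (%x. indicator B x*(2*M))" by (rule integrable_bounded_compact[OF _ _ B, of _ "2*M"]) (use M0 in auto)
  show "AE x in lborel. (%n. indicator B x*abs (v x-g n x)) \<longlonglongrightarrow> 0" using g(3)
  proof eventually_elim
   case (elim x)
   have "(%n. indicator B x*abs (v x-g n x)) \<longlonglongrightarrow> indicator B x*abs (v x-v x)" by (intro tendsto_intros elim)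
   then show ?case by simp
  qed
  show "AE x in lborel. norm (indicator B x*abs (v x-g n x)) <= indicator B x*(2*M)" for n
  proof (rule AE_I2)
   fix x show "norm (indicator B x*abs (v x-g n x)) <= indicator B x*(2*M)" using b2[OF M[of x] g(2)[of n x]] by (auto simp: indicator_def)
  qed
 qed (use i1[OF B] in auto)
 show ?thesis
 proof (rule LIMSEQ_I)
  fix e :: real assume e: "0 < e"
  then have e3: "0 < e/3" by simp
  obtain n where n: "(LINT x|lborel. indicator B x*abs (v x-g n x)) < e/3"
  proof -
   have "\<forall>\<^sub>F n in sequentially. (LINT x|lborel. indicator B x*abs (v x-g n x)) < e/3"
    using order_tendstoD(2)[OF d0, of "e/3"] e3 by simp
   then obtain n0 where "\<forall>n\<ge>n0. (LINT x|lborel. indicator B x*abs (v x-g n x)) < e/3" unfolding eventually_sequentially by blast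
   then show thesis using that[of n0] by blast
  qed
  have mc: "(%x. u (x + c i))\<in>borel_measurable borel" if "u\<in>borel_measurable borel" for u :: "'a => real" and i using that by measurable
  have b3: "abs ((abs (g n (x + c i)-g n x))) <= 2*M" "abs ((abs (v (x + c i)-v x))) <= 2*M"
   "abs ((abs (v (x + c i)-g n (x + c i)))) <= 2*M" for x i using b2 M g(2) by auto
  have i2: "integrable lborel (%x. indicator K x*abs (g n (x + c i)-g n x))" for i
   by (rule integrable_bounded_compact[OF _ b3(1) K]) (use mc[OF gm] gm in auto)
  have i3: "integrable lborel (%x. indicator K x*abs (v (x + c i)-v x))" for i
   by (rule integrable_bounded_compact[OF _ b3(2) K]) (use mc[OF v] v in auto)
  have i4: "integrable lborel (%x. indicator K x*abs (v (x + c i)-g n (x + c i)))" for i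
   by (rule integrable_bounded_compact[OF _ b3(3) K]) (use mc[OF v] mc[OF gm] in auto)
  have "(%i. LINT x|lborel. indicator K x*abs (g n (x + c i)-g n x)) \<longlonglongrightarrow> (LINT x::'a|lborel. (0::real))"
  proof (rule integral_dominated_convergence)
   show "integrable lborel (%x. indicator K x*(2*M))" by (rule integrable_bounded_compact[OF _ _ K, of _ "2*M"]) (use M0 in auto)
   show "AE x in lborel. (%i. indicator K x*abs (g n (x + c i)-g n x)) \<longlonglongrightarrow> 0"
   proof (rule AE_I2)
    fix x
    have "isCont (g n) x" using g(1)[of n] by (simp add: continuous_on_eq_continuous_at)
    moreover have "(%i. x + c i) \<longlonglongrightarrow> x" using tendsto_add[OF tendsto_const c, of x] by simp
    ultimately have "(%i. g n (x + c i)) \<longlonglongrightarrow> g n x" by (rule isCont_tendsto_compose)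
    then have "(%i. indicator K x*abs (g n (x + c i)-g n x)) \<longlonglongrightarrow> indicator K x*abs (g n x-g n x)" by (intro tendsto_intros)
    then show "(%i. indicator K x*abs (g n (x + c i)-g n x)) \<longlonglongrightarrow> 0" by simp
   qed
   show "AE x in lborel. norm (indicator K x*abs (g n (x + c i)-g n x)) <= indicator K x*(2*M)" for i
    using b3(1) by (intro AE_I2) (auto simp: indicator_def)
  qed (use i2 in auto)
  then have "\<forall>\<^sub>F i in sequentially. (LINT x|lborel. indicator K x*abs (g n (x + c i)-g n x)) < e/3"
   using order_tendstoD(2)[of _ "LINT x::'a|lborel. (0::real)" sequentially "e/3"] e3 by simp
  moreover have "\<forall>\<^sub>F i in sequentially. norm (c i) < 1" using tendsto_norm[OF c] by (intro order_tendstoD(2)) auto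
  ultimately have "\<forall>\<^sub>F i in sequentially. norm ((LINT x|lborel. indicator K x*abs (v (x + c i)-v x))-0) < e"
  proof eventually_elim
   case (elim i)
   have t: "(LINT x|lborel. indicator K x*abs (v (x + c i)-g n (x + c i))) <= (LINT x|lborel. indicator B x*abs (v x-g n x))"
   proof -
    have "(LINT x|lborel. indicator K x*abs (v (x + c i)-g n (x + c i))) <=
      (LINT x|lborel. indicator B (c i+x)*abs (v (c i+x)-g n (c i+x)))"
    proof (rule integral_mono)
     show "integrable lborel (%x. indicator B (c i+x)*abs (v (c i+x)-g n (c i+x)))"
      using lborel_translation_integral(1)[of "%x. indicator B x*abs (v x-g n x)" "c i"] i1[OF B, of n] m1[of n] by (simp add: B_def)
     fix x
     have "norm (c i+x) <= r+1" if "x\<in>K" using norm_triangle_ineq[of "c i" x] r[OF that] elim by linarith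
     then show "indicator K x*abs (v (x + c i)-g n (x + c i)) <= indicator B (c i+x)*abs (v (c i+x)-g n (c i+x))"
      by (auto simp: indicator_def B_def add.commute)
    qed (rule i4)
    also have "... = (LINT x|lborel. indicator B x*abs (v x-g n x))"
     using lborel_translation_integral(2)[of "%x. indicator B x*abs (v x-g n x)" "c i"] m1[of n] by (simp add: B_def)
    finally show ?thesis .
   qed
   have t2: "(LINT x|lborel. indicator K x*abs (v x-g n x)) <= (LINT x|lborel. indicator B x*abs (v x-g n x))"
   proof (rule integral_mono[OF i1[OF K] i1[OF B]])
    fix x
    have "norm x <= r+1" if "x\<in>K" using r[OF that] by linarith
    then show "indicator K x*abs (v x-g n x) <= indicator B x*abs (v x-g n x)" by (auto simp: indicator_def B_def)
   qed
   have "(LINT x|lborel. indicator K x*abs (v (x + c i)-v x)) <=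
    (LINT x|lborel. indicator K x*abs (v (x + c i)-g n (x + c i))+indicator K x*abs (g n (x + c i)-g n x)+indicator K x*abs (v x-g n x))"
   proof (rule integral_mono)
    show "integrable lborel (%x. indicator K x*abs (v (x + c i)-g n (x + c i))+indicator K x*abs (g n (x + c i)-g n x)+indicator K x*abs (v x-g n x))"
     by (intro Bochner_Integration.integrable_add i4 i2 i1 K)
   qed (use i3 in \<open>auto simp: indicator_def\<close>)
   also have "... = (LINT x|lborel. indicator K x*abs (v (x + c i)-g n (x + c i)))+(LINT x|lborel. indicator K x*abs (g n (x + c i)-g n x))
     + (LINT x|lborel. indicator K x*abs (v x-g n x))" using i4[of i] i2[of i] i1[OF K, of n] by simp
   finally have "(LINT x|lborel. indicator K x*abs (v (x + c i)-v x)) < e" using t t2 n elim by linarith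
   moreover have "0 <= (LINT x|lborel. indicator K x*abs (v (x + c i)-v x))" by (rule integral_nonneg_AE) auto
   ultimately show ?case by simp
  qed
  then show "\<exists>no. \<forall>i\<ge>no. norm ((LINT x|lborel. indicator K x*abs (v (x + c i)-v x))-0) < e" by (simp add: eventually_sequentially)
 qed
qed

text \<open>
 The heat flow averages the translates \<open>v(x + \<surd>t z)\<close> over a fixed Gaussian, and translation is continuous in \<open>L\<^sup>1\<close>.
\<close>

lemma heat_flow_tendsto_L1:
 fixes v :: "'a::euclidean_space => real"
 assumes v: "v\<in>borel_measurable borel" and M: "!!y. abs (v y) <= M" and K: "compact K"
  and X: "!!i. 0 < X i" "X \<longlonglongrightarrow> 0"
 shows "(%i. LINT x|lborel. indicator K x*abs (heat_flow v (X i) x-v x)) \<longlonglongrightarrow> 0"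
proof -
 have M0: "0 <= M" using order_trans[OF abs_ge_zero M] .
 have Kb: "K\<in>sets borel" using K by (simp add: borel_compact)
 have iK: "integrable lborel (indicator K :: 'a => real)"
  using Kb emeasure_bounded_finite[OF compact_imp_bounded[OF K]] by (intro integrable_real_indicator) auto
 define \<omega> where "\<omega> c = (LINT x|lborel. indicator K x*abs (v (x + c)-v x))" for c
 define f where "f i x z = indicator K x*(heat_kernel 1 z*abs (v (x + sqrt (X i) *\<^sub>R z)-v x))" for i and x z :: 'a
 have mv: "(%z. v (fst z + sqrt (X i) *\<^sub>R snd z))\<in>borel_measurable (borel :: ('a\<times>'a) measure)" for i
  by (rule measurable_compose[OF _ v]) (intro borel_measurable_continuous_onI continuous_intros)
 have fm: "(%z. f i (fst z) (snd z))\<in>borel_measurable borel" for i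
 proof -
  have "(%z. indicator K (fst z) :: real)\<in>borel_measurable (borel :: ('a\<times>'a) measure)"
   by (intro measurable_compose[OF borel_fst_comp, of "%z. z" _ "indicator K"] borel_measurable_indicator Kb) auto
  moreover have "(%z. heat_kernel 1 (snd z))\<in>borel_measurable (borel :: ('a\<times>'a) measure)" by (intro borel_heat_kernel' borel_snd_comp) auto
  moreover have "(%z. v (fst z))\<in>borel_measurable (borel :: ('a\<times>'a) measure)" by (intro measurable_compose[OF borel_fst_comp v]) auto
  ultimately show ?thesis unfolding f_def using mv[of i] by (intro borel_measurable_times borel_measurable_abs borel_measurable_diff) auto
 qed
 have b2: "abs (v y-v x) <= 2*M" for x y using M[of x] M[of y] by linarith
 have kb: "abs (heat_kernel 1 z*abs (v (x + sqrt (X i) *\<^sub>R z)-v x)) <= 2*M * heat_kernel 1 z" for i x z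
  using mult_left_mono[OF b2[of "x + sqrt (X i) *\<^sub>R z" x], of "heat_kernel 1 z"] by (simp add: abs_mult mult.commute)
 have ik: "integrable lborel (%z. heat_kernel 1 z*abs (v (x + sqrt (X i) *\<^sub>R z)-v x))" for i x
 proof (rule Bochner_Integration.integrable_bound)
  show "integrable lborel (%z::'a. 2*M * heat_kernel 1 z)" by (intro integrable_mult_right integrable_heat_kernel_1)
  show "AE z in lborel. norm (heat_kernel 1 z*abs (v (x + sqrt (X i) *\<^sub>R z)-v x)) <= norm (2*M * heat_kernel 1 z)"
   using kb by (intro AE_I2) (metis abs_ge_self order_trans real_norm_def)
 qed (use v in measurable)
 have ifx: "integrable lborel (f i x)" for i x unfolding f_def using ik by (rule integrable_mult_right)
 have le: "(LINT z|lborel. abs (f i x z)) <= 2*M * indicator K x" for i x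
 proof -
  have "(LINT z|lborel. abs (f i x z)) <= (LINT z|lborel. indicator K x*(2*M * heat_kernel 1 (z::'a)))"
  proof (rule integral_mono)
   show "integrable lborel (%z::'a. indicator K x*(2*M * heat_kernel 1 z))" by (intro integrable_mult_right integrable_heat_kernel_1)
   show "abs (f i x z) <= indicator K x*(2*M * heat_kernel 1 z)" for z using kb[of z x i] by (auto simp: f_def indicator_def)
  qed (use ifx in auto)
  also have "... = 2*M * indicator K x" by (simp add: integral_heat_kernel_1)
  finally show ?thesis .
 qed
 have i2: "integrable lborel (%x. 2*M * indicator K x :: real)" using iK by (rule integrable_mult_right)
 note F = integral_product_sections[OF fm ifx i2 AE_I2[OF le]]
 have up: "(LINT x|lborel. indicator K x*abs (heat_flow v (X i) x-v x)) <= (LINT z|lborel. heat_kernel 1 z*\<omega> (sqrt (X i) *\<^sub>R z))" for i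
 proof -
  have "(LINT x|lborel. indicator K x*abs (heat_flow v (X i) x-v x)) <= (LINT x|lborel. (LINT z|lborel. f i x z))"
  proof (rule integral_mono')
   show "integrable lborel (%x. LINT z|lborel. f i x z)" by (rule F(1))
   fix x
   have iv: "integrable lborel (%z. heat_kernel 1 z * v (x + sqrt (X i) *\<^sub>R z))" by (rule heat_flow_bound(2)[OF v M X(1)])
   have i1: "integrable lborel (%z::'a. heat_kernel 1 z * v x)" by (intro integrable_mult_left integrable_heat_kernel_1)
   have "heat_flow v (X i) x-v x = (LINT z|lborel. heat_kernel 1 z * v (x + sqrt (X i) *\<^sub>R z))-(LINT z::'a|lborel. heat_kernel 1 z * v x)"
    unfolding heat_flow_def heat_kernel_average(2)[OF X(1) v] by (simp add: integral_heat_kernel_1)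
   also have "... = (LINT z|lborel. heat_kernel 1 z*(v (x + sqrt (X i) *\<^sub>R z)-v x))"
    unfolding right_diff_distrib by (rule Bochner_Integration.integral_diff[OF iv i1, symmetric])
   finally have "abs (heat_flow v (X i) x-v x) <= (LINT z|lborel. abs (heat_kernel 1 z*(v (x + sqrt (X i) *\<^sub>R z)-v x)))"
    by (simp only: integral_abs_bound)
   also have "... = (LINT z|lborel. heat_kernel 1 z*abs (v (x + sqrt (X i) *\<^sub>R z)-v x))" by (simp add: abs_mult)
   finally have "indicator K x*abs (heat_flow v (X i) x-v x) <= indicator K x*(LINT z|lborel. heat_kernel 1 z*abs (v (x + sqrt (X i) *\<^sub>R z)-v x))"
    by (intro mult_left_mono) auto
   then show "indicator K x*abs (heat_flow v (X i) x-v x) <= (LINT z|lborel. f i x z)" unfolding f_def by simp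
   show "0 <= (LINT z|lborel. f i x z)" by (rule integral_nonneg_AE) (simp add: f_def)
  qed
  also have "... = (LINT z|lborel. (LINT x|lborel. f i x z))" by (rule F(2))
  also have "... = (LINT z|lborel. heat_kernel 1 z*\<omega> (sqrt (X i) *\<^sub>R z))"
  proof (rule Bochner_Integration.integral_cong[OF refl])
   fix z
   have "(%x. f i x z) = (%x. heat_kernel 1 z*(indicator K x*abs (v (x + sqrt (X i) *\<^sub>R z)-v x)))" by (auto simp: f_def mult_ac)
   then show "(LINT x|lborel. f i x z) = heat_kernel 1 z*\<omega> (sqrt (X i) *\<^sub>R z)"
    unfolding \<omega>_def by (simp only: integral_mult_right_zero)
  qed
  finally show ?thesis .
 qed
 define V where "V = (LINT x|lborel. 2*M * indicator K x :: real)"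
 have \<omega>b: "0 <= \<omega> c" "\<omega> c <= V" for c
 proof -
  show "0 <= \<omega> c" unfolding \<omega>_def by (rule integral_nonneg_AE) auto
  show "\<omega> c <= V" unfolding \<omega>_def V_def by (rule integral_mono'[OF i2]) (use b2 M0 in \<open>auto simp: indicator_def\<close>)
 qed
 have "(%i. LINT z|lborel. heat_kernel 1 z*\<omega> (sqrt (X i) *\<^sub>R z)) \<longlonglongrightarrow> (LINT z::'a|lborel. 0)"
 proof (rule integral_dominated_convergence)
  show "integrable lborel (%z::'a. V*heat_kernel 1 z)" by (intro integrable_mult_right integrable_heat_kernel_1)
  show "AE z in lborel. (%i. heat_kernel 1 z*\<omega> (sqrt (X i) *\<^sub>R z)) \<longlonglongrightarrow> 0"
  proof (rule AE_I2)
   fix z :: 'a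
   have "(%i. sqrt (X i) *\<^sub>R z) \<longlonglongrightarrow> sqrt 0 *\<^sub>R z" by (intro tendsto_intros X)
   then have "(%i. \<omega> (sqrt (X i) *\<^sub>R z)) \<longlonglongrightarrow> 0" unfolding \<omega>_def by (intro translation_continuous_L1[OF v M K]) simp
   then show "(%i. heat_kernel 1 z*\<omega> (sqrt (X i) *\<^sub>R z)) \<longlonglongrightarrow> 0" by (rule tendsto_mult_right_zero)
  qed
  show "AE z in lborel. norm (heat_kernel 1 z*\<omega> (sqrt (X i) *\<^sub>R z)) <= V*heat_kernel 1 z" for i
   using \<omega>b by (intro AE_I2) (simp add: abs_mult mult.commute[of V] mult_left_mono)
  have "(%z. heat_kernel 1 z*\<omega> (sqrt (X i) *\<^sub>R z)) = (%z. LINT x|lborel. f i x z)" for i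
  proof (rule ext)
   fix z
   have "(%x. f i x z) = (%x. heat_kernel 1 z*(indicator K x*abs (v (x + sqrt (X i) *\<^sub>R z)-v x)))" by (auto simp: f_def mult_ac)
   then show "heat_kernel 1 z*\<omega> (sqrt (X i) *\<^sub>R z) = (LINT x|lborel. f i x z)"
    unfolding \<omega>_def by (simp only: integral_mult_right_zero)
  qed
  then show "(%z. heat_kernel 1 z*\<omega> (sqrt (X i) *\<^sub>R z))\<in>borel_measurable lborel" for i using F(3)[of i] by auto
 qed auto
 then have "(%i. LINT z|lborel. heat_kernel 1 z*\<omega> (sqrt (X i) *\<^sub>R z)) \<longlonglongrightarrow> 0" by simp
 then show ?thesis
 proof (rule tendsto_sandwich[OF _ _ tendsto_const, rotated 2])
  show "\<forall>\<^sub>F i in sequentially. 0 <= (LINT x|lborel. indicator K x*abs (heat_flow v (X i) x-v x))"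
   by (intro always_eventually allI integral_nonneg_AE) auto
 qed (use up in auto)
qed

section \<open>Explicit supersolutions\<close>

text \<open>
 As a function of \<open>\<sigma> = |x|\<^sup>2\<close>: the shift by \<open>K s\<close> makes the time derivative large where \<open>|x|\<^sup>2\<close> is comparable with the time.
\<close>

definition blk :: "real => real => real => real => real => real => real" where
 "blk \<Lambda> K a J s \<sigma> = exp (\<Lambda> * s)*\<sigma> powr a*(\<sigma>+K * s) powr J"

text \<open>
 This is \<open>\<partial>\<^sub>s - \<Delta>\<close> of a block in dimension \<open>n\<close>, written again in blocks.
\<close>

definition blk_source :: "real => real => real => real => real => real => real => real" where
 "blk_source n \<Lambda> K a J s \<sigma> = \<Lambda>*blk \<Lambda> K a J s \<sigma>-(4*a * (a-1)+2*n * a)*blk \<Lambda> K (a-1) J s \<sigma>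
   + J*(K-2*n-8*a)*blk \<Lambda> K a (J-1) s \<sigma>-4*J * (J-1)*blk \<Lambda> K (a+1) (J-2) s \<sigma>"

lemma blk_nonneg [simp]: "0 <= blk \<Lambda> K a J s \<sigma>" by (simp add: blk_def)

lemma borel_blk: "(%p. blk \<Lambda> K a J (fst p) (snd p))\<in>borel_measurable borel" unfolding blk_def by (rule borel_pairI) measurable

lemma continuous_blk:
 assumes "0 <= K" "!!s. s\<in>I ==> 0 <= s"
 shows "continuous_on (I\<times>{0<..}) (%p. blk \<Lambda> K a J (fst p) (snd p))" unfolding blk_def using assms
 by (intro continuous_intros) (auto, smt (verit) mult_nonneg_nonneg)

lemma has_derivative_powr_const:
 fixes f :: "'a::real_normed_vector => real"
 assumes "(f has_derivative f') (at x)" "0 < f x"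
 shows "((%z. f z powr a) has_derivative (%h. a*f x powr (a-1)*f' h)) (at x)"
 using DERIV_compose_FDERIV[OF has_real_derivative_powr[OF assms(2), of a] assms(1)] by (simp add: mult.commute)

lemma has_derivative_blk:
 assumes "0 <= K" "0 < s" "0 < \<sigma>"
 shows "((%p. blk \<Lambda> K a J (fst p) (snd p)) has_derivative
  (%k. fst k*(\<Lambda>*blk \<Lambda> K a J s \<sigma>+J*K * blk \<Lambda> K a (J-1) s \<sigma>) +
     snd k*(a*blk \<Lambda> K (a-1) J s \<sigma>+J*blk \<Lambda> K a (J-1) s \<sigma>))) (at (s, \<sigma>))"
proof -
 have f: "(fst has_derivative fst) (at (s, \<sigma>))" "(snd has_derivative snd) (at (s, \<sigma>))"
  by (auto intro!: bounded_linear_imp_has_derivative bounded_linear_fst bounded_linear_snd)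
 have E: "0 < \<sigma>+K * s" using assms by (simp add: add_pos_nonneg)
 have l: "((%p. \<Lambda>*fst p) has_derivative (%h. \<Lambda>*fst h)) (at (s, \<sigma>))" by (rule has_derivative_mult_right[OF f(1)])
 have d1: "((%p. exp (\<Lambda>*fst p)) has_derivative (%h. (\<Lambda>*fst h)*exp (\<Lambda> * s))) (at (s, \<sigma>))"
  using DERIV_compose_FDERIV[OF DERIV_exp l] by simp
 have d2: "((%p. snd p powr a) has_derivative (%h. a*\<sigma> powr (a-1) * snd h)) (at (s, \<sigma>))"
  using has_derivative_powr_const[OF f(2), of a] assms by simp
 have "((%p. snd p+K*fst p) has_derivative (%h. snd h+K*fst h)) (at (s, \<sigma>))" by (intro has_derivative_add f has_derivative_mult_right)
 then have d3: "((%p. (snd p+K*fst p) powr J) has_derivative (%h. J*(\<sigma>+K * s) powr (J-1)*(snd h+K*fst h))) (at (s, \<sigma>))"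
  using has_derivative_powr_const[of "%p. snd p+K*fst p" _ "(s, \<sigma>)" J] E by simp
 show ?thesis unfolding blk_def by (rule has_derivative_eq_rhs[OF has_derivative_mult[OF has_derivative_mult[OF d1 d2] d3]])
   (auto simp: fun_eq_iff algebra_simps)
qed

lemma DERIV_blk:
 assumes "0 <= K" "0 < s" "0 < \<sigma>"
 shows "(blk \<Lambda> K a J s has_real_derivative a*blk \<Lambda> K (a-1) J s \<sigma>+J*blk \<Lambda> K a (J-1) s \<sigma>) (at \<sigma>)"
proof -
 have E: "0 < \<sigma>+K * s" using assms by (simp add: add_pos_nonneg)
 have d2: "((%\<sigma>. \<sigma> powr a) has_real_derivative a*\<sigma> powr (a-1)) (at \<sigma>)" using assms by (intro has_real_derivative_powr)
 have d3: "((%\<sigma>. (\<sigma>+K * s) powr J) has_real_derivative J*(\<sigma>+K * s) powr (J-1)*1) (at \<sigma>)"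
  by (rule DERIV_chain2[where f = "%x. x powr J" and g = "%\<sigma>. \<sigma>+K * s"])
   (use E in \<open>auto intro!: derivative_eq_intros has_real_derivative_powr\<close>)
 have "((%\<sigma>. exp (\<Lambda> * s)*\<sigma> powr a*(\<sigma>+K * s) powr J) has_real_derivative
   (exp (\<Lambda> * s)*(a*\<sigma> powr (a-1)))*(\<sigma>+K * s) powr J+(J*(\<sigma>+K * s) powr (J-1)*1)*(exp (\<Lambda> * s)*\<sigma> powr a)) (at \<sigma>)"
  by (rule DERIV_mult[OF DERIV_cmult[OF d2] d3])
 then show ?thesis unfolding blk_def by (simp add: algebra_simps)
qed

lemma polynomial_le_exp_sqrt:
 fixes m :: real
 assumes "0 <= m"
 obtains C where "0 <= C" "!!\<sigma>. 0 <= \<sigma> ==> (1+\<sigma>) powr m <= C*exp (sqrt \<sigma>/2)"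
proof -
 obtain n :: nat where n: "2*m <= real n" using real_arch_simple by blast
 define C :: real where "C = 2 ^ n*fact n*exp (1/2)"
 have "(1+\<sigma>) powr m <= C*exp (sqrt \<sigma>/2)" if s: "0 <= \<sigma>" for \<sigma>
 proof -
  define y where "y = (1 + sqrt \<sigma>)/2"
  have y: "0 < y" "1 <= 2*y" using s by (auto simp: y_def add_pos_nonneg)
  have y2: "2*y = 1 + sqrt \<sigma>" by (simp add: y_def)
  have "(2*y) powr 2 = (1 + sqrt \<sigma>)\<^sup>2" unfolding y2 using s by (simp add: add_pos_nonneg)
  also have "... = 1+\<sigma>+2 * sqrt \<sigma>" using s by (simp add: power2_sum)
  finally have "1+\<sigma> <= (2*y) powr 2" using s by simp
  then have "(1+\<sigma>) powr m <= ((2*y) powr 2) powr m" using s assms by (intro powr_mono2) auto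
  also have "... = (2*y) powr (2*m)" by (simp add: powr_powr)
  also have "... <= (2*y) powr real n" using n y by (intro powr_mono) auto
  also have "... = 2 ^ n*y ^ n" using y by (simp add: powr_realpow power_mult_distrib)
  also have "... <= 2 ^ n*(fact n*exp y)" using power_le_exp[of y n] y by (intro mult_left_mono) (auto simp: field_simps)
  also have "exp y = exp (1/2)*exp (sqrt \<sigma>/2)" unfolding y_def by (simp add: add_divide_distrib flip: exp_add)
  finally show ?thesis unfolding C_def by (simp add: mult_ac)
 qed
 then show thesis using that[of C] by (simp add: C_def)
qed

lemma blk_bound:
 assumes K: "0 <= K" and L: "0 <= \<Lambda>" and J: "0 <= J" and a: "- (\<gamma>/2) <= a" and t: "0 < t"
 obtains C where "0 <= C" "!!s \<sigma>. 0 <= s ==> s <= t ==> 0 < \<sigma> ==> blk \<Lambda> K a J s \<sigma> <= C*(\<sigma> powr - (\<gamma>/2)*exp (sqrt \<sigma>/2))"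
proof -
 define m where "m = a+\<gamma>/2+J"
 obtain C where C: "0 <= C" "!!\<sigma>. 0 <= \<sigma> ==> (1+\<sigma>) powr m <= C*exp (sqrt \<sigma>/2)"
  using polynomial_le_exp_sqrt[of m] J a by (auto simp: m_def)
 define C' where "C' = exp (\<Lambda>*t)*(1+K*t) powr J*C"
 have "blk \<Lambda> K a J s \<sigma> <= C'*(\<sigma> powr - (\<gamma>/2)*exp (sqrt \<sigma>/2))" if s: "0 <= s" "s <= t" "0 < \<sigma>" for s \<sigma>
 proof -
  have Ks: "0 <= K * s" "K * s <= K*t" using K s by (auto intro: mult_left_mono)
  have p: "0 <= (K*t)*\<sigma>" using K t s by simp
  have "\<sigma>+K * s <= (1+K*t)*(1+\<sigma>)" using Ks s p by (simp add: algebra_simps)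
  then have "(\<sigma>+K * s) powr J <= ((1+K*t)*(1+\<sigma>)) powr J" using s Ks J by (intro powr_mono2) auto
  also have "... = (1+K*t) powr J*(1+\<sigma>) powr J" using s K t by (simp add: powr_mult)
  finally have 1: "(\<sigma>+K * s) powr J <= (1+K*t) powr J*(1+\<sigma>) powr J" .
  have "\<sigma> powr a = \<sigma> powr - (\<gamma>/2)*\<sigma> powr (a+\<gamma>/2)" by (simp flip: powr_add)
  also have "... <= \<sigma> powr - (\<gamma>/2)*(1+\<sigma>) powr (a+\<gamma>/2)" using s a by (intro mult_left_mono powr_mono2) auto
  finally have 2: "\<sigma> powr a <= \<sigma> powr - (\<gamma>/2)*(1+\<sigma>) powr (a+\<gamma>/2)" .
  have 3: "exp (\<Lambda> * s) <= exp (\<Lambda>*t)" using L s by (simp add: mult_left_mono)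
  have "blk \<Lambda> K a J s \<sigma> <= exp (\<Lambda>*t)*(\<sigma> powr - (\<gamma>/2)*(1+\<sigma>) powr (a+\<gamma>/2))*((1+K*t) powr J*(1+\<sigma>) powr J)"
   unfolding blk_def by (intro mult_mono 1 2 3) auto
  also have "... = exp (\<Lambda>*t)*(1+K*t) powr J*\<sigma> powr - (\<gamma>/2)*((1+\<sigma>) powr (a+\<gamma>/2)*(1+\<sigma>) powr J)"
   by (simp add: mult_ac)
  also have "(1+\<sigma>) powr (a+\<gamma>/2)*(1+\<sigma>) powr J = (1+\<sigma>) powr m" unfolding m_def by (simp only: powr_add)
  also have "exp (\<Lambda>*t)*(1+K*t) powr J*\<sigma> powr - (\<gamma>/2)*(1+\<sigma>) powr m <=
    exp (\<Lambda>*t)*(1+K*t) powr J*\<sigma> powr - (\<gamma>/2)*(C*exp (sqrt \<sigma>/2))" using C(2)[of \<sigma>] s by (intro mult_left_mono) auto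
  finally show ?thesis unfolding C'_def by (simp add: mult_ac)
 qed
 moreover have "0 <= C'" unfolding C'_def using C by simp
 ultimately show thesis using that by blast
qed

lemma blk_mult: "0 < \<sigma> ==> \<sigma>*blk \<Lambda> K a J s \<sigma> = blk \<Lambda> K (a+1) J s \<sigma>"
 unfolding blk_def by (simp add: powr_add)

lemma block_mild:
 fixes x :: "'a::euclidean_space"
 assumes t: "0 < t" and x: "x ~= 0" and g: "0 <= \<gamma>" "\<gamma> < real DIM('a)"
  and K: "0 <= K" and L: "0 <= \<Lambda>" and J: "J = 0 \<or> 2 <= J" and a: "1-\<gamma>/2 <= a"
 shows "integrable lborel (%p. duhamel_kernel t x p*blk_source (real DIM('a)) \<Lambda> K a J (fst p) ((norm (snd p))\<^sup>2))"
  and "blk \<Lambda> K a J t ((norm x)\<^sup>2) = heat_flow (%y. blk \<Lambda> K a J 0 ((norm y)\<^sup>2)) t x +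
   duhamel (%p. blk_source (real DIM('a)) \<Lambda> K a J (fst p) ((norm (snd p))\<^sup>2)) t x"
proof -
 define b where "b = blk \<Lambda> K"
 define F1 where "F1 s \<sigma> = \<Lambda>*b a J s \<sigma>+J*K * b a (J-1) s \<sigma>" for s \<sigma>
 define F2 where "F2 s \<sigma> = a*b (a-1) J s \<sigma>+J*b a (J-1) s \<sigma>" for s \<sigma>
 define F3 where "F3 s \<sigma> = a*((a-1)*b (a-2) J s \<sigma>+J*b (a-1) (J-1) s \<sigma>) +
   J*(a*b (a-1) (J-1) s \<sigma>+(J-1)*b a (J-2) s \<sigma>)" for s \<sigma>
 have mb: "(%p. b a' J' (fst p) (snd p))\<in>borel_measurable borel" for a' J' unfolding b_def by (rule borel_blk)
 have cb: "continuous_on (I\<times>{0<..}) (%p. b a' J' (fst p) (snd p))" if "!!s. s\<in>I ==> 0 <= s" for a' J' I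
  unfolding b_def using K that by (rule continuous_blk)
 have ex: "\<exists>C. 0 <= C \<and> (\<forall>s \<sigma>. 0 <= s --> s <= t --> 0 < \<sigma> --> b a' J' s \<sigma> <= C*(\<sigma> powr - (\<gamma>/2)*exp (sqrt \<sigma>/2)))"
  if "0 <= J'" "- (\<gamma>/2) <= a'" for a' J' unfolding b_def using blk_bound[OF K L that t] by metis
 have J0: "0 <= J" using J by auto
 obtain C1 where C1: "0 <= C1" "!!s \<sigma>. 0 <= s ==> s <= t ==> 0 < \<sigma> ==> b a J s \<sigma> <= C1*(\<sigma> powr - (\<gamma>/2)*exp (sqrt \<sigma>/2))"
  using ex[of J a] J0 a by auto
 obtain C2 where C2: "0 <= C2" "!!s \<sigma>. 0 <= s ==> s <= t ==> 0 < \<sigma> ==> b (a-1) J s \<sigma> <= C2*(\<sigma> powr - (\<gamma>/2)*exp (sqrt \<sigma>/2))"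
  using ex[of J "a-1"] J0 a by auto
 have "\<exists>C. 0 <= C \<and> (\<forall>s \<sigma>. 0 <= s --> s <= t --> 0 < \<sigma> --> J*b a (J-1) s \<sigma> <= C*(\<sigma> powr - (\<gamma>/2)*exp (sqrt \<sigma>/2)))"
 proof (cases "J = 0")
  case False
  then have J2: "2 <= J" using J by auto
  obtain C where "0 <= C" "\<forall>s \<sigma>. 0 <= s --> s <= t --> 0 < \<sigma> --> b a (J-1) s \<sigma> <= C*(\<sigma> powr - (\<gamma>/2)*exp (sqrt \<sigma>/2))"
   using ex[of "J-1" a] J2 a by auto
  then show ?thesis using J0 by (intro exI[of _ "J*C"]) (auto simp: mult.assoc intro!: mult_left_mono)
 qed (auto intro!: exI[of _ 0])
 then obtain C3 where C3: "0 <= C3" "!!s \<sigma>. 0 <= s ==> s <= t ==> 0 < \<sigma> ==> J*b a (J-1) s \<sigma> <= C3*(\<sigma> powr - (\<gamma>/2)*exp (sqrt \<sigma>/2))"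
  by blast
 have "\<exists>C. 0 <= C \<and> (\<forall>s \<sigma>. 0 <= s --> s <= t --> 0 < \<sigma> --> J*abs (J-1)*b (a+1) (J-2) s \<sigma> <= C*(\<sigma> powr - (\<gamma>/2)*exp (sqrt \<sigma>/2)))"
 proof (cases "J = 0")
  case False
  then have J2: "2 <= J" using J by auto
  obtain C where "0 <= C" "\<forall>s \<sigma>. 0 <= s --> s <= t --> 0 < \<sigma> --> b (a+1) (J-2) s \<sigma> <= C*(\<sigma> powr - (\<gamma>/2)*exp (sqrt \<sigma>/2))"
   using ex[of "J-2" "a+1"] J2 a by auto
  then show ?thesis using J0 by (intro exI[of _ "J*abs (J-1)*C"]) (auto simp: mult.assoc intro!: mult_left_mono)
 qed (auto intro!: exI[of _ 0])
 then obtain C4 where C4: "0 <= C4" "!!s \<sigma>. 0 <= s ==> s <= t ==> 0 < \<sigma> ==> J*abs (J-1)*b (a+1) (J-2) s \<sigma> <= C4*(\<sigma> powr - (\<gamma>/2)*exp (sqrt \<sigma>/2))"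
  by blast
 define C where "C = C1+\<Lambda>*C1+K*C3+abs a*C2+C3+abs (a*(a-1))*C2+2*abs a*C3+C4"
 have bn: "0 <= b a' J' s \<sigma>" for a' J' s \<sigma> by (simp add: b_def)
 have sb: "\<sigma>*b (a-2) J s \<sigma> = b (a-1) J s \<sigma>" "\<sigma>*b (a-1) (J-1) s \<sigma> = b a (J-1) s \<sigma>"
  "\<sigma>*b a (J-2) s \<sigma> = b (a+1) (J-2) s \<sigma>" "\<sigma>*b (a-1) J s \<sigma> = b a J s \<sigma>" if "0 < \<sigma>" for s \<sigma>
  unfolding b_def using blk_mult[OF that, of \<Lambda> K "a-2"] blk_mult[OF that, of \<Lambda> K "a-1"] blk_mult[OF that, of \<Lambda> K a] by simp_all
 have F3s: "\<sigma>*F3 s \<sigma> = a*(a-1)*b (a-1) J s \<sigma>+2*a * (J*b a (J-1) s \<sigma>)+J*(J-1)*b (a+1) (J-2) s \<sigma>"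
  if "0 < \<sigma>" for s \<sigma>
 proof -
  have "\<sigma>*F3 s \<sigma> = a*(a-1)*(\<sigma>*b (a-2) J s \<sigma>)+2*a * (J*(\<sigma>*b (a-1) (J-1) s \<sigma>))+J*(J-1)*(\<sigma>*b a (J-2) s \<sigma>)"
   unfolding F3_def by (simp add: algebra_simps)
  then show ?thesis unfolding sb[OF that] .
 qed
 define S where "S = (%p::real\<times>'a. F1 (fst p) ((norm (snd p))\<^sup>2) -
   (2 * real DIM('a)*F2 (fst p) ((norm (snd p))\<^sup>2)+4*(norm (snd p))\<^sup>2*F3 (fst p) ((norm (snd p))\<^sup>2)))"
 have ineqs: "abs (b a J s \<sigma>) <= C*(\<sigma> powr - (\<gamma>/2)*exp (sqrt \<sigma>/2))"
   "abs (F1 s \<sigma>) <= C*(\<sigma> powr - (\<gamma>/2)*exp (sqrt \<sigma>/2))"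
   "abs (F2 s \<sigma>) <= C*(\<sigma> powr - (\<gamma>/2)*exp (sqrt \<sigma>/2))"
   "\<sigma>*abs (F3 s \<sigma>) <= C*(\<sigma> powr - (\<gamma>/2)*exp (sqrt \<sigma>/2))"
  if s: "0 <= s" "s <= t" and sg: "0 < \<sigma>" for s \<sigma>
 proof -
  define W where "W = \<sigma> powr - (\<gamma>/2)*exp (sqrt \<sigma>/2)"
  have W: "0 <= W" by (simp add: W_def)
  define B1 where "B1 = b a J s \<sigma>"
  define B2 where "B2 = b (a-1) J s \<sigma>"
  define B3 where "B3 = J*b a (J-1) s \<sigma>"
  define B4 where "B4 = b (a+1) (J-2) s \<sigma>"
  have B: "0 <= B1" "B1 <= C1*W" "0 <= B2" "B2 <= C2*W" "0 <= B3" "B3 <= C3*W" "0 <= B4" "J*abs (J-1)*B4 <= C4*W"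
   unfolding B1_def B2_def B3_def B4_def W_def using C1 C2 C3 C4 s sg bn J0 by auto
  have p: "0 <= C1*W" "0 <= \<Lambda>*C1*W" "0 <= K*C3*W" "0 <= abs a*C2*W" "0 <= C3*W"
   "0 <= abs (a*(a-1))*C2*W" "0 <= 2*abs a*C3*W" "0 <= C4*W" using W C1(1) C2(1) C3(1) C4(1) K L by auto
  have CW: "C*W = C1*W+\<Lambda>*C1*W+K*C3*W+abs a*C2*W+C3*W+abs (a*(a-1))*C2*W+2*abs a*C3*W+C4*W" unfolding C_def by (simp add: algebra_simps)
  show "abs (b a J s \<sigma>) <= C*(\<sigma> powr - (\<gamma>/2)*exp (sqrt \<sigma>/2))"
   unfolding W_def[symmetric] B1_def[symmetric] CW using B(1,2) p by linarith
  have "F1 s \<sigma> = \<Lambda>*B1+K*B3" unfolding F1_def B1_def B3_def by simp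
  moreover have "0 <= \<Lambda>*B1" "\<Lambda>*B1 <= \<Lambda>*C1*W" "0 <= K*B3" "K*B3 <= K*C3*W"
   using B L K mult_left_mono[OF B(2) L] mult_left_mono[OF B(6) K] by (auto simp: mult.assoc)
  ultimately show "abs (F1 s \<sigma>) <= C*(\<sigma> powr - (\<gamma>/2)*exp (sqrt \<sigma>/2))" unfolding W_def[symmetric] CW using p by linarith
  have "F2 s \<sigma> = a*B2+B3" unfolding F2_def B2_def B3_def by simp
  moreover have aB: "abs (a*B2) <= abs a*C2*W" using mult_left_mono[OF B(4), of "abs a"] B(3) by (simp add: abs_mult mult.assoc)
  ultimately show "abs (F2 s \<sigma>) <= C*(\<sigma> powr - (\<gamma>/2)*exp (sqrt \<sigma>/2))" unfolding W_def[symmetric] CW using p B by linarith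
  have "\<sigma>*abs (F3 s \<sigma>) = abs (\<sigma>*F3 s \<sigma>)" using sg by (simp add: abs_mult)
  also have "\<sigma>*F3 s \<sigma> = a*(a-1)*B2+2*a * B3+J*(J-1)*B4" unfolding F3s[OF sg] B2_def B3_def B4_def ..
  finally have e: "\<sigma>*abs (F3 s \<sigma>) = abs (a*(a-1)*B2+2*a * B3+J*(J-1)*B4)" .
  have "abs (a*(a-1)*B2) <= abs (a*(a-1))*C2*W" using mult_left_mono[OF B(4), of "abs (a*(a-1))"] B(3) by (simp add: abs_mult mult.assoc)
  moreover have "abs (2*a * B3) <= 2*abs a*C3*W" using mult_left_mono[OF B(6), of "2*abs a"] B(5) by (simp add: abs_mult mult.assoc)
  moreover have "abs (J*(J-1)*B4) <= C4*W" using B(7,8) J0 by (simp add: abs_mult)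
  ultimately show "\<sigma>*abs (F3 s \<sigma>) <= C*(\<sigma> powr - (\<gamma>/2)*exp (sqrt \<sigma>/2))"
   unfolding e W_def[symmetric] CW using p by linarith
 qed
 have DF: "((%p. b a J (fst p) (snd p)) has_derivative (%k. fst k*F1 s \<sigma> + snd k*F2 s \<sigma>)) (at (s, \<sigma>))"
  if "0 < s" "s < t" "0 < \<sigma>" for s \<sigma> unfolding b_def F1_def F2_def by (rule has_derivative_blk[OF K that(1,3)])
 have DF2: "(F2 s has_real_derivative F3 s \<sigma>) (at \<sigma>)" if "0 < s" "s < t" "0 < \<sigma>" for s \<sigma>
 proof -
  have e: "J-1-1 = J-2" "a-1-1 = a-2" by auto
  show ?thesis unfolding F2_def[abs_def] F3_def b_def
   using DERIV_add[OF DERIV_cmult[OF DERIV_blk[OF K that(1,3), of \<Lambda> "a-1" J], of a] DERIV_cmult[OF DERIV_blk[OF K that(1,3), of \<Lambda> a "J-1"], of J]]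
   unfolding e .
 qed
 have c: "continuous_on ({0<..<t}\<times>{0<..}) (%p. F1 (fst p) (snd p))" "continuous_on ({0<..<t}\<times>{0<..}) (%p. F2 (fst p) (snd p))"
   "continuous_on ({0<..<t}\<times>{0<..}) (%p. F3 (fst p) (snd p))" unfolding F1_def F2_def F3_def by (intro continuous_intros cb; simp)+
 have m: "(%p. F1 (fst p) (snd p))\<in>borel_measurable borel" "(%p. F2 (fst p) (snd p))\<in>borel_measurable borel"
   "(%p. F3 (fst p) (snd p))\<in>borel_measurable borel"
  unfolding F1_def F2_def F3_def by (intro borel_measurable_add borel_measurable_times borel_measurable_const mb)+
 note R = radial_mild[where F = "b a J" and C = C, OF t x g DF DF2 cb c mb m ineqs(1) ineqs(2) ineqs(3) ineqs(4)]
 have Seq: "AE p in lborel. S p = blk_source (real DIM('a)) \<Lambda> K a J (fst p) ((norm (snd p))\<^sup>2)" using AE_snd_nonzero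
 proof eventually_elim
  case (elim p)
  then have sg: "0 < (norm (snd p))\<^sup>2" by simp
  have "S p = F1 (fst p) ((norm (snd p))\<^sup>2)-(2 * real DIM('a)*F2 (fst p) ((norm (snd p))\<^sup>2)+4*((norm (snd p))\<^sup>2*F3 (fst p) ((norm (snd p))\<^sup>2)))"
   unfolding S_def by simp
  then show ?case unfolding F3s[OF sg] F1_def F2_def blk_source_def b_def by (simp add: algebra_simps)
 qed
 have mS: "S\<in>borel_measurable borel"
 proof -
  have ns: "(%p::real\<times>'a. (norm (snd p))\<^sup>2)\<in>borel_measurable borel" by (intro borel_measurable_continuous_onI continuous_intros)
  show ?thesis unfolding S_def using borel_radial[OF m(1), of 0] borel_radial[OF m(2), of 0] borel_radial[OF m(3), of 0] ns
   by (intro borel_measurable_diff borel_measurable_add borel_measurable_times borel_measurable_const) auto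
 qed
 have mB: "(%p::real\<times>'a. blk_source (real DIM('a)) \<Lambda> K a J (fst p) ((norm (snd p))\<^sup>2))\<in>borel_measurable borel"
  unfolding blk_source_def using borel_radial[OF borel_blk, of _ _ _ _ 0]
  by (intro borel_measurable_diff borel_measurable_add borel_measurable_times borel_measurable_const) auto
 have mk: "(%p. duhamel_kernel t x p)\<in>borel_measurable borel" by measurable
 have ae: "AE p in lborel. duhamel_kernel t x p * S p = duhamel_kernel t x p*blk_source (real DIM('a)) \<Lambda> K a J (fst p) ((norm (snd p))\<^sup>2)"
  using Seq by eventually_elim simp
 have R1: "integrable lborel (%p. duhamel_kernel t x p * S p)" unfolding S_def by (rule R(1)) auto
 have R2: "b a J t ((norm x)\<^sup>2) = heat_flow (%y. b a J 0 ((norm y)\<^sup>2)) t x+duhamel S t x" unfolding S_def by (rule R(2)) auto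
 show "integrable lborel (%p. duhamel_kernel t x p*blk_source (real DIM('a)) \<Lambda> K a J (fst p) ((norm (snd p))\<^sup>2))"
  using R1 ae borel_measurable_times[OF mk mS] borel_measurable_times[OF mk mB] by (subst integrable_cong_AE[symmetric]) auto
 have "duhamel S t x = duhamel (%p. blk_source (real DIM('a)) \<Lambda> K a J (fst p) ((norm (snd p))\<^sup>2)) t x"
  unfolding duhamel_def using ae borel_measurable_times[OF mk mS] borel_measurable_times[OF mk mB] by (intro integral_cong_AE) auto
 then show "blk \<Lambda> K a J t ((norm x)\<^sup>2) = heat_flow (%y. blk \<Lambda> K a J 0 ((norm y)\<^sup>2)) t x +
   duhamel (%p. blk_source (real DIM('a)) \<Lambda> K a J (fst p) ((norm (snd p))\<^sup>2)) t x" using R2 unfolding b_def by simp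
qed

lemma borel_blk_source:
 "(%p::real\<times>'a::euclidean_space. blk_source n \<Lambda> K a J (fst p) ((norm (snd p))\<^sup>2))\<in>borel_measurable borel"
 unfolding blk_source_def using borel_radial[OF borel_blk, of _ _ _ _ 0]
 by (intro borel_measurable_diff borel_measurable_add borel_measurable_times borel_measurable_const) auto

section \<open>The choice of the supersolution\<close>

context singular_exponents
begin

lemma eta_plus_2: "\<eta>+2 < real N" using eta_less_half n_ge_1 by simp

text \<open>
 With \<open>\<theta> = \<sigma>/(\<sigma> + K s)\<close> and \<open>y = \<theta>\<^bsup>b\<^esup>\<close> the inequality becomes one between powers of \<open>\<theta>\<close>. For \<open>\<theta>\<close> not small the
 time derivative, of size \<open>J K \<theta>\<close>, absorbs the excess \<open>D\<close> of the potential. For small \<open>\<theta>\<close> that excess is a small power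
 of \<open>\<theta>\<close>, which the strictly supercritical exponent \<open>a + b\<close> of the subtracted block absorbs.
\<close>

lemma supersolution_exists:
 assumes D: "0 <= D" and s0: "0 < s0" "s0 <= 1"
 obtains K J b where "1 <= K" "real N <= J" "0 < b" "b <= 1"
  "!!\<Lambda> s \<sigma>. 0 < \<sigma> ==> 0 <= s ==> blk \<Lambda> K (- \<eta>/2+b) (J-b) s \<sigma> <= blk \<Lambda> K (- \<eta>/2) J s \<sigma>"
  "!!\<Lambda> s \<sigma>. 0 < \<sigma> ==> 0 < s ==>
    (\<Lambda>+(\<beta>*(\<alpha>+1)+D*min 1 ((\<sigma> / s) powr (s0/2)))/\<sigma>) *
     (blk \<Lambda> K (- \<eta>/2) J s \<sigma>-1/2 * blk \<Lambda> K (- \<eta>/2+b) (J-b) s \<sigma>)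
    <= blk_source (real N) \<Lambda> K (- \<eta>/2) J s \<sigma>-1/2 * blk_source (real N) \<Lambda> K (- \<eta>/2+b) (J-b) s \<sigma>"
proof -
 define n where "n = real N"
 define a where "a = - \<eta>/2"
 define b where "b = s0/8"
 have b: "0 < b" "b <= 1" using s0 by (auto simp: b_def)
 define \<beta>1 where "\<beta>1 = \<beta>*(\<alpha>+1)"
 have \<beta>1: "0 <= \<beta>1" unfolding \<beta>1_def using beta_pos alpha_pos by simp
 have root: "\<beta>1 = \<eta>*(n-2-\<eta>)" unfolding \<beta>1_def n_def eta_root ..
 define P where "P = 2*b * (n-2-2*\<eta>+2*b)"
 have P: "0 < P" unfolding P_def n_def using b eta_less_half by (intro mult_pos_pos) auto
 have poly: "4*a * (a-1)+2*n * a = - \<beta>1" "4*(a+b)*(a+b-1)+2*n * (a+b) = P-\<beta>1" unfolding root a_def P_def by (simp_all add: algebra_simps)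
 have "((%K. D*2 powr (s0/2)*K powr - (s0/16)) \<longlongrightarrow> D*2 powr (s0/2)*0) at_top"
  using s0 by (intro tendsto_mult tendsto_const tendsto_neg_powr filterlim_ident) auto
 then have e1: "\<forall>\<^sub>F K in at_top. D*2 powr (s0/2)*K powr - (s0/16) < P/2" by (rule order_tendstoD(2)) (use P in simp)
 obtain K where K1: "D*2 powr (s0/2)*K powr - (s0/16) < P/2"
  and K2: "(64*(D+1)+8*n)\<^sup>2 <= K"
  using eventually_happens'[OF trivial_limit_at_top_linorder eventually_conj[OF e1 eventually_ge_at_top]] by blast
 define q where "q = sqrt K"
 have n3: "3 <= n" using N_ge_3 by (simp add: n_def)
 have q: "64*(D+1)+8*n <= q" unfolding q_def using K2 by (rule real_le_rsqrt)
 have "1 <= 64*(D+1)+8*n" using D n3 by simp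
 then have q1: "1 <= q" using q by (rule order_trans)
 have Kq: "K = q * q" unfolding q_def using K2 by (simp add: order_trans[OF zero_le_power2 K2])
 have K0: "1 <= K" unfolding Kq using mult_mono[of 1 q 1 q] q1 by simp
 define J where "J = 4*(D+1) * q"
 have J4: "4 <= J"
 proof -
  have "1*1 <= (D+1) * q" using D q1 by (intro mult_mono) auto
  moreover have "J = 4*((D+1) * q)" by (simp add: J_def)
  ultimately show ?thesis by linarith
 qed
 have Jn: "n <= J"
 proof -
  have "n <= q" using q D n3 by (simp add: algebra_simps)
  also have "q = 1 * q" by simp
  also have "... <= J" unfolding J_def using D q1 by (intro mult_right_mono) auto
  finally show ?thesis .
 qed
 have KJ: "8*n+16*J <= K"
 proof -
  have "8*n * 1 <= 8*n * q" using q1 n3 by (intro mult_left_mono) auto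
  moreover have "(64*(D+1)+8*n) * q <= q * q" using q q1 by (intro mult_right_mono) auto
  ultimately show ?thesis unfolding Kq J_def by (simp add: algebra_simps)
 qed
 show thesis
 proof (rule that[of K J b])
  show "1 <= K" by (rule K0)
  show "real N <= J" using Jn unfolding n_def .
  show "0 < b" "b <= 1" by (rule b)+
  fix \<Lambda> s \<sigma> :: real assume sg: "0 < \<sigma>" and s: "0 <= s"
  define E where "E = \<sigma>+K * s"
  have E: "0 < E" "\<sigma> <= E" using sg s K0 by (auto simp: E_def add_pos_nonneg)
  have "\<sigma> powr (a+b)*E powr (J-b) = \<sigma> powr a*E powr J*(\<sigma> powr b/E powr b)" by (simp add: powr_add powr_diff)
  also have "... <= \<sigma> powr a*E powr J*1" using E sg b by (intro mult_left_mono) (auto simp: divide_le_eq powr_mono2)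
  finally have "exp (\<Lambda> * s)*(\<sigma> powr (a+b)*E powr (J-b)) <= exp (\<Lambda> * s)*(\<sigma> powr a*E powr J)"
   by (intro mult_left_mono) auto
  then show "blk \<Lambda> K (- \<eta>/2+b) (J-b) s \<sigma> <= blk \<Lambda> K (- \<eta>/2) J s \<sigma>"
   unfolding blk_def a_def[symmetric] E_def[symmetric] by (simp add: mult.assoc)
 next
  fix \<Lambda> s \<sigma> :: real assume sg: "0 < \<sigma>" and s: "0 < s"
  define E where "E = \<sigma>+K * s"
  have E: "0 < E" "\<sigma> < E" using sg s K0 by (auto simp: E_def add_pos_pos)
  define \<theta> where "\<theta> = \<sigma>/E"
  have th: "0 < \<theta>" "\<theta> < 1" using E sg by (auto simp: \<theta>_def)
  define X where "X = exp (\<Lambda> * s)*\<sigma> powr (a-1)*E powr J"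
  have X: "0 < X" unfolding X_def using sg E by simp
  have sgE: "\<sigma> = \<theta>*E" using E by (simp add: \<theta>_def)
  define y where "y = \<theta> powr b"
  have y: "0 < y" "y <= 1" unfolding y_def using th b by (auto simp: powr_le1)
  have pw: "\<sigma> powr (a-1+i)*E powr (J-j) = \<sigma> powr (a-1)*E powr J*(\<sigma> powr i*E powr (- j))" for i j
   by (simp add: powr_add powr_diff powr_minus field_simps)
  have e1: "blk \<Lambda> K a J s \<sigma> = \<sigma>*X" "blk \<Lambda> K (a-1) J s \<sigma> = X"
   unfolding blk_def E_def[symmetric] X_def using sg by (simp_all add: powr_diff)
  have e2: "blk \<Lambda> K a (J-1) s \<sigma> = \<theta>*X"
   using pw[of 1 1] sg E unfolding blk_def E_def[symmetric] X_def \<theta>_def by (simp add: powr_minus field_simps)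
  have e3: "blk \<Lambda> K (a+1) (J-2) s \<sigma> = \<theta>\<^sup>2*X"
   using pw[of 2 2] sg E unfolding blk_def E_def[symmetric] X_def \<theta>_def by (simp add: powr_minus field_simps power2_eq_square)
  have sb: "\<sigma> powr b*E powr (- b) = y" unfolding y_def \<theta>_def using sg E by (simp add: powr_divide powr_minus field_simps)
  have pb: "\<sigma> powr (b+i)*E powr (- (b+j)) = y*(\<sigma> powr i*E powr (- j))" for i j
  proof -
   have "\<sigma> powr (b+i)*E powr (- (b+j)) = (\<sigma> powr b*E powr (- b))*(\<sigma> powr i*E powr (- j))"
    by (simp add: powr_add powr_diff powr_minus field_simps)
   then show ?thesis unfolding sb .
  qed
  have e4: "blk \<Lambda> K (a+b-1) (J-b) s \<sigma> = y*X"
   using pw[of b b] sg E pb[of 0 0] unfolding blk_def E_def[symmetric] X_def by (simp add: algebra_simps)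
  have e5: "blk \<Lambda> K (a+b) (J-b) s \<sigma> = \<sigma>*(y*X)"
   using pw[of "b+1" b] sg E pb[of 1 0] unfolding blk_def E_def[symmetric] X_def by (simp add: algebra_simps)
  have e6: "blk \<Lambda> K (a+b) (J-b-1) s \<sigma> = y*(\<theta>*X)"
   using pw[of "b+1" "b+1"] sg E pb[of 1 1] unfolding blk_def E_def[symmetric] X_def \<theta>_def
   by (simp add: algebra_simps powr_minus) (simp add: field_simps)
  have e7: "blk \<Lambda> K (a+b+1) (J-b-2) s \<sigma> = y*(\<theta>\<^sup>2*X)"
   using pw[of "b+2" "b+2"] sg E pb[of 2 2] unfolding blk_def E_def[symmetric] X_def \<theta>_def
   by (simp add: algebra_simps powr_minus) (simp add: field_simps power2_eq_square)
  define m where "m = min 1 ((\<sigma> / s) powr (s0/2))"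
  have m: "0 <= m" "m <= 1" unfolding m_def by auto
  \<comment> \<open>where \<theta> is not small the growth of \<open>\<sigma>+K s\<close> in time pays for the potential, where it is small the subtracted term does\<close>
  have main: "D*m <= J*K / 4*\<theta>+P/2 * y"
  proof (cases "K powr - (3/2) <= \<theta>")
   case True
   have "J*K * K powr - (3/2) = 4*(D+1)"
   proof -
    have "K powr - (3/2) = 1/(K * q)" unfolding q_def using K0 by (simp add: powr_minus powr_add[of K 1 "1/2", simplified] powr_half_sqrt field_simps)
    then have "J*K * K powr - (3/2) = 4*(D+1)*((K * q)*(1/(K * q)))" unfolding J_def by (simp only: mult_ac)
    then show ?thesis using K0 q1 by simp
   qed
   then have "4*(D+1) <= J*K * \<theta>" using True mult_left_mono[OF True, of "J*K"] J4 K0 by simp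
   moreover have "D*m <= D" using m D by (simp add: mult_left_le)
   moreover have "0 <= P/2 * y" using P y by simp
   ultimately show ?thesis by simp
  next
   case False
   have "K powr - (3/2) <= K powr - 1" using K0 by (intro powr_mono) auto
   also have "... <= 1/2" using KJ J4 n3 by (simp add: powr_minus divide_simps)
   finally have th2: "\<theta> <= 1/2" using False by simp
   have "\<sigma> / s = K*\<theta>/(1-\<theta>)"
   proof -
    have "E*(1-\<theta>) = E-\<sigma>" using sgE by (simp add: right_diff_distrib mult.commute)
    then have "K * s = E*(1-\<theta>)" using E_def by linarith
    then have "(K*\<theta>/(1-\<theta>))*(K * s) = K*(\<theta>*E)" using th by simp
    then have "K*((K*\<theta>/(1-\<theta>)) * s) = K*\<sigma>" unfolding sgE[symmetric] by (simp add: mult_ac)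
    then have "(K*\<theta>/(1-\<theta>)) * s = \<sigma>" using K0 by (simp only: mult_cancel_left) auto
    then show ?thesis using s by (metis nonzero_mult_div_cancel_right less_irrefl)
   qed
   also have "... <= 2*K * \<theta>" using th th2 K0 mult_left_mono[OF th2, of "2*K * \<theta>"] by (simp add: divide_le_eq algebra_simps)
   finally have "m <= (2*K * \<theta>) powr (s0/2)" unfolding m_def using sg s s0 by (intro min.coboundedI2 powr_mono2) auto
   also have "... = (2*K) powr (s0/2)*\<theta> powr (s0/2-b)*y" unfolding y_def using th K0 by (simp add: powr_mult flip: powr_add)
   also have "... <= (2*K) powr (s0/2)*(K powr - (3/2)) powr (s0/2-b)*y"
    using False th y s0 by (intro mult_right_mono mult_left_mono powr_mono2) (auto simp: b_def)
   also have "... = 2 powr (s0/2)*K powr - (s0/16)*y" using K0 by (simp add: powr_mult powr_powr b_def field_simps flip: powr_add)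
   finally have "D*m <= D*(2 powr (s0/2)*K powr - (s0/16)*y)" using D by (intro mult_left_mono)
   also have "... = (D*2 powr (s0/2)*K powr - (s0/16))*y" by simp
   also have "... <= P/2 * y" using K1 y by (intro mult_right_mono) auto
   also have "... <= J*K / 4*\<theta>+P/2 * y" using J4 K0 th by simp
   finally show ?thesis .
  qed
  define F where "F = blk \<Lambda> K a J s \<sigma>-1/2 * blk \<Lambda> K (a+b) (J-b) s \<sigma>"
  have F: "F = \<sigma>*(X-1/2 * (y*X))" unfolding F_def e1 e5 by (simp add: algebra_simps)
  have y\<theta>: "y*\<theta> <= \<theta>" "\<theta>\<^sup>2 <= \<theta>" "0 <= y*\<theta>\<^sup>2" "0 <= y*\<theta>"
   using y th by (auto simp: power2_eq_square mult_left_le_one_le)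
  have core: "\<beta>1*(1-1/2 * y)+D*m * (1-1/2 * y) <=
    \<beta>1+J*(K-2*n-8*a)*\<theta>-4*J * (J-1)*\<theta>\<^sup>2
    - 1/2 * (- (P-\<beta>1)*y+(J-b)*(K-2*n-8*(a+b))*(y*\<theta>)-4*(J-b)*(J-b-1)*(y*\<theta>\<^sup>2))"
  proof -
   have 1: "D*m * (1-1/2 * y) <= D*m" using D m y by (intro mult_left_le) auto
   have 2: "J*(K-2*n)*\<theta> <= J*(K-2*n-8*a)*\<theta>" using J4 th eta_pos by (intro mult_right_mono mult_left_mono) (auto simp: a_def)
   have 3: "4*J * (J-1)*\<theta>\<^sup>2 <= 4*J * J*\<theta>" using J4 th y\<theta> by (intro mult_mono) auto
   have 4: "(J-b)*(K-2*n-8*(a+b))*(y*\<theta>) <= J*K * \<theta>"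
   proof -
    have "K-2*n-8*(a+b) <= K" unfolding a_def n_def using eta_less_half b n_ge_1 by (simp add: algebra_simps)
    then have "(J-b)*(K-2*n-8*(a+b)) <= (J-b)*K" using J4 b by (intro mult_left_mono) auto
    also have "... <= J*K" using b K0 by (intro mult_right_mono) auto
    finally have "(J-b)*(K-2*n-8*(a+b))*(y*\<theta>) <= J*K * (y*\<theta>)" using y\<theta> by (intro mult_right_mono) auto
    also have "... <= J*K * \<theta>" using y\<theta> J4 K0 by (intro mult_left_mono) auto
    finally show ?thesis .
   qed
   have 5: "0 <= 4*(J-b)*(J-b-1)*(y*\<theta>\<^sup>2)" using J4 b y by (intro mult_nonneg_nonneg) auto
   have 6: "J*K / 4*\<theta> <= J*(K-2*n)*\<theta>-4*J * J*\<theta>-1/2 * (J*K * \<theta>)"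
   proof -
    have "J*\<theta>*(8*n+16*J) <= J*\<theta>*K" using KJ J4 th by (intro mult_left_mono) auto
    then show ?thesis by (simp add: algebra_simps)
   qed
   show ?thesis using 1 2 3 4 5 6 main by (simp add: algebra_simps)
  qed
  have "(\<Lambda>+(\<beta>1+D*m)/\<sigma>)*F = \<Lambda>*F+(\<beta>1*(1-1/2 * y)+D*m * (1-1/2 * y))*X"
   unfolding F using sg by (simp add: algebra_simps add_divide_distrib)
  also have "... <= \<Lambda>*F+(\<beta>1+J*(K-2*n-8*a)*\<theta>-4*J * (J-1)*\<theta>\<^sup>2
    - 1/2 * (- (P-\<beta>1)*y+(J-b)*(K-2*n-8*(a+b))*(y*\<theta>)-4*(J-b)*(J-b-1)*(y*\<theta>\<^sup>2)))*X"
   using core X by (intro add_left_mono mult_right_mono) auto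
  also have "... = blk_source n \<Lambda> K a J s \<sigma>-1/2 * blk_source n \<Lambda> K (a+b) (J-b) s \<sigma>"
   unfolding blk_source_def poly e1 e2 e3 e4 e5 e6 e7 F by (simp add: algebra_simps)
  finally show "(\<Lambda>+(\<beta>*(\<alpha>+1)+D*min 1 ((\<sigma> / s) powr (s0/2)))/\<sigma>) *
     (blk \<Lambda> K (- \<eta>/2) J s \<sigma>-1/2 * blk \<Lambda> K (- \<eta>/2+b) (J-b) s \<sigma>)
    <= blk_source (real N) \<Lambda> K (- \<eta>/2) J s \<sigma>-1/2 * blk_source (real N) \<Lambda> K (- \<eta>/2+b) (J-b) s \<sigma>"
   unfolding F_def \<beta>1_def m_def n_def a_def .
 qed
qed

end

section \<open>Bounds for the linearised potential\<close>

context singular_profile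
begin

lemma profile_bound:
 obtains D s where "0 <= D" "0 < s" "!!r. 0 < r ==> r powr \<kappa>*abs (f r) <= L+D*min 1 (r powr s)"
proof -
 obtain s C r1 where s: "s > 0" "r1 > 0" and
  C: "!!r. 0 < r ==> r <= r1 ==> abs (r powr \<kappa>*f r-L) <= C * r powr s" using rate_near_zero by blast
 obtain \<mu> where mu: "((%r. r powr \<kappa>*f r) \<longlongrightarrow> \<mu>) at_top" using limit_at_infinity by blast
 have "\<forall>\<^sub>F r in at_top. dist (r powr \<kappa>*f r) \<mu> < 1" using mu unfolding tendsto_iff by simp
 then obtain R where R: "!!r. R <= r ==> dist (r powr \<kappa>*f r) \<mu> < 1" by (auto simp: eventually_at_top_linorder)
 have cf: "continuous_on {0<..} (%r. r powr \<kappa>*f r)" by (intro continuous_intros continuous_f) auto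
 have C0: "0 <= C"
 proof -
  have "0 <= C * r1 powr s" using order_trans[OF abs_ge_zero C[of r1]] s by simp
  then show ?thesis using s by (simp add: zero_le_mult_iff)
 qed
 have near: "abs (r powr \<kappa>*f r) <= L+C * r powr s" if "0 < r" "r <= r1" for r using C[OF that] L_pos by linarith
 have "abs (r powr \<kappa>*f r) <= L+C * r1 powr s" if r: "0 < r" "r <= r1" for r
 proof -
  have "C * r powr s <= C * r1 powr s" using r s C0 by (intro mult_left_mono powr_mono2) auto
  then show ?thesis using near[OF r] by linarith
 qed
 then have "\<exists>B. \<forall>r. 0 < r --> r <= R --> abs (r powr \<kappa>*f r) <= B" by (rule bounded_from_zero[OF cf s(2)])
 then obtain B where B: "!!r. 0 < r ==> r <= R ==> abs (r powr \<kappa>*f r) <= B" by blast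
 define B' where "B' = abs B+abs \<mu>+1"
 have all: "abs (r powr \<kappa>*f r) <= B'" if "0 < r" for r
 proof (cases "r <= R")
  case True
  then show ?thesis using B[OF that True] unfolding B'_def by linarith
 next
  case False
  then show ?thesis using R[of r] unfolding B'_def dist_real_def by linarith
 qed
 define m1 where "m1 = min 1 (r1 powr s)"
 have m1: "0 < m1" "m1 <= 1" using s by (auto simp: m1_def)
 define D where "D = C+abs C/m1+B'/m1+C * r1 powr s/m1"
 have B'0: "0 <= B'" by (simp add: B'_def)
 have "r powr \<kappa>*abs (f r) <= L+D*min 1 (r powr s)" if r: "0 < r" for r
 proof -
  have eq: "r powr \<kappa>*abs (f r) = abs (r powr \<kappa>*f r)" by (simp add: abs_mult)
  have D1: "C <= D" "B' <= D*m1" "C * r1 powr s <= D*m1" unfolding D_def using C0 B'0 m1 by (auto simp: field_simps add_nonneg_nonneg)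
  have D0: "0 <= D" using D1 C0 by linarith
  show ?thesis
  proof (cases "r <= r1")
   case True
   show ?thesis
   proof (cases "r powr s <= 1")
    case True
    then show ?thesis using near[OF r \<open>r <= r1\<close>] mult_right_mono[OF D1(1), of "r powr s"] unfolding eq by (simp add: min_def)
   next
    case False
    have "C * r powr s <= C * r1 powr s" using r s C0 \<open>r <= r1\<close> by (intro mult_left_mono powr_mono2) auto
    also have "... <= D*m1" by (rule D1(3))
    also have "... <= D*1" using D0 m1 by (intro mult_left_mono) auto
    finally show ?thesis using near[OF r \<open>r <= r1\<close>] False unfolding eq by (simp add: min_def)
   qed
  next
   case False
   then have "r1 powr s <= r powr s" using s by (intro powr_mono2) auto
   then have "m1 <= min 1 (r powr s)" unfolding m1_def by (simp add: min.coboundedI2)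
   then have "D*m1 <= D*min 1 (r powr s)" using D0 by (intro mult_left_mono) auto
   then show ?thesis using all[OF r] D1(2) L_pos unfolding eq by linarith
  qed
 qed
 moreover have "0 <= D" unfolding D_def using C0 B'0 m1 by (intro add_nonneg_nonneg) auto
 ultimately show thesis using that s(1) by blast
qed

lemma U_of_rescaled:
 assumes "0 < t" "0 < X"
 shows "X powr \<kappa>*abs (t powr (- 1/\<alpha>)*f (X / sqrt t)) = (X / sqrt t) powr \<kappa>*abs (f (X / sqrt t))"
proof -
 have "sqrt t powr \<kappa> = t powr (1/\<alpha>)" using assms by (simp add: powr_half_sqrt[symmetric] powr_powr)
 then have "(X / sqrt t) powr \<kappa> = X powr \<kappa>*t powr (- 1/\<alpha>)" using assms by (simp add: powr_divide powr_minus field_simps)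
 then show ?thesis by (simp add: abs_mult)
qed

text \<open>
 The profile approaches its singular limit at a power rate, and \<open>|x|\<^bsup>2/\<alpha>\<^esup> W\<close> is small because \<open>\<eta> < 2/\<alpha>\<close>.
\<close>

lemma potential_bound:
 obtains D s0 where "0 <= D" "0 < s0" "s0 <= 1"
  "!!t X W. 0 < t ==> t <= 1 ==> 0 < X ==> X <= 1 ==> 0 <= W ==> X powr \<eta>*W <= 1 ==>
   (\<alpha>+1)*(abs (t powr (- 1/\<alpha>)*f (X / sqrt t))+W) powr \<alpha> <=
    (\<beta>*(\<alpha>+1)+D*min 1 ((X\<^sup>2/t) powr (s0/2)))/X\<^sup>2"
proof -
 obtain D1 s where D1: "0 <= D1" "0 < s" "!!r. 0 < r ==> r powr \<kappa>*abs (f r) <= L+D1*min 1 (r powr s)" using profile_bound by blast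
 define s0 where "s0 = Min {1, s, \<kappa>-\<eta>}"
 have s0: "0 < s0" "s0 <= 1" "s0 <= s" "s0 <= \<kappa>-\<eta>" unfolding s0_def using D1 eta_less_kappa by (auto intro: Min_le)
 define D2 where "D2 = D1+1"
 define D3 where "D3 = \<alpha>*max (L powr (\<alpha>-1)) ((L+D2) powr (\<alpha>-1))*D2"
 have D3: "0 <= D3" unfolding D3_def D2_def using alpha_pos D1 by (intro mult_nonneg_nonneg) (auto simp: le_max_iff_disj)
 have lin: "(L+D2*m) powr \<alpha> <= \<beta>+D3*m" if m: "0 <= m" "m <= 1" for m
 proof -
  have "norm ((L+D2*m) powr \<alpha>-L powr \<alpha>) <= (\<alpha>*max (L powr (\<alpha>-1)) ((L+D2) powr (\<alpha>-1)))*norm ((L+D2*m)-L)"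
  proof (rule field_differentiable_bound[of "{L..L+D2}"])
   fix z assume z: "z\<in>{L..L+D2}"
   then have "L <= z" by simp
   with L_pos have z0: "0 < z" by (rule less_le_trans)
   show "((%z. z powr \<alpha>) has_field_derivative \<alpha>*z powr (\<alpha>-1)) (at z within {L..L+D2})"
    using has_real_derivative_powr[OF z0] has_field_derivative_at_within by blast
   have "z powr (\<alpha>-1) <= max (L powr (\<alpha>-1)) ((L+D2) powr (\<alpha>-1))"
   proof (cases "1 <= \<alpha>")
    case True
    then have "z powr (\<alpha>-1) <= (L+D2) powr (\<alpha>-1)" using z z0 by (intro powr_mono2) auto
    then show ?thesis by simp
   next
    case False
    then have "z powr (\<alpha>-1) <= L powr (\<alpha>-1)" using z z0 L_pos by (intro powr_mono2') auto
    then show ?thesis by simp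
   qed
   then show "norm (\<alpha>*z powr (\<alpha>-1)) <= \<alpha>*max (L powr (\<alpha>-1)) ((L+D2) powr (\<alpha>-1))"
    using alpha_pos by (simp add: abs_mult mult_left_mono)
  next
   show "L+D2*m\<in>{L..L+D2}" using m D1 by (auto simp: D2_def mult_left_le)
   show "L\<in>{L..L+D2}" using D1 by (auto simp: D2_def)
  qed auto
  also have "... = D3*m" unfolding D3_def using m D1 by (simp add: D2_def mult_ac)
  finally show ?thesis unfolding L_powr by simp
 qed
 define D where "D = (\<alpha>+1)*D3"
 show thesis
 proof (rule that[of D s0])
  show "0 <= D" unfolding D_def using D3 alpha_pos by simp
  fix t X W assume t: "0 < t" "t <= (1::real)" and X: "0 < X" "X <= (1::real)" and W: "0 <= W" "X powr \<eta>*W <= 1"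
  define r where "r = X / sqrt t"
  have r: "0 < r" "X <= r" unfolding r_def using t X by (auto simp: pos_le_divide_eq mult_left_le)
  define m where "m = min 1 (r powr s0)"
  have m: "0 <= m" "m <= 1" by (auto simp: m_def)
  have meq: "m = min 1 ((X\<^sup>2/t) powr (s0/2))"
  proof -
   have "X\<^sup>2/t = r powr 2" unfolding r_def using t X by (simp add: power_divide)
   then show ?thesis unfolding m_def by (simp add: powr_powr)
  qed
  have 1: "r powr \<kappa>*abs (f r) <= L+D1*m"
  proof -
   have "min 1 (r powr s) <= m"
   proof (cases "r <= 1")
    case True
    then have "r powr s <= r powr s0" using r s0 by (intro powr_mono') auto
    then show ?thesis unfolding m_def by (auto simp: min_def)
   next
    case False
    then have "1 <= r powr s0" using s0 by (intro ge_one_powr_ge_zero) auto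
    then show ?thesis unfolding m_def by simp
   qed
   then have "D1*min 1 (r powr s) <= D1*m" using D1 by (intro mult_left_mono) auto
   then show ?thesis using D1(3)[OF r(1)] by linarith
  qed
  have 2: "X powr \<kappa>*W <= m"
  proof -
   have "X powr \<kappa>*W = X powr (\<kappa>-\<eta>)*(X powr \<eta>*W)" by (simp add: mult.assoc[symmetric] flip: powr_add)
   also have "... <= X powr (\<kappa>-\<eta>)*1" using W by (intro mult_left_mono) auto
   also have "... <= X powr s0" using X s0 by (simp add: powr_mono')
   finally have *: "X powr \<kappa>*W <= X powr s0" .
   have "X powr s0 <= 1" using X s0 by (simp add: powr_le1)
   moreover have "X powr s0 <= r powr s0" using X r s0 by (intro powr_mono2) auto
   ultimately show ?thesis using*unfolding m_def by simp
  qed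
  define u where "u = abs (t powr (- 1/\<alpha>)*f (X / sqrt t))"
  have u: "X powr \<kappa>*u = r powr \<kappa>*abs (f r)" unfolding u_def r_def by (rule U_of_rescaled[OF t(1) X(1)])
  have "X powr \<kappa>*(u+W) <= L+D2*m" using 1 2 u unfolding D2_def by (simp add: algebra_simps)
  then have "(X powr \<kappa>*(u+W)) powr \<alpha> <= (L+D2*m) powr \<alpha>" using W alpha_pos by (intro powr_mono2) (auto simp: u_def)
  also have "... <= \<beta>+D3*m" by (rule lin[OF m])
  finally have "(X powr \<kappa>) powr \<alpha>*(u+W) powr \<alpha> <= \<beta>+D3*m" using W by (simp add: powr_mult u_def)
  moreover have "(X powr \<kappa>) powr \<alpha> = X\<^sup>2" using alpha_pos X by (simp add: powr_powr)
  ultimately have "X\<^sup>2*(u+W) powr \<alpha> <= \<beta>+D3*m" by simp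
  then have "(\<alpha>+1)*(X\<^sup>2*(u+W) powr \<alpha>) <= (\<alpha>+1)*(\<beta>+D3*m)" using alpha_pos by (intro mult_left_mono) auto
  then have "(\<alpha>+1)*(u+W) powr \<alpha> <= (\<alpha>+1)*(\<beta>+D3*m)/X\<^sup>2" using X by (simp add: pos_le_divide_eq mult_ac)
  also have "(\<alpha>+1)*(\<beta>+D3*m) = \<beta>*(\<alpha>+1)+D*m" unfolding D_def by (simp add: algebra_simps)
  finally show "(\<alpha>+1)*(abs (t powr (- 1/\<alpha>)*f (X / sqrt t))+W) powr \<alpha> <=
    (\<beta>*(\<alpha>+1)+D*min 1 ((X\<^sup>2/t) powr (s0/2)))/X\<^sup>2" unfolding u_def meq .
 qed (use s0 in auto)
qed

end

section \<open>Monotone iteration\<close>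

lemma borel_duhamel:
 assumes h: "h\<in>borel_measurable borel"
 shows "(%p. duhamel h (fst p) (snd p))\<in>borel_measurable (borel :: (real\<times>'a::euclidean_space) measure)"
proof -
 have "(%z. duhamel_kernel (fst (fst z)) (snd (fst z)) (snd z)*h (snd z)) \<in>
   borel_measurable (borel :: ((real\<times>'a)\<times>(real\<times>'a)) measure)"
  by (intro borel_measurable_times borel_duhamel_kernel measurable_compose[OF borel_snd_comp h]
    borel_snd_comp borel_fst_comp) auto
 then have "(%(p, q). duhamel_kernel (fst p) (snd p) q*h q) \<in>
   borel_measurable (lborel \<Otimes>\<^sub>M (lborel :: (real\<times>'a) measure))" by (simp add: lborel_prod case_prod_beta')
 then have "(%p. duhamel h (fst p) (snd p))\<in>borel_measurable lborel" unfolding duhamel_def by (rule lborel.borel_measurable_lebesgue_integral)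
 then show ?thesis by simp
qed

lemma borel_heat_flow:
 assumes v: "v\<in>borel_measurable borel"
 shows "(%p. heat_flow v (fst p) (snd p))\<in>borel_measurable (borel :: (real\<times>'a::euclidean_space) measure)"
proof -
 have "(%z. heat_kernel (fst (fst z)) (snd (fst z)-snd z) * v (snd z)) \<in>
   borel_measurable (borel :: ((real\<times>'a)\<times>'a) measure)"
  by (intro borel_measurable_times borel_heat_kernel' measurable_compose[OF borel_snd_comp v]
    borel_measurable_diff borel_snd_comp borel_fst_comp) auto
 then have "(%(p, y). heat_kernel (fst p) (snd p-y) * v y)\<in>borel_measurable ((lborel :: (real\<times>'a) measure) \<Otimes>\<^sub>M lborel)"
  by (simp add: lborel_prod case_prod_beta')
 then have "(%p. heat_flow v (fst p) (snd p))\<in>borel_measurable lborel" unfolding heat_flow_def by (rule lborel.borel_measurable_lebesgue_integral)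
 then show ?thesis by simp
qed

lemma monotone_fixed_point:
 fixes G :: "real\<times>'a::euclidean_space => real => real"
 assumes v: "v\<in>borel_measurable borel"
  and Gm: "!!w. w\<in>borel_measurable borel ==> (%p. G p (w p))\<in>borel_measurable borel"
  and Gmono: "!!p a b. a <= b ==> G p a <= G p b"
  and Gcont: "!!p. continuous_on UNIV (G p)"
  and W: "W\<in>borel_measurable borel"
  and Sint: "!!t x. 0 < t ==> t < T ==> x ~= 0 ==> integrable lborel (%p. duhamel_kernel t x p * S p)"
  and GS: "!!p w. 0 < fst p ==> fst p < T ==> snd p ~= 0 ==> abs w <= W p ==> abs (G p w) <= S p"
  and W0: "!!p. 0 < fst p ==> fst p < T ==> snd p ~= 0 ==> 0 <= W p"
  and inv: "!!w t x. w\<in>borel_measurable borel ==>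
   (!!p. 0 < fst p ==> fst p < T ==> snd p ~= 0 ==> abs (w p) <= W p) ==> 0 < t ==> t < T ==> x ~= 0 ==>
   abs (heat_flow v t x+duhamel (%p. G p (w p)) t x) <= W (t, x)"
 obtains w where "w\<in>borel_measurable borel"
  "!!p. 0 < fst p ==> fst p < T ==> snd p ~= 0 ==> abs (w p) <= W p"
  "!!t x. 0 < t ==> t < T ==> x ~= 0 ==> w (t, x) = heat_flow v t x+duhamel (%p. G p (w p)) t x"
proof -
 define D where "D = {p :: real\<times>'a. 0 < fst p \<and> fst p < T \<and> snd p ~= 0}"
 define \<Phi> where "\<Phi> w p = heat_flow v (fst p) (snd p)+duhamel (%p. G p (w p)) (fst p) (snd p)" for w p
 define ws where "ws n = (\<Phi> ^^ n) (%p. - W p)" for n :: nat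
 have ws0: "ws 0 = (%p. - W p)" and wsS: "ws (Suc n) = \<Phi> (ws n)" for n by (auto simp: ws_def)
 have m: "ws n\<in>borel_measurable borel" for n
 proof (induction n)
  case (Suc n)
  then show ?case unfolding wsS \<Phi>_def[abs_def] by (intro borel_measurable_add borel_heat_flow v borel_duhamel Gm)
 qed (use W in \<open>simp add: ws0\<close>)
 have b: "abs (ws n p) <= W p" if "p\<in>D" for n p using that
 proof (induction n arbitrary: p)
  case (Suc n)
  have "abs (heat_flow v (fst p) (snd p)+duhamel (%p. G p (ws n p)) (fst p) (snd p)) <= W (fst p, snd p)"
   by (rule inv[OF m]) (use Suc in \<open>auto simp: D_def\<close>)
  then show ?case unfolding wsS \<Phi>_def by simp
 qed (use W0 in \<open>auto simp: ws0 D_def\<close>)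
 have aeD: "AE p in lborel. 0 < fst p --> fst p < t --> abs (G p (u p)) <= S p"
  if "t < T" "!!p. p\<in>D ==> abs (u p) <= W p" for u t using AE_snd_nonzero
 proof eventually_elim
  case (elim p)
  show ?case using GS[of p "u p"] that(2)[of p] that(1) elim unfolding D_def by auto
 qed
 have int: "integrable lborel (%p. duhamel_kernel t x p*G p (u p))"
  if "0 < t" "t < T" "x ~= 0" "u\<in>borel_measurable borel" "!!p. p\<in>D ==> abs (u p) <= W p" for t x u
  by (rule duhamel_bound(1)[OF Gm[OF that(4)] Sint[OF that(1-3)] aeD[OF that(2,5)]])
 have mono: "ws n p <= ws (Suc n) p" if "p\<in>D" for n p using that
 proof (induction n arbitrary: p)
  case 0
  then show ?case using b[OF 0, of "Suc 0"] unfolding ws0 by (simp add: abs_le_iff)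
 next
  case (Suc n)
  then have p: "0 < fst p" "fst p < T" "snd p ~= 0" by (auto simp: D_def)
  have "duhamel (%p. G p (ws n p)) (fst p) (snd p) <= duhamel (%p. G p (ws (Suc n) p)) (fst p) (snd p)" unfolding duhamel_def
  proof (rule integral_mono_AE)
   show "AE q in lborel. duhamel_kernel (fst p) (snd p) q*G q (ws n q) <= duhamel_kernel (fst p) (snd p) q*G q (ws (Suc n) q)" using AE_snd_nonzero
   proof eventually_elim
    case (elim q)
    show ?case
    proof (cases "0 < fst q \<and> fst q < fst p")
     case True
     then have "q\<in>D" using elim p by (auto simp: D_def)
     then show ?thesis using Suc.IH Gmono by (intro mult_left_mono) auto
    qed (auto simp: duhamel_kernel_def)
   qed
  qed (use int[OF p m b] in auto)
  then show ?case unfolding wsS[of "Suc n"] wsS[of n] \<Phi>_def by simp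
 qed
 define w where "w p = lim (%n. ws n p)" for p
 have wm: "w\<in>borel_measurable borel" unfolding w_def[abs_def] by (intro borel_measurable_lim_metric m)
 have lim: "(%n. ws n p) \<longlonglongrightarrow> w p" if "p\<in>D" for p
 proof -
  have "incseq (%n. ws n p)" by (rule incseq_SucI) (rule mono[OF that])
  moreover have "!!n. ws n p <= W p" using b[OF that] by (simp add: abs_le_iff)
  ultimately have "convergent (%n. ws n p)" using incseq_convergent by (metis convergentI)
  then show ?thesis unfolding w_def by (simp add: convergent_LIMSEQ_iff)
 qed
 have wb: "abs (w p) <= W p" if "p\<in>D" for p by (rule LIMSEQ_le_const2[OF tendsto_rabs[OF lim[OF that]]]) (use b[OF that] in auto)
 have fix_: "w p = \<Phi> w p" if p: "p\<in>D" for p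
 proof -
  have p': "0 < fst p" "fst p < T" "snd p ~= 0" using p by (auto simp: D_def)
  have "(%n. duhamel (%p. G p (ws n p)) (fst p) (snd p)) \<longlonglongrightarrow> duhamel (%p. G p (w p)) (fst p) (snd p)" unfolding duhamel_def
  proof (rule integral_dominated_convergence[OF _ _ Sint[OF p']])
   show "AE q in lborel. (%n. duhamel_kernel (fst p) (snd p) q*G q (ws n q)) \<longlonglongrightarrow> duhamel_kernel (fst p) (snd p) q*G q (w q)"
    using AE_snd_nonzero
   proof eventually_elim
    case (elim q)
    show ?case
    proof (cases "0 < fst q \<and> fst q < fst p")
     case True
     then have q: "q\<in>D" using elim p' by (auto simp: D_def)
     have "isCont (G q) (w q)" using Gcont[of q] by (simp add: continuous_on_eq_continuous_at)
     from isCont_tendsto_compose[OF this lim[OF q]] have "(%n. G q (ws n q)) \<longlonglongrightarrow> G q (w q)" .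
     then show ?thesis by (intro tendsto_mult tendsto_const)
    qed (auto simp: duhamel_kernel_def)
   qed
   show "AE q in lborel. norm (duhamel_kernel (fst p) (snd p) q*G q (ws n q)) <= duhamel_kernel (fst p) (snd p) q * S q" for n using AE_snd_nonzero
   proof eventually_elim
    case (elim q)
    show ?case
    proof (cases "0 < fst q \<and> fst q < fst p")
     case True
     then have "q\<in>D" using elim p' by (auto simp: D_def)
     then have "abs (G q (ws n q)) <= S q" using GS b unfolding D_def by auto
     then have "duhamel_kernel (fst p) (snd p) q*abs (G q (ws n q)) <= duhamel_kernel (fst p) (snd p) q * S q" by (intro mult_left_mono) auto
     then show ?thesis by (simp add: abs_mult)
    qed (auto simp: duhamel_kernel_def)
   qed
  qed (use borel_measurable_times[OF borel_duhamel_kernel[of "%_. fst p" borel "%_. snd p" "%q. q"] Gm[OF wm]]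
    borel_measurable_times[OF borel_duhamel_kernel[of "%_. fst p" borel "%_. snd p" "%q. q"] Gm[OF m]] in auto)
  then have "(%n. ws (Suc n) p) \<longlonglongrightarrow> \<Phi> w p" unfolding wsS \<Phi>_def by (intro tendsto_add tendsto_const)
  moreover have "(%n. ws (Suc n) p) \<longlonglongrightarrow> w p" using LIMSEQ_Suc[OF lim[OF p]] .
  ultimately show ?thesis using LIMSEQ_unique by blast
 qed
 show thesis
 proof (rule that[OF wm])
  show "abs (w p) <= W p" if "0 < fst p" "fst p < T" "snd p ~= 0" for p using wb that by (auto simp: D_def)
  show "w (t, x) = heat_flow v t x+duhamel (%p. G p (w p)) t x" if "0 < t" "t < T" "x ~= 0" for t x
  proof -
   have "(t, x)\<in>D" using that by (auto simp: D_def)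
   from fix_[OF this] show ?thesis unfolding \<Phi>_def fst_conv snd_conv .
  qed
 qed
qed

section \<open>Barriers and the perturbed solution\<close>

lemma borel_slice:
 fixes h :: "real\<times>'a::euclidean_space => real"
 assumes "h\<in>borel_measurable borel"
 shows "(%y. h (c, y))\<in>borel_measurable borel"
proof -
 have "(%y::'a. (c, y))\<in>borel_measurable borel" by (intro borel_measurable_continuous_onI continuous_intros)
 from measurable_compose[OF this assms] show ?thesis .
qed

text \<open>
 A barrier together with the source for which it solves the linear integral equation.
\<close>

definition mild_pair :: "(real\<times>'a::euclidean_space => real) => (real\<times>'a => real) => bool" where
 "mild_pair A S \<longleftrightarrow> A\<in>borel_measurable borel \<and> S\<in>borel_measurable borel \<and>
   (\<forall>t>0. \<forall>x. x ~= 0 --> integrable lborel (%y. heat_kernel t (x-y)*A (0, y)) \<and>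
    integrable lborel (%p. duhamel_kernel t x p * S p) \<and>
    A (t, x) = heat_flow (%y. A (0, y)) t x+duhamel S t x)"

lemma mild_pair_combine:
 assumes "mild_pair A S" "mild_pair B R"
 shows "mild_pair (%p. c*A p+d*B p) (%p. c * S p+d * R p)" unfolding mild_pair_def
proof (intro conjI allI impI)
 show "(%p. c*A p+d*B p)\<in>borel_measurable borel" "(%p. c * S p+d * R p)\<in>borel_measurable borel"
  using assms unfolding mild_pair_def by (intro borel_measurable_add borel_measurable_times borel_measurable_const; blast)+
 fix t :: real and x assume tx: "0 < t" "x ~= (0::'a)"
 have i: "integrable lborel (%y. heat_kernel t (x-y)*A (0, y))" "integrable lborel (%y. heat_kernel t (x-y)*B (0, y))"
  "integrable lborel (%p. duhamel_kernel t x p * S p)" "integrable lborel (%p. duhamel_kernel t x p * R p)"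
  using assms tx unfolding mild_pair_def by (blast)+
 have e1: "(%y. heat_kernel t (x-y)*(c*A (0, y)+d*B (0, y))) =
   (%y. c*(heat_kernel t (x-y)*A (0, y))+d*(heat_kernel t (x-y)*B (0, y)))"
  and e2: "(%p. duhamel_kernel t x p*(c * S p+d * R p)) =
   (%p. c*(duhamel_kernel t x p * S p)+d*(duhamel_kernel t x p * R p))" by (auto simp: algebra_simps)
 show "integrable lborel (%y. heat_kernel t (x-y)*(c*A (0, y)+d*B (0, y)))"
  unfolding e1 using i by (intro Bochner_Integration.integrable_add integrable_mult_right)
 show "integrable lborel (%p. duhamel_kernel t x p*(c * S p+d * R p))"
  unfolding e2 using i by (intro Bochner_Integration.integrable_add integrable_mult_right)
 have "A (t, x) = heat_flow (%y. A (0, y)) t x+duhamel S t x" "B (t, x) = heat_flow (%y. B (0, y)) t x+duhamel R t x"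
  using assms tx unfolding mild_pair_def by (blast)+
 moreover have "heat_flow (%y. c*A (0, y)+d*B (0, y)) t x = c*heat_flow (%y. A (0, y)) t x+d*heat_flow (%y. B (0, y)) t x"
  unfolding heat_flow_def e1 using i by simp
 moreover have "duhamel (%p. c * S p+d * R p) t x = c*duhamel S t x+d*duhamel R t x" unfolding duhamel_def e2 using i by simp
 ultimately show "c*A (t, x)+d*B (t, x) = heat_flow (%y. c*A (0, y)+d*B (0, y)) t x+duhamel (%p. c * S p+d * R p) t x" by (simp add: algebra_simps)
qed

lemma mild_pair_blk:
 assumes g: "0 <= \<gamma>" "\<gamma> < real DIM('a)"
  and K: "0 <= K" and L: "0 <= \<Lambda>" and J: "J = 0 \<or> 2 <= J" and a: "1-\<gamma>/2 <= a"
 shows "mild_pair (%p::real\<times>'a::euclidean_space. blk \<Lambda> K a J (fst p) ((norm (snd p))\<^sup>2))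
  (%p. blk_source (real DIM('a)) \<Lambda> K a J (fst p) ((norm (snd p))\<^sup>2))"
proof -
 have m: "(%p::real\<times>'a. blk \<Lambda> K a J (fst p) ((norm (snd p))\<^sup>2))\<in>borel_measurable borel"
  using borel_radial[OF borel_blk[of \<Lambda> K a J], where 'a = 'a and \<epsilon> = 0] by simp
 have "integrable lborel (%y::'a. heat_kernel t (x-y)*blk \<Lambda> K a J 0 ((norm y)\<^sup>2))" if tx: "0 < t" "x ~= 0" for t x
 proof -
  have J0: "0 <= J" "- (\<gamma>/2) <= a" using J a by auto
  obtain C where C: "0 <= C" "!!s \<sigma>. 0 <= s ==> s <= t ==> 0 < \<sigma> ==> blk \<Lambda> K a J s \<sigma> <= C*(\<sigma> powr - (\<gamma>/2)*exp (sqrt \<sigma>/2))"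
   using blk_bound[OF K L J0 tx(1)] by metis
  have b: "blk \<Lambda> K a J 0 ((norm y)\<^sup>2) <= C * sing_weight \<gamma> y" for y :: 'a
  proof (cases "y = 0")
   case False
   then have "blk \<Lambda> K a J 0 ((norm y)\<^sup>2) <= C*(((norm y)\<^sup>2) powr - (\<gamma>/2)*exp (norm y/2))"
    using C(2)[of 0 "(norm y)\<^sup>2"] tx by simp
   also have "((norm y)\<^sup>2) powr - (\<gamma>/2) = norm y powr - \<gamma>" using False by (simp add: powr_powr flip: powr_numeral)
   also have "C*(norm y powr - \<gamma>*exp (norm y/2)) <= C*(norm y powr - \<gamma>*exp (norm y))" using C(1) by (intro mult_left_mono) auto
   finally show ?thesis by (simp add: sing_weight_def)
  qed (simp add: blk_def sing_weight_def)
  have mb: "(%y::'a. blk \<Lambda> K a J 0 ((norm y)\<^sup>2))\<in>borel_measurable borel" using borel_slice[OF m, of 0] by simp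
  have mh: "(%y::'a. heat_kernel t (x-y))\<in>borel_measurable borel" by measurable
  show ?thesis
  proof (rule Bochner_Integration.integrable_bound[OF integrable_mult_right[OF integrable_heat_kernel_sing_weight[OF g tx(2,1)], of C]])
   show "AE y in lborel. norm (heat_kernel t (x-y)*blk \<Lambda> K a J 0 ((norm y)\<^sup>2)) <= norm (C*(heat_kernel t (x-y) * sing_weight \<gamma> y))"
   proof (rule AE_I2)
    fix y :: 'a
    have "heat_kernel t (x-y)*blk \<Lambda> K a J 0 ((norm y)\<^sup>2) <= heat_kernel t (x-y)*(C * sing_weight \<gamma> y)"
     using tx by (intro mult_left_mono b heat_kernel_nonneg) simp
    then show "norm (heat_kernel t (x-y)*blk \<Lambda> K a J 0 ((norm y)\<^sup>2)) <= norm (C*(heat_kernel t (x-y) * sing_weight \<gamma> y))"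
     using tx C(1) by (simp add: abs_mult mult_ac)
   qed
  qed (use borel_measurable_times[OF mh mb] in simp)
 qed
 then show ?thesis unfolding mild_pair_def using m borel_blk_source[where 'a = 'a] block_mild[OF _ _ g K L J a] by auto
qed

context singular_profile
begin

lemma U_of_bound:
 obtains C where "0 <= C" "!!t x::'a::euclidean_space. 0 < t ==> x ~= 0 ==> abs (U_of \<alpha> f t x) <= C*norm x powr - \<kappa>"
proof -
 obtain D s where D: "0 <= D" "0 < s" "!!r. 0 < r ==> r powr \<kappa>*abs (f r) <= L+D*min 1 (r powr s)" using profile_bound by blast
 show thesis
 proof (rule that[of "L+D"])
  show "0 <= L+D" using L_pos D by simp
  fix t :: real and x :: 'a assume tx: "0 < t" "x ~= 0"
  define r where "r = norm x / sqrt t"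
  have "norm x powr \<kappa>*abs (U_of \<alpha> f t x) = r powr \<kappa>*abs (f r)" unfolding U_of_def r_def using tx by (intro U_of_rescaled) auto
  also have "... <= L+D*min 1 (r powr s)" using tx by (intro D(3)) (auto simp: r_def)
  also have "... <= L+D" using D(1) by (simp add: mult_left_le)
  finally show "abs (U_of \<alpha> f t x) <= (L+D)*norm x powr - \<kappa>" using tx by (simp add: powr_minus field_simps)
 qed
qed

text \<open>
 Extension by zero makes the self-similar function Borel measurable on the whole space.
\<close>

definition selfsim :: "real\<times>'a::euclidean_space => real" where
 "selfsim p = (if 0 < fst p \<and> snd p ~= 0 then U_of \<alpha> f (fst p) (snd p) else 0)"

definition excess :: "real\<times>'a::euclidean_space => real => real" where
 "excess p w = nonlin \<alpha> (selfsim p+w)-nonlin \<alpha> (selfsim p)"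

lemma continuous_U_of:
 "continuous_on ({0<..}\<times>- {0}) (%p. U_of \<alpha> f (fst p) (snd p :: 'a::euclidean_space))"
proof -
 have "continuous_on ({0<..}\<times>- {0}) (%p::real\<times>'a. f (norm (snd p) / sqrt (fst p)))"
  by (rule continuous_on_compose2[OF continuous_f]) (auto intro!: continuous_intros divide_pos_pos)
 then show ?thesis unfolding U_of_def by (intro continuous_intros) auto
qed

lemma borel_selfsim [measurable]: "selfsim\<in>borel_measurable (borel :: (real\<times>'a::euclidean_space) measure)"
proof -
 have o: "open ({0::real<..}\<times>- {0::'a})" by (intro open_Times) auto
 have "(%p::real\<times>'a. if p\<in>{0<..}\<times>- {0} then U_of \<alpha> f (fst p) (snd p) else 0)\<in>borel_measurable borel"
  using o by (intro borel_measurable_continuous_on_if continuous_U_of) auto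
 moreover have "(%p::real\<times>'a. if p\<in>{0<..}\<times>- {0} then U_of \<alpha> f (fst p) (snd p) else 0) = selfsim"
  by (auto simp: selfsim_def fun_eq_iff)
 ultimately show ?thesis by simp
qed

lemma excess_bound: "abs w <= W ==> abs (excess p w) <= (\<alpha>+1)*(abs (selfsim p)+W) powr \<alpha>*W"
 unfolding excess_def using alpha_pos by (rule nonlin_diff_bound)

text \<open>
 The constants are fixed in this order: the inner barrier from the initial bound, then the radius \<open>\<surd>\<xi>\<close> up to which it
 stays below \<open>|x|\<^bsup>-\<eta>\<^esup>\<close>, then the height of the outer barrier, then \<open>\<Lambda>\<close>, which beats the potential outside that
 radius, and finally the time \<open>T\<close>.
\<close>

lemma barriers:
 assumes dim: "DIM('a::euclidean_space) = N" and \<delta>: "0 < \<delta>" and M: "0 <= M"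
 obtains T C and A SA B SB :: "real\<times>'a::euclidean_space => real" where
  "0 < T" "mild_pair A SA" "mild_pair B SB"
  "!!y. 0 <= A (0, y)" "!!y. \<delta> <= norm y ==> M <= A (0, y)" "!!y. y ~= 0 ==> M <= B (0, y)"
  "!!t x. 0 < t ==> t < T ==> x ~= 0 ==> 0 <= A (t, x)" "!!p. 0 <= B p"
  "!!t x. 0 <= t ==> t < T ==> B (t, x) <= C*(1+norm x powr - \<eta>)"
  "!!t x. 0 < t ==> t < T ==> x ~= 0 ==> SB (t, x) <= C*(1+norm x powr - (\<eta>+2))"
  "continuous_on ({0<..}\<times>- {0}) B"
  "!!t x w. 0 < t ==> t < T ==> x ~= 0 ==> abs w <= min (A (t, x)) (B (t, x)) ==>
    abs (excess (t, x) w) <= SA (t, x) \<and> abs (excess (t, x) w) <= SB (t, x)"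
proof -
 define a where "a = - \<eta>/2"
 define \<beta>1 where "\<beta>1 = \<beta>*(\<alpha>+1)"
 have \<beta>1: "0 < \<beta>1" unfolding \<beta>1_def using beta_pos alpha_pos by simp
 have poly: "4*a * (a-1)+2 * real N*a = - \<beta>1" unfolding \<beta>1_def eta_root[symmetric] a_def by (simp add: algebra_simps)
 obtain D s0 where D: "0 <= D" "0 < s0" "s0 <= 1" and
  pot: "!!t X W. 0 < t ==> t <= 1 ==> 0 < X ==> X <= 1 ==> 0 <= W ==> X powr \<eta>*W <= 1 ==>
   (\<alpha>+1)*(abs (t powr (- 1/\<alpha>)*f (X / sqrt t))+W) powr \<alpha> <=
    (\<beta>1+D*min 1 ((X\<^sup>2/t) powr (s0/2)))/X\<^sup>2" using potential_bound unfolding \<beta>1_def by metis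
 obtain K J b where K: "1 <= K" and J: "real N <= J" and b: "0 < b" "b <= 1" and
  mon: "!!\<Lambda> s \<sigma>. 0 < \<sigma> ==> 0 <= s ==> blk \<Lambda> K (a+b) (J-b) s \<sigma> <= blk \<Lambda> K a J s \<sigma>" and
  sup: "!!\<Lambda> s \<sigma>. 0 < \<sigma> ==> 0 < s ==>
    (\<Lambda>+(\<beta>1+D*min 1 ((\<sigma> / s) powr (s0/2)))/\<sigma>)*(blk \<Lambda> K a J s \<sigma>-1/2 * blk \<Lambda> K (a+b) (J-b) s \<sigma>)
    <= blk_source (real N) \<Lambda> K a J s \<sigma>-1/2 * blk_source (real N) \<Lambda> K (a+b) (J-b) s \<sigma>"
  using supersolution_exists[OF D] unfolding \<beta>1_def a_def by metis
 obtain C0 where C0: "0 <= C0" "!!t x::'a. 0 < t ==> x ~= 0 ==> abs (U_of \<alpha> f t x) <= C0*norm x powr - \<kappa>" using U_of_bound by blast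
 have J3: "3 <= J" using J N_ge_3 by linarith
 have "\<eta> < real N" using eta_plus_2 by linarith
 then have aJ: "0 <= a+J" unfolding a_def using J eta_pos by (simp add: field_simps)
 define A0 where "A0 = 2*M * \<delta> powr - (2*(a+J))"
 have A0: "0 <= A0" using M by (simp add: A0_def)
 define \<xi> where "\<xi> = 1/(2*(1+exp 1*A0))"
 have ez: "0 <= exp 1*A0" using A0 by simp
 have \<xi>: "0 < \<xi>" "2*\<xi> <= 1" "exp 1*A0*(2*\<xi>) <= 1" unfolding \<xi>_def using ez by (auto simp: divide_le_eq add_pos_nonneg)
 define MB where "MB = M+(\<beta>1+D)/\<beta>1"
 have MB: "M <= MB" "0 <= MB" "\<beta>1+D <= MB*\<beta>1" unfolding MB_def using \<beta>1 D M by (auto simp: field_simps)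
 define x1 where "x1 = sqrt \<xi>"
 have x1: "0 < x1" using \<xi> by (simp add: x1_def)
 define \<Lambda> where "\<Lambda> = (\<alpha>+1)*(C0*x1 powr - \<kappa>+MB*exp 1*(1+x1 powr - \<eta>)) powr \<alpha>"
 have \<Lambda>: "0 <= \<Lambda>" unfolding \<Lambda>_def using alpha_pos by simp
 define T where "T = min 1 (min (1/(\<Lambda>+1)) (\<xi>/K))"
 have T: "0 < T" unfolding T_def using \<Lambda> \<xi> K by simp
 have tT: "t <= 1" "\<Lambda>*t <= 1" "K*t <= \<xi>" if "0 <= t" "t < T" for t
 proof -
  have "t < 1/(\<Lambda>+1)" "t < \<xi>/K" using that unfolding T_def by auto
  then have "t*(\<Lambda>+1) < 1" "t*K < \<xi>" using \<Lambda> K by (auto simp: less_divide_eq)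
  then show "\<Lambda>*t <= 1" "K*t <= \<xi>" using that by (auto simp: algebra_simps)
  show "t <= 1" using that unfolding T_def by simp
 qed
 define src where "src K a J p = blk_source (real DIM('a)) \<Lambda> K a J (fst p) ((norm (snd p :: 'a))\<^sup>2)" for K a J and p :: "real\<times>'a"
 define bl where "bl K a J p = blk \<Lambda> K a J (fst p) ((norm (snd p :: 'a))\<^sup>2)" for K a J and p :: "real\<times>'a"
 define A where "A p = A0*bl K a J p+(- A0/2)*bl K (a+b) (J-b) p" for p
 define SA where "SA p = A0 * src K a J p+(- A0/2) * src K (a+b) (J-b) p" for p
 define B where "B p = MB*bl 0 0 0 p+MB*bl 0 a 0 p" for p
 define SB where "SB p = MB * src 0 0 0 p+MB * src 0 a 0 p" for p
 have mp: "mild_pair (bl K' a' J') (src K' a' J')" if "0 <= K'" "J' = 0 \<or> 2 <= J'" "a <= a'" for K' a' J'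
  unfolding bl_def[abs_def] src_def[abs_def]
  using that eta_plus_2 eta_pos dim \<Lambda> by (intro mild_pair_blk[of "\<eta>+2"]) (auto simp: a_def add_divide_distrib)
 have mA: "mild_pair A SA" unfolding A_def[abs_def] SA_def[abs_def] using K J3 b by (intro mild_pair_combine mp) auto
 have mB: "mild_pair B SB" unfolding B_def[abs_def] SB_def[abs_def] using eta_pos by (intro mild_pair_combine mp) (auto simp: a_def)
 have npow: "((norm (x::'a))\<^sup>2) powr c = norm x powr (2 * c)" if "x ~= 0" for x c using that by (simp add: powr_powr flip: powr_numeral)
 have Bform: "B (t, x) = MB*exp (\<Lambda>*t)*(1+norm x powr - \<eta>)" if "x ~= 0" for t x
  unfolding B_def bl_def blk_def using that npow[OF that, of a] by (simp add: a_def algebra_simps)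
 have SBform: "SB (t, x) = MB*exp (\<Lambda>*t)*(\<Lambda>*(1+norm x powr - \<eta>)+\<beta>1*norm x powr - (\<eta>+2))" if "x ~= 0" for t x
 proof -
  have "2*(a-1) = - (\<eta>+2)" by (simp add: a_def)
  then have p2: "((norm x)\<^sup>2) powr (a-1) = norm x powr - (\<eta>+2)" using npow[OF that, of "a-1"] by simp
  have p1: "((norm x)\<^sup>2) powr a = norm x powr - \<eta>" using npow[OF that, of a] by (simp add: a_def)
  show ?thesis unfolding SB_def src_def blk_source_def dim poly blk_def fst_conv snd_conv p1 p2 using that by (simp add: algebra_simps)
 qed
 have etE: "1 <= exp (\<Lambda>*t)" "exp (\<Lambda>*t) <= exp 1" if "0 <= t" "t < T" for t using tT[OF that] \<Lambda> that by auto
 have B0: "0 <= B p" for p unfolding B_def bl_def using MB by simp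
 define C where "C = MB*exp 1*(1+2*\<Lambda>+\<beta>1)"
 have C1: "MB*exp 1 <= C" using mult_left_mono[of 1 "1+2*\<Lambda>+\<beta>1" "MB*exp 1"] MB \<Lambda> \<beta>1 unfolding C_def by simp
 have Bbd: "B (t, x) <= C*(1+norm x powr - \<eta>)" if "0 <= t" "t < T" for t x
 proof (cases "x = 0")
  case True
  have "0 <= C" using C1 MB by (smt (verit) exp_gt_zero mult_nonneg_nonneg)
  then show ?thesis unfolding True B_def bl_def blk_def by simp
 next
  case False
  have "MB*exp (\<Lambda>*t) <= MB*exp 1" using etE[OF that] MB by (intro mult_left_mono) auto
  then have "MB*exp (\<Lambda>*t) <= C" using C1 by (rule order_trans)
  then show ?thesis unfolding Bform[OF False] by (intro mult_right_mono) auto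
 qed
 have SBbd: "SB (t, x) <= C*(1+norm x powr - (\<eta>+2))" if t: "0 < t" "t < T" and x: "x ~= 0" for t x
 proof -
  define P where "P = norm x powr - (\<eta>+2)"
  have P: "0 <= P" by (simp add: P_def)
  have "norm x powr - \<eta> <= 1+P"
  proof (cases "norm x <= 1")
   case True
   then have "norm x powr - \<eta> <= P" unfolding P_def using x by (intro powr_mono') auto
   then show ?thesis by simp
  next
   case False
   then have "norm x powr - \<eta> <= norm x powr 0" using eta_pos by (intro powr_mono) auto
   then show ?thesis using P x by simp
  qed
  then have "\<Lambda>*(1+norm x powr - \<eta>)+\<beta>1*P <= \<Lambda>*(2+P)+\<beta>1*P" using \<Lambda> by (intro add_right_mono mult_left_mono) auto
  also have "... <= (1+2*\<Lambda>+\<beta>1)*(1+P)" using P \<Lambda> \<beta>1 by (simp add: algebra_simps add_nonneg_nonneg)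
  finally have *: "\<Lambda>*(1+norm x powr - \<eta>)+\<beta>1*P <= (1+2*\<Lambda>+\<beta>1)*(1+P)" .
  have "0 <= \<Lambda>*(1+norm x powr - \<eta>)+\<beta>1*P" using \<Lambda> \<beta>1 P by simp
  then have "MB*exp (\<Lambda>*t)*(\<Lambda>*(1+norm x powr - \<eta>)+\<beta>1*P) <= MB*exp 1*((1+2*\<Lambda>+\<beta>1)*(1+P))"
   using*etE[of t] t MB by (intro mult_mono mult_left_mono) auto
  then show ?thesis unfolding SBform[OF x] C_def P_def by (simp add: mult.assoc)
 qed
 have cB: "continuous_on ({0<..}\<times>- {0}) B"
 proof (rule continuous_on_eq)
  show "continuous_on ({0<..}\<times>- {0}) (%p::real\<times>'a. MB*exp (\<Lambda>*fst p)*(1+norm (snd p) powr - \<eta>))"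
   by (intro continuous_intros) auto
  fix p :: "real\<times>'a" assume "p\<in>{0<..}\<times>- {0}"
  then have "snd p ~= 0" by auto
  then show "MB*exp (\<Lambda>*fst p)*(1+norm (snd p) powr - \<eta>) = B p" using Bform[of "snd p" "fst p"] by simp
 qed
 have Apos: "0 <= A (t, x)" and Ale: "A (t, x) <= A0*bl K a J (t, x)" and
  sub: "(\<Lambda>+(\<beta>1+D*min 1 (((norm x)\<^sup>2/t) powr (s0/2)))/(norm x)\<^sup>2)*A (t, x) <= SA (t, x)"
  if t: "0 < t" and x: "x ~= 0" for t x
 proof -
  have nx: "0 < (norm x)\<^sup>2" using x by simp
  define F where "F = bl K a J (t, x)-1/2 * bl K (a+b) (J-b) (t, x)"
  have AF: "A (t, x) = A0*F" unfolding A_def F_def by (simp add: algebra_simps)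
  have bn: "0 <= bl K a J (t, x)" "0 <= bl K (a+b) (J-b) (t, x)" by (auto simp: bl_def)
  have "bl K (a+b) (J-b) (t, x) <= bl K a J (t, x)" unfolding bl_def using mon[OF nx, of t] t by simp
  then have F: "0 <= F" "F <= bl K a J (t, x)" unfolding F_def using bn by auto
  show "0 <= A (t, x)" "A (t, x) <= A0*bl K a J (t, x)" unfolding AF using F A0 by (auto intro: mult_left_mono)
  have "A0*((\<Lambda>+(\<beta>1+D*min 1 (((norm x)\<^sup>2/t) powr (s0/2)))/(norm x)\<^sup>2)*F) <= A0*(src K a J (t, x)-1/2 * src K (a+b) (J-b) (t, x))"
   unfolding F_def bl_def src_def dim fst_conv snd_conv by (intro mult_left_mono sup[OF nx t] A0)
  then show "(\<Lambda>+(\<beta>1+D*min 1 (((norm x)\<^sup>2/t) powr (s0/2)))/(norm x)\<^sup>2)*A (t, x) <= SA (t, x)"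
   unfolding AF SA_def by (simp add: algebra_simps)
 qed
 have A00: "A (0, y) = A0/2 * ((norm y)\<^sup>2) powr (a+J)" for y unfolding A_def bl_def blk_def by (simp flip: powr_add)
 show thesis
 proof (rule that[OF T mA mB _ _ _ Apos B0 Bbd SBbd cB])
  show "0 <= A (0, y)" for y unfolding A00 using A0 by simp
  show "M <= B (0, y)" if "y ~= 0" for y
  proof -
   have "M*1 <= MB*(1+norm y powr - \<eta>)" using MB M by (intro mult_mono) auto
   then show ?thesis unfolding Bform[OF that] by simp
  qed
  show "M <= A (0, y)" if "\<delta> <= norm y" for y
  proof -
   have y: "y ~= 0" using that \<delta> by auto
   have "\<delta> powr (2*(a+J)) <= norm y powr (2*(a+J))" using that \<delta> aJ by (intro powr_mono2) auto
   then have "1 <= \<delta> powr - (2*(a+J))*norm y powr (2*(a+J))" using \<delta> unfolding powr_minus by (simp add: field_simps)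
   then have "M*1 <= M*(\<delta> powr - (2*(a+J))*norm y powr (2*(a+J)))" using M by (rule mult_left_mono)
   then show ?thesis unfolding A00 A0_def npow[OF y] by simp
  qed
  fix t x w assume t: "0 < t" "t < T" and x: "x ~= 0" and w: "abs w <= min (A (t, x)) (B (t, x))"
  define W where "W = min (A (t, x)) (B (t, x))"
  define X where "X = norm x"
  have X: "0 < X" using x by (simp add: X_def)
  have W: "0 <= W" "W <= A (t, x)" "W <= B (t, x)" unfolding W_def using Apos[OF t(1) x] B0 by auto
  have ss: "selfsim (t, x) = t powr (- 1/\<alpha>)*f (X / sqrt t)" unfolding selfsim_def U_of_def X_def using t x by simp
  have ex: "abs (excess (t, x) w) <= (\<alpha>+1)*(abs (selfsim (t, x))+W) powr \<alpha>*W" using w unfolding W_def by (rule excess_bound)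
  define V where "V = (\<beta>1+D*min 1 ((X\<^sup>2/t) powr (s0/2)))/X\<^sup>2"
  have m01: "0 <= min 1 ((X\<^sup>2/t) powr (s0/2))" "min 1 ((X\<^sup>2/t) powr (s0/2)) <= 1" by auto
  have V: "0 <= V" "V <= (\<beta>1+D)/X\<^sup>2" unfolding V_def using m01 D \<beta>1
   by (auto intro!: divide_nonneg_nonneg divide_right_mono add_nonneg_nonneg mult_nonneg_nonneg simp: mult_left_le)
  have subV: "(\<Lambda>+V)*A (t, x) <= SA (t, x)" using sub[OF t(1) x] unfolding V_def X_def .
  have t1: "0 <= t" using t by simp
  show "abs (excess (t, x) w) <= SA (t, x) \<and> abs (excess (t, x) w) <= SB (t, x)"
  proof (cases "X\<^sup>2 <= \<xi>")
   case True
   have "X\<^sup>2 <= 1\<^sup>2" using True \<xi> by simp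
   then have X1: "X <= 1" by (rule power2_le_imp_le) simp
   have "X powr \<eta>*A (t, x) <= 1"
   proof -
    have E0: "0 <= X\<^sup>2+K*t" "X\<^sup>2+K*t <= 2*\<xi>" using True tT[OF t1 t(2)] K t by auto
    have "(X\<^sup>2+K*t) powr J <= (2*\<xi>) powr J" using E0 J3 by (intro powr_mono2) auto
    also have "... <= (2*\<xi>) powr 1" using \<xi> J3 by (intro powr_mono') auto
    finally have pJ: "(X\<^sup>2+K*t) powr J <= 2*\<xi>" using \<xi> by simp
    have "X powr \<eta>*A (t, x) <= X powr \<eta>*(A0*bl K a J (t, x))" using Ale[OF t(1) x] by (intro mult_left_mono) auto
    also have "... = A0*exp (\<Lambda>*t)*(X\<^sup>2+K*t) powr J"
    proof -
     have "X powr \<eta>*(X\<^sup>2) powr a = 1" unfolding X_def npow[OF x] a_def using x by (simp flip: powr_add)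
     then show ?thesis unfolding bl_def blk_def X_def by (simp add: mult_ac)
    qed
    also have "... <= A0*exp 1*(2*\<xi>)" using A0 etE[OF t1 t(2)] pJ by (intro mult_mono mult_left_mono) auto
    also have "... <= 1" using \<xi>(3) by (simp add: mult_ac)
    finally show ?thesis .
   qed
   then have W\<eta>: "X powr \<eta>*W <= 1" using mult_left_mono[OF W(2), of "X powr \<eta>"] by simp
   have "(\<alpha>+1)*(abs (selfsim (t, x))+W) powr \<alpha> <= V" unfolding ss V_def using t tT[OF t1 t(2)] X X1 W W\<eta> by (intro pot) auto
   then have "(\<alpha>+1)*(abs (selfsim (t, x))+W) powr \<alpha>*W <= V*W" using W by (intro mult_right_mono)
   with ex have exV: "abs (excess (t, x) w) <= V*W" by (rule order_trans)
   have "V*W <= V*A (t, x)" using V W by (intro mult_left_mono) auto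
   also have "... <= (\<Lambda>+V)*A (t, x)" using \<Lambda> Apos[OF t(1) x] by (intro mult_right_mono) auto
   also have "... <= SA (t, x)" by (rule subV)
   finally have 1: "abs (excess (t, x) w) <= SA (t, x)" using exV by simp
   have "W <= X powr - \<eta>" using W\<eta> X by (simp add: powr_minus field_simps)
   then have "V*W <= (\<beta>1+D)/X\<^sup>2*X powr - \<eta>" using V W \<beta>1 D by (intro mult_mono) auto
   also have "... = (\<beta>1+D)*X powr - (\<eta>+2)"
   proof -
    have "X powr (- \<eta>-2) = X powr - \<eta>/X powr 2" by (rule powr_diff)
    moreover have "- (\<eta>+2) = - \<eta>-2" by simp
    ultimately show ?thesis using X by (simp add: powr_numeral)
   qed
   also have "... <= (MB*\<beta>1)*X powr - (\<eta>+2)" using MB by (intro mult_right_mono) auto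
   also have "... <= exp (\<Lambda>*t)*((MB*\<beta>1)*X powr - (\<eta>+2))"
    using mult_right_mono[OF etE(1)[OF t1 t(2)], of "(MB*\<beta>1)*X powr - (\<eta>+2)"] MB \<beta>1 by simp
   also have "... <= SB (t, x)" unfolding SBform[OF x] X_def using MB \<Lambda> by (simp add: algebra_simps)
   finally show ?thesis using 1 exV by simp
  next
   case False
   have xX: "x1 <= X" unfolding x1_def using False X by (intro real_le_lsqrt) auto
   have "abs (selfsim (t, x)) <= C0*X powr - \<kappa>" unfolding selfsim_def X_def using C0(2)[OF t(1) x] t x by simp
   also have "... <= C0*x1 powr - \<kappa>" using C0 x1 xX kappa_pos by (intro mult_left_mono powr_mono2') auto
   finally have s1: "abs (selfsim (t, x)) <= C0*x1 powr - \<kappa>" .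
   have "X powr - \<eta> <= x1 powr - \<eta>" using x1 xX eta_pos by (intro powr_mono2') auto
   then have "B (t, x) <= MB*exp 1*(1+x1 powr - \<eta>)"
    unfolding Bform[OF x] X_def[symmetric] using MB etE[OF t1 t(2)] by (intro mult_mono mult_left_mono) auto
   then have "(abs (selfsim (t, x))+W) powr \<alpha> <= (C0*x1 powr - \<kappa>+MB*exp 1*(1+x1 powr - \<eta>)) powr \<alpha>"
    using s1 W alpha_pos by (intro powr_mono2 add_mono) auto
   then have "(\<alpha>+1)*(abs (selfsim (t, x))+W) powr \<alpha> <= \<Lambda>" unfolding \<Lambda>_def using alpha_pos by (intro mult_left_mono) auto
   then have "(\<alpha>+1)*(abs (selfsim (t, x))+W) powr \<alpha>*W <= \<Lambda>*W" using W by (intro mult_right_mono)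
   with ex have ex\<Lambda>: "abs (excess (t, x) w) <= \<Lambda>*W" by (rule order_trans)
   have "\<Lambda>*W <= \<Lambda>*A (t, x)" using \<Lambda> W by (intro mult_left_mono) auto
   also have "... <= (\<Lambda>+V)*A (t, x)" using V Apos[OF t(1) x] by (intro mult_right_mono) auto
   also have "... <= SA (t, x)" by (rule subV)
   finally have 1: "abs (excess (t, x) w) <= SA (t, x)" using ex\<Lambda> by simp
   have "\<Lambda>*W <= \<Lambda>*B (t, x)" using \<Lambda> W by (intro mult_left_mono) auto
   also have "... <= SB (t, x)" unfolding Bform[OF x] SBform[OF x] using MB \<beta>1 by (simp add: algebra_simps)
   finally show ?thesis using 1 ex\<Lambda> by simp
  qed
 qed auto
qed

lemma perturbation:
 fixes v :: "'a::euclidean_space => real"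
 assumes dim: "DIM('a) = N" and v: "v\<in>borel_measurable borel" "!!y. abs (v y) <= M"
  and \<delta>: "0 < \<delta>" "!!y. norm y < \<delta> ==> v y = 0"
 obtains T C w where "0 < T" "w\<in>borel_measurable borel"
  "!!t x. 0 < t ==> t < T ==> x ~= 0 ==> abs (w (t, x)) <= C*(1+norm x powr - \<eta>)"
  "continuous_on ({0<..<T}\<times>- {0}) w"
  "!!\<phi>. test_function ({0<..<T}\<times>UNIV) \<phi> ==>
    (LINT p|lborel. w p*adjoint_heat \<phi> p) =
    (LINT p|lborel. excess p (w p)*\<phi> p)"
  "!!K X. compact K ==> (!!i. 0 < X i) ==> (!!i. X i < T) ==> X \<longlonglongrightarrow> 0 ==>
    (%i. LINT x|lborel. indicator K x*abs (w (X i, x)-v x)) \<longlonglongrightarrow> 0"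
proof -
 have M: "0 <= M" using order_trans[OF abs_ge_zero v(2)] .
 obtain T C and A SA B SB :: "real\<times>'a => real" where T: "0 < T" and mA: "mild_pair A SA" and mB: "mild_pair B SB"
  and A0: "!!y. 0 <= A (0, y)" "!!y. \<delta> <= norm y ==> M <= A (0, y)" and B0: "!!y. y ~= 0 ==> M <= B (0, y)"
  and Apos: "!!t x. 0 < t ==> t < T ==> x ~= 0 ==> 0 <= A (t, x)" and Bpos: "!!p. 0 <= B p"
  and Bbd: "!!t x. 0 <= t ==> t < T ==> B (t, x) <= C*(1+norm x powr - \<eta>)"
  and SBbd: "!!t x. 0 < t ==> t < T ==> x ~= 0 ==> SB (t, x) <= C*(1+norm x powr - (\<eta>+2))"
  and cB: "continuous_on ({0<..}\<times>- {0}) B"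
  and exc: "!!t x w. 0 < t ==> t < T ==> x ~= 0 ==> abs w <= min (A (t, x)) (B (t, x)) ==>
    abs (excess (t, x) w) <= SA (t, x) \<and> abs (excess (t, x) w) <= SB (t, x)" by (rule barriers[OF dim \<delta>(1) M]) (rule that; assumption)
 have g: "0 <= \<eta>" "\<eta> < real DIM('a)" "0 <= \<eta>+2" "\<eta>+2 < real DIM('a)" using eta_pos eta_plus_2 dim by auto
 note mp = mA[unfolded mild_pair_def] mB[unfolded mild_pair_def]
 have exm: "(%p. excess p (w p))\<in>borel_measurable borel" if "w\<in>borel_measurable borel" for w :: "real\<times>'a => real"
  unfolding excess_def by (intro borel_measurable_diff measurable_compose[OF _ borel_nonlin] borel_measurable_add borel_selfsim that)
 \<comment> \<open>the heat flow of the initial value is dominated by that of either barrier\<close>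
 have hf: "abs (heat_flow v t x) <= heat_flow (%y. E (0, y)) t x"
  if E: "integrable lborel (%y. heat_kernel t (x-y)*E (0, y))" "!!y. y ~= 0 ==> abs (v y) <= E (0, y)" and t: "0 < t" for E t x
 proof -
  have ae: "AE y in lborel. abs (heat_kernel t (x-y) * v y) <= heat_kernel t (x-y)*E (0, y)" using AE_lborel_singleton[of "0::'a"]
  proof eventually_elim
   case (elim y)
   then show ?case using mult_left_mono[OF E(2) heat_kernel_nonneg[of t "x-y"]] t by (simp add: abs_mult)
  qed
  have "(%y. heat_kernel t (x-y))\<in>borel_measurable borel" by measurable
  from borel_measurable_times[OF this v(1)]
  have i: "integrable lborel (%y. heat_kernel t (x-y) * v y)"
   by (intro Bochner_Integration.integrable_bound[OF E(1)]) (use ae in \<open>auto elim!: eventually_mono\<close>)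
  have "abs (heat_flow v t x) <= (LINT y|lborel. abs (heat_kernel t (x-y) * v y))" unfolding heat_flow_def by (rule integral_abs_bound)
  also have "... <= heat_flow (%y. E (0, y)) t x" unfolding heat_flow_def using i E(1) ae by (intro integral_mono_AE) auto
  finally show ?thesis .
 qed
 have hA: "abs (heat_flow v t x) <= heat_flow (%y. A (0, y)) t x" if "0 < t" "x ~= 0" for t x
 proof (rule hf)
  show "abs (v y) <= A (0, y)" for y
  proof (cases "norm y < \<delta>")
   case False
   then show ?thesis using A0(2)[of y] v(2)[of y] by linarith
  qed (use \<delta>(2) A0(1) in simp)
 qed (use mp that in auto)
 have hB: "abs (heat_flow v t x) <= heat_flow (%y. B (0, y)) t x" if "0 < t" "x ~= 0" for t x
 proof (rule hf)
  show "abs (v y) <= B (0, y)" if "y ~= 0" for y using order_trans[OF v(2) B0[OF that]] .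
 qed (use mp that in auto)
 define W where "W p = min (A p) (B p)" for p
 have aeE: "AE p in lborel. 0 < fst p --> fst p < t --> abs (excess p (w p)) <= SA p"
    "AE p in lborel. 0 < fst p --> fst p < t --> abs (excess p (w p)) <= SB p"
  if "t <= T" "!!p. 0 < fst p ==> fst p < T ==> snd p ~= 0 ==> abs (w p) <= W p" for w :: "real\<times>'a => real" and t
 proof -
  have "AE p in lborel. 0 < fst p --> fst p < t --> abs (excess p (w p)) <= SA p \<and> abs (excess p (w p)) <= SB p" using AE_snd_nonzero
  proof eventually_elim
   case (elim p)
   then show ?case using exc[of "fst p" "snd p" "w p"] that(2)[of p] that(1) by (auto simp: W_def)
  qed
  then show "AE p in lborel. 0 < fst p --> fst p < t --> abs (excess p (w p)) <= SA p"
    "AE p in lborel. 0 < fst p --> fst p < t --> abs (excess p (w p)) <= SB p" by (auto elim!: eventually_mono)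
 qed
 have cts: "continuous_on UNIV (excess p)" for p :: "real\<times>'a" unfolding excess_def[abs_def] using alpha_pos
  by (intro continuous_on_diff continuous_on_const continuous_on_compose2[OF continuous_nonlin]) (auto intro!: continuous_intros)
 have mon: "excess p a <= excess p b" if "a <= b" for p :: "real\<times>'a" and a b
  unfolding excess_def using that alpha_pos nonlin_mono[of \<alpha> "selfsim p+a" "selfsim p+b"] by simp
 obtain w where wm: "w\<in>borel_measurable borel" and wW: "!!p. 0 < fst p ==> fst p < T ==> snd p ~= 0 ==> abs (w p) <= W p"
  and w: "!!t x. 0 < t ==> t < T ==> x ~= 0 ==> w (t, x) = heat_flow v t x+duhamel (%p. excess p (w p)) t x"
 proof (rule monotone_fixed_point[of v excess W T SB])
  show "W\<in>borel_measurable borel" unfolding W_def[abs_def] using mp by (intro borel_measurable_min) auto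
  show "integrable lborel (%p. duhamel_kernel t x p * SB p)" if "0 < t" "t < T" "x ~= 0" for t x using mp that by auto
  show "abs (excess p w) <= SB p" if "0 < fst p" "fst p < T" "snd p ~= 0" "abs w <= W p" for p w
   using exc[of "fst p" "snd p" w] that by (auto simp: W_def)
  show "0 <= W p" if "0 < fst p" "fst p < T" "snd p ~= 0" for p using Apos[of "fst p" "snd p"] Bpos[of p] that by (auto simp: W_def)
  fix w and t :: real and x :: 'a
  assume wm: "w\<in>borel_measurable borel" and wW: "!!p. 0 < fst p ==> fst p < T ==> snd p ~= 0 ==> abs (w p) <= W p"
   and t: "0 < t" "t < T" and x: "x ~= 0"
  have "abs (duhamel (%p. excess p (w p)) t x) <= duhamel SA t x" "abs (duhamel (%p. excess p (w p)) t x) <= duhamel SB t x"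
   using mp t x aeE[of t w] wW by (auto intro!: duhamel_bound(2) exm wm)
  moreover have "A (t, x) = heat_flow (%y. A (0, y)) t x+duhamel SA t x" "B (t, x) = heat_flow (%y. B (0, y)) t x+duhamel SB t x" using mp t x by auto
  ultimately show "abs (heat_flow v t x+duhamel (%p. excess p (w p)) t x) <= W (t, x)" using hA[OF t(1) x] hB[OF t(1) x] unfolding W_def by linarith
 qed (use v exm mon cts in auto)
 define h where "h p = excess p (w p)" for p
 have hm: "h\<in>borel_measurable borel" unfolding h_def[abs_def] by (rule exm[OF wm])
 have aeh: "AE p in lborel. 0 < fst p --> fst p < t --> abs (h p) <= SB p" if "t <= T" for t unfolding h_def using aeE(2)[OF that wW] .
 have ha: "integrable lborel (%p. duhamel_kernel t x p*abs (h p))" "abs (duhamel (%p. abs (h p)) t x) <= duhamel SB t x"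
   "abs (duhamel h t x) <= duhamel SB t x" "duhamel SB t x <= B (t, x)"
  if t: "0 < t" "t < T" and x: "x ~= 0" for t x
 proof -
  have i: "integrable lborel (%p. duhamel_kernel t x p * SB p)" using mp t x by auto
  have "AE p in lborel. 0 < fst p --> fst p < t --> abs ((abs (h p))) <= SB p" using aeh[of t] t by simp
  from duhamel_bound[OF borel_measurable_abs[OF hm] i this] duhamel_bound(2)[OF hm i aeh[of t]] t
  show "integrable lborel (%p. duhamel_kernel t x p*abs (h p))" "abs (duhamel (%p. abs (h p)) t x) <= duhamel SB t x"
   "abs (duhamel h t x) <= duhamel SB t x" by auto
  have "B (t, x) = heat_flow (%y. B (0, y)) t x+duhamel SB t x" using mp t x by auto
  then show "duhamel SB t x <= B (t, x)" using hB[OF t(1) x] by linarith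
 qed
 show thesis
 proof (rule that[OF T wm])
  show wb: "abs (w (t, x)) <= C*(1+norm x powr - \<eta>)" if "0 < t" "t < T" "x ~= 0" for t x
   using wW[of "(t, x)"] Bbd[of t x] that by (simp add: W_def)
  have D0: "{0<..<T}\<times>- {0} \<subseteq> {0<..}\<times>(UNIV :: 'a set)" by auto
  have bB: "abs (B (0, y)) <= C*(1+norm y powr - \<eta>)" for y using Bbd[of 0 y] Bpos[of "(0, y)"] T by simp
  have mB0: "(%y::'a. B (0, y))\<in>borel_measurable borel" using mp by (intro borel_slice) auto
  have "continuous_on ({0<..<T}\<times>- {0}) (%p. B p-heat_flow (%y. B (0, y)) (fst p) (snd p))"
   by (intro continuous_on_diff continuous_on_subset[OF cB] continuous_on_subset[OF continuous_heat_flow(1)[OF mB0 g(1,2) bB] D0]) auto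
  then have cS: "continuous_on ({0<..<T}\<times>- {0}) (%p. duhamel SB (fst p) (snd p))"
  proof (rule continuous_on_eq)
   fix p assume "p\<in>{0<..<T}\<times>- {0::'a}"
   then have "0 < fst p" "snd p ~= 0" by auto
   then have "B (fst p, snd p) = heat_flow (%y. B (0, y)) (fst p) (snd p)+duhamel SB (fst p) (snd p)" using mp by blast
   then show "B p-heat_flow (%y. B (0, y)) (fst p) (snd p) = duhamel SB (fst p) (snd p)" by simp
  qed
  have ch: "continuous_on ({0<..<T}\<times>- {0}) (%p. duhamel h (fst p) (snd p))"
   proof (rule continuous_duhamel[OF hm _ _ _ aeh[OF order_refl] cS])
   show "integrable lborel (%q. duhamel_kernel (fst p) (snd p) q * SB q)" if "p\<in>{0<..<T}\<times>- {0}" for p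
   proof -
    have "0 < fst p" "snd p ~= 0" using that by auto
    then show ?thesis using mp by blast
   qed
  qed (use mp in auto)
  have bv: "abs (v y) <= M*(1+norm y powr - 0)" for y
  proof -
   have "M*1 <= M*(1+norm y powr - 0)" using M by (intro mult_left_mono) auto
   then show ?thesis using v(2)[of y] by linarith
  qed
  have "continuous_on ({0<..<T}\<times>- {0}) (%p. heat_flow v (fst p) (snd p))"
   by (rule continuous_on_subset[OF continuous_heat_flow(1)[OF v(1) _ _ bv] D0]) auto
  from continuous_on_add[OF this ch] show "continuous_on ({0<..<T}\<times>- {0}) w"
  proof (rule continuous_on_eq)
   fix p assume "p\<in>{0<..<T}\<times>- {0::'a}"
   then have "0 < fst p" "fst p < T" "snd p ~= 0" by auto
   from w[OF this] show "heat_flow v (fst p) (snd p)+duhamel h (fst p) (snd p) = w p" unfolding h_def[abs_def] by simp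
  qed
  show "(LINT p|lborel. w p*adjoint_heat \<phi> p) =
    (LINT p|lborel. excess p (w p)*\<phi> p)" if tf: "test_function ({0<..<T}\<times>UNIV) \<phi>" for \<phi>
  proof -
   obtain K where K: "K \<subseteq> {0<..<T}\<times>UNIV"
    "!!p. p ~: K ==> test_dt \<phi> (fst p) (snd p) = 0" "!!p b. p ~: K ==> test_hess \<phi> b (fst p) (snd p) = 0"
    using test_function_support[OF tf] by metis
   define \<zeta> where "\<zeta> p = adjoint_heat \<phi> p" for p
   have \<zeta>m: "\<zeta>\<in>borel_measurable borel" using test_function_C12[OF tf] unfolding \<zeta>_def[abs_def] C12_with_def
    by (intro borel_measurable_continuous_onI continuous_intros) auto
   have "(LINT p|lborel. w p*\<zeta> p) = (LINT p|lborel. (heat_flow v (fst p) (snd p)+duhamel h (fst p) (snd p))*\<zeta> p)"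
   proof (rule integral_cong_AE)
    show "AE p in lborel. w p*\<zeta> p = (heat_flow v (fst p) (snd p)+duhamel h (fst p) (snd p))*\<zeta> p" using AE_snd_nonzero
    proof eventually_elim
     case (elim p)
     show ?case
     proof (cases "p\<in>K")
      case True
      then have "0 < fst p" "fst p < T" using K(1) by auto
      then show ?thesis using w[of "fst p" "snd p"] elim by (simp add: h_def[abs_def])
     qed (simp add: \<zeta>_def K)
    qed
   qed (use borel_measurable_times[OF wm \<zeta>m] borel_measurable_times[OF borel_measurable_add[OF borel_heat_flow[OF v(1)] borel_duhamel[OF hm]] \<zeta>m] in auto)
   also have "... = (LINT q|lborel. h q*\<phi> q)" unfolding \<zeta>_def
   proof (rule mild_weak[OF tf T v hm g(1,2) ha(1)])
    show "duhamel (%q. abs (h q)) t x <= C*(1+norm x powr - \<eta>)" if "0 < t" "t < T" "x ~= 0" for t x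
     using ha(2,4)[OF that] Bbd[of t x] that by linarith
   qed
   finally show ?thesis unfolding \<zeta>_def h_def .
  qed
  fix K :: "'a set" and X :: "nat => real"
  assume K: "compact K" and X: "!!i. 0 < X i" "!!i. X i < T" "X \<longlonglongrightarrow> 0"
  obtain R where "\<forall>x\<in>K. norm x <= R" using compact_imp_bounded[OF K] bounded_iff by blast
  then have R: "K \<subseteq> cball 0 R" by auto
  have Kb: "K\<in>sets borel" using K by (simp add: borel_compact)
  define d where "d i x = duhamel h (X i) x" for i x
  have dm: "d i\<in>borel_measurable borel" for i unfolding d_def using borel_slice[OF borel_duhamel[OF hm], of "X i"] by simp
  define H where "H x = abs C*(norm x powr - 0*indicator (cball 0 R) x+norm x powr - \<eta>*indicator (cball 0 R) x)" for x :: 'a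
  have iH: "integrable lborel H" unfolding H_def by (intro integrable_mult_right Bochner_Integration.integrable_add integrable_norm_powr_ball g) auto
  have db: "abs (indicator K x*d i x) <= H x" if "x ~= 0" for i x
  proof (cases "x\<in>K")
   case True
   have "abs (d i x) <= C*(1+norm x powr - \<eta>)" using ha(3,4)[OF X(1,2) that, of i] Bbd[of "X i" x] X(1,2)[of i] unfolding d_def by linarith
   also have "... <= abs C*(1+norm x powr - \<eta>)" by (intro mult_right_mono) auto
   finally show ?thesis using True R that unfolding H_def by auto
  qed (simp add: H_def)
  have d0: "(%i. indicator K x*abs (d i x)) \<longlonglongrightarrow> 0" if x: "x ~= 0" for x
  proof -
   obtain Q where Q: "0 <= Q"
    "!!s. 0 < s ==> s <= T ==> integrable lborel (%p. duhamel_kernel s x p * sing_weight 0 (snd p))"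
    "!!s. 0 < s ==> s <= T ==> (LINT p|lborel. duhamel_kernel s x p * sing_weight 0 (snd p)) <= Q * s"
    by (rule duhamel_sing_weight[of 0 x T]) (use x T in auto)
   obtain Q' where Q': "0 <= Q'"
    "!!s. 0 < s ==> s <= T ==> integrable lborel (%p. duhamel_kernel s x p * sing_weight (\<eta>+2) (snd p))"
    "!!s. 0 < s ==> s <= T ==> (LINT p|lborel. duhamel_kernel s x p * sing_weight (\<eta>+2) (snd p)) <= Q' * s"
    by (rule duhamel_sing_weight[OF g(3,4) x T]) auto
   define S where "S p = abs C*(sing_weight 0 (snd p) + sing_weight (\<eta>+2) (snd p))" for p :: "real\<times>'a"
   have dS: "abs (d i x) <= abs C*(Q+Q')*X i" for i
   proof -
    have e: "(%p. duhamel_kernel (X i) x p * S p) = (%p. abs C*(duhamel_kernel (X i) x p * sing_weight 0 (snd p)+duhamel_kernel (X i) x p * sing_weight (\<eta>+2) (snd p)))"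
     unfolding S_def by (auto simp: algebra_simps)
    have iS: "integrable lborel (%p. duhamel_kernel (X i) x p * S p)"
     unfolding e using Q(2) Q'(2) X(1,2)[of i] by (intro integrable_mult_right Bochner_Integration.integrable_add) auto
    have "AE p in lborel. 0 < fst p --> fst p < X i --> abs (h p) <= S p" using aeh[OF order_refl] AE_snd_nonzero
    proof eventually_elim
     case (elim p)
     show ?case
     proof (intro impI)
      assume p: "0 < fst p" "fst p < X i"
      then have pT: "fst p < T" using X(2)[of i] by linarith
      have "abs (h p) <= C*(1+norm (snd p) powr - (\<eta>+2))" using elim p pT SBbd[of "fst p" "snd p"] by simp
      also have "... <= abs C*(1+norm (snd p) powr - (\<eta>+2))" by (intro mult_right_mono) auto
      also have "... <= S p"
      proof -
       have "norm (snd p) powr - (\<eta>+2)*1 <= norm (snd p) powr - (\<eta>+2)*exp (norm (snd p))" by (intro mult_left_mono) auto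
       moreover have "1 <= norm (snd p) powr - 0*exp (norm (snd p))" using elim by simp
       ultimately have "1+norm (snd p) powr - (\<eta>+2) <= sing_weight 0 (snd p) + sing_weight (\<eta>+2) (snd p)"
        unfolding sing_weight_def by linarith
       then show ?thesis unfolding S_def by (intro mult_left_mono) auto
      qed
      finally show "abs (h p) <= S p" .
     qed
    qed
    then have "abs (d i x) <= duhamel S (X i) x" unfolding d_def by (rule duhamel_bound(2)[OF hm iS])
    also have "... <= abs C*(Q*X i+Q'*X i)" unfolding duhamel_def e
     using Q(2,3)[of "X i"] Q'(2,3)[of "X i"] X(1,2)[of i] by (auto intro!: mult_left_mono add_mono)
    finally show ?thesis by (simp add: algebra_simps)
   qed
   show ?thesis
   proof (rule Lim_null_comparison[OF always_eventually])
    show "(%i. abs C*(Q+Q')*X i) \<longlonglongrightarrow> 0" using tendsto_mult_left[OF X(3)] by simp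
    show "\<forall>i. norm (indicator K x*abs (d i x)) <= abs C*(Q+Q')*X i"
    proof
     fix i
     have "norm (indicator K x*abs (d i x)) <= abs (d i x)" by (simp add: indicator_def)
     then show "norm (indicator K x*abs (d i x)) <= abs C*(Q+Q')*X i" using dS[of i] by (rule order_trans)
    qed
   qed
  qed
  have nz: "AE x in lborel. x ~= (0::'a)" by (rule AE_lborel_singleton)
  have md: "(%x. indicator K x*abs (d i x))\<in>borel_measurable lborel" for i
   using borel_measurable_times[OF borel_measurable_indicator[OF Kb] borel_measurable_abs[OF dm[of i]]] by simp
  have "(%i. LINT x|lborel. indicator K x*abs (d i x)) \<longlonglongrightarrow> (LINT x::'a|lborel. 0)"
  proof (rule integral_dominated_convergence[OF _ md iH])
   show "AE x in lborel. (%i. indicator K x*abs (d i x)) \<longlonglongrightarrow> 0" using nz by eventually_elim (rule d0)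
   show "AE x in lborel. norm (indicator K x*abs (d i x)) <= H x" for i
    using nz by eventually_elim (use db[of _ i] in \<open>simp add: abs_mult\<close>)
  qed simp
  from tendsto_add[OF this heat_flow_tendsto_L1[OF v K X(1,3)]]
  have lim: "(%i. (LINT x|lborel. indicator K x*abs (d i x))+(LINT x|lborel. indicator K x*abs (heat_flow v (X i) x-v x))) \<longlonglongrightarrow> 0"
   by simp
  show "(%i. LINT x|lborel. indicator K x*abs (w (X i, x)-v x)) \<longlonglongrightarrow> 0"
  proof (rule Lim_null_comparison[OF always_eventually lim], intro allI)
   fix i
   have i1: "integrable lborel (%x. indicator K x*abs (d i x))"
   proof (rule Bochner_Integration.integrable_bound[OF iH md])
    show "AE x in lborel. norm (indicator K x*abs (d i x)) <= norm (H x)"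
     using nz by eventually_elim (use db[of _ i] in \<open>simp add: abs_mult H_def\<close>)
   qed
   have hfm: "(%x. heat_flow v (X i) x)\<in>borel_measurable borel" using borel_slice[OF borel_heat_flow[OF v(1)], of "X i"] by simp
   have i2: "integrable lborel (%x. indicator K x*abs (heat_flow v (X i) x-v x))"
   proof (rule integrable_bounded_compact[OF _ _ K, of _ "M+M"])
    show "(%x. abs (heat_flow v (X i) x-v x))\<in>borel_measurable borel" by (intro borel_measurable_abs borel_measurable_diff hfm v)
    show "abs ((abs (heat_flow v (X i) y-v y))) <= M+M" for y using heat_flow_bound(1)[OF v X(1)[of i], of y] v(2)[of y] by linarith
   qed
   have "norm (LINT x|lborel. indicator K x*abs (w (X i, x)-v x)) = (LINT x|lborel. indicator K x*abs (w (X i, x)-v x))"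
    by (simp add: abs_of_nonneg integral_nonneg_AE)
   also have "... <= (LINT x|lborel. indicator K x*abs (d i x)+indicator K x*abs (heat_flow v (X i) x-v x))"
   proof (rule integral_mono_AE')
    show "integrable lborel (%x. indicator K x*abs (d i x)+indicator K x*abs (heat_flow v (X i) x-v x))"
     using i1 i2 by (rule Bochner_Integration.integrable_add)
    show "AE x in lborel. indicator K x*abs (w (X i, x)-v x) <= indicator K x*abs (d i x)+indicator K x*abs (heat_flow v (X i) x-v x)" using nz
    proof eventually_elim
     case (elim x)
     have "w (X i, x) = heat_flow v (X i) x+d i x" unfolding d_def h_def[abs_def] using w[OF X(1,2) elim] .
     then have "abs (w (X i, x)-v x) <= abs (d i x)+abs (heat_flow v (X i) x-v x)" by linarith
     then show ?case by (simp add: indicator_def)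
    qed
    show "AE x in lborel. 0 <= indicator K x*abs (d i x)+indicator K x*abs (heat_flow v (X i) x-v x)" by (simp add: indicator_def)
   qed
   finally show "norm (LINT x|lborel. indicator K x*abs (w (X i, x)-v x)) <=
     (LINT x|lborel. indicator K x*abs (d i x))+(LINT x|lborel. indicator K x*abs (heat_flow v (X i) x-v x))" using i1 i2 by simp
  qed
 qed
qed

end

section \<open>The self-similar function as a distributional solution\<close>

lemma integral_derivative_compact_support:
 fixes G G' :: "'a::euclidean_space => real"
 assumes K: "compact K" "!!p. p ~: K ==> G p = 0" "!!p. p ~: K ==> G' p = 0"
  and c: "continuous_on UNIV G" "continuous_on UNIV G'" and b: "norm b <= 1"
  and D: "!!p. ((%s. G (p + s *\<^sub>R b)) has_real_derivative G' p) (at 0)"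
 shows "(LINT p|lborel. G' p) = 0"
proof -
 obtain R where R: "!!p. p\<in>K ==> norm p <= R" using compact_imp_bounded[OF K(1)] bounded_iff by metis
 obtain B where B: "0 <= B" "!!p. norm (G p) <= B" using continuous_compact_support_bounded[OF K(1,2) c(1)] by blast
 obtain B' where B': "0 <= B'" "!!p. norm (G' p) <= B'" using continuous_compact_support_bounded[OF K(1,3) c(2)] by blast
 have Gm: "G\<in>borel_measurable borel" using c(1) by (rule borel_measurable_continuous_onI)
 have "integrable lborel (%x. indicator K x*G x)" by (rule integrable_bounded_compact[OF Gm _ K(1), where M = B]) (use B(2) in simp)
 moreover have "(%x. indicator K x*G x) = G" using K(2) by (auto simp: indicator_def fun_eq_iff)
 ultimately have iG: "integrable lborel G" by simp
 have "integrable lborel (indicator (cball (0::'a) (R+1)) :: 'a => real)"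
  by (rule integrable_real_indicator) (use emeasure_lborel_cball_finite[of "0::'a" "R+1"] in auto)
 then have iH: "integrable lborel (%x. B'*indicator (cball (0::'a) (R+1)) x)" by (rule integrable_mult_right)
 show ?thesis
 proof (rule integral_directional_derivative(2)[OF iG D borel_measurable_continuous_onI[OF c(2)] iH])
  fix x and s :: real assume s: "abs s <= 1"
  show "abs (G' (x + s *\<^sub>R b)) <= B'*indicator (cball 0 (R+1)) x"
  proof (cases "x + s *\<^sub>R b\<in>K")
   case True
   have "norm (s *\<^sub>R b) <= 1*1" unfolding norm_scaleR using s b by (intro mult_mono) auto
   then have "norm x <= R+1" using R[OF True] norm_triangle_ineq4[of "x + s *\<^sub>R b" "s *\<^sub>R b"] by simp
   then show ?thesis using B'(2)[of "x + s *\<^sub>R b"] by simp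
  qed (use K(3) B'(1) in simp)
 qed
qed

lemma continuous_zero_extension:
 fixes a z :: "'a::euclidean_space => real"
 assumes "open \<Omega>" "closed K" "K \<subseteq> \<Omega>" "continuous_on \<Omega> a" "continuous_on UNIV z" "!!p. p ~: K ==> z p = 0"
 shows "continuous_on UNIV (%p. a p*z p)"
proof (rule continuous_on_open_cover)
 fix p
 show "\<exists>D. open D \<and> p\<in>D \<and> continuous_on D (%p. a p*z p)"
 proof (cases "p\<in>K")
  case True
  then show ?thesis using assms by (intro exI[of _ \<Omega>] conjI continuous_on_mult continuous_on_subset[OF assms(5)]) auto
 next
  case False
  have "continuous_on (- K) (%p. a p*z p)" by (rule continuous_on_eq[OF continuous_on_const[of _ 0]]) (use assms(6) in auto)
  then show ?thesis using assms(2) False by (intro exI[of _ "- K"]) auto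
 qed
qed

lemma test_function_continuous:
 assumes "test_function \<Omega> \<phi>" shows "continuous_on UNIV \<phi>" using test_function_differentiable(1)[OF assms]
 by (auto intro!: continuous_at_imp_continuous_on differentiable_imp_continuous_within)

text \<open>
 The test function supplies compact support, so the total derivatives of the products integrate to zero.
\<close>

lemma C12_weak:
 fixes \<phi> :: "real\<times>'a::euclidean_space => real"
 assumes C: "C12_with I \<psi> \<psi>t g H" and I: "open I" and tf: "test_function (I\<times>UNIV) \<phi>"
 shows "(LINT p|lborel. \<psi> (fst p) (snd p)*adjoint_heat \<phi> p) =
  (LINT p|lborel. (\<psi>t (fst p) (snd p)-(\<Sum>b\<in>Basis. H b (fst p) (snd p)))*\<phi> p)"
proof -
 obtain K where K: "compact K" "K \<subseteq> I\<times>UNIV" "!!p. p ~: K ==> \<phi> p = 0"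
  "!!p. p ~: K ==> test_dt \<phi> (fst p) (snd p) = 0"
  "!!p. p ~: K ==> test_grad \<phi> (fst p) (snd p) = 0"
  "!!p b. p ~: K ==> test_hess \<phi> b (fst p) (snd p) = 0" using test_function_support[OF tf] by blast
 have o: "open (I\<times>(UNIV::'a set))" using I by (intro open_Times) auto
 have cK: "closed K" using K(1) by (rule compact_imp_closed)
 note C' = C[unfolded C12_with_def] and T = test_function_C12[OF tf]
 note T' = T[unfolded C12_with_def]
 have c\<psi>: "continuous_on (I\<times>UNIV) (%p. \<psi> (fst p) (snd p))"
 proof (rule continuous_at_imp_continuous_on, rule ballI)
  fix p :: "real\<times>'a" assume "p\<in>I\<times>UNIV"
  then show "isCont (%p. \<psi> (fst p) (snd p)) p" using C' by (cases p) (auto intro!: has_derivative_continuous)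
 qed
 have c\<phi>: "continuous_on UNIV \<phi>" "continuous_on UNIV (%p. test_dt \<phi> (fst p) (snd p))"
   "continuous_on UNIV (%p. test_grad \<phi> (fst p) (snd p))"
   "!!b. b\<in>Basis ==> continuous_on UNIV (%p. test_hess \<phi> b (fst p) (snd p))" using T' test_function_continuous[OF tf] by auto
 have ext: "continuous_on UNIV (%p. a p*z p)" if "continuous_on (I\<times>UNIV) a" "continuous_on UNIV z" "!!p. p ~: K ==> z p = 0"
  for a z :: "real\<times>'a => real" by (rule continuous_zero_extension[OF o cK K(2) that])
 have gb: "continuous_on UNIV (%p. test_grad \<phi> (fst p) (snd p) \<bullet> b)" for b by (intro continuous_intros c\<phi>)
 have gb': "continuous_on (I\<times>UNIV) (%p. g (fst p) (snd p) \<bullet> b)" for b using C' by (intro continuous_intros) auto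
 have ii: "integrable lborel (%p. a p*z p)" if *: "continuous_on (I\<times>UNIV) a" "continuous_on UNIV z" "!!p. p ~: K ==> z p = 0"
  for a z :: "real\<times>'a => real"
 proof -
  note c = ext[OF *]
  have "a p*z p = 0" if "p ~: K" for p using *(3)[OF that] by simp
  from continuous_compact_support_bounded[OF K(1) this c] obtain B where "!!p. norm (a p*z p) <= B" by blast
  then have "integrable lborel (%x. indicator K x*(a x*z x))"
   by (intro integrable_bounded_compact[OF borel_measurable_continuous_onI[OF c] _ K(1)]) auto
  moreover have "(%x. indicator K x*(a x*z x)) = (%p. a p*z p)" using *(3) by (auto simp: indicator_def fun_eq_iff)
  ultimately show ?thesis by simp
 qed
 have zero: "((%s. G (p + s *\<^sub>R c)) has_real_derivative 0) (at 0)" if p: "p ~: K" and z: "!!q. q ~: K ==> G q = 0" for G and p c :: "real\<times>'a"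
 proof -
  have "((%s. p + s *\<^sub>R c) \<longlongrightarrow> p+0 *\<^sub>R c) (at 0)" by (intro tendsto_intros)
  then have "\<forall>\<^sub>F s in at 0. p + s *\<^sub>R c\<in>- K" by (rule topological_tendstoD) (use cK p in auto)
  then have ev: "\<forall>\<^sub>F s in nhds 0. G (p + s *\<^sub>R c) = 0" unfolding eventually_at_filter
  proof (rule eventually_mono)
   fix s :: real assume "s ~= 0 --> s\<in>UNIV --> p + s *\<^sub>R c\<in>- K"
   then show "G (p + s *\<^sub>R c) = 0" using z p by (cases "s = 0") auto
  qed
  show ?thesis by (subst DERIV_cong_ev[OF refl ev refl]) simp
 qed
 have t0: "(LINT p|lborel. \<psi>t (fst p) (snd p)*\<phi> p+\<psi> (fst p) (snd p)*test_dt \<phi> (fst p) (snd p)) = 0"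
 proof (rule integral_derivative_compact_support[where G = "%p. \<psi> (fst p) (snd p)*\<phi> p" and b = "(1, 0)", OF K(1)])
  fix p :: "real\<times>'a"
  show "((%s. \<psi> (fst (p + s *\<^sub>R (1, 0))) (snd (p + s *\<^sub>R (1, 0)))*\<phi> (p + s *\<^sub>R (1, 0))) has_real_derivative
    \<psi>t (fst p) (snd p)*\<phi> p+\<psi> (fst p) (snd p)*test_dt \<phi> (fst p) (snd p)) (at 0)"
  proof (cases "p\<in>K")
   case True
   obtain t x where p: "p = (t, x)" by (meson surj_pair)
   have t: "t\<in>I" using True K(2) p by auto
   have "((%r. \<psi> r x*\<phi> (r, x)) has_real_derivative \<psi>t t x*\<phi> (t, x)+test_dt \<phi> t x*\<psi> t x) (at t)"
    by (rule DERIV_mult[OF C12_line_derivs(1)[OF C t] C12_line_derivs(1)[OF T UNIV_I]])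
   then have "((%s. \<psi> (s+t) x*\<phi> (s+t, x)) has_real_derivative \<psi>t t x*\<phi> (t, x)+test_dt \<phi> t x*\<psi> t x) (at 0)"
    using DERIV_shift[of "%r. \<psi> r x*\<phi> (r, x)" _ 0 t] by simp
   then show ?thesis unfolding p by (simp add: ac_simps)
  qed (use zero[where p = p and G = "%p. \<psi> (fst p) (snd p)*\<phi> p" and c = "(1, 0)"] K in simp)
 qed (use K in \<open>auto intro!: continuous_on_add ext c\<psi> c\<phi> C'[THEN conjunct2, THEN conjunct2, THEN conjunct1]\<close>)
 have b0: "(LINT p|lborel. H b (fst p) (snd p)*\<phi> p-\<psi> (fst p) (snd p)*test_hess \<phi> b (fst p) (snd p)) = 0" if b: "b\<in>Basis" for b
 proof (rule integral_derivative_compact_support[where b = "(0, b)" and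
   G = "%p. (g (fst p) (snd p) \<bullet> b)*\<phi> p-\<psi> (fst p) (snd p)*(test_grad \<phi> (fst p) (snd p) \<bullet> b)", OF K(1)])
  have cH: "continuous_on (I\<times>UNIV) (%p. H b (fst p) (snd p))" using C' b by blast
  show "continuous_on UNIV (%p. H b (fst p) (snd p)*\<phi> p-\<psi> (fst p) (snd p)*test_hess \<phi> b (fst p) (snd p))"
   using K by (intro continuous_on_diff ext cH c\<psi> c\<phi> b) auto
  show "continuous_on UNIV (%p. (g (fst p) (snd p) \<bullet> b)*\<phi> p-\<psi> (fst p) (snd p)*(test_grad \<phi> (fst p) (snd p) \<bullet> b))"
   using K by (intro continuous_on_diff ext gb gb' c\<psi> c\<phi>) auto
  fix p :: "real\<times>'a"
  show "((%s. (g (fst (p + s *\<^sub>R (0, b))) (snd (p + s *\<^sub>R (0, b))) \<bullet> b)*\<phi> (p + s *\<^sub>R (0, b)) -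
    \<psi> (fst (p + s *\<^sub>R (0, b))) (snd (p + s *\<^sub>R (0, b)))*(test_grad \<phi> (fst (p + s *\<^sub>R (0, b))) (snd (p + s *\<^sub>R (0, b))) \<bullet> b))
    has_real_derivative H b (fst p) (snd p)*\<phi> p-\<psi> (fst p) (snd p)*test_hess \<phi> b (fst p) (snd p)) (at 0)"
  proof (cases "p\<in>K")
   case True
   obtain t x where p: "p = (t, x)" by (meson surj_pair)
   have t: "t\<in>I" using True K(2) p by auto
   have 1: "((%r. g t (x + r *\<^sub>R b) \<bullet> b) has_real_derivative H b t x) (at 0)"
    and 2: "((%r. test_grad \<phi> t (x + r *\<^sub>R b) \<bullet> b) has_real_derivative test_hess \<phi> b t x) (at 0)" using C' T' t b by (blast)+
   have 3: "((%r. \<phi> (t, x + r *\<^sub>R b)) has_real_derivative test_grad \<phi> t x \<bullet> b) (at 0)"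
    and 4: "((%r. \<psi> t (x + r *\<^sub>R b)) has_real_derivative g t x \<bullet> b) (at 0)"
    using C12_line_derivs(2)[OF T UNIV_I, of t x b 0] C12_line_derivs(2)[OF C t, of x b 0] by simp_all
   show ?thesis unfolding p using DERIV_diff[OF DERIV_mult[OF 1 3] DERIV_mult[OF 4 2]] by (simp add: algebra_simps)
  qed (use zero[where p = p and G = "%p. (g (fst p) (snd p) \<bullet> b)*\<phi> p-\<psi> (fst p) (snd p)*(test_grad \<phi> (fst p) (snd p) \<bullet> b)" and c = "(0, b)"] K in simp)
 qed (use K b in auto)
 have i1: "integrable lborel (%p. \<psi>t (fst p) (snd p)*\<phi> p)" "integrable lborel (%p. \<psi> (fst p) (snd p)*test_dt \<phi> (fst p) (snd p))"
  using C' by (auto intro!: ii c\<psi> c\<phi> K)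
 have i2: "integrable lborel (%p. H b (fst p) (snd p)*\<phi> p)" "integrable lborel (%p. \<psi> (fst p) (snd p)*test_hess \<phi> b (fst p) (snd p))"
  if "b\<in>Basis" for b using C' that by (auto intro!: ii c\<psi> c\<phi> K)
 have "(LINT p|lborel. \<psi> (fst p) (snd p)*adjoint_heat \<phi> p) =
   - (LINT p|lborel. \<psi> (fst p) (snd p)*test_dt \<phi> (fst p) (snd p))-(\<Sum>b\<in>Basis. LINT p|lborel. \<psi> (fst p) (snd p)*test_hess \<phi> b (fst p) (snd p))"
  using i1(2) i2(2) by (simp add: right_diff_distrib sum_distrib_left Bochner_Integration.integral_diff Bochner_Integration.integral_sum Bochner_Integration.integrable_sum)
 also have "... = (LINT p|lborel. \<psi>t (fst p) (snd p)*\<phi> p)-(\<Sum>b\<in>Basis. LINT p|lborel. H b (fst p) (snd p)*\<phi> p)"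
  using t0 b0 i1 i2 by (simp cong: sum.cong)
 also have "... = (LINT p|lborel. (\<psi>t (fst p) (snd p)-(\<Sum>b\<in>Basis. H b (fst p) (snd p)))*\<phi> p)"
  using i1(1) i2(1) by (simp add: left_diff_distrib sum_distrib_right Bochner_Integration.integral_diff Bochner_Integration.integral_sum Bochner_Integration.integrable_sum)
 finally show ?thesis .
qed

context singular_profile
begin

definition sim_var :: "real => real => real" where "sim_var t \<sigma> = \<sigma> powr (1/2)*t powr - (1/2)"

definition Us :: "real => real => real" where "Us t \<sigma> = t powr - (1/\<alpha>)*f (sim_var t \<sigma>)"

definition Us_t :: "real => real => real" where
 "Us_t t \<sigma> = - (t powr - (1/\<alpha>)/t)*(1/\<alpha>*f (sim_var t \<sigma>) + sim_var t \<sigma>/2 * deriv f (sim_var t \<sigma>))"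

definition Us_s :: "real => real => real" where
 "Us_s t \<sigma> = t powr - (1/\<alpha>)*(deriv f (sim_var t \<sigma>) * sim_var t \<sigma>)/(2*\<sigma>)"

definition Us_ss :: "real => real => real" where
 "Us_ss t \<sigma> = t powr - (1/\<alpha>)*(deriv (deriv f) (sim_var t \<sigma>)*(sim_var t \<sigma>)\<^sup>2-deriv f (sim_var t \<sigma>) * sim_var t \<sigma>)/(4*\<sigma>\<^sup>2)"

lemma sim_var_pos: "0 < t ==> 0 < \<sigma> ==> 0 < sim_var t \<sigma>" by (simp add: sim_var_def)

lemma sim_var_square: "0 < t ==> 0 < \<sigma> ==> (sim_var t \<sigma>)\<^sup>2*t = \<sigma>"
 unfolding sim_var_def by (simp add: powr_minus powr_half_sqrt power_mult_distrib power_divide field_simps)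

lemma sim_var_powr: "0 < t ==> 0 < \<sigma> ==> t powr - (1/\<alpha>) * sim_var t \<sigma> powr - \<kappa> = \<sigma> powr - (1/\<alpha>)"
 unfolding sim_var_def by (simp add: powr_mult powr_powr) (simp add: field_simps flip: powr_add)

lemma U_of_eq: "0 < t ==> U_of \<alpha> f t x = Us t ((norm x)\<^sup>2)"
 unfolding U_of_def Us_def sim_var_def by (simp add: powr_half_sqrt powr_minus field_simps)

lemma has_derivative_Us:
 assumes t: "0 < t" and s: "0 < \<sigma>"
 shows "((%p. Us (fst p) (snd p)) has_derivative (%k. fst k*Us_t t \<sigma> + snd k*Us_s t \<sigma>)) (at (t, \<sigma>))"
  and "(Us_s t has_real_derivative Us_ss t \<sigma>) (at \<sigma>)"
proof -
 define r where "r = sim_var t \<sigma>"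
 have r: "0 < r" unfolding r_def using t s by (rule sim_var_pos)
 have fs: "(fst has_derivative fst) (at (t, \<sigma>))" "(snd has_derivative snd) (at (t, \<sigma>))"
  by (auto intro!: bounded_linear_imp_has_derivative bounded_linear_fst bounded_linear_snd)
 have pw: "x powr (c-1) = x powr c/x" if "0 < x" for x c :: real using that by (simp add: powr_diff)
 have d0: "((%p. fst p powr c) has_derivative (%k. c*(t powr c/t)*fst k)) (at (t, \<sigma>))"
  "((%p. snd p powr c) has_derivative (%k. c*(\<sigma> powr c/\<sigma>) * snd k)) (at (t, \<sigma>))" for c
  using has_derivative_powr_const[OF fs(1), of c] has_derivative_powr_const[OF fs(2), of c] t s pw by auto
 have "((%p. sim_var (fst p) (snd p)) has_derivative (%k. snd k*(r/(2*\<sigma>))-fst k*(r/(2*t)))) (at (t, \<sigma>))" unfolding sim_var_def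
  by (rule has_derivative_eq_rhs[OF has_derivative_mult[OF d0(2) d0(1)]]) (auto simp: r_def sim_var_def fun_eq_iff field_simps)
 from DERIV_compose_FDERIV[OF _ this, of f, unfolded fst_conv snd_conv r_def[symmetric], OF Df[OF r]]
 have df: "((%p. f (sim_var (fst p) (snd p))) has_derivative (%k. (snd k*(r/(2*\<sigma>))-fst k*(r/(2*t)))*deriv f r)) (at (t, \<sigma>))" .
 show "((%p. Us (fst p) (snd p)) has_derivative (%k. fst k*Us_t t \<sigma> + snd k*Us_s t \<sigma>)) (at (t, \<sigma>))" unfolding Us_def
  by (rule has_derivative_eq_rhs[OF has_derivative_mult[OF d0(1) df]])
   (use t s in \<open>auto simp: Us_t_def Us_s_def r_def[symmetric] fun_eq_iff field_simps\<close>)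
 have "((%\<sigma>. \<sigma> powr (1/2)) has_real_derivative (1/2)*\<sigma> powr (1/2-1)) (at \<sigma>)" using s by (rule has_real_derivative_powr)
 from DERIV_cmult[OF this[unfolded pw[OF s]], of "t powr - (1/2)"]
 have dr: "(sim_var t has_real_derivative r/(2*\<sigma>)) (at \<sigma>)" unfolding sim_var_def r_def by (simp add: mult_ac)
 have d1: "((%\<sigma>. deriv f (sim_var t \<sigma>)) has_real_derivative deriv (deriv f) r*(r/(2*\<sigma>))) (at \<sigma>)"
  using DERIV_chain2[OF Ddf[OF r, unfolded r_def] dr] unfolding r_def .
 have d2: "((%\<sigma>. 2*\<sigma>) has_real_derivative 2) (at \<sigma>)" by (auto intro!: derivative_eq_intros)
 show "(Us_s t has_real_derivative Us_ss t \<sigma>) (at \<sigma>)" unfolding Us_s_def[abs_def]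
  by (rule DERIV_cong[OF DERIV_divide[OF DERIV_cmult[OF DERIV_mult[OF d1 dr]] d2]])
   (use s in \<open>simp_all add: Us_ss_def r_def[symmetric] power2_eq_square field_simps\<close>)
qed

lemma Us_equation:
 assumes t: "0 < t" and s: "0 < \<sigma>"
 shows "Us_t t \<sigma>-(2 * real N*Us_s t \<sigma>+4*\<sigma>*Us_ss t \<sigma>) = nonlin \<alpha> (Us t \<sigma>)"
proof -
 define r where "r = sim_var t \<sigma>"
 have r: "0 < r" unfolding r_def using t s by (rule sim_var_pos)
 have sg: "\<sigma> = r\<^sup>2*t" unfolding r_def using sim_var_square[OF t s] ..
 define P where "P = t powr - (1/\<alpha>)"
 have "- (1/\<alpha>)*(\<alpha>+1) = - (1/\<alpha>)-1" using alpha_pos by (simp add: field_simps)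
 then have "P powr (\<alpha>+1) = t powr (- (1/\<alpha>)-1)" unfolding P_def by (simp only: powr_powr)
 then have "P powr (\<alpha>+1) = P/t" unfolding P_def powr_diff using t by simp
 then have rhs: "nonlin \<alpha> (Us t \<sigma>) = P/t * nonlin \<alpha> (f r)"
  unfolding Us_def P_def[symmetric] r_def[symmetric] by (subst nonlin_scale) (auto simp: P_def)
 have "2 * real N*Us_s t \<sigma> = P/t * (real N*deriv f r / r)"
  unfolding Us_s_def P_def[symmetric] r_def[symmetric] unfolding sg using r t by (simp add: power2_eq_square field_simps)
 moreover have "4*\<sigma>*Us_ss t \<sigma> = P/t * (deriv (deriv f) r-deriv f r / r)"
  unfolding Us_ss_def P_def[symmetric] r_def[symmetric] unfolding sg using r t by (simp add: power2_eq_square field_simps)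
 moreover have "Us_t t \<sigma> = P/t * (- (1/\<alpha>*f r)-r/2 * deriv f r)"
  unfolding Us_t_def P_def[symmetric] r_def[symmetric] by (simp add: algebra_simps)
 ultimately have "Us_t t \<sigma>-(2 * real N*Us_s t \<sigma>+4*\<sigma>*Us_ss t \<sigma>) =
   P/t * (- (1/\<alpha>*f r)-r/2 * deriv f r-(real N*deriv f r / r+(deriv (deriv f) r-deriv f r / r)))" by (simp add: algebra_simps)
 also have "- (1/\<alpha>*f r)-r/2 * deriv f r-(real N*deriv f r / r+(deriv (deriv f) r-deriv f r / r)) = nonlin \<alpha> (f r)"
  unfolding ode[OF r] using r by (simp add: field_simps)
 finally show ?thesis unfolding rhs .
qed

lemma continuous_Us:
 "continuous_on ({0<..}\<times>{0<..}) (%p. Us (fst p) (snd p))"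
 "continuous_on ({0<..}\<times>{0<..}) (%p. Us_t (fst p) (snd p))"
 "continuous_on ({0<..}\<times>{0<..}) (%p. Us_s (fst p) (snd p))"
 "continuous_on ({0<..}\<times>{0<..}) (%p. Us_ss (fst p) (snd p))"
proof -
 have sv: "continuous_on ({0<..}\<times>{0<..}) (%p. sim_var (fst p) (snd p))" unfolding sim_var_def by (intro continuous_intros) auto
 have c: "continuous_on ({0<..}\<times>{0<..}) (%p. g (sim_var (fst p) (snd p)))" if "continuous_on {0<..} g" for g :: "real => real"
  by (rule continuous_on_compose2[OF that sv]) (auto intro!: sim_var_pos)
 note cs = sv c[OF continuous_f] c[OF continuous_df] c[OF continuous_ddf]
 show "continuous_on ({0<..}\<times>{0<..}) (%p. Us (fst p) (snd p))"
  "continuous_on ({0<..}\<times>{0<..}) (%p. Us_t (fst p) (snd p))"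
  "continuous_on ({0<..}\<times>{0<..}) (%p. Us_s (fst p) (snd p))"
  "continuous_on ({0<..}\<times>{0<..}) (%p. Us_ss (fst p) (snd p))"
  unfolding Us_def Us_t_def Us_s_def Us_ss_def by (intro continuous_intros cs; force)+
qed

text \<open>
 The regularised function solves the equation up to \<open>4 \<epsilon>\<close> times a second derivative, which is bounded by an integrable
 power of \<open>|x|\<close> uniformly in \<open>\<epsilon>\<close> and tends to zero off the origin.
\<close>

lemma selfsim_weak:
 fixes \<phi> :: "real\<times>'a::euclidean_space => real"
 assumes dim: "DIM('a) = N" and tf: "test_function ({0<..}\<times>UNIV) \<phi>"
 shows "(LINT p|lborel. selfsim p*adjoint_heat \<phi> p) =
  (LINT p|lborel. nonlin \<alpha> (selfsim p)*\<phi> p)"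
proof -
 obtain K where K: "compact K" "K \<subseteq> {0<..}\<times>UNIV" "!!p. p ~: K ==> \<phi> p = 0"
  "!!p. p ~: K ==> test_dt \<phi> (fst p) (snd p) = 0" "!!p b. p ~: K ==> test_hess \<phi> b (fst p) (snd p) = 0"
  using test_function_support[OF tf] by metis
 define \<zeta> where "\<zeta> p = adjoint_heat \<phi> p" for p
 have \<zeta>c: "continuous_on UNIV \<zeta>" unfolding \<zeta>_def
  using test_function_C12[OF tf] unfolding C12_with_def by (intro continuous_intros) auto
 have \<zeta>K: "p ~: K ==> \<zeta> p = 0" for p unfolding \<zeta>_def using K(4,5) by simp
 note \<phi>c = test_function_continuous[OF tf]
 obtain R0 where R0: "!!p. p\<in>K ==> norm p <= R0" using compact_imp_bounded[OF K(1)] bounded_iff by metis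
 have "\<exists>t0>0. \<forall>p\<in>K. t0 <= fst p"
 proof (cases "K = {}")
  case False
  obtain q where "q\<in>K" "\<forall>p\<in>K. fst q <= fst p"
   using continuous_attains_inf[OF K(1) False continuous_on_fst[OF continuous_on_id]] by blast
  then show ?thesis using K(2) by (intro exI[of _ "fst q"]) auto
 qed (auto intro: exI[of _ 1])
 then obtain t0 where t0: "0 < t0" "!!p. p\<in>K ==> t0 <= fst p" by blast
 define R where "R = sqrt ((R0\<^sup>2+1)/t0)"
 obtain C where C: "!!r. 0 < r ==> r <= R ==> abs (f r) <= C * r powr (- \<kappa>)"
  "!!r. 0 < r ==> r <= R ==> abs (deriv f r) <= C * r powr (- \<kappa>-1)"
  "!!r. 0 < r ==> r <= R ==> abs (deriv (deriv f) r) <= C * r powr (- \<kappa>-2)" using profile_bounds_near_zero[of R] by metis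
 have R: "0 < R" unfolding R_def using t0 by (simp add: add_nonneg_pos)
 have C0: "0 <= C" using order_trans[OF abs_ge_zero C(1)[OF R order_refl]] R by (simp add: zero_le_mult_iff)
 \<comment> \<open>\<open>\<epsilon>\<close> moves the singularity off the real axis\<close>
 define e where "e n = 1/(real n+1)" for n
 have e: "0 < e n" "e n <= 1" for n by (auto simp: e_def)
 define F where "F n p = Us (fst p) ((norm (snd p :: 'a))\<^sup>2+e n)" for n p
 define F3 where "F3 n p = Us_ss (fst p) ((norm (snd p :: 'a))\<^sup>2+e n)" for n p
 have pos: "0 < (norm x)\<^sup>2+e n" for n and x :: 'a using e by (simp add: add_nonneg_pos)
 have C12: "C12_with {0<..} (%s y::'a. Us s ((norm y)\<^sup>2+e n)) (%s y. Us_t s ((norm y)\<^sup>2+e n))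
   (%s y. (2*Us_s s ((norm y)\<^sup>2+e n)) *\<^sub>R y)
   (%b s y. 2*Us_s s ((norm y)\<^sup>2+e n)+4*(y \<bullet> b)\<^sup>2*Us_ss s ((norm y)\<^sup>2+e n))" for n
  by (rule radial_C12) (auto intro!: e has_derivative_Us continuous_Us)
 have weak: "(LINT p|lborel. F n p*\<zeta> p) = (LINT p|lborel. (nonlin \<alpha> (F n p)+4*e n*F3 n p)*\<phi> p)" for n
 proof -
  have "(Us_t (fst p) ((norm (snd p))\<^sup>2+e n)-(\<Sum>b\<in>Basis. 2*Us_s (fst p) ((norm (snd p))\<^sup>2+e n) +
    4*(snd p \<bullet> b)\<^sup>2*Us_ss (fst p) ((norm (snd p))\<^sup>2+e n)))*\<phi> p = (nonlin \<alpha> (F n p)+4*e n*F3 n p)*\<phi> p" for p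
  proof (cases "p\<in>K")
   case True
   then have "0 < fst p" using K(2) by auto
   from Us_equation[OF this pos, of "snd p" n] show ?thesis unfolding radial_laplacian_sum dim F_def F3_def by (simp add: algebra_simps)
  qed (use K(3) in simp)
  then have eq: "(%p. (Us_t (fst p) ((norm (snd p))\<^sup>2+e n)-(\<Sum>b\<in>Basis. 2*Us_s (fst p) ((norm (snd p))\<^sup>2+e n) +
    4*(snd p \<bullet> b)\<^sup>2*Us_ss (fst p) ((norm (snd p))\<^sup>2+e n)))*\<phi> p) = (%p. (nonlin \<alpha> (F n p)+4*e n*F3 n p)*\<phi> p)"
   by (rule ext)
  show ?thesis using C12_weak[OF C12 open_greaterThan tf, of n] unfolding F_def[symmetric] \<zeta>_def[symmetric] eq .
 qed
 have bounds: "abs (F n p) <= C*norm (snd p) powr - \<kappa>"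
  "abs (nonlin \<alpha> (F n p)) <= C powr (\<alpha>+1)*norm (snd p) powr - (\<kappa>+2)"
  "4*abs (F3 n p) <= 2*C * norm (snd p) powr - (\<kappa>+4)"
  "4*e n*abs (F3 n p) <= 2*C * norm (snd p) powr - (\<kappa>+2)"
  if p: "p\<in>K" "snd p ~= 0" for n p
 proof -
  define X where "X = norm (snd p)"
  define \<sigma> where "\<sigma> = X\<^sup>2+e n"
  define r where "r = sim_var (fst p) \<sigma>"
  have X: "0 < X" using p by (simp add: X_def)
  have t: "0 < fst p" "t0 <= fst p" using t0 p K(2) by auto
  have sg: "0 < \<sigma>" "X\<^sup>2 <= \<sigma>" "e n <= \<sigma>" unfolding \<sigma>_def using pos[of "snd p" n] e(1)[of n] by (auto simp: X_def)
  have r: "0 < r" unfolding r_def using t(1) sg(1) by (rule sim_var_pos)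
  have "X <= R0" unfolding X_def using R0[OF p(1)] norm_snd_le[of "snd p" "fst p"] by simp
  then have "\<sigma> <= R0\<^sup>2+1" unfolding \<sigma>_def using e(2)[of n] X by (intro add_mono power_mono) auto
  moreover have "r\<^sup>2*t0 <= \<sigma>" using mult_left_mono[OF t(2), of "r\<^sup>2"] sim_var_square[OF t(1) sg(1)] by (simp add: r_def)
  ultimately have "r\<^sup>2*t0 <= R0\<^sup>2+1" by linarith
  then have "r\<^sup>2 <= (R0\<^sup>2+1)/t0" using t0(1) by (simp add: pos_le_divide_eq)
  then have rR: "r <= R" unfolding R_def by (rule real_le_rsqrt)
  have Xp: "\<sigma> powr - c <= X powr - (2 * c)" if "0 <= c" for c
  proof -
   have "\<sigma> powr - c <= (X\<^sup>2) powr - c" using sg X that by (intro powr_mono2') auto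
   then show ?thesis using X by (simp add: powr_powr flip: powr_numeral)
  qed
  have k2: "2*(1/\<alpha>) = \<kappa>" by simp
  have Fp: "F n p = fst p powr - (1/\<alpha>)*f r" and F3p: "F3 n p = fst p powr - (1/\<alpha>)*(deriv (deriv f) r * r\<^sup>2-deriv f r * r)/(4*\<sigma>\<^sup>2)"
   unfolding F_def F3_def Us_def Us_ss_def r_def \<sigma>_def X_def by auto
  have "abs (F n p) <= fst p powr - (1/\<alpha>)*(C * r powr - \<kappa>)" unfolding Fp abs_mult using C(1)[OF r rR] by (intro mult_mono) auto
  also have "... = C*\<sigma> powr - (1/\<alpha>)" using sim_var_powr[OF t(1) sg(1)] unfolding r_def by (simp add: mult.left_commute)
  also have "... <= C*X powr - \<kappa>" using Xp[of "1/\<alpha>"] alpha_pos C0 unfolding k2 by (intro mult_left_mono) auto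
  finally show b1: "abs (F n p) <= C*norm (snd p) powr - \<kappa>" unfolding X_def .
  have "abs (nonlin \<alpha> (F n p)) <= (C*X powr - \<kappa>) powr (\<alpha>+1)"
   unfolding nonlin_abs using b1 alpha_pos by (intro powr_mono2) (auto simp: X_def)
  also have "... = C powr (\<alpha>+1)*X powr - (\<kappa>*(\<alpha>+1))" using C0 by (simp add: powr_mult powr_powr)
  finally show "abs (nonlin \<alpha> (F n p)) <= C powr (\<alpha>+1)*norm (snd p) powr - (\<kappa>+2)" unfolding kappa_alpha X_def .
  have d1: "abs (deriv f r * r) <= C * r powr - \<kappa>" using mult_right_mono[OF C(2)[OF r rR], of r] r by (simp add: abs_mult powr_diff)
  have d2: "abs (deriv (deriv f) r * r\<^sup>2) <= C * r powr - \<kappa>"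
   using mult_right_mono[OF C(3)[OF r rR], of "r\<^sup>2"] r by (simp add: abs_mult powr_diff powr_numeral)
  have "abs (F3 n p) = fst p powr - (1/\<alpha>)*abs (deriv (deriv f) r * r\<^sup>2-deriv f r * r)/(4*\<sigma>\<^sup>2)"
   unfolding F3p by (simp add: abs_mult)
  also have "... <= fst p powr - (1/\<alpha>)*(2*(C * r powr - \<kappa>))/(4*\<sigma>\<^sup>2)"
   using d1 d2 by (intro divide_right_mono mult_left_mono) auto
  also have "... = 2*C * \<sigma> powr - (1/\<alpha>)/(4*\<sigma>\<^sup>2)" using sim_var_powr[OF t(1) sg(1)] unfolding r_def by (simp add: mult_ac)
  finally have "4*abs (F3 n p) <= 2*C * (\<sigma> powr - (1/\<alpha>)/\<sigma>\<^sup>2)" by simp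
  also have "\<sigma> powr - (1/\<alpha>)/\<sigma>\<^sup>2 = \<sigma> powr (- (1/\<alpha>)-2)" using sg(1) by (simp add: powr_diff powr_numeral)
  finally have b3: "4*abs (F3 n p) <= 2*C * \<sigma> powr - (1/\<alpha>+2)" by simp
  also have "... <= 2*C * X powr - (2*(1/\<alpha>+2))" using Xp[of "1/\<alpha>+2"] alpha_pos C0 by (intro mult_left_mono) auto
  also have "2*(1/\<alpha>+2) = \<kappa>+4" by simp
  finally show "4*abs (F3 n p) <= 2*C * norm (snd p) powr - (\<kappa>+4)" unfolding X_def .
  have "4*e n*abs (F3 n p) = e n*(4*abs (F3 n p))" by simp
  also have "... <= \<sigma>*(2*C * \<sigma> powr - (1/\<alpha>+2))" using sg e(1)[of n] by (intro mult_mono[OF _ b3]) auto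
  also have "... = 2*C * \<sigma> powr - (1/\<alpha>+1)"
  proof -
   have e1: "- (1/\<alpha>+1) = 1 + - (1/\<alpha>+2)" by simp
   have "\<sigma> powr - (1/\<alpha>+1) = \<sigma> powr (1 + - (1/\<alpha>+2))" unfolding e1 ..
   also have "... = \<sigma> powr 1*\<sigma> powr - (1/\<alpha>+2)" by (rule powr_add)
   finally show ?thesis using sg(1) by simp
  qed
  also have "... <= 2*C * X powr - (2*(1/\<alpha>+1))" using Xp[of "1/\<alpha>+1"] alpha_pos C0 by (intro mult_left_mono) auto
  also have "2*(1/\<alpha>+1) = \<kappa>+2" by simp
  finally show "4*e n*abs (F3 n p) <= 2*C * norm (snd p) powr - (\<kappa>+2)" unfolding X_def .
 qed
 have e0: "e \<longlonglongrightarrow> 0" unfolding e_def[abs_def] using LIMSEQ_inverse_real_of_nat by (simp add: inverse_eq_divide add.commute)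
 have limF: "(%n. F n p) \<longlonglongrightarrow> selfsim p" if p: "p\<in>K" "snd p ~= 0" for p
 proof -
  have t: "0 < fst p" using K(2) p by auto
  have "isCont (%q. Us (fst q) (snd q)) (fst p, (norm (snd p))\<^sup>2)"
   using continuous_Us(1) t p by (subst (asm) continuous_on_eq_continuous_at) (auto intro!: open_Times)
  moreover have "(%n. (fst p, (norm (snd p))\<^sup>2+e n)) \<longlonglongrightarrow> (fst p, (norm (snd p))\<^sup>2+0)"
   by (intro tendsto_Pair tendsto_const tendsto_add e0)
  ultimately have "(%n. Us (fst p) ((norm (snd p))\<^sup>2+e n)) \<longlonglongrightarrow> Us (fst p) ((norm (snd p))\<^sup>2)"
   using isCont_tendsto_compose[of "(fst p, (norm (snd p))\<^sup>2)" "%q. Us (fst q) (snd q)"] by fastforce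
  then show ?thesis unfolding F_def selfsim_def using t p U_of_eq[OF t, of "snd p"] by simp
 qed
 have lim3: "(%n. 4*e n*F3 n p) \<longlonglongrightarrow> 0" if p: "p\<in>K" "snd p ~= 0" for p
 proof (rule Lim_null_comparison[OF always_eventually], intro allI)
  show "norm (4*e n*F3 n p) <= e n*(2*C * norm (snd p) powr - (\<kappa>+4))" for n
   using mult_left_mono[OF bounds(3)[OF p, of n], of "e n"] e(1)[of n] by (simp add: abs_mult mult_ac)
  show "(%n. e n*(2*C * norm (snd p) powr - (\<kappa>+4))) \<longlonglongrightarrow> 0" by (rule tendsto_mult_left_zero[OF e0])
 qed
 have o: "open ({0::real<..}\<times>(UNIV :: 'a set))" by (intro open_Times) auto
 have cF: "continuous_on ({0<..}\<times>UNIV) (F n)" "continuous_on ({0<..}\<times>UNIV) (F3 n)" for n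
  using continuous_on_compose2[OF continuous_Us(1), of "{0<..}\<times>UNIV" "%p::real\<times>'a. (fst p, (norm (snd p))\<^sup>2+e n)"]
   continuous_on_compose2[OF continuous_Us(4), of "{0<..}\<times>UNIV" "%p::real\<times>'a. (fst p, (norm (snd p))\<^sup>2+e n)"] pos[of _ n]
  unfolding F_def F3_def by (force intro!: continuous_intros)+
 have mF: "(%p. F n p*\<zeta> p)\<in>borel_measurable lborel" for n
  using borel_measurable_continuous_onI[OF continuous_zero_extension[OF o compact_imp_closed[OF K(1)] K(2) cF(1) \<zeta>c \<zeta>K], of n] by simp
 have cN: "continuous_on ({0<..}\<times>UNIV) (%p. nonlin \<alpha> (F n p)+4*e n*F3 n p)" for n
  by (intro continuous_intros cF continuous_on_compose2[OF continuous_nonlin[OF alpha_pos]]) auto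
 have mN: "(%p. (nonlin \<alpha> (F n p)+4*e n*F3 n p)*\<phi> p)\<in>borel_measurable lborel" for n
  using borel_measurable_continuous_onI[OF continuous_zero_extension[OF o compact_imp_closed[OF K(1)] K(2) cN \<phi>c K(3)], of n] by simp
 have g: "0 <= \<kappa>" "\<kappa> < real DIM('a)" "0 <= \<kappa>+2" "\<kappa>+2 < real DIM('a)" using kappa_pos kappa_less dim by auto
 have s\<zeta>: "(%p. selfsim p*\<zeta> p)\<in>borel_measurable lborel" and s\<phi>: "(%p. nonlin \<alpha> (selfsim p)*\<phi> p)\<in>borel_measurable lborel"
  using borel_measurable_times[OF borel_selfsim borel_measurable_continuous_onI[OF \<zeta>c]]
   borel_measurable_times[OF measurable_compose[OF borel_selfsim borel_nonlin] borel_measurable_continuous_onI[OF \<phi>c]] by auto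
 have L1: "(%n. LINT p|lborel. F n p*\<zeta> p) \<longlonglongrightarrow> (LINT p|lborel. selfsim p*\<zeta> p)"
 proof (rule integral_dominated_convergence[OF s\<zeta> mF integrable_test_times_singular[OF \<zeta>c K(1) \<zeta>K g(1,2), of C]])
  show "AE p in lborel. (%n. F n p*\<zeta> p) \<longlonglongrightarrow> selfsim p*\<zeta> p" using AE_snd_nonzero
  proof eventually_elim
   case (elim p)
   then show ?case using limF[of p] \<zeta>K[of p] by (cases "p\<in>K") (auto intro!: tendsto_mult tendsto_const)
  qed
  show "AE p in lborel. norm (F n p*\<zeta> p) <= (C*(1+norm (snd p) powr - \<kappa>))*abs (\<zeta> p)" for n using AE_snd_nonzero
  proof eventually_elim
   case (elim p)
   have "abs (F n p) <= C*(1+norm (snd p) powr - \<kappa>)" if "p\<in>K" using bounds(1)[OF that elim, of n] C0 by (simp add: distrib_left)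
   then show ?case using \<zeta>K[of p] by (cases "p\<in>K") (auto simp: abs_mult intro!: mult_right_mono)
  qed
 qed
 have L2: "(%n. LINT p|lborel. (nonlin \<alpha> (F n p)+4*e n*F3 n p)*\<phi> p) \<longlonglongrightarrow> (LINT p|lborel. nonlin \<alpha> (selfsim p)*\<phi> p)"
 proof (rule integral_dominated_convergence[OF s\<phi> mN integrable_test_times_singular[OF \<phi>c K(1,3) g(3,4), of "C powr (\<alpha>+1)+2*C"]])
  show "AE p in lborel. (%n. (nonlin \<alpha> (F n p)+4*e n*F3 n p)*\<phi> p) \<longlonglongrightarrow> nonlin \<alpha> (selfsim p)*\<phi> p"
   using AE_snd_nonzero
  proof eventually_elim
   case (elim p)
   show ?case
   proof (cases "p\<in>K")
    case True
    have "(%n. nonlin \<alpha> (F n p)) \<longlonglongrightarrow> nonlin \<alpha> (selfsim p)"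
     by (rule continuous_on_tendsto_compose[OF continuous_nonlin[OF alpha_pos] limF[OF True elim]]) auto
    from tendsto_add[OF this lim3[OF True elim]] show ?thesis by (intro tendsto_mult tendsto_const) simp
   qed (simp add: K(3))
  qed
  show "AE p in lborel. norm ((nonlin \<alpha> (F n p)+4*e n*F3 n p)*\<phi> p) <=
    ((C powr (\<alpha>+1)+2*C)*(1+norm (snd p) powr - (\<kappa>+2)))*abs (\<phi> p)" for n using AE_snd_nonzero
  proof eventually_elim
   case (elim p)
   show ?case
   proof (cases "p\<in>K")
    case True
    have "abs (4*e n*F3 n p) = 4*e n*abs (F3 n p)" using e(1)[of n] by (simp add: abs_mult)
    then have "abs (nonlin \<alpha> (F n p)+4*e n*F3 n p) <= (C powr (\<alpha>+1)+2*C)*norm (snd p) powr - (\<kappa>+2)"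
     using bounds(2,4)[OF True elim, of n] by (simp add: distrib_right)
    also have "... <= (C powr (\<alpha>+1)+2*C)*(1+norm (snd p) powr - (\<kappa>+2))" using C0 by (intro mult_left_mono) auto
    finally show ?thesis unfolding real_norm_def abs_mult by (rule mult_right_mono) simp
   qed (simp add: K(3))
  qed
 qed
 from LIMSEQ_unique[OF L1[unfolded weak] L2] show ?thesis unfolding \<zeta>_def .
qed

end

section \<open>Local integrability of functions with a power singularity\<close>

lemma tendsto_norm_powr_zero:
 assumes "0 < c" shows "((%x::'a::euclidean_space. norm x powr c) \<longlongrightarrow> 0) (at 0)"
 by (rule tendsto_zero_powrI[OF tendsto_norm_zero[OF tendsto_ident_at] tendsto_const]) (use assms in auto)

lemma integrable_lebesgue_on_iff:
 fixes g :: "'a::euclidean_space => real"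
 assumes "S\<in>sets borel" "g\<in>borel_measurable borel"
 shows "integrable (lebesgue_on S) g \<longleftrightarrow> integrable lborel (%x. indicator S x*g x)"
proof -
 have "S \<inter> space lebesgue\<in>sets lebesgue" using assms(1) by simp
 then have "integrable (lebesgue_on S) g \<longleftrightarrow> integrable lebesgue (%x. indicator S x*g x)"
  using integrable_restrict_space[of S lebesgue g] by simp
 also have "... \<longleftrightarrow> integrable lborel (%x. indicator S x*g x)"
  using borel_measurable_times[OF borel_measurable_indicator[OF assms(1)] assms(2)] by (intro integrable_completion) simp
 finally show ?thesis .
qed

lemma integral_lebesgue_on_eq:
 fixes g :: "'a::euclidean_space => real"
 assumes "S\<in>sets borel" "g\<in>borel_measurable borel"
 shows "(LINT x|lebesgue_on S. g x) = (LINT x|lborel. indicator S x*g x)"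
proof -
 have "S \<inter> space lebesgue\<in>sets lebesgue" using assms(1) by simp
 then have "(LINT x|lebesgue_on S. g x) = (LINT x|lebesgue. indicator S x*g x)" using integral_restrict_space[of S lebesgue g] by simp
 also have "... = (LINT x|lborel. indicator S x*g x)"
  using borel_measurable_times[OF borel_measurable_indicator[OF assms(1)] assms(2)] by (intro integral_completion) simp
 finally show ?thesis .
qed

lemma Lp_loc_borelI:
 fixes g q :: "'a::euclidean_space => real"
 assumes eq: "!!z. z\<in>\<Omega> ==> g z = q z" and q: "q\<in>borel_measurable borel"
  and i: "!!K. compact K ==> K \<subseteq> \<Omega> ==> integrable lborel (%z. indicator K z*abs (q z) powr p)"
 shows "Lp_loc p \<Omega> g" unfolding Lp_loc_def
proof (intro conjI allI impI)
 have "q\<in>borel_measurable (lebesgue_on \<Omega>)" using q by (intro measurable_restrict_space1 measurable_completion) simp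
 then show "g\<in>borel_measurable (lebesgue_on \<Omega>)" by (subst measurable_cong[of _ _ q]) (auto simp: space_restrict_space eq)
 fix K assume K: "compact K" "K \<subseteq> \<Omega>"
 have m: "(%z. abs (q z) powr p)\<in>borel_measurable borel" using q by measurable
 have "integrable (lebesgue_on K) (%z. abs (q z) powr p)" using i[OF K] by (subst integrable_lebesgue_on_iff[OF borel_compact[OF K(1)] m])
 moreover have "integrable (lebesgue_on K) (%z. abs (g z) powr p) \<longleftrightarrow> integrable (lebesgue_on K) (%z. abs (q z) powr p)"
  using eq K(2) by (intro Bochner_Integration.integrable_cong) (auto simp: space_restrict_space)
 ultimately show "integrable (lebesgue_on K) (%z. abs (g z) powr p)" by simp
qed

lemma powr_singular_bound:
 fixes q C X k p :: real
 assumes q: "abs q <= C*(1+X powr - k)" and p: "0 <= p"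
 shows "abs q powr p <= (2*abs C) powr p*(1+X powr - (k*p))"
proof -
 have "abs q <= abs C*(1+X powr - k)" using q by (rule order_trans) (intro mult_right_mono, auto)
 also have "... <= abs C*(2*max 1 (X powr - k))" by (intro mult_left_mono) auto
 finally have "abs q powr p <= (2*abs C*max 1 (X powr - k)) powr p" using p by (intro powr_mono2) (auto simp: mult_ac)
 also have "... = (2*abs C) powr p*max 1 (X powr - k) powr p" by (subst powr_mult) auto
 also have "max 1 (X powr - k) powr p <= 1+(X powr - k) powr p" by (cases "X powr - k <= 1") (auto simp: max_def)
 then have "(2*abs C) powr p*max 1 (X powr - k) powr p <= (2*abs C) powr p*(1+X powr - (k*p))" by (intro mult_left_mono) (auto simp: powr_powr)
 finally show ?thesis .
qed

lemma integrable_singular_compact':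
 fixes q :: "'a::euclidean_space => real"
 assumes g: "0 <= \<gamma>" "\<gamma> < real DIM('a)" and K: "compact K" and q: "q\<in>borel_measurable borel"
  and b: "!!x. x ~= 0 ==> abs (q x) <= C*(1+norm x powr - \<gamma>)"
 shows "integrable lborel (%x. indicator K x * q x)"
proof -
 obtain R where R: "!!x. x\<in>K ==> norm x <= R" using compact_imp_bounded[OF K] bounded_iff by metis
 show ?thesis
 proof (rule Bochner_Integration.integrable_bound[OF integrable_mult_right[OF integrable_singular_box(2)[OF g, where R = R], of "abs C"]])
  show "(%p. indicator K p * q p)\<in>borel_measurable lborel"
   using borel_measurable_times[OF borel_measurable_indicator[OF borel_compact[OF K]] q] by simp
  show "AE x in lborel. norm (indicator K x * q x) <= norm (abs C*(indicator (cball 0 R) x+norm x powr - \<gamma>*indicator (cball 0 R) x))"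
   using AE_lborel_singleton[of "0::'a"]
  proof eventually_elim
   case (elim x)
   have "C*(1+norm x powr - \<gamma>) <= abs C*(1+norm x powr - \<gamma>)" by (intro mult_right_mono) auto
   then show ?case using b[OF elim] R[of x] by (cases "x\<in>K") (auto simp: abs_mult)
  qed
 qed
qed

context singular_profile
begin

lemma singular_solutionI:
 fixes q :: "real\<times>'a::euclidean_space => real"
 assumes dim: "DIM('a) = N" and I: "open I" and q: "q\<in>borel_measurable borel" and eq: "!!t x. t\<in>I ==> u t x = q (t, x)"
  and b: "!!p. p\<in>I\<times>UNIV ==> snd p ~= 0 ==> abs (q p) <= C*(1+norm (snd p) powr - \<kappa>)"
  and weak: "!!\<phi>. test_function (I\<times>UNIV) \<phi> ==>
    (LINT p|lborel. q p*adjoint_heat \<phi> p) = (LINT p|lborel. nonlin \<alpha> (q p)*\<phi> p)"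
 shows "Lp_loc (\<alpha>+1) (I\<times>UNIV) (%(t, x). u t x)" and "heat_solution \<alpha> I u"
proof -
 have Ib: "I\<times>(UNIV :: 'a set)\<in>sets borel" using I by (intro borel_open open_Times) auto
 have g: "0 <= \<kappa>" "\<kappa> < real DIM('a)" "0 <= \<kappa>*(\<alpha>+1)" "\<kappa>*(\<alpha>+1) < real DIM('a)"
  using kappa_pos kappa_less alpha_pos dim unfolding kappa_alpha by auto
 have qn: "(%p. nonlin \<alpha> (q p))\<in>borel_measurable borel" using q by (rule measurable_compose) (rule borel_nonlin)
 have bp: "abs (q p) powr (\<alpha>+1) <= (2*abs C) powr (\<alpha>+1)*(1+norm (snd p) powr - (\<kappa>*(\<alpha>+1)))"
  if "p\<in>I\<times>UNIV" "snd p ~= 0" for p by (rule powr_singular_bound[OF b[OF that]]) (use alpha_pos in simp)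
 have ip: "integrable lborel (%z. indicator K z*abs (q z) powr (\<alpha>+1))" if K: "compact K" "K \<subseteq> I\<times>UNIV" for K
 proof (rule integrable_singular_compact[OF g(3,4) K(1)])
  show "(%z. abs (q z) powr (\<alpha>+1))\<in>borel_measurable borel" using q by measurable
  show "abs ((abs (q p)) powr (\<alpha>+1)) <= (2*abs C) powr (\<alpha>+1)*(1+norm (snd p) powr - (\<kappa>*(\<alpha>+1)))"
   if "p\<in>K" "snd p ~= 0" for p using bp[of p] that K(2) by fastforce
 qed
 show "Lp_loc (\<alpha>+1) (I\<times>UNIV) (%(t, x). u t x)" by (rule Lp_loc_borelI[OF _ q ip]) (auto simp: eq)
 have L1: "Lp_loc 1 (I\<times>UNIV) (%(t, x). u t x)"
 proof (rule Lp_loc_borelI[OF _ q])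
  fix K :: "(real\<times>'a) set" assume K: "compact K" "K \<subseteq> I\<times>UNIV"
  have "integrable lborel (%z. indicator K z*abs (q z))"
   by (rule integrable_singular_compact[OF g(1,2) K(1), where C = C]) (use q b K(2) in \<open>auto simp: subset_iff\<close>)
  then show "integrable lborel (%z. indicator K z*abs (q z) powr 1)" by simp
 qed (auto simp: eq)
 have L2: "Lp_loc 1 (I\<times>UNIV) (%(t, x). nonlin \<alpha> (u t x))"
  by (rule Lp_loc_borelI[OF _ qn]) (use ip in \<open>auto simp: eq nonlin_abs powr_powr\<close>)
 show "heat_solution \<alpha> I u" unfolding heat_solution_def
 proof (intro conjI L1 L2 allI impI)
  fix \<phi> :: "real\<times>'a => real" assume tf: "test_function (I\<times>UNIV) \<phi>"
  obtain K where K: "compact K" "K \<subseteq> I\<times>UNIV" "!!p. p ~: K ==> \<phi> p = 0"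
   "!!p. p ~: K ==> test_dt \<phi> (fst p) (snd p) = 0" "!!p b. p ~: K ==> test_hess \<phi> b (fst p) (snd p) = 0"
   using test_function_support[OF tf] by metis
  have c: "continuous_on UNIV (%p. test_dt \<phi> (fst p) (snd p))" "continuous_on UNIV (%p. \<Sum>b\<in>Basis. test_hess \<phi> b (fst p) (snd p))"
   using test_function_C12[OF tf] unfolding C12_with_def by (auto intro!: continuous_intros)
  have conv: "(LINT z|lebesgue_on (I\<times>UNIV). h z) = (LINT z|lborel. r z*\<zeta> z)"
   if "!!z. z\<in>I\<times>UNIV ==> h z = r z*\<zeta> z" "r\<in>borel_measurable borel" "continuous_on UNIV \<zeta>" "!!p. p ~: K ==> \<zeta> p = 0"
   for h r \<zeta> :: "real\<times>'a => real"
  proof -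
   have m: "(%z. r z*\<zeta> z)\<in>borel_measurable borel" using that(2) borel_measurable_continuous_onI[OF that(3)] by (rule borel_measurable_times)
   have "(LINT z|lebesgue_on (I\<times>UNIV). h z) = (LINT z|lebesgue_on (I\<times>UNIV). r z*\<zeta> z)"
    by (rule Bochner_Integration.integral_cong) (auto simp: space_restrict_space that(1))
   also have "... = (LINT z|lborel. indicator (I\<times>UNIV) z*(r z*\<zeta> z))" by (rule integral_lebesgue_on_eq[OF Ib m])
   also have "(%z. indicator (I\<times>UNIV) z*(r z*\<zeta> z)) = (%z. r z*\<zeta> z)" using K(2) that(4) by (force simp: indicator_def fun_eq_iff)
   finally show ?thesis .
  qed
  have 1: "(LINT (t, x)|lebesgue_on (I\<times>UNIV). u t x*deriv (%s. \<phi> (s, x)) t) = (LINT p|lborel. q p*test_dt \<phi> (fst p) (snd p))"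
   by (rule conv[OF _ q c(1) K(4)]) (auto simp: eq test_function_deriv_laplacian(1)[OF tf])
  have 2: "(LINT (t, x)|lebesgue_on (I\<times>UNIV). u t x*laplacian (%y. \<phi> (t, y)) x) = (LINT p|lborel. q p*(\<Sum>b\<in>Basis. test_hess \<phi> b (fst p) (snd p)))"
   by (rule conv[OF _ q c(2)]) (auto simp: eq test_function_deriv_laplacian(2)[OF tf] K(5))
  have 3: "(LINT (t, x)|lebesgue_on (I\<times>UNIV). nonlin \<alpha> (u t x)*\<phi> (t, x)) = (LINT p|lborel. nonlin \<alpha> (q p)*\<phi> p)"
   by (rule conv[OF _ qn test_function_continuous[OF tf] K(3)]) (auto simp: eq)
  have i1: "integrable lborel (%p. q p*test_dt \<phi> (fst p) (snd p))"
   by (rule integrable_times_test[OF g(1,2) K(1) q _ c(1) K(4), where C = C]) (use b K(2) in auto)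
  have i2: "integrable lborel (%p. q p*(\<Sum>b\<in>Basis. test_hess \<phi> b (fst p) (snd p)))"
   by (rule integrable_times_test[OF g(1,2) K(1) q _ c(2), where C = C]) (use b K(2,5) in auto)
  have "(LINT p|lborel. q p*adjoint_heat \<phi> p) =
    - (LINT p|lborel. q p*test_dt \<phi> (fst p) (snd p))-(LINT p|lborel. q p*(\<Sum>b\<in>Basis. test_hess \<phi> b (fst p) (snd p)))"
   using i1 i2 by (simp add: right_diff_distrib)
  then show "- (LINT (t, x)|lebesgue_on (I\<times>UNIV). u t x*deriv (%s. \<phi> (s, x)) t) =
    (LINT (t, x)|lebesgue_on (I\<times>UNIV). u t x*laplacian (%y. \<phi> (t, y)) x) +
    (LINT (t, x)|lebesgue_on (I\<times>UNIV). nonlin \<alpha> (u t x)*\<phi> (t, x))" unfolding 1 2 3 using weak[OF tf] by linarith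
 qed
qed

lemma self_similar_U_of: "self_similar \<alpha> (U_of \<alpha> f :: real => 'a::euclidean_space => real)" unfolding self_similar_def
proof (intro allI impI)
 fix c t :: real and x :: 'a assume c: "0 < c" "0 < t"
 have "(c\<^sup>2*t) powr (- 1/\<alpha>) = c powr - \<kappa>*t powr (- 1/\<alpha>)" using c by (simp add: powr_mult powr_powr flip: powr_numeral)
 moreover have "norm (c *\<^sub>R x) / sqrt (c\<^sup>2*t) = norm x / sqrt t" using c by (simp add: real_sqrt_mult)
 ultimately have e: "U_of \<alpha> f (c\<^sup>2*t) (c *\<^sub>R x) = c powr - \<kappa>*U_of \<alpha> f t x" unfolding U_of_def by simp
 have "c powr \<kappa> * c powr - \<kappa> = 1" using c by (simp flip: powr_add)
 then show "c powr (2/\<alpha>)*U_of \<alpha> f (c\<^sup>2*t) (c *\<^sub>R x) = U_of \<alpha> f t x" unfolding e mult.assoc[symmetric] by simp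
qed

lemma singular_bound_mono:
 assumes "abs w <= C*(1+X powr - \<eta>)" "0 < X"
 shows "abs w <= 2*abs C*(1+X powr - \<kappa>)"
proof -
 have "X powr - \<eta> <= 1+X powr - \<kappa>"
 proof (cases "X <= 1")
  case True
  then have "X powr - \<eta> <= X powr - \<kappa>" using assms(2) eta_less_kappa by (intro powr_mono') auto
  then show ?thesis by simp
 next
  case False
  then have "X powr - \<eta> <= X powr 0" using eta_pos by (intro powr_mono) auto
  then show ?thesis using assms(2) by (simp add: add_increasing2)
 qed
 moreover have "1+y <= 2*(1+z)" if "y <= 1+z" "0 <= z" for y z :: real using that by simp
 ultimately have "1+X powr - \<eta> <= 2*(1+X powr - \<kappa>)" using powr_ge_zero by blast
 then have "abs C*(1+X powr - \<eta>) <= abs C*(2*(1+X powr - \<kappa>))" by (intro mult_left_mono) auto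
 moreover have "C*(1+X powr - \<eta>) <= abs C*(1+X powr - \<eta>)" by (intro mult_right_mono) auto
 moreover have "2*abs C*(1+X powr - \<kappa>) = abs C*(2*(1+X powr - \<kappa>))" by simp
 ultimately show ?thesis using assms(1) by linarith
qed

lemma heat_solution_U_of:
 assumes dim: "DIM('a::euclidean_space) = N"
 shows "heat_solution \<alpha> {0<..} (U_of \<alpha> f :: real => 'a => real)"
proof -
 obtain C where C: "0 <= C" "!!t x::'a. 0 < t ==> x ~= 0 ==> abs (U_of \<alpha> f t x) <= C*norm x powr - \<kappa>" using U_of_bound by blast
 define z where "z p = indicator ({0<..}\<times>{0::'a}) p*(fst p powr (- 1/\<alpha>)*f 0)" for p
 define q where "q p = selfsim p+z p" for p :: "real\<times>'a"
 have zm: "z\<in>borel_measurable borel"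
 proof -
  have e: "{0::real<..}\<times>{0::'a} = ({0<..}\<times>UNIV) \<inter> (UNIV\<times>{0})" by auto
  have "{0::real<..}\<times>(UNIV :: 'a set)\<in>sets borel" by (intro borel_open open_Times) auto
  moreover have "(UNIV :: real set)\<times>{0::'a}\<in>sets borel" by (intro borel_closed closed_Times) auto
  ultimately have A: "{0::real<..}\<times>{0::'a}\<in>sets borel" unfolding e by (rule sets.Int)
  have B: "(%p::real\<times>'a. fst p powr (- 1/\<alpha>)*f 0)\<in>borel_measurable borel" by (rule borel_pairI) measurable
  show ?thesis unfolding z_def[abs_def] by (rule borel_measurable_times[OF borel_measurable_indicator[OF A] B])
 qed
 have qm: "q\<in>borel_measurable borel" unfolding q_def[abs_def] by (intro borel_measurable_add borel_selfsim zm)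
 have qs: "AE p in lborel. q p = selfsim p" using AE_snd_nonzero by eventually_elim (auto simp: q_def z_def)
 show ?thesis
 proof (rule singular_solutionI(2)[OF dim open_greaterThan qm, where C = C])
  show "U_of \<alpha> f t x = q (t, x)" if "t\<in>{0<..}" for t and x :: 'a
   using that by (cases "x = 0") (auto simp: q_def z_def selfsim_def U_of_def)
  show "abs (q p) <= C*(1+norm (snd p) powr - \<kappa>)" if "p\<in>{0<..}\<times>UNIV" "snd p ~= 0" for p
   using C(2)[of "fst p" "snd p"] that C(1) by (auto simp: q_def z_def selfsim_def distrib_left)
  fix \<phi> :: "real\<times>'a => real" assume tf: "test_function ({0<..}\<times>UNIV) \<phi>"
  define \<zeta> where "\<zeta> p = adjoint_heat \<phi> p" for p
  have \<zeta>: "\<zeta>\<in>borel_measurable borel" using test_function_C12[OF tf] unfolding \<zeta>_def[abs_def] C12_with_def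
   by (intro borel_measurable_continuous_onI continuous_intros) auto
  have \<phi>: "\<phi>\<in>borel_measurable borel" by (rule borel_measurable_continuous_onI[OF test_function_continuous[OF tf]])
  have "(LINT p|lborel. q p*\<zeta> p) = (LINT p|lborel. selfsim p*\<zeta> p)"
   using qs borel_measurable_times[OF qm \<zeta>] borel_measurable_times[OF borel_selfsim \<zeta>] by (intro integral_cong_AE) auto
  also have "... = (LINT p|lborel. nonlin \<alpha> (selfsim p)*\<phi> p)" unfolding \<zeta>_def by (rule selfsim_weak[OF dim tf])
  also have "... = (LINT p|lborel. nonlin \<alpha> (q p)*\<phi> p)" using qs borel_measurable_times[OF measurable_compose[OF qm borel_nonlin] \<phi>]
    borel_measurable_times[OF measurable_compose[OF borel_selfsim borel_nonlin] \<phi>] by (intro integral_cong_AE) auto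
  finally show "(LINT p|lborel. q p*adjoint_heat \<phi> p) = (LINT p|lborel. nonlin \<alpha> (q p)*\<phi> p)" unfolding \<zeta>_def .
 qed
qed

lemma selfsim_profile:
 assumes "0 < t" "x ~= (0::'a::euclidean_space)"
 shows "norm x powr \<kappa> * selfsim (t, x) = (norm x / sqrt t) powr \<kappa>*f (norm x / sqrt t)"
proof -
 have "sqrt t powr \<kappa> = t powr (1/\<alpha>)" using assms by (simp add: powr_half_sqrt[symmetric] powr_powr)
 then have "(norm x / sqrt t) powr \<kappa> = norm x powr \<kappa>*t powr (- 1/\<alpha>)"
  using assms by (simp add: powr_divide powr_minus field_simps)
 then show ?thesis using assms by (simp add: selfsim_def U_of_def)
qed

lemma singular_atI:
 fixes g :: "'a::euclidean_space => real"
 assumes lim: "((%x. norm x powr \<kappa>*g x) \<longlongrightarrow> L) (at 0)"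
 shows "singular_at g 0" unfolding singular_at_def
proof (intro allI impI notI)
 fix \<rho> :: real assume r: "0 < \<rho>" and "\<exists>C. AE x in lebesgue_on (ball 0 \<rho>). abs (g x) <= C"
 then obtain C where "AE x in lebesgue_on (ball (0::'a) \<rho>). abs (g x) <= C" by blast
 then have ae: "AE x in lebesgue. x\<in>ball (0::'a) \<rho> --> abs (g x) <= C" by (subst (asm) AE_restrict_space_iff) auto
 have lim0: "((%x::'a. norm x powr \<kappa>*(abs C+1)) \<longlongrightarrow> 0*(abs C+1)) (at 0)"
  using kappa_pos by (intro tendsto_mult tendsto_const tendsto_norm_powr_zero)
 have "\<forall>\<^sub>F x::'a in at 0. norm x powr \<kappa>*(abs C+1) < L/2" by (rule order_tendstoD(2)[OF lim0]) (use L_pos in simp)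
 moreover have "\<forall>\<^sub>F x in at 0. L/2 < norm x powr \<kappa>*g x" by (rule order_tendstoD(1)[OF lim]) (use L_pos in simp)
 ultimately have "\<forall>\<^sub>F x in at (0::'a). C < g x"
 proof eventually_elim
  case (elim x)
  then have "norm x powr \<kappa>*(abs C+1) < norm x powr \<kappa>*g x" by linarith
  then have "abs C+1 < g x" using mult_less_cancel_left_pos[of "norm x powr \<kappa>"] by (cases "x = 0") auto
  then show ?case by linarith
 qed
 then obtain d where d: "0 < d" "!!x. x ~= 0 ==> dist x 0 < d ==> C < g x" unfolding eventually_at by blast
 define e where "e = min d \<rho>"
 have e: "0 < e" using d r by (simp add: e_def)
 have "AE x in lebesgue. x ~: ball (0::'a) e" using ae AE_completion[OF AE_lborel_singleton[of "0::'a"]]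
 proof eventually_elim
  case (elim x)
  show ?case
  proof
   assume "x\<in>ball 0 e"
   then have "C < g x" "x\<in>ball 0 \<rho>" using d(2)[of x] elim by (auto simp: e_def)
   then show False using elim by auto
  qed
 qed
 then have "negligible (ball (0::'a) e)" unfolding negligible_iff_null_sets by (simp add: completion.null_sets_iff_AE)
 then show False using open_not_negligible[of "ball (0::'a) e"] e by auto
qed

text \<open>
 Truncation turns the essential bound into a bound everywhere, and the sphere between the two regions is a null set.
\<close>

lemma initial_perturbation:
 fixes u0 :: "'a::euclidean_space => real"
 assumes \<delta>: "0 < \<delta>" and l: "Lp_loc 1 UNIV u0" and b: "Linf_on {x. norm x > \<delta>} u0"
  and s: "AE x in lebesgue. norm x < \<delta> --> u0 x = \<mu>*norm x powr - \<kappa>"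
 obtains v M where "v\<in>borel_measurable borel" "!!y. abs (v y) <= M" "!!y. norm y < \<delta> ==> v y = 0"
  "AE x in lebesgue. u0 x = \<mu>*norm x powr - \<kappa>+v x"
proof -
 have "u0\<in>borel_measurable lebesgue" using l unfolding Lp_loc_def lebesgue_on_UNIV_eq by blast
 then obtain u1 where u1: "u1\<in>borel_measurable lborel" "AE x in lborel. u0 x = u1 x" using completion_ex_borel_measurable_real by blast
 obtain C where "AE x in lebesgue_on {x. norm x > \<delta>}. abs (u0 x) <= C" using b unfolding Linf_on_def by blast
 moreover have o: "open {x::'a. norm x > \<delta>}" by (intro open_Collect_less continuous_intros)
 ultimately have C: "AE x in lebesgue. x\<in>{x. norm x > \<delta>} --> abs (u0 x) <= C" by (subst (asm) AE_restrict_space_iff) auto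
 define M where "M = abs C+abs \<mu>*\<delta> powr - \<kappa>"
 have M: "0 <= M" by (simp add: M_def)
 define v where "v x = (if norm x < \<delta> then 0 else max (- M) (min M (u1 x-\<mu>*norm x powr - \<kappa>)))" for x
 show thesis
 proof (rule that[of v M])
  have [measurable]: "u1\<in>borel_measurable borel" using u1(1) by simp
  show "v\<in>borel_measurable borel" unfolding v_def[abs_def] by measurable
  show "abs (v y) <= M" for y using M by (auto simp: v_def)
  show "v y = 0" if "norm y < \<delta>" for y using that by (simp add: v_def)
  have "AE x in lebesgue. x ~: sphere (0::'a) \<delta>" by (rule AE_not_in) (use negligible_sphere negligible_iff_null_sets in blast)
  with s C AE_completion[OF u1(2)] show "AE x in lebesgue. u0 x = \<mu>*norm x powr - \<kappa>+v x"
  proof eventually_elim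
   case (elim x)
   consider "norm x < \<delta>" | "norm x > \<delta>" using elim(4) by force
   then show ?case
   proof cases
    case 2
    have "norm x powr - \<kappa> <= \<delta> powr - \<kappa>" using 2 \<delta> kappa_pos by (intro powr_mono2') auto
    then have "abs (\<mu>*norm x powr - \<kappa>) <= abs \<mu>*\<delta> powr - \<kappa>" by (auto simp: abs_mult intro!: mult_left_mono)
    moreover have "abs (u0 x) <= abs C" using elim(2) 2 by auto
    ultimately have "abs (u1 x-\<mu>*norm x powr - \<kappa>) <= M" unfolding M_def using elim(3) by linarith
    then show ?thesis using 2 elim(3) by (auto simp: v_def max_def min_def abs_le_iff)
   qed (use elim in \<open>simp add: v_def\<close>)
  qed
 qed
qed

lemma selfsim_tendsto_L1:
 fixes X :: "nat => real"
 assumes dim: "DIM('a::euclidean_space) = N" and \<mu>: "((%r. r powr \<kappa>*f r) \<longlongrightarrow> \<mu>) at_top"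
  and K: "compact K" and X: "!!i. 0 < X i" "X \<longlonglongrightarrow> 0"
 shows "(%i. LINT x::'a|lborel. indicator K x*abs (selfsim (X i, x)-\<mu>*norm x powr - \<kappa>)) \<longlonglongrightarrow> 0"
  and "integrable lborel (%x::'a. indicator K x*abs (selfsim (X i, x)-\<mu>*norm x powr - \<kappa>))"
proof -
 obtain C where C: "0 <= C" "!!t x::'a. 0 < t ==> x ~= 0 ==> abs (U_of \<alpha> f t x) <= C*norm x powr - \<kappa>" using U_of_bound by blast
 have g: "0 <= \<kappa>" "\<kappa> < real DIM('a)" using kappa_pos kappa_less dim by auto
 have m: "(%x::'a. abs (selfsim (X i, x)-\<mu>*norm x powr - \<kappa>))\<in>borel_measurable borel" for i
  using borel_slice[OF borel_selfsim, of "X i"] by measurable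
 have b: "abs (selfsim (X i, x)-\<mu>*norm x powr - \<kappa>) <= (C+abs \<mu>)*norm x powr - \<kappa>" if "x ~= 0" for i and x :: 'a
 proof -
  have "abs (selfsim (X i, x)) <= C*norm x powr - \<kappa>" using C(2)[OF X(1) that, of i] X(1)[of i] that by (simp add: selfsim_def)
  then show ?thesis using abs_triangle_ineq4[of "selfsim (X i, x)" "\<mu>*norm x powr - \<kappa>"] by (simp add: abs_mult distrib_right)
 qed
 have mk: "(%x::'a. indicator K x*abs (selfsim (X i, x)-\<mu>*norm x powr - \<kappa>))\<in>borel_measurable lborel" for i
  using borel_measurable_times[OF borel_measurable_indicator[OF borel_compact[OF K]] m[of i]] by simp
 have iH: "integrable lborel (%x::'a. indicator K x*((C+abs \<mu>)*norm x powr - \<kappa>))"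
  by (rule integrable_singular_compact'[OF g K, where C = "C+abs \<mu>"]) (use C(1) in \<open>auto simp: abs_mult intro!: mult_left_mono\<close>)
 have dom: "AE x in lborel. norm (indicator K x*abs (selfsim (X i, x)-\<mu>*norm x powr - \<kappa>)) <= indicator K (x::'a)*((C+abs \<mu>)*norm x powr - \<kappa>)" for i
  using AE_lborel_singleton[of "0::'a"] by eventually_elim (use b in \<open>auto simp: indicator_def\<close>)
 show "integrable lborel (%x::'a. indicator K x*abs (selfsim (X i, x)-\<mu>*norm x powr - \<kappa>))"
 proof (rule Bochner_Integration.integrable_bound[OF iH mk])
  show "AE x in lborel. norm (indicator K x*abs (selfsim (X i, x)-\<mu>*norm x powr - \<kappa>)) <= norm (indicator K (x::'a)*((C+abs \<mu>)*norm x powr - \<kappa>))"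
   using dom[of i] by eventually_elim (simp add: order_trans[OF _ abs_ge_self])
 qed
 have "(%i. LINT x::'a|lborel. indicator K x*abs (selfsim (X i, x)-\<mu>*norm x powr - \<kappa>)) \<longlonglongrightarrow> (LINT x::'a|lborel. 0)"
 proof (rule integral_dominated_convergence[OF _ mk iH _ dom])
  show "AE x::'a in lborel. (%i. indicator K x*abs (selfsim (X i, x)-\<mu>*norm x powr - \<kappa>)) \<longlonglongrightarrow> 0"
   using AE_lborel_singleton[of "0::'a"]
  proof eventually_elim
   case (elim x)
   have nx: "0 < norm x" using elim by simp
   have "X i ~= 0" for i using X(1)[of i] by simp
   then have "filterlim (%i. sqrt (X i)) (at_right 0) sequentially" using X tendsto_real_sqrt[OF X(2)] by (auto simp: filterlim_at)
   from filterlim_compose[OF filterlim_inverse_at_top_right this]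
   have "filterlim (%i. inverse (sqrt (X i))) at_top sequentially" .
   from filterlim_tendsto_pos_mult_at_top[OF tendsto_const nx this]
   have "filterlim (%i. norm x / sqrt (X i)) at_top sequentially" by (simp add: divide_inverse)
   from filterlim_compose[OF \<mu> this]
   have "(%i. norm x powr \<kappa> * selfsim (X i, x)) \<longlonglongrightarrow> \<mu>" using selfsim_profile[OF X(1) elim] by simp
   have e: "norm x powr - \<kappa>*(norm x powr \<kappa>*y) = y" for y using nx by (simp add: mult.assoc[symmetric] flip: powr_add)
   from tendsto_mult[OF tendsto_const[of "norm x powr - \<kappa>"] \<open>(%i. norm x powr \<kappa> * selfsim (X i, x)) \<longlonglongrightarrow> \<mu>\<close>]
   have "(%i. selfsim (X i, x)) \<longlonglongrightarrow> \<mu>*norm x powr - \<kappa>" unfolding e mult.commute[of _ \<mu>] .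
   then have "(%i. abs (selfsim (X i, x)-\<mu>*norm x powr - \<kappa>)) \<longlonglongrightarrow> abs (\<mu>*norm x powr - \<kappa>-\<mu>*norm x powr - \<kappa>)"
    by (intro tendsto_rabs tendsto_diff tendsto_const)
   from tendsto_mult[OF tendsto_const[of "indicator K x"] this] show ?case by simp
  qed
 qed simp
 then show "(%i. LINT x::'a|lborel. indicator K x*abs (selfsim (X i, x)-\<mu>*norm x powr - \<kappa>)) \<longlonglongrightarrow> 0" by simp
qed

lemma perturbed_solution:
 fixes u0 :: "'a::euclidean_space => real"
 assumes dim: "DIM('a) = N" and \<mu>: "((%r. r powr \<kappa>*f r) \<longlongrightarrow> \<mu>) at_top"
  and \<delta>: "0 < \<delta>" and u0: "Lp_loc 1 UNIV u0" "Linf_on {x. norm x > \<delta>} u0"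
   "AE x in lebesgue. norm x < \<delta> --> u0 x = \<mu>*norm x powr - \<kappa>"
 shows "\<exists>T>0. \<exists>u. Lp_loc (\<alpha>+1) ({0<..<T}\<times>UNIV) (%(t, x). u t x) \<and>
   continuous_on ({0<..<T}\<times>(- {0})) (%(t, x). u t x) \<and> heat_solution \<alpha> {0<..<T} u \<and>
   (\<exists>C. \<forall>t\<in>{0<..<T}. \<forall>x. x ~= 0 --> abs (u t x-U_of \<alpha> f t x) <= C*(1+norm x powr - \<eta>)) \<and>
   tendsto_L1_loc u u0 (at_right 0) \<and>
   (\<forall>t\<in>{0<..<T}. singular_at (u t) 0 \<and> ((%x. norm x powr \<kappa>*u t x) \<longlongrightarrow> L) (at 0))"
proof -
 obtain v M where v: "v\<in>borel_measurable borel" "!!y. abs (v y) <= M" "!!y. norm y < \<delta> ==> v y = 0"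
  and u0v: "AE x in lebesgue. u0 x = \<mu>*norm x powr - \<kappa>+v x" using initial_perturbation[OF \<delta> u0] by blast
 obtain T C w where T: "0 < T" and wm: "w\<in>borel_measurable borel"
  and wb: "!!t x. 0 < t ==> t < T ==> x ~= 0 ==> abs (w (t, x)) <= C*(1+norm x powr - \<eta>)"
  and wc: "continuous_on ({0<..<T}\<times>- {0}) w"
  and ww: "!!\<phi>. test_function ({0<..<T}\<times>UNIV) \<phi> ==>
    (LINT p|lborel. w p*adjoint_heat \<phi> p) =
    (LINT p|lborel. excess p (w p)*\<phi> p)"
  and wl: "!!K X. compact K ==> (!!i. 0 < X i) ==> (!!i. X i < T) ==> X \<longlonglongrightarrow> 0 ==>
    (%i. LINT x|lborel. indicator K x*abs (w (X i, x)-v x)) \<longlonglongrightarrow> 0"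
  by (rule perturbation[OF dim v(1,2) \<delta> v(3)], assumption, rule that, assumption+, simp)
 define q where "q p = selfsim p+w p" for p
 define u where "u t x = q (t, x)" for t x
 have qm: "q\<in>borel_measurable borel" unfolding q_def[abs_def] by (intro borel_measurable_add borel_selfsim wm)
 obtain C0 where C0: "0 <= C0" "!!t x::'a. 0 < t ==> x ~= 0 ==> abs (U_of \<alpha> f t x) <= C0*norm x powr - \<kappa>" using U_of_bound by blast
 have g: "0 <= \<kappa>" "\<kappa> < real DIM('a)" "0 <= \<kappa>*(\<alpha>+1)" "\<kappa>*(\<alpha>+1) < real DIM('a)"
  using kappa_pos kappa_less alpha_pos dim unfolding kappa_alpha by auto
 have wk: "abs (w p) <= 2*abs C*(1+norm (snd p) powr - \<kappa>)" if "0 < fst p" "fst p < T" "snd p ~= 0" for p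
  using singular_bound_mono[OF wb[OF that]] that by simp
 have sb: "abs (selfsim p) <= C0*(1+norm (snd p) powr - \<kappa>)" for p :: "real\<times>'a"
  using C0(2)[of "fst p" "snd p"] C0(1) by (auto simp: selfsim_def distrib_left)
 define C1 where "C1 = C0+2*abs C"
 have qb: "abs (q p) <= C1*(1+norm (snd p) powr - \<kappa>)" if "p\<in>{0<..<T}\<times>UNIV" "snd p ~= 0" for p
  using wk[of p] sb[of p] that abs_triangle_ineq[of "selfsim p" "w p"] unfolding q_def C1_def distrib_right by auto
 have weak: "(LINT p|lborel. q p*adjoint_heat \<phi> p) = (LINT p|lborel. nonlin \<alpha> (q p)*\<phi> p)"
  if tf: "test_function ({0<..<T}\<times>UNIV) \<phi>" for \<phi>
 proof -
  have tf': "test_function ({0<..}\<times>UNIV) \<phi>" using tf unfolding test_function_def by fastforce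
  obtain K where K: "compact K" "K \<subseteq> {0<..<T}\<times>UNIV" "!!p. p ~: K ==> \<phi> p = 0"
   "!!p. p ~: K ==> test_dt \<phi> (fst p) (snd p) = 0" "!!p b. p ~: K ==> test_hess \<phi> b (fst p) (snd p) = 0"
   using test_function_support[OF tf] by metis
  define \<zeta> where "\<zeta> p = adjoint_heat \<phi> p" for p
  have \<zeta>c: "continuous_on UNIV \<zeta>" using test_function_C12[OF tf] unfolding \<zeta>_def[abs_def] C12_with_def
   by (intro continuous_intros) auto
  have \<zeta>K: "p ~: K ==> \<zeta> p = 0" for p using K(4,5) by (simp add: \<zeta>_def)
  have i1: "integrable lborel (%p. selfsim p*\<zeta> p)" by (rule integrable_times_test[OF g(1,2) K(1) borel_selfsim _ \<zeta>c \<zeta>K]) (rule sb)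
  have i2: "integrable lborel (%p. w p*\<zeta> p)" by (rule integrable_times_test[OF g(1,2) K(1) wm _ \<zeta>c \<zeta>K]) (rule wk, use K(2) in auto)
  have i3: "integrable lborel (%p. nonlin \<alpha> (selfsim p)*\<phi> p)"
  proof (rule integrable_times_test[OF g(3,4) K(1) measurable_compose[OF borel_selfsim borel_nonlin] _ test_function_continuous[OF tf] K(3)])
   show "abs (nonlin \<alpha> (selfsim p)) <= (2*abs C0) powr (\<alpha>+1)*(1+norm (snd p) powr - (\<kappa>*(\<alpha>+1)))" for p :: "real\<times>'a"
    unfolding nonlin_abs by (rule powr_singular_bound[OF sb]) (use alpha_pos in simp)
  qed
  have i4: "integrable lborel (%p. nonlin \<alpha> (q p)*\<phi> p)"
  proof (rule integrable_times_test[OF g(3,4) K(1) measurable_compose[OF qm borel_nonlin] _ test_function_continuous[OF tf] K(3)])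
   show "abs (nonlin \<alpha> (q p)) <= (2*abs C1) powr (\<alpha>+1)*(1+norm (snd p) powr - (\<kappa>*(\<alpha>+1)))" if "p\<in>K" "snd p ~= 0" for p
    unfolding nonlin_abs by (rule powr_singular_bound[OF qb]) (use alpha_pos K(2) that in auto)
  qed
  have "(LINT p|lborel. q p*\<zeta> p) = (LINT p|lborel. selfsim p*\<zeta> p)+(LINT p|lborel. w p*\<zeta> p)"
   unfolding q_def distrib_right using i1 i2 by simp
  also have "... = (LINT p|lborel. nonlin \<alpha> (selfsim p)*\<phi> p)+(LINT p|lborel. excess p (w p)*\<phi> p)"
   unfolding \<zeta>_def selfsim_weak[OF dim tf'] ww[OF tf] ..
  also have "... = (LINT p|lborel. nonlin \<alpha> (q p)*\<phi> p)" using i3 i4 unfolding excess_def q_def[symmetric] left_diff_distrib by simp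
  finally show ?thesis unfolding \<zeta>_def .
 qed
 have sol: "Lp_loc (\<alpha>+1) ({0<..<T}\<times>UNIV) (%(t, x). u t x)" "heat_solution \<alpha> {0<..<T} u"
  by (rule singular_solutionI[OF dim open_greaterThanLessThan qm u_def qb weak]; assumption)+
 have uU: "u t x = U_of \<alpha> f t x+w (t, x)" if "0 < t" "x ~= 0" for t x using that by (simp add: u_def q_def selfsim_def)
 have cont: "continuous_on ({0<..<T}\<times>(- {0})) (%(t, x). u t x)"
 proof (rule continuous_on_eq)
  show "continuous_on ({0<..<T}\<times>- {0}) (%p. U_of \<alpha> f (fst p) (snd p :: 'a)+w p)"
   by (intro continuous_on_add wc continuous_on_subset[OF continuous_U_of]) auto
  fix p assume "p\<in>{0<..<T}\<times>- {0::'a}"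
  then have "0 < fst p" "snd p ~= 0" by auto
  from uU[OF this] show "U_of \<alpha> f (fst p) (snd p)+w p = (case p of (t, x) => u t x)" by (simp add: case_prod_beta)
 qed
 have lim: "((%x. norm x powr \<kappa>*u t x) \<longlongrightarrow> L) (at 0)" if t: "0 < t" "t < T" for t
 proof -
  have ne: "\<forall>\<^sub>F x in at (0::'a). x ~= 0" by (simp add: eventually_at_filter)
  have n0: "((%x::'a. norm x) \<longlongrightarrow> 0) (at 0)" by (intro tendsto_norm_zero tendsto_ident_at)
  have "((%x::'a. norm x / sqrt t) \<longlongrightarrow> 0 / sqrt t) (at 0)" using t by (intro tendsto_divide tendsto_const n0) auto
  then have "filterlim (%x::'a. norm x / sqrt t) (at_right 0) (at 0)" using t ne by (auto simp: filterlim_at elim!: eventually_mono)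
  from filterlim_compose[OF singularity this]
  have 1: "((%x::'a. norm x powr \<kappa> * selfsim (t, x)) \<longlongrightarrow> L) (at 0)"
   by (rule Lim_transform_eventually) (use ne in \<open>eventually_elim, simp add: selfsim_profile t\<close>)
  have "((%x::'a. abs C*(norm x powr \<kappa>+norm x powr (\<kappa>-\<eta>))) \<longlongrightarrow> abs C*(0+0)) (at 0)"
   using kappa_pos eta_less_kappa by (intro tendsto_mult tendsto_add tendsto_const tendsto_norm_powr_zero) auto
  then have 2: "((%x::'a. abs C*(norm x powr \<kappa>+norm x powr (\<kappa>-\<eta>))) \<longlongrightarrow> 0) (at 0)" by simp
  have 3: "((%x. norm x powr \<kappa>*w (t, x)) \<longlongrightarrow> 0) (at 0)"
  proof (rule Lim_null_comparison[OF _ 2])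
   show "\<forall>\<^sub>F x in at 0. norm (norm x powr \<kappa>*w (t, x)) <= abs C*(norm x powr \<kappa>+norm x powr (\<kappa>-\<eta>))" using ne
   proof eventually_elim
    case (elim x)
    have "abs (w (t, x)) <= abs C*(1+norm x powr - \<eta>)" using wb[OF t elim] by (rule order_trans) (intro mult_right_mono, auto)
    then have "norm x powr \<kappa>*abs (w (t, x)) <= norm x powr \<kappa>*(abs C*(1+norm x powr - \<eta>))" by (intro mult_left_mono) auto
    also have "... = abs C*(norm x powr \<kappa>+norm x powr \<kappa>*norm x powr - \<eta>)" by (simp add: algebra_simps)
    also have "norm x powr \<kappa>*norm x powr - \<eta> = norm x powr (\<kappa>-\<eta>)" by (simp flip: powr_add)
    finally show ?case by (simp add: abs_mult)
   qed
  qed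
  show ?thesis using tendsto_add[OF 1 3] by (simp add: u_def q_def distrib_left)
 qed
 have L1: "tendsto_L1_loc u u0 (at_right 0)" unfolding tendsto_L1_loc_def
 proof (intro conjI allI impI u0(1))
  have "\<forall>\<^sub>F t in at_right 0. t\<in>{0<..<T}" using T by (rule eventually_at_right_real)
  then show "\<forall>\<^sub>F t in at_right 0. Lp_loc 1 UNIV (u t)"
  proof eventually_elim
   case (elim t)
   have m: "u t\<in>borel_measurable borel" unfolding u_def by (rule borel_slice[OF qm])
   show ?case
   proof (rule Lp_loc_borelI[OF refl m])
    fix K :: "'a set" assume K: "compact K"
    have "integrable lborel (%x. indicator K x*abs (u t x))"
     by (rule integrable_singular_compact'[OF g(1,2) K borel_measurable_abs[OF m], where C = C1]) (use qb[of "(t, _)"] elim in \<open>auto simp: u_def\<close>)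
    then show "integrable lborel (%x. indicator K x*abs (u t x) powr 1)" by simp
   qed
  qed
  fix K :: "'a set" assume K: "compact K"
  show "((%t. LINT x|lebesgue_on K. abs (u t x-u0 x)) \<longlongrightarrow> 0) (at_right 0)"
  proof (rule tendsto_at_right_sequentially[OF T])
   fix X :: "nat => real" assume X: "!!i. 0 < X i" "!!i. X i < T" "X \<longlonglongrightarrow> 0"
   have vm: "(%x. w (X i, x)-v x)\<in>borel_measurable borel" for i by (intro borel_measurable_diff borel_slice wm v)
   have sm: "(%x::'a. selfsim (X i, x)-\<mu>*norm x powr - \<kappa>)\<in>borel_measurable borel" for i
    using borel_slice[OF borel_selfsim, of "X i"] by measurable
   note S = selfsim_tendsto_L1[where 'a = 'a, OF dim \<mu> K X(1,3)]
   have iw: "integrable lborel (%x. indicator K x*abs (w (X i, x)-v x))" for i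
   proof (rule integrable_singular_compact'[OF g(1,2) K, where C = "2*abs C+abs M"])
    show "(%x. abs (w (X i, x)-v x))\<in>borel_measurable borel" using vm by (rule borel_measurable_abs)
    fix x :: 'a assume x: "x ~= 0"
    have "abs M*1 <= abs M*(1+norm x powr - \<kappa>)" by (intro mult_left_mono) auto
    then show "abs ((abs (w (X i, x)-v x))) <= (2*abs C+abs M)*(1+norm x powr - \<kappa>)"
     unfolding distrib_right[of "2*abs C"] using wk[of "(X i, x)"] X(1,2)[of i] x v(2)[of x] by simp
   qed
   have "(%i. (LINT x::'a|lborel. indicator K x*abs (selfsim (X i, x)-\<mu>*norm x powr - \<kappa>)) +
     (LINT x|lborel. indicator K x*abs (w (X i, x)-v x))) \<longlonglongrightarrow> 0+0" by (intro tendsto_add S(1) wl K X)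
   then have lim0: "(%i. (LINT x::'a|lborel. indicator K x*abs (selfsim (X i, x)-\<mu>*norm x powr - \<kappa>)) +
     (LINT x|lborel. indicator K x*abs (w (X i, x)-v x))) \<longlonglongrightarrow> 0" by simp
   show "(%i. LINT x|lebesgue_on K. abs (u (X i) x-u0 x)) \<longlonglongrightarrow> 0"
   proof (rule Lim_null_comparison[OF always_eventually lim0], intro allI)
    fix i
    define h where "h x = selfsim (X i, x)-\<mu>*norm x powr - \<kappa>+(w (X i, x)-v x)" for x
    have hm: "(%x. abs (h x))\<in>borel_measurable borel" unfolding h_def by (intro borel_measurable_abs borel_measurable_add sm vm)
    have Kl: "K \<inter> space lebesgue\<in>sets lebesgue" using borel_compact[OF K] by simp
    have ae: "AE x in lebesgue_on K. abs (u (X i) x-u0 x) = abs (h x)"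
     unfolding AE_restrict_space_iff[OF Kl] using u0v by eventually_elim (simp add: u_def q_def h_def algebra_simps)
    have u0m: "u0\<in>borel_measurable (lebesgue_on K)"
     using u0(1) unfolding Lp_loc_def lebesgue_on_UNIV_eq by (intro measurable_restrict_space1) blast
    have um: "u (X i)\<in>borel_measurable (lebesgue_on K)"
     unfolding u_def using borel_slice[OF qm] by (intro measurable_restrict_space1 measurable_completion) simp
    have "(%x. abs (h x))\<in>borel_measurable (lebesgue_on K)" using hm by (intro measurable_restrict_space1 measurable_completion) simp
    with ae have "(LINT x|lebesgue_on K. abs (u (X i) x-u0 x)) = (LINT x|lebesgue_on K. abs (h x))"
     by (intro integral_cong_AE[OF borel_measurable_abs[OF borel_measurable_diff[OF um u0m]]])
    also have "... = (LINT x|lborel. indicator K x*abs (h x))" by (rule integral_lebesgue_on_eq[OF borel_compact[OF K] hm])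
    also have "... <= (LINT x|lborel. indicator K x*abs (selfsim (X i, x)-\<mu>*norm x powr - \<kappa>)+indicator K x*abs (w (X i, x)-v x))"
    proof (rule integral_mono_AE')
     show "integrable lborel (%x. indicator K x*abs (selfsim (X i, x)-\<mu>*norm x powr - \<kappa>)+indicator K x*abs (w (X i, x)-v x))"
      using S(2) iw by (rule Bochner_Integration.integrable_add)
    qed (auto simp: h_def indicator_def intro!: AE_I2)
    also have "... = (LINT x::'a|lborel. indicator K x*abs (selfsim (X i, x)-\<mu>*norm x powr - \<kappa>))+(LINT x|lborel. indicator K x*abs (w (X i, x)-v x))"
     using S(2) iw by simp
    finally show "norm (LINT x|lebesgue_on K. abs (u (X i) x-u0 x)) <=
      (LINT x::'a|lborel. indicator K x*abs (selfsim (X i, x)-\<mu>*norm x powr - \<kappa>))+(LINT x|lborel. indicator K x*abs (w (X i, x)-v x))"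
     by (simp add: integral_nonneg_AE)
   qed
  qed
 qed
 have est: "\<exists>C. \<forall>t\<in>{0<..<T}. \<forall>x. x ~= 0 --> abs (u t x-U_of \<alpha> f t x) <= C*(1+norm x powr - \<eta>)"
  using wb uU by (intro exI[of _ C]) auto
 have fin: "\<forall>t\<in>{0<..<T}. singular_at (u t) 0 \<and> ((%x. norm x powr \<kappa>*u t x) \<longlongrightarrow> L) (at 0)"
  using lim by (auto intro!: singular_atI)
 show ?thesis by (rule exI[of _ T], intro conjI exI[of _ u] T sol cont est L1 fin)
qed

end

theorem theorem1p4:
  fixes N :: nat and \<alpha> :: real and f :: "real \<Rightarrow> real"
    and U :: "real \<Rightarrow> real ^ 'n \<Rightarrow> real"
  assumes "CARD('n) = N" and "N \<ge> 3"
    and "2 / (real N - 2) < \<alpha>" and "\<alpha> < alpha0 N"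
    and "profile_solution N \<alpha> f"
    and "((\<lambda>r. r powr (2 / \<alpha>) * f r) \<longlongrightarrow> beta N \<alpha> powr (1 / \<alpha>)) (at_right 0)"
  defines "U \<equiv> U_of \<alpha> f"
  shows "\<exists>\<mu>. ((\<lambda>r. r powr (2 / \<alpha>) * f r) \<longlongrightarrow> \<mu>) at_top \<and>
    self_similar \<alpha> U \<and> heat_solution \<alpha> {0<..} U \<and>
    (\<forall>\<delta>>0. \<forall>u0 :: real ^ 'n \<Rightarrow> real.
       Lp_loc 1 UNIV u0 \<and> Linf_on {x. norm x > \<delta>} u0 \<and>
       (AE x in lebesgue. norm x < \<delta> \<longrightarrow> u0 x = \<mu> * norm x powr (- 2 / \<alpha>)) \<longrightarrow>
       (\<exists>T>0. \<exists>u :: real \<Rightarrow> real ^ 'n \<Rightarrow> real.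
          Lp_loc (\<alpha> + 1) ({0<..<T} \<times> UNIV) (\<lambda>(t, x). u t x) \<and>
          continuous_on ({0<..<T} \<times> (- {0})) (\<lambda>(t, x). u t x) \<and>
          heat_solution \<alpha> {0<..<T} u \<and>
          (\<exists>C. \<forall>t\<in>{0<..<T}. \<forall>x. x \<noteq> 0 \<longrightarrow>
             \<bar>u t x - U t x\<bar> \<le> C * (1 + norm x powr (- eta N \<alpha>))) \<and>
          tendsto_L1_loc u u0 (at_right 0) \<and>
          (\<forall>t\<in>{0<..<T}. singular_at (u t) 0 \<and>
             ((\<lambda>x. norm x powr (2 / \<alpha>) * u t x) \<longlongrightarrow> beta N \<alpha> powr (1 / \<alpha>)) (at 0))))"
proof -
  interpret singular_profile N \<alpha> f
    by unfold_locales (use assms in auto)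
  have dim: "DIM(real ^ 'n) = N" using assms(1) by simp
  obtain \<mu> where \<mu>: "((\<lambda>r. r powr (2 / \<alpha>) * f r) \<longlongrightarrow> \<mu>) at_top" using limit_at_infinity by blast
  have e: "- 2 / \<alpha> = - (2 / \<alpha>)" by simp
  show ?thesis unfolding U_def e
  proof (rule exI[of _ \<mu>], intro conjI allI impI \<mu> self_similar_U_of heat_solution_U_of[OF dim])
    fix \<delta> :: real and u0 :: "real ^ 'n \<Rightarrow> real"
    assume "0 < \<delta>" "Lp_loc 1 UNIV u0 \<and> Linf_on {x. norm x > \<delta>} u0 \<and>
       (AE x in lebesgue. norm x < \<delta> \<longrightarrow> u0 x = \<mu> * norm x powr - (2 / \<alpha>))"
    then show "\<exists>T>0. \<exists>u. Lp_loc (\<alpha> + 1) ({0<..<T} \<times> UNIV) (\<lambda>(t, x). u t x) \<and>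
      continuous_on ({0<..<T} \<times> (- {0})) (\<lambda>(t, x). u t x) \<and> heat_solution \<alpha> {0<..<T} u \<and>
      (\<exists>C. \<forall>t\<in>{0<..<T}. \<forall>x. x \<noteq> 0 \<longrightarrow> \<bar>u t x - U_of \<alpha> f t x\<bar> \<le> C * (1 + norm x powr - \<eta>)) \<and>
      tendsto_L1_loc u u0 (at_right 0) \<and>
      (\<forall>t\<in>{0<..<T}. singular_at (u t) 0 \<and> ((\<lambda>x. norm x powr \<kappa> * u t x) \<longlongrightarrow> L) (at 0))"
      by (intro perturbed_solution[OF dim \<mu>]) auto
  qed
qed

end
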